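(* Let $f$ and $g$ be as in the context, and assume that $f\cdot g\in L^1(\mathbb{R})\cap L^2(\mathbb{R})$. Assume also that the covariance function $r=\widehat f$ and the generating kernel $a=\widehat g$ satisfy $$ r\in L^p(\mathbb{R}),\quad a\in L^q(\mathbb{R})\quad\text{for some } p,q\ge1 \text{ with } \frac1p+\frac1q\ge\frac32. $$ Then, as $T\to\infty$, the process $\{\widetilde Q_T(t),\ t\in[0,1]\}$ converges weakly in $C[0,1]$ to $\{\sigma B(t),\ t\in[0,1]\}$, where $B(t)$ is a standard Brownian motion and $$ \sigma^2=16\pi^3\int_{-\infty}^{\infty} f^2(x)g^2(x)\,dx. $$
   Context: $\{X(t),\ t\in\mathbb{R}\}$ is a centered real-valued stationary Gaussian process with spectral density $f\in L^1(\mathbb{R})$ and covariance function $r(t)=\widehat f(t)=\int_{\mathbb{R}}e^{ixt}f(x)\,dx$. The generating function $g\in L^1(\mathbb{R})$ is a real-valued even function with $g\ge 0$ (standing assumption), and $a(t)=\widehat g(t)=\int_{\mathbb{R}}e^{ixt}g(x)\,dx$. For $T>0$ and $t\in[0,1]$ define $$Q_T(t)=\int_0^{Tt}\int_0^{Tt}\widehat g(u-v)X(u)X(v)\,du\,dv,\qquad \widetilde Q_T(t)=T^{-1/2}\big(Q_T(t)-\mathbb{E}[Q_T(t)]\big).$$ Weak convergence in $C[0,1]$ (with the uniform metric) is understood for continuous versions of the processes. *)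

theory Defs
  imports "HOL-Probability.Probability"
begin

section \<open>Fourier transform and Lebesgue spaces\<close>

definition fourier :: "(real \<Rightarrow> real) \<Rightarrow> real \<Rightarrow> complex" where
  "fourier h t = (LINT x|lborel. iexp (x * t) * complex_of_real (h x))"

text \<open>Finite exponents only. Membership is expressed for Borel representatives.\<close>

definition in_Lp :: "real \<Rightarrow> (real \<Rightarrow> 'b::real_normed_vector) \<Rightarrow> bool" where
  "in_Lp p h \<longleftrightarrow> h \<in> borel_measurable lborel \<and> integrable lborel (\<lambda>x. norm (h x) powr p)"

section \<open>Stationary Gaussian processes\<close>

text \<open>Degenerate (almost surely constant) variables count as Gaussian.\<close>

definition gaussian_rv :: "'a measure \<Rightarrow> ('a \<Rightarrow> real) \<Rightarrow> bool" where
  "gaussian_rv M Y \<longleftrightarrow> Y \<in> borel_measurable M \<and>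
     ((\<exists>m s. s > 0 \<and> distributed M lborel Y (normal_density m s)) \<or>
      (\<exists>m. AE \<omega> in M. Y \<omega> = m))"

definition gaussian_process :: "'a measure \<Rightarrow> (real \<Rightarrow> 'a \<Rightarrow> real) \<Rightarrow> bool" where
  "gaussian_process M X \<longleftrightarrow>
     (\<forall>J c. finite J \<longrightarrow> gaussian_rv M (\<lambda>\<omega>. \<Sum>t\<in>J. c t * X t \<omega>))"

definition centered_process :: "'a measure \<Rightarrow> (real \<Rightarrow> 'a \<Rightarrow> real) \<Rightarrow> bool" where
  "centered_process M X \<longleftrightarrow> (\<forall>t. integrable M (X t) \<and> (LINT \<omega>|M. X t \<omega>) = 0)"

definition stationary_process :: "'a measure \<Rightarrow> (real \<Rightarrow> 'a \<Rightarrow> real) \<Rightarrow> bool" where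
  "stationary_process M X \<longleftrightarrow>
     (\<forall>J h. finite J \<longrightarrow>
        distr M (Pi\<^sub>M J (\<lambda>_. borel)) (\<lambda>\<omega>. \<lambda>t\<in>J. X (t + h) \<omega>) =
        distr M (Pi\<^sub>M J (\<lambda>_. borel)) (\<lambda>\<omega>. \<lambda>t\<in>J. X t \<omega>))"

text \<open>The covariance function of a centered stationary process.\<close>

definition covariance_fun :: "'a measure \<Rightarrow> (real \<Rightarrow> 'a \<Rightarrow> real) \<Rightarrow> real \<Rightarrow> real" where
  "covariance_fun M X t = (LINT \<omega>|M. X t \<omega> * X 0 \<omega>)"

text \<open>Evenness of \<open>f\<close> almost everywhere is a consequence, as the covariance is real.\<close>

definition has_spectral_density ::
    "'a measure \<Rightarrow> (real \<Rightarrow> 'a \<Rightarrow> real) \<Rightarrow> (real \<Rightarrow> real) \<Rightarrow> bool" where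
  "has_spectral_density M X f \<longleftrightarrow>
     (\<forall>x. 0 \<le> f x) \<and> integrable lborel f \<and>
     (\<forall>t. complex_of_real (covariance_fun M X t) = fourier f t)"

section \<open>Toeplitz quadratic functionals\<close>

text \<open>The real part only serves to have a real-valued functional: the transform of a real
  even function is real.\<close>

definition toeplitz_Q ::
    "(real \<Rightarrow> real) \<Rightarrow> (real \<Rightarrow> 'a \<Rightarrow> real) \<Rightarrow> real \<Rightarrow> real \<Rightarrow> 'a \<Rightarrow> real" where
  "toeplitz_Q g X T t \<omega> =
     (LINT u:{0..T * t}|lborel. (LINT v:{0..T * t}|lborel.
        Re (fourier g (u - v)) * X u \<omega> * X v \<omega>))"

definition normalized_Q ::
    "'a measure \<Rightarrow> (real \<Rightarrow> real) \<Rightarrow> (real \<Rightarrow> 'a \<Rightarrow> real) \<Rightarrow> real \<Rightarrow> real \<Rightarrow> 'a \<Rightarrow> real" where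
  "normalized_Q M g X T t \<omega> =
     T powr (- 1 / 2) * (toeplitz_Q g X T t \<omega> - (LINT \<eta>|M. toeplitz_Q g X T t \<eta>))"

section \<open>Weak convergence in the space of continuous functions on the unit interval\<close>

definition C01 :: "(real \<Rightarrow> real) metric" where
  "C01 = cfunspace (top_of_set {0..1}) euclidean_metric"

text \<open>Elements of the library's function space are extensional, hence the restriction.\<close>

definition path01 :: "(real \<Rightarrow> 'a \<Rightarrow> real) \<Rightarrow> 'a \<Rightarrow> real \<Rightarrow> real" where
  "path01 Y \<omega> = (\<lambda>t\<in>{0..1}. Y t \<omega>)"

definition continuous_version ::
    "'a measure \<Rightarrow> (real \<Rightarrow> 'a \<Rightarrow> real) \<Rightarrow> (real \<Rightarrow> 'a \<Rightarrow> real) \<Rightarrow> bool" where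
  "continuous_version M Z Y \<longleftrightarrow>
     (\<forall>t\<in>{0..1}. Y t \<in> borel_measurable M \<and> (AE \<omega> in M. Y t \<omega> = Z t \<omega>)) \<and>
     (\<forall>\<omega>\<in>space M. continuous_on {0..1} (\<lambda>t. Y t \<omega>))"

definition metric_borel :: "'s metric \<Rightarrow> 's measure" where
  "metric_borel S = sigma (mspace S) {U. openin (mtopology_of S) U}"

text \<open>Convergence in distribution of \<open>S\<close>-valued random elements along the filter \<open>G\<close>; the
  limit may live on a different probability space.\<close>

definition converges_weakly_in ::
    "'s metric \<Rightarrow> 'a measure \<Rightarrow> ('i \<Rightarrow> 'a \<Rightarrow> 's) \<Rightarrow> 'i filter \<Rightarrow> 'b measure \<Rightarrow> ('b \<Rightarrow> 's) \<Rightarrow> bool" where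
  "converges_weakly_in S M \<xi> G N \<zeta> \<longleftrightarrow>
     (\<forall>\<^sub>F i in G. \<xi> i \<in> measurable M (metric_borel S)) \<and>
     \<zeta> \<in> measurable N (metric_borel S) \<and>
     (\<forall>\<phi>. continuous_map (mtopology_of S) euclideanreal \<phi> \<and> bounded (\<phi> ` mspace S) \<longrightarrow>
        ((\<lambda>i. LINT \<omega>|M. \<phi> (\<xi> i \<omega>)) \<longlongrightarrow> (LINT \<omega>|N. \<phi> (\<zeta> \<omega>))) G)"

section \<open>Brownian motion\<close>

definition standard_brownian_motion01 :: "'b measure \<Rightarrow> (real \<Rightarrow> 'b \<Rightarrow> real) \<Rightarrow> bool" where
  "standard_brownian_motion01 N B \<longleftrightarrow>
     prob_space N \<and>
     (\<forall>t\<in>{0..1}. B t \<in> borel_measurable N) \<and>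
     (AE \<omega> in N. B 0 \<omega> = 0) \<and>
     (\<forall>s t. 0 \<le> s \<and> s < t \<and> t \<le> 1 \<longrightarrow>
        distributed N lborel (\<lambda>\<omega>. B t \<omega> - B s \<omega>) (normal_density 0 (sqrt (t - s)))) \<and>
     (\<forall>(n::nat) \<tau>. (\<forall>i\<le>n. \<tau> i \<in> {0..1}) \<and> (\<forall>i<n. \<tau> i \<le> \<tau> (Suc i)) \<longrightarrow>
        prob_space.indep_vars N (\<lambda>_. borel) (\<lambda>i \<omega>. B (\<tau> (Suc i)) \<omega> - B (\<tau> i) \<omega>) {..<n}) \<and>
     (\<forall>\<omega>\<in>space N. continuous_on {0..1} (\<lambda>t. B t \<omega>))"

end

theory Submission
  imports Defs
begin

text \<open>Write \<open>r\<close> and \<open>a\<close> for the transforms of \<open>f\<close> and \<open>g\<close>. The functional \<open>toeplitz_Q\<close>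
is a quadratic form in the Gaussian process \<open>X\<close> whose kernel \<open>a (u - v)\<close> is cut off to the square
\<open>{0..T * t} \<times> {0..T * t}\<close>. Everything rests on the kernel obtained by composing the cut-off kernel with the
covariance kernel \<open>r (u - v)\<close>; call it \<open>K\<close>.

Gaussian integration by parts (\<open>by_parts\<close>, \<open>by_parts_quad_power\<close>) yields a recursion for the moments of a centered
quadratic form (\<open>quad_moment_recursion\<close>). It expresses the moment of order \<open>k + 1\<close> by the trace of \<open>K\<close> composed with itself
and by a mixed moment with a second quadratic form, whose composed kernel is the square of \<open>K\<close>. Two
consequences carry the proof: all moments of the form are bounded by powers of its squared Hilbert-Schmidt norm
(\<open>quad_moment_bound\<close>), and if the Hilbert-Schmidt norm of the square of \<open>K\<close> tends to zero while twice the trace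
converges, then in the limit the recursion becomes that of the normal moments (\<open>quad_central_limit\<close>).

For the Toeplitz kernels all the entries of \<open>K\<close> are dominated by \<open>H = \<bar>a\<bar> * \<bar>r\<bar>\<close> (convolution) evaluated at \<open>u - v\<close>. The
condition on the exponents \<open>p\<close> and \<open>q\<close> is what Young's inequality needs to place \<open>H\<close> in \<open>L\<^sup>2\<close> (\<open>Young_two\<close>).
Then the self-convolution \<open>J\<close> of \<open>H\<close> is bounded and vanishes at infinity, so that after
rescaling by \<open>T\<close> the square of \<open>K\<close> is negligible (\<open>norm2_combo_cov_comp\<close>, \<open>J_mean_tendsto\<close>); and dominated
convergence identifies the limit of the traces as \<open>min s t\<close> times the energy of the convolution of \<open>a\<close> and \<open>r\<close>
(\<open>trace_trunc_tendsto\<close>). By Plancherel's theorem this energy is \<open>8 * pi ^ 3\<close> times the integral of \<open>(f x)\<^sup>2 * (g x)\<^sup>2\<close>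
(\<open>integral_conv_square\<close>). This gives the convergence of the finite-dimensional distributions
to those of the scaled Brownian motion.

For tightness, the composed kernel of an increment over \<open>{s..t}\<close> has squared Hilbert-Schmidt norm at most a
constant times \<open>t - s\<close> (\<open>norm2_increment\<close>), hence the fourth moment of the increment is at most a constant times
\<open>(t - s)\<^sup>2\<close>. Kolmogorov's chaining argument then compares a path with its piecewise linear interpolation at
the dyadic points, uniformly in \<open>T\<close>, and reduces the weak convergence to that of the finitely many dyadic values
(\<open>Lipschitz_interp_error\<close>, \<open>weak_convergence\<close>).

Elementary outcomes of the probability spaces are mostly denoted by \<open>w\<close>.\<close>

section \<open>Continuity of translations\<close>

lemma integrable_translate:
  fixes \<phi> :: "real => 'b::{banach, second_countable_topology}"
  assumes "integrable lborel \<phi>" shows "integrable lborel (\<lambda>x. \<phi> (x + h))"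
  using lborel_integrable_real_affine[OF assms, of 1 h] by (simp add: add.commute)

lemma integral_translate:
  fixes \<phi> :: "real => 'b::{banach, second_countable_topology}"
  shows "(LBINT x. \<phi> (x + h)) = (LBINT x. \<phi> x)"
  using lborel_integral_real_affine[of 1 \<phi> h] by (simp add: add.commute)

definition shift_dist :: "(real => real) => real => real" where
  "shift_dist \<phi> h = (LBINT x. \<bar>\<phi> (x + h) - \<phi> x\<bar>)"

lemma shift_dist_nonneg: "0 \<le> shift_dist \<phi> h"
  unfolding shift_dist_def by simp

lemma shift_dist_approx:
  assumes \<phi>: "integrable lborel \<phi>" and s: "integrable lborel s"
  shows "shift_dist \<phi> h \<le> 2 * (LBINT x. \<bar>\<phi> x - s x\<bar>) + shift_dist s h"
proof -
  have d: "integrable lborel (\<lambda>x. \<bar>\<phi> x - s x\<bar>)" using \<phi> s by simp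
  note i = integrable_translate[OF d, of h] integrable_translate[OF s, of h] integrable_translate[OF \<phi>, of h] d s \<phi>
  have "shift_dist \<phi> h \<le> (LBINT x. \<bar>\<phi> (x + h) - s (x + h)\<bar> + (\<bar>s (x + h) - s x\<bar> + \<bar>\<phi> x - s x\<bar>))"
    unfolding shift_dist_def using i by (intro integral_mono) auto
  also have "... = (LBINT x. \<bar>\<phi> (x + h) - s (x + h)\<bar>) + (shift_dist s h + (LBINT x. \<bar>\<phi> x - s x\<bar>))"
    unfolding shift_dist_def using i by simp
  also have "(LBINT x. \<bar>\<phi> (x + h) - s (x + h)\<bar>) = (LBINT x. \<bar>\<phi> x - s x\<bar>)"
    by (rule integral_translate)
  finally show ?thesis by simp
qed

text \<open>At a point of the open set a small translation stays inside, so by dominated convergence the set and its translate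
overlap in nearly full measure; what they do not share has twice the missing measure.\<close>
lemma shift_dist_open:
  fixes U :: "real set"
  assumes U: "open U" "emeasure lborel U < \<infinity>" and h: "h \<longlonglongrightarrow> 0"
  shows "(\<lambda>n. shift_dist (indicator U) (h n)) \<longlonglongrightarrow> 0"
proof -
  have [measurable]: "U \<in> sets borel" using U by simp
  have iU: "integrable lborel (indicator U :: real => real)" using U by (simp add: integrable_indicator_iff)
  let ?m = "\<lambda>n x. min (indicator U (x + h n)) (indicator U x) :: real"
  have im: "integrable lborel (?m n)" for n
    by (rule integrable_min[OF integrable_translate[OF iU] iU])
  have "(\<lambda>n. \<integral>x. ?m n x \<partial>lborel) \<longlonglongrightarrow> (LBINT x. indicator U x)"
  proof (rule integral_dominated_convergence[where w = "indicator U"])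
    show "AE x in lborel. (\<lambda>n. ?m n x) \<longlonglongrightarrow> indicator U x"
    proof (rule AE_I2)
      fix x :: real
      show "(\<lambda>n. ?m n x) \<longlonglongrightarrow> indicator U x"
      proof (cases "x \<in> U")
        case True
        have "(\<lambda>n. x + h n) \<longlonglongrightarrow> x" using tendsto_add[OF tendsto_const h, of x] by simp
        then have "\<forall>\<^sub>F n in sequentially. x + h n \<in> U" using U(1) True by (rule topological_tendstoD)
        then have "\<forall>\<^sub>F n in sequentially. ?m n x = 1" by eventually_elim (use True in simp)
        then show ?thesis using True by (simp add: tendsto_eventually)
      next
        case False
        then have "?m n x = 0" for n by (simp add: indicator_def)
        then show ?thesis using False by simp
      qed
    qed
  qed (use iU in \<open>auto simp: indicator_def\<close>)
  then have "(\<lambda>n. 2 * ((LBINT x. indicator U x) - (LBINT x. ?m n x))) \<longlonglongrightarrow>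
      2 * ((LBINT x. indicator U x) - (LBINT x. indicator U x))"
    by (rule tendsto_mult[OF tendsto_const tendsto_diff[OF tendsto_const]])
  moreover have "shift_dist (indicator U) (h n) = 2 * ((LBINT x. indicator U x) - (LBINT x. ?m n x))" for n
  proof -
    have "shift_dist (indicator U) (h n) = (LBINT x. indicator U (x + h n) + indicator U x - 2 * ?m n x)"
      unfolding shift_dist_def by (rule Bochner_Integration.integral_cong) (auto simp: indicator_def)
    also have "... = (LBINT x. indicator U (x + h n)) + (LBINT x. indicator U x) - 2 * (LBINT x. ?m n x)"
      using iU integrable_translate[OF iU, of "h n"] im by simp
    also have "(LBINT x. indicator U (x + h n)) = (LBINT x. (indicator U x :: real))"
      by (rule integral_translate)
    finally show ?thesis by simp
  qed
  ultimately show ?thesis by simp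
qed

text \<open>The functions with continuous translation are closed in \<open>L\<^sup>1\<close>, because translating changes both
\<open>\<phi>\<close> and its approximation by the same \<open>L\<^sup>1\<close> error.\<close>
lemma shift_dist_limit_approx:
  assumes \<phi>: "integrable lborel \<phi>"
    and ap: "\<And>e. 0 < e ==> \<exists>s. integrable lborel s \<and> (LBINT x. \<bar>\<phi> x - s x\<bar>) < e \<and> (\<lambda>n. shift_dist s (h n)) \<longlonglongrightarrow> 0"
  shows "(\<lambda>n. shift_dist \<phi> (h n)) \<longlonglongrightarrow> 0"
proof (rule LIMSEQ_I)
  fix e :: real assume e: "0 < e"
  then obtain s where s: "integrable lborel s" "(LBINT x. \<bar>\<phi> x - s x\<bar>) < e / 4" "(\<lambda>n. shift_dist s (h n)) \<longlonglongrightarrow> 0"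
    using ap[of "e/4"] by auto
  from LIMSEQ_D[OF s(3), of "e/2"] e obtain n0 where n0: "\<And>n. n \<ge> n0 ==> \<bar>shift_dist s (h n)\<bar> < e / 2" by auto
  have "\<bar>shift_dist \<phi> (h n)\<bar> < e" if "n \<ge> n0" for n
    using shift_dist_approx[OF \<phi> s(1), of "h n"] s(2) n0[OF that] shift_dist_nonneg[of \<phi> "h n"] by linarith
  then show "\<exists>no. \<forall>n\<ge>no. norm (shift_dist \<phi> (h n) - 0) < e" by auto
qed

text \<open>Translation is continuous in \<open>L\<^sup>1\<close>: from open sets one passes to measurable sets by outer regularity, to simple
functions by linearity and to integrable functions by density.\<close>
lemma shift_dist_tendsto:
  assumes \<phi>: "integrable lborel \<phi>" and h: "h \<longlonglongrightarrow> 0"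
  shows "(\<lambda>n. shift_dist \<phi> (h n)) \<longlonglongrightarrow> 0"
  using \<phi>
proof (induction rule: integrable_induct)
  case (base A c)
  have iA: "integrable lborel (indicator A :: real => real)" using base by (simp add: integrable_indicator_iff)
  have "(\<lambda>n. shift_dist (indicator A) (h n)) \<longlonglongrightarrow> 0"
  proof (rule shift_dist_limit_approx[OF iA])
    fix e :: real assume e: "0 < e"
    have A: "A \<in> sets borel" using base by simp
    obtain U where U: "open U" "A \<subseteq> U" "emeasure lborel (U - A) < ennreal e"
      using outer_regular_lborel[OF A, of e] e by (auto simp: ennreal_less_iff)
    have mU: "U \<in> sets lborel" "U - A \<in> sets lborel" using U A by auto
    have "emeasure lborel U = emeasure lborel (A \<union> (U - A))" using U(2) by (simp add: Un_absorb1)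
    also have "... \<le> emeasure lborel A + emeasure lborel (U - A)" using base mU by (intro emeasure_subadditive) auto
    also have "... < \<infinity>" using base U(3) by (auto intro: less_trans)
    finally have fU: "emeasure lborel U < \<infinity>" .
    have iU: "integrable lborel (indicator U :: real => real)" using mU fU by (simp add: integrable_indicator_iff)
    have "(LBINT x. \<bar>indicator A x - (indicator U x :: real)\<bar>) = (LBINT x. indicator (U - A) x)"
      by (rule Bochner_Integration.integral_cong) (use U(2) in \<open>auto simp: indicator_def\<close>)
    also have "... = measure lborel (U - A)" using mU by simp
    also have "... < e"
    proof -
      have "emeasure lborel (U - A) = ennreal (measure lborel (U - A))"
        using U(3) by (intro emeasure_eq_ennreal_measure) auto
      then show ?thesis using U(3) by (simp add: ennreal_less_iff)
    qed
    finally show "\<exists>s. integrable lborel s \<and> (LBINT x. \<bar>indicator A x - s x\<bar>) < e \<and> (\<lambda>n. shift_dist s (h n)) \<longlonglongrightarrow> 0"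
      using iU shift_dist_open[OF U(1) fU h] by blast
  qed
  then have "(\<lambda>n. \<bar>c\<bar> * shift_dist (indicator A) (h n)) \<longlonglongrightarrow> \<bar>c\<bar> * 0" by (rule tendsto_mult[OF tendsto_const])
  moreover have "shift_dist (\<lambda>x. indicator A x *\<^sub>R c) t = \<bar>c\<bar> * shift_dist (indicator A) t" for t
  proof -
    have "\<bar>indicator A (x + t) *\<^sub>R c - indicator A x *\<^sub>R c\<bar> = \<bar>c\<bar> * \<bar>indicator A (x + t) - indicator A x\<bar>" for x
      by (simp add: abs_mult[symmetric] algebra_simps)
    then show ?thesis unfolding shift_dist_def by simp
  qed
  ultimately show ?case by simp
next
  case (add f g)
  have l: "(\<lambda>n. shift_dist f (h n) + shift_dist g (h n)) \<longlonglongrightarrow> 0" using tendsto_add[OF add(3,4)] by simp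
  have "shift_dist (\<lambda>x. f x + g x) t \<le> shift_dist f t + shift_dist g t" for t
  proof -
    note i = add(1,2) integrable_translate[OF add(1), of t] integrable_translate[OF add(2), of t]
    have "shift_dist (\<lambda>x. f x + g x) t \<le> (LBINT x. \<bar>f (x + t) - f x\<bar> + \<bar>g (x + t) - g x\<bar>)"
      unfolding shift_dist_def using i by (intro integral_mono) auto
    also have "... = shift_dist f t + shift_dist g t"
      unfolding shift_dist_def using i by simp
    finally show ?thesis .
  qed
  then show ?case by (intro Lim_null_comparison[OF _ l] always_eventually allI) (simp add: shift_dist_nonneg)
next
  case (lim f s)
  show ?case
  proof (rule shift_dist_limit_approx[OF lim(4)])
    fix e :: real assume e: "0 < e"
    have "(\<lambda>i. \<integral>x. \<bar>f x - s i x\<bar> \<partial>lborel) \<longlonglongrightarrow> (\<integral>x. 0 \<partial>(lborel :: real measure))"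
    proof (rule integral_dominated_convergence[where w = "\<lambda>x. 3 * \<bar>f x\<bar>"])
      show "AE x in lborel. (\<lambda>i. \<bar>f x - s i x\<bar>) \<longlonglongrightarrow> 0"
      proof (rule AE_I2)
        fix x
        have "(\<lambda>i. \<bar>f x - s i x\<bar>) \<longlonglongrightarrow> \<bar>f x - f x\<bar>"
          by (intro tendsto_rabs tendsto_diff tendsto_const lim(2)) simp
        then show "(\<lambda>i. \<bar>f x - s i x\<bar>) \<longlonglongrightarrow> 0" by simp
      qed
      show "AE x in lborel. norm \<bar>f x - s i x\<bar> \<le> 3 * \<bar>f x\<bar>" for i
      proof (rule AE_I2)
        fix x
        have "\<bar>s i x\<bar> \<le> 2 * \<bar>f x\<bar>" using lim(3)[of x i] by simp
        then show "norm \<bar>f x - s i x\<bar> \<le> 3 * \<bar>f x\<bar>" by simp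
      qed
    qed (use lim(1,4) in auto)
    from LIMSEQ_D[OF this, of e] e obtain i where "(LBINT x. \<bar>f x - s i x\<bar>) < e" by auto
    then show "\<exists>s. integrable lborel s \<and> (LBINT x. \<bar>f x - s x\<bar>) < e \<and> (\<lambda>n. shift_dist s (h n)) \<longlonglongrightarrow> 0"
      using lim(1,5) by blast
  qed
qed

definition autocorrelation :: "(real => real) => real => real" where
  "autocorrelation \<phi> h = (LBINT x. \<phi> x * \<phi> (x + h))"

lemma integrable_mult_square:
  fixes u v :: "'a => real"
  assumes [measurable]: "u \<in> borel_measurable M" "v \<in> borel_measurable M"
    and "integrable M (\<lambda>x. (u x)^2)" "integrable M (\<lambda>x. (v x)^2)"
  shows "integrable M (\<lambda>x. u x * v x)"
proof (rule Bochner_Integration.integrable_bound)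
  show "integrable M (\<lambda>x. (u x)^2 + (v x)^2)" using assms by simp
  show "AE x in M. norm (u x * v x) \<le> norm ((u x)^2 + (v x)^2)"
  proof (rule AE_I2)
    fix x
    have "0 \<le> (\<bar>u x\<bar> - \<bar>v x\<bar>)^2" by simp
    then have "2 * (\<bar>u x\<bar> * \<bar>v x\<bar>) \<le> (u x)^2 + (v x)^2" by (simp add: power2_diff)
    moreover have "0 \<le> \<bar>u x\<bar> * \<bar>v x\<bar>" by simp
    ultimately have "\<bar>u x\<bar> * \<bar>v x\<bar> \<le> (u x)^2 + (v x)^2" by linarith
    then show "norm (u x * v x) \<le> norm ((u x)^2 + (v x)^2)" by (simp add: abs_mult)
  qed
qed simp

context
  fixes \<phi> :: "real => real"
  assumes int1: "integrable lborel \<phi>" and int2: "integrable lborel (\<lambda>x. (\<phi> x)^2)"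
begin

lemma measurable_phi: "\<phi> \<in> borel_measurable borel"
  using int1 by auto

lemma autocorrelation_integrable: "integrable lborel (\<lambda>x. \<phi> x * \<phi> (x + h))"
proof -
  note [measurable] = measurable_phi
  show ?thesis using integrable_translate[OF int2, of h] by (intro integrable_mult_square int2) auto
qed

text \<open>Continuity of translation is needed for \<open>\<phi>\<close> in \<open>L\<^sup>2\<close>, and it follows from the \<open>L\<^sup>1\<close> statement for the signed
square: half the squared distance of two reals is at most the distance of their signed squares.\<close>
lemma autocorrelation_gap:
  "\<bar>autocorrelation \<phi> 0 - autocorrelation \<phi> h\<bar> \<le> shift_dist (\<lambda>x. \<phi> x * \<bar>\<phi> x\<bar>) h"
proof -
  note [measurable] = measurable_phi
  note i2h = integrable_translate[OF int2, of h]
  have i\<theta>: "integrable lborel (\<lambda>x. \<phi> x * \<bar>\<phi> x\<bar>)"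
    by (rule Bochner_Integration.integrable_bound[OF int2]) (auto simp: abs_mult power2_eq_square)
  note i\<theta>h = integrable_translate[OF i\<theta>, of h]
  have "autocorrelation \<phi> 0 - autocorrelation \<phi> h = (LBINT x. ((\<phi> (x + h))^2 + (\<phi> x)^2) / 2 - \<phi> x * \<phi> (x + h))"
    using int2 i2h autocorrelation_integrable[of h] integral_translate[of "\<lambda>x. (\<phi> x)^2" h]
    by (simp add: autocorrelation_def power2_eq_square)
  also have "... = (LBINT x. (\<phi> (x + h) - \<phi> x)^2 / 2)"
    by (rule Bochner_Integration.integral_cong) (auto simp: power2_diff field_simps)
  finally have eq: "autocorrelation \<phi> 0 - autocorrelation \<phi> h = (LBINT x. (\<phi> (x + h) - \<phi> x)^2 / 2)" .
  have "(a - b)^2 / 2 \<le> \<bar>a * \<bar>a\<bar> - b * \<bar>b\<bar>\<bar>" for a b :: real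
  proof (cases "0 \<le> a * b")
    case True
    then have "a * \<bar>a\<bar> - b * \<bar>b\<bar> = a\<^sup>2 - b\<^sup>2 \<or> a * \<bar>a\<bar> - b * \<bar>b\<bar> = b\<^sup>2 - a\<^sup>2"
      by (auto simp: zero_le_mult_iff power2_eq_square)
    then have e: "\<bar>a * \<bar>a\<bar> - b * \<bar>b\<bar>\<bar> = \<bar>a - b\<bar> * \<bar>a + b\<bar>"
      by (auto simp: abs_mult[symmetric] power2_eq_square algebra_simps abs_minus_commute)
    have "\<bar>a - b\<bar> \<le> \<bar>a + b\<bar>" using True by (auto simp: zero_le_mult_iff abs_if)
    then have "\<bar>a - b\<bar> * \<bar>a - b\<bar> \<le> \<bar>a - b\<bar> * \<bar>a + b\<bar>" by (intro mult_left_mono) auto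
    then have "(a - b)^2 \<le> \<bar>a * \<bar>a\<bar> - b * \<bar>b\<bar>\<bar>" unfolding e by (simp add: power2_eq_square abs_mult[symmetric])
    then show ?thesis using zero_le_power2[of "a - b"] by linarith
  next
    case False
    then have e: "\<bar>a * \<bar>a\<bar> - b * \<bar>b\<bar>\<bar> = a\<^sup>2 + b\<^sup>2"
    proof -
      have "0 < a \<and> b < 0 \<or> a < 0 \<and> 0 < b" using False by (auto simp: not_le mult_less_0_iff)
      moreover have "0 \<le> a * a" "0 \<le> b * b" by simp_all
      ultimately show ?thesis by (auto simp: power2_eq_square)
    qed
    have "0 \<le> (a + b)^2" by simp
    then show ?thesis unfolding e by (simp add: power2_diff power2_sum)
  qed
  note pt = this
  have isq: "integrable lborel (\<lambda>x. (\<phi> (x + h) - \<phi> x)^2 / 2)"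
  proof (rule Bochner_Integration.integrable_bound)
    show "integrable lborel (\<lambda>x. \<bar>\<phi> (x + h) * \<bar>\<phi> (x + h)\<bar> - \<phi> x * \<bar>\<phi> x\<bar>\<bar>)" using i\<theta> i\<theta>h by simp
    show "AE x in lborel. norm ((\<phi> (x + h) - \<phi> x)^2 / 2) \<le> norm \<bar>\<phi> (x + h) * \<bar>\<phi> (x + h)\<bar> - \<phi> x * \<bar>\<phi> x\<bar>\<bar>"
      using pt by simp
  qed simp
  have "0 \<le> autocorrelation \<phi> 0 - autocorrelation \<phi> h" unfolding eq by simp
  moreover have "autocorrelation \<phi> 0 - autocorrelation \<phi> h \<le> shift_dist (\<lambda>x. \<phi> x * \<bar>\<phi> x\<bar>) h"
    unfolding eq shift_dist_def using i\<theta> i\<theta>h isq pt by (intro integral_mono) auto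
  ultimately show ?thesis by simp
qed

lemma autocorrelation_tendsto:
  assumes "h \<longlonglongrightarrow> 0"
  shows "(\<lambda>n. autocorrelation \<phi> (h n)) \<longlonglongrightarrow> (LBINT x. (\<phi> x)^2)"
proof -
  note [measurable] = measurable_phi
  have i\<theta>: "integrable lborel (\<lambda>x. \<phi> x * \<bar>\<phi> x\<bar>)"
    by (rule Bochner_Integration.integrable_bound[OF int2]) (auto simp: abs_mult power2_eq_square)
  have "(\<lambda>n. autocorrelation \<phi> (h n) - autocorrelation \<phi> 0) \<longlonglongrightarrow> 0"
    by (rule Lim_null_comparison[OF _ shift_dist_tendsto[OF i\<theta> assms]])
       (use autocorrelation_gap in \<open>simp add: abs_minus_commute[of _ "autocorrelation \<phi> 0"]\<close>)
  then show ?thesis by (simp add: LIM_zero_iff autocorrelation_def power2_eq_square)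
qed

lemma autocorrelation_bound: "\<bar>autocorrelation \<phi> h\<bar> \<le> (LBINT x. (\<phi> x)^2)"
proof -
  note [measurable] = measurable_phi
  note i2h = integrable_translate[OF int2, of h]
  have "\<bar>autocorrelation \<phi> h\<bar> \<le> (LBINT x. \<bar>\<phi> x * \<phi> (x + h)\<bar>)"
    unfolding autocorrelation_def by (rule integral_abs_bound)
  also have "... \<le> (LBINT x. ((\<phi> x)^2 + (\<phi> (x + h))^2) / 2)"
  proof (rule integral_mono)
    fix x
    have "0 \<le> (\<bar>\<phi> x\<bar> - \<bar>\<phi> (x + h)\<bar>)^2" by simp
    then show "\<bar>\<phi> x * \<phi> (x + h)\<bar> \<le> ((\<phi> x)^2 + (\<phi> (x + h))^2) / 2" by (simp add: power2_diff abs_mult)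
  qed (use int2 i2h autocorrelation_integrable[of h] in auto)
  also have "... = (LBINT x. (\<phi> x)^2)"
    using int2 i2h integral_translate[of "\<lambda>x. (\<phi> x)^2" h] by simp
  finally show ?thesis .
qed

end

section \<open>Plancherel theorem\<close>

text \<open>Summability weights for the Fourier integral, together with their transforms (\<open>gauss_kernel\<close>), which have total
mass \<open>2 * pi\<close> and concentrate at the origin as \<open>\<epsilon>\<close> tends to zero.\<close>
definition gauss_weight :: "real => real => real" where
  "gauss_weight \<epsilon> s = exp (- (\<epsilon> * s)\<^sup>2 / 2)"

definition gauss_kernel :: "real => real => real" where
  "gauss_kernel \<epsilon> z = sqrt (2 * pi) / \<epsilon> * exp (- (z / \<epsilon>)\<^sup>2 / 2)"

lemma gauss_weight_altdef: "gauss_weight \<epsilon> s = sqrt (2 * pi) * std_normal_density (\<epsilon> * s)"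
  by (simp add: gauss_weight_def std_normal_density_def)

lemma gauss_kernel_altdef: "gauss_kernel \<epsilon> z = 2 * pi / \<epsilon> * std_normal_density (z / \<epsilon>)"
proof -
  have "2 * pi / \<epsilon> * (1 / sqrt (2 * pi)) = sqrt (2 * pi) / \<epsilon>"
  proof -
    have "2 * pi / \<epsilon> * (1 / sqrt (2 * pi)) = (2 * pi / sqrt (2 * pi)) / \<epsilon>" by simp
    also have "2 * pi / sqrt (2 * pi) = sqrt (2 * pi)" by (rule real_div_sqrt) simp
    finally show ?thesis .
  qed
  then show ?thesis unfolding gauss_kernel_def std_normal_density_def by (simp only: mult.assoc[symmetric])
qed

lemma measurable_gauss [measurable]: "gauss_weight \<epsilon> \<in> borel_measurable borel" "gauss_kernel \<epsilon> \<in> borel_measurable borel"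
  unfolding gauss_weight_def[abs_def] gauss_kernel_def[abs_def] by measurable

lemma gauss_weight_bounds: "0 \<le> gauss_weight \<epsilon> s" "gauss_weight \<epsilon> s \<le> 1"
  by (auto simp: gauss_weight_def)

lemma gauss_kernel_nonneg: "0 < \<epsilon> ==> 0 \<le> gauss_kernel \<epsilon> z"
  by (simp add: gauss_kernel_def)

lemma gauss_kernel_bound: "0 < \<epsilon> ==> gauss_kernel \<epsilon> z \<le> sqrt (2 * pi) / \<epsilon>"
  unfolding gauss_kernel_def by (intro mult_left_le) auto

lemma gauss_weight_integrable: "0 < \<epsilon> ==> integrable lborel (gauss_weight \<epsilon>)"
  unfolding gauss_weight_altdef[abs_def]
  using lborel_integrable_real_affine[of std_normal_density \<epsilon> 0] by simp

lemma fourier_gauss: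
  assumes \<epsilon>: "0 < \<epsilon>"
  shows "(LBINT s. iexp (s * z) * complex_of_real (gauss_weight \<epsilon> s)) = complex_of_real (gauss_kernel \<epsilon> z)"
proof -
  let ?F = "\<lambda>x. complex_of_real (sqrt (2 * pi)) * (complex_of_real (std_normal_density x) * iexp (z / \<epsilon> * x))"
  have "(LBINT s. iexp (s * z) * complex_of_real (gauss_weight \<epsilon> s)) = (LBINT s. ?F (0 + \<epsilon> * s))"
    by (rule Bochner_Integration.integral_cong) (use \<epsilon> in \<open>auto simp: gauss_weight_altdef mult_ac\<close>)
  also have "... = (1 / \<epsilon>) *\<^sub>R (LBINT x. ?F x)"
    using lborel_integral_real_affine[of \<epsilon> ?F 0] \<epsilon> by (simp add: divide_inverse)
  also have "(LBINT x. ?F x) = complex_of_real (sqrt (2 * pi)) * (LBINT x. complex_of_real (std_normal_density x) * iexp (z / \<epsilon> * x))"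
    by (rule integral_mult_right_zero)
  also have "(LBINT x. complex_of_real (std_normal_density x) * iexp (z / \<epsilon> * x)) = char std_normal_distribution (z / \<epsilon>)"
    unfolding char_def by (subst integral_density) (auto simp: scaleR_conv_of_real)
  also have "... = complex_of_real (exp (- (z / \<epsilon>)\<^sup>2 / 2))"
    by (simp add: char_std_normal_distribution exp_of_real[symmetric])
  finally show ?thesis by (simp add: gauss_kernel_def scaleR_conv_of_real)
qed

lemma fourier_measurable [measurable]:
  assumes [measurable]: "\<phi> \<in> borel_measurable borel"
  shows "fourier \<phi> \<in> borel_measurable borel"
  unfolding fourier_def[abs_def] by measurable

lemma fourier_integrand: "integrable lborel \<phi> ==> integrable lborel (\<lambda>x. iexp (x * t) * complex_of_real (\<phi> x))"
  by (rule Bochner_Integration.integrable_bound[of lborel \<phi>]) (auto simp: norm_mult)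

lemma fourier_bound:
  assumes "integrable lborel \<phi>"
  shows "cmod (fourier \<phi> t) \<le> (LBINT x. \<bar>\<phi> x\<bar>)"
  unfolding fourier_def
  by (rule order_trans[OF integral_norm_bound]) (simp add: norm_mult)

text \<open>Fubini's theorem: it moves the transform from \<open>\<phi>\<close> to the integrable weight \<open>u\<close>.\<close>
lemma multiplication_formula:
  fixes u :: "real => complex"
  assumes u: "integrable lborel u" and \<phi>: "integrable lborel \<phi>"
  shows "(LBINT s. u s * fourier \<phi> s) = (LBINT x. complex_of_real (\<phi> x) * (LBINT s. u s * iexp (x * s)))"
proof -
  have [measurable]: "u \<in> borel_measurable borel" "\<phi> \<in> borel_measurable borel" using u \<phi> by auto
  let ?k = "\<lambda>s x. u s * (iexp (x * s) * complex_of_real (\<phi> x))"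
  have "integrable (lborel \<Otimes>\<^sub>M lborel) (\<lambda>(s, x). u s * complex_of_real (\<phi> x))"
  proof (rule lborel_pair.Fubini_integrable)
    show "integrable lborel (\<lambda>s. \<integral>x. norm (case (s, x) of (s, x) => u s * complex_of_real (\<phi> x)) \<partial>lborel)"
      using u by (simp add: norm_mult)
    show "AE s in lborel. integrable lborel (\<lambda>x. case (s, x) of (s, x) => u s * complex_of_real (\<phi> x))"
      using \<phi> by simp
  qed measurable
  then have int: "integrable (lborel \<Otimes>\<^sub>M lborel) (\<lambda>(s, x). ?k s x)"
    by (rule Bochner_Integration.integrable_bound) (auto simp: norm_mult split_beta')
  have "(LBINT s. u s * fourier \<phi> s) = (LBINT s. (LBINT x. ?k s x))"
    by (simp add: fourier_def)
  also have "... = (LBINT x. (LBINT s. ?k s x))"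
    using lborel_pair.Fubini_integral[OF int] by simp
  also have "... = (LBINT x. complex_of_real (\<phi> x) * (LBINT s. u s * iexp (x * s)))"
  proof -
    have "(LBINT s. ?k s x) = complex_of_real (\<phi> x) * (LBINT s. u s * iexp (x * s))" for x
      unfolding integral_mult_right_zero[symmetric] by (rule Bochner_Integration.integral_cong) (auto simp: mult_ac)
    then show ?thesis by simp
  qed
  finally show ?thesis .
qed

definition gauss_energy :: "real => (real => real) => real" where
  "gauss_energy \<epsilon> \<phi> = (LBINT x. \<phi> x * (LBINT y. \<phi> y * gauss_kernel \<epsilon> (y - x)))"

lemma weighted_Plancherel:
  assumes \<phi>: "integrable lborel \<phi>" and \<epsilon>: "0 < \<epsilon>"
  shows "integrable lborel (\<lambda>s. (cmod (fourier \<phi> s))^2 * gauss_weight \<epsilon> s)"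
    and "(LBINT s. (cmod (fourier \<phi> s))^2 * gauss_weight \<epsilon> s) = gauss_energy \<epsilon> \<phi>"
proof -
  have [measurable]: "\<phi> \<in> borel_measurable borel" using \<phi> by auto
  define K where "K = (LBINT x. \<bar>\<phi> x\<bar>)"
  let ?g = "\<lambda>s. complex_of_real (gauss_weight \<epsilon> s)"
  have K: "cmod (fourier \<phi> s) \<le> K" for s unfolding K_def by (rule fourier_bound[OF \<phi>])
  show int: "integrable lborel (\<lambda>s. (cmod (fourier \<phi> s))^2 * gauss_weight \<epsilon> s)"
  proof (rule Bochner_Integration.integrable_bound)
    show "integrable lborel (\<lambda>s. K\<^sup>2 * gauss_weight \<epsilon> s)" using gauss_weight_integrable[OF \<epsilon>] by simp
    show "AE s in lborel. norm ((cmod (fourier \<phi> s))^2 * gauss_weight \<epsilon> s) \<le> norm (K\<^sup>2 * gauss_weight \<epsilon> s)"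
      using K by (auto simp: abs_mult gauss_weight_bounds intro!: mult_right_mono power_mono)
  qed simp
  have u1: "integrable lborel (\<lambda>s. ?g s * iexp (- x * s))" for x
    by (rule Bochner_Integration.integrable_bound[OF gauss_weight_integrable[OF \<epsilon>]]) (auto simp: norm_mult)
  have u2: "integrable lborel (\<lambda>s. ?g s * cnj (fourier \<phi> s))"
  proof (rule Bochner_Integration.integrable_bound)
    show "integrable lborel (\<lambda>s. K * gauss_weight \<epsilon> s)" using gauss_weight_integrable[OF \<epsilon>] by simp
    show "AE s in lborel. norm (?g s * cnj (fourier \<phi> s)) \<le> norm (K * gauss_weight \<epsilon> s)"
      using K order_trans[OF norm_ge_zero K]
      by (auto simp: abs_mult norm_mult gauss_weight_bounds mult.commute[of K] intro!: mult_left_mono)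
    have [measurable]: "(\<lambda>s. cnj (fourier \<phi> s)) \<in> borel_measurable borel"
      by (rule measurable_compose[OF fourier_measurable borel_measurable_continuous_onI]) (auto intro: continuous_intros)
    show "(\<lambda>s. ?g s * cnj (fourier \<phi> s)) \<in> borel_measurable lborel" by measurable
  qed
  have inner: "(LBINT s. ?g s * cnj (fourier \<phi> s) * iexp (x * s)) =
      complex_of_real (LBINT y. \<phi> y * gauss_kernel \<epsilon> (y - x))" for x
  proof -
    have "(LBINT s. ?g s * cnj (fourier \<phi> s) * iexp (x * s)) =
       (LBINT s. cnj (?g s * iexp (- x * s) * fourier \<phi> s))"
      by (rule Bochner_Integration.integral_cong) (auto simp: exp_cnj)
    also have "... = cnj (LBINT s. ?g s * iexp (- x * s) * fourier \<phi> s)"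
      by (rule Bochner_Integration.integral_cnj)
    also have "(LBINT s. ?g s * iexp (- x * s) * fourier \<phi> s) =
       (LBINT y. complex_of_real (\<phi> y) * (LBINT s. ?g s * iexp (- x * s) * iexp (y * s)))"
      by (rule multiplication_formula[OF u1 \<phi>])
    also have "... = (LBINT y. complex_of_real (\<phi> y * gauss_kernel \<epsilon> (y - x)))"
    proof (rule Bochner_Integration.integral_cong[OF refl])
      fix y
      have "(LBINT s. ?g s * iexp (- x * s) * iexp (y * s)) = (LBINT s. iexp (s * (y - x)) * ?g s)"
        by (rule Bochner_Integration.integral_cong) (auto simp: exp_add[symmetric] algebra_simps)
      then show "complex_of_real (\<phi> y) * (LBINT s. ?g s * iexp (- x * s) * iexp (y * s)) = complex_of_real (\<phi> y * gauss_kernel \<epsilon> (y - x))"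
        using fourier_gauss[OF \<epsilon>, of "y - x"] by simp
    qed
    finally show ?thesis by (simp only: integral_complex_of_real complex_cnj_complex_of_real)
  qed
  have "complex_of_real (LBINT s. (cmod (fourier \<phi> s))^2 * gauss_weight \<epsilon> s) =
      (LBINT s. complex_of_real ((cmod (fourier \<phi> s))^2 * gauss_weight \<epsilon> s))"
    by (rule integral_complex_of_real[symmetric])
  also have "... = (LBINT s. ?g s * cnj (fourier \<phi> s) * fourier \<phi> s)"
    by (rule Bochner_Integration.integral_cong) (simp_all add: complex_norm_square[symmetric] mult_ac del: of_real_power add: of_real_power[symmetric])
  also have "... = (LBINT x. complex_of_real (\<phi> x) * (LBINT s. ?g s * cnj (fourier \<phi> s) * iexp (x * s)))"
    by (rule multiplication_formula[OF u2 \<phi>])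
  also have "... = (LBINT x. complex_of_real (\<phi> x * (LBINT y. \<phi> y * gauss_kernel \<epsilon> (y - x))))"
    unfolding inner by simp
  also have "... = complex_of_real (gauss_energy \<epsilon> \<phi>)"
    unfolding gauss_energy_def by (rule integral_complex_of_real)
  finally show "(LBINT s. (cmod (fourier \<phi> s))^2 * gauss_weight \<epsilon> s) = gauss_energy \<epsilon> \<phi>"
    by (simp only: of_real_eq_iff)
qed

text \<open>After rescaling, the smoothed energy is an average of the autocorrelation at distance of order \<open>\<epsilon>\<close>, so its
limit only needs the continuity of the autocorrelation at the origin.\<close>
lemma gauss_energy_eq_autocorrelation:
  assumes i1: "integrable lborel \<phi>" and i2: "integrable lborel (\<lambda>x. (\<phi> x)^2)" and \<epsilon>: "0 < \<epsilon>"
  shows "gauss_energy \<epsilon> \<phi> = 2 * pi * (LBINT z. std_normal_density z * autocorrelation \<phi> (\<epsilon> * z))"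
proof -
  have [measurable]: "\<phi> \<in> borel_measurable borel" using i1 by auto
  have sub: "(LBINT y. \<phi> y * gauss_kernel \<epsilon> (y - x)) = (LBINT z. \<phi> (x + \<epsilon> * z) * (2 * pi * std_normal_density z))" for x
    using lborel_integral_real_affine[of \<epsilon> "\<lambda>y. \<phi> y * gauss_kernel \<epsilon> (y - x)" x] \<epsilon>
    by (simp add: gauss_kernel_altdef)
  have int: "integrable (lborel \<Otimes>\<^sub>M lborel) (\<lambda>(z, x). std_normal_density z * (\<phi> x * \<phi> (x + \<epsilon> * z)))"
  proof (rule lborel_pair.Fubini_integrable)
    show "integrable lborel (\<lambda>z. \<integral>x. norm (case (z, x) of (z, x) => std_normal_density z * (\<phi> x * \<phi> (x + \<epsilon> * z))) \<partial>lborel)"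
    proof (rule Bochner_Integration.integrable_bound)
      show "integrable lborel (\<lambda>z. std_normal_density z * (LBINT x. (\<bar>\<phi> x\<bar>)^2))"
        by (intro integrable_mult_left integrable_normal_density) simp
      show "AE z in lborel. norm (LBINT x. norm (case (z, x) of (z, x) => std_normal_density z * (\<phi> x * \<phi> (x + \<epsilon> * z)))) \<le>
         norm (std_normal_density z * (LBINT x. (\<bar>\<phi> x\<bar>)^2))"
      proof (rule AE_I2)
        fix z
        have "(LBINT x. norm (case (z, x) of (z, x) => std_normal_density z * (\<phi> x * \<phi> (x + \<epsilon> * z)))) =
            std_normal_density z * autocorrelation (\<lambda>x. \<bar>\<phi> x\<bar>) (\<epsilon> * z)" (is "?l = _")
          by (simp add: autocorrelation_def abs_mult)
        moreover have "\<bar>autocorrelation (\<lambda>x. \<bar>\<phi> x\<bar>) (\<epsilon> * z)\<bar> \<le> (LBINT x. (\<bar>\<phi> x\<bar>)^2)"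
          using i1 i2 by (intro autocorrelation_bound) auto
        ultimately show "norm (LBINT x. norm (case (z, x) of (z, x) => std_normal_density z * (\<phi> x * \<phi> (x + \<epsilon> * z)))) \<le>
         norm (std_normal_density z * (LBINT x. (\<bar>\<phi> x\<bar>)^2))"
          by (simp only: real_norm_def abs_mult abs_of_nonneg[OF normal_density_nonneg]) (intro mult_left_mono; simp)
      qed
    qed measurable
    show "AE z in lborel. integrable lborel (\<lambda>x. case (z, x) of (z, x) => std_normal_density z * (\<phi> x * \<phi> (x + \<epsilon> * z)))"
      using autocorrelation_integrable[OF i1 i2] by simp
  qed measurable
  have "gauss_energy \<epsilon> \<phi> = (LBINT x. (LBINT z. 2 * pi * (std_normal_density z * (\<phi> x * \<phi> (x + \<epsilon> * z)))))"
    unfolding gauss_energy_def sub by (simp add: integral_mult_right_zero[symmetric] mult_ac del: integral_mult_right_zero)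
  also have "... = 2 * pi * (LBINT x. (LBINT z. std_normal_density z * (\<phi> x * \<phi> (x + \<epsilon> * z))))"
    by simp
  also have "(LBINT x. (LBINT z. std_normal_density z * (\<phi> x * \<phi> (x + \<epsilon> * z)))) =
     (LBINT z. (LBINT x. std_normal_density z * (\<phi> x * \<phi> (x + \<epsilon> * z))))"
    using lborel_pair.Fubini_integral[OF int] by simp
  finally show ?thesis by (simp add: autocorrelation_def)
qed

lemma gauss_energy_tendsto:
  assumes i1: "integrable lborel \<phi>" and i2: "integrable lborel (\<lambda>x. (\<phi> x)^2)"
  shows "(\<lambda>n. gauss_energy (1 / real (Suc n)) \<phi>) \<longlonglongrightarrow> 2 * pi * (LBINT x. (\<phi> x)^2)"
proof -
  have [measurable]: "\<phi> \<in> borel_measurable borel" using i1 by auto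
  let ?c = "\<integral>x. (\<phi> x)^2 \<partial>lborel"
  have "(\<lambda>n. \<integral>z. std_normal_density z * autocorrelation \<phi> (1 / real (Suc n) * z) \<partial>lborel) \<longlonglongrightarrow> (LBINT z. std_normal_density z * ?c)"
  proof (rule integral_dominated_convergence[where w = "\<lambda>z. std_normal_density z * ?c"])
    show "(\<lambda>z. std_normal_density z * autocorrelation \<phi> (1 / real (Suc n) * z)) \<in> borel_measurable lborel" for n
      unfolding autocorrelation_def by measurable
    show "AE z in lborel. (\<lambda>n. std_normal_density z * autocorrelation \<phi> (1 / real (Suc n) * z)) \<longlonglongrightarrow> std_normal_density z * ?c"
    proof (rule AE_I2)
      fix z :: real
      have "(\<lambda>n. 1 / real (Suc n) * z) \<longlonglongrightarrow> 0 * z"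
        by (rule tendsto_mult[OF LIMSEQ_Suc[OF lim_1_over_n] tendsto_const])
      then have "(\<lambda>n. 1 / real (Suc n) * z) \<longlonglongrightarrow> 0" by simp
      from autocorrelation_tendsto[OF i1 i2 this]
      show "(\<lambda>n. std_normal_density z * autocorrelation \<phi> (1 / real (Suc n) * z)) \<longlonglongrightarrow> std_normal_density z * ?c"
        by (rule tendsto_mult[OF tendsto_const])
    qed
    show "AE z in lborel. norm (std_normal_density z * autocorrelation \<phi> (1 / real (Suc n) * z)) \<le> std_normal_density z * ?c" for n
      using autocorrelation_bound[OF i1 i2] by (auto simp: abs_mult intro!: mult_left_mono)
  qed (auto intro!: integrable_mult_left)
  then have "(\<lambda>n. 2 * pi * (LBINT z. std_normal_density z * autocorrelation \<phi> (1 / real (Suc n) * z))) \<longlonglongrightarrow> 2 * pi * (LBINT z. std_normal_density z * ?c)"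
    by (rule tendsto_mult[OF tendsto_const])
  then show ?thesis by (simp add: gauss_energy_eq_autocorrelation[OF i1 i2])
qed

lemma gauss_weight_tendsto: "(\<lambda>n. gauss_weight (1 / real (Suc n)) s) \<longlonglongrightarrow> 1"
proof -
  have "(\<lambda>n. 1 / real (Suc n) * s) \<longlonglongrightarrow> 0 * s"
    by (rule tendsto_mult[OF LIMSEQ_Suc[OF lim_1_over_n] tendsto_const])
  then have "(\<lambda>n. exp (- (1 / real (Suc n) * s)\<^sup>2 / 2)) \<longlonglongrightarrow> exp (- (0 * s)\<^sup>2 / 2)"
    by (rule tendsto_exp[OF tendsto_divide[OF tendsto_minus[OF tendsto_power] tendsto_const]]) simp
  then show ?thesis by (simp add: gauss_weight_def)
qed

lemma gauss_weight_mono: "mono (\<lambda>n. gauss_weight (1 / real (Suc n)) s)"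
proof (rule monoI)
  fix m n :: nat assume "m \<le> n"
  then have "1 / real (Suc n) * \<bar>s\<bar> \<le> 1 / real (Suc m) * \<bar>s\<bar>" by (intro mult_right_mono) (auto simp: field_simps)
  then have "(1 / real (Suc n) * \<bar>s\<bar>)^2 \<le> (1 / real (Suc m) * \<bar>s\<bar>)^2" by (rule power_mono) simp
  then show "gauss_weight (1 / real (Suc m)) s \<le> gauss_weight (1 / real (Suc n)) s"
    by (simp add: gauss_weight_def power_mult_distrib power_divide)
qed

text \<open>The weights increase to one as \<open>\<epsilon>\<close> decreases to zero, so monotone convergence turns the weighted identity
into the unweighted one.\<close>
theorem Plancherel:
  assumes i1: "integrable lborel \<phi>" and i2: "integrable lborel (\<lambda>x. (\<phi> x)^2)"
  shows "integrable lborel (\<lambda>s. (cmod (fourier \<phi> s))^2)"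
    and "(LBINT s. (cmod (fourier \<phi> s))^2) = 2 * pi * (LBINT x. (\<phi> x)^2)"
proof -
  have [measurable]: "\<phi> \<in> borel_measurable borel" using i1 by auto
  have a: "integrable lborel (\<lambda>s. (cmod (fourier \<phi> s))^2 * gauss_weight (1 / real (Suc n)) s)" for n
    by (rule weighted_Plancherel(1)[OF i1]) simp
  have b: "(\<lambda>n. \<integral>s. (cmod (fourier \<phi> s))^2 * gauss_weight (1 / real (Suc n)) s \<partial>lborel) \<longlonglongrightarrow> 2 * pi * (LBINT x. (\<phi> x)^2)"
    using gauss_energy_tendsto[OF i1 i2] by (subst weighted_Plancherel(2)[OF i1]) simp_all
  have c: "AE s in lborel. mono (\<lambda>n. (cmod (fourier \<phi> s))^2 * gauss_weight (1 / real (Suc n)) s)"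
    using gauss_weight_mono by (auto simp: mono_def intro!: mult_left_mono)
  have d: "AE s in lborel. (\<lambda>n. (cmod (fourier \<phi> s))^2 * gauss_weight (1 / real (Suc n)) s) \<longlonglongrightarrow> (cmod (fourier \<phi> s))^2"
  proof (rule AE_I2)
    fix s
    show "(\<lambda>n. (cmod (fourier \<phi> s))^2 * gauss_weight (1 / real (Suc n)) s) \<longlonglongrightarrow> (cmod (fourier \<phi> s))^2"
      using tendsto_mult[OF tendsto_const gauss_weight_tendsto[of s], of "(cmod (fourier \<phi> s))^2"] by simp
  qed
  have m: "(\<lambda>s. (cmod (fourier \<phi> s))^2) \<in> borel_measurable lborel" by measurable
  show "integrable lborel (\<lambda>s. (cmod (fourier \<phi> s))^2)"
    by (rule integrable_monotone_convergence[OF a c d b m])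
  show "(LBINT s. (cmod (fourier \<phi> s))^2) = 2 * pi * (LBINT x. (\<phi> x)^2)"
    by (rule integral_monotone_convergence[OF a c d b m])
qed

text \<open>The converse of Plancherel's theorem for nonnegative functions. The truncation \<open>min (\<phi> x) n\<close> is square integrable,
and since the Gauss kernel is nonnegative its smoothed energy is at most that of \<open>\<phi>\<close>, which the weighted
identity bounds by the energy of the transform.\<close>
theorem square_integrable_of_fourier:
  assumes i1: "integrable lborel \<phi>" and nn: "\<And>x. 0 \<le> \<phi> x" and f2: "integrable lborel (\<lambda>s. (cmod (fourier \<phi> s))^2)"
  shows "integrable lborel (\<lambda>x. (\<phi> x)^2)"
proof -
  have [measurable]: "\<phi> \<in> borel_measurable borel" using i1 by auto
  define K where "K = (LBINT s. (cmod (fourier \<phi> s))^2)"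
  define \<psi> where "\<psi> M x = min (\<phi> x) (real M)" for M :: nat and x
  have [measurable]: "\<psi> M \<in> borel_measurable borel" for M unfolding \<psi>_def by measurable
  have \<psi>: "0 \<le> \<psi> M x" "\<psi> M x \<le> \<phi> x" "\<psi> M x \<le> real M" for M x using nn by (auto simp: \<psi>_def)
  have j1: "integrable lborel (\<psi> M)" for M
    by (rule Bochner_Integration.integrable_bound[OF i1]) (use \<psi> nn in auto)
  have j2: "integrable lborel (\<lambda>x. (\<psi> M x)^2)" for M
  proof (rule Bochner_Integration.integrable_bound)
    show "integrable lborel (\<lambda>x. real M * \<phi> x)" using i1 by simp
    show "AE x in lborel. norm ((\<psi> M x)^2) \<le> norm (real M * \<phi> x)"
      using \<psi> nn by (auto simp: power2_eq_square abs_mult intro!: mult_mono)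
  qed measurable
  have inner_int: "integrable lborel (\<lambda>y. u y * gauss_kernel \<epsilon> (y - x))" if "integrable lborel u" "0 < \<epsilon>" for u \<epsilon> and x :: real
  proof (rule Bochner_Integration.integrable_bound)
    have [measurable]: "u \<in> borel_measurable borel" using that by auto
    show "integrable lborel (\<lambda>y. sqrt (2 * pi) / \<epsilon> * u y)" using that by simp
    show "AE y in lborel. norm (u y * gauss_kernel \<epsilon> (y - x)) \<le> norm (sqrt (2 * pi) / \<epsilon> * u y)"
    proof (rule AE_I2)
      fix y
      have "gauss_kernel \<epsilon> (y - x) * \<bar>u y\<bar> \<le> sqrt (2 * pi) / \<epsilon> * \<bar>u y\<bar>"
        by (intro mult_right_mono gauss_kernel_bound that) simp
      then show "norm (u y * gauss_kernel \<epsilon> (y - x)) \<le> norm (sqrt (2 * pi) / \<epsilon> * u y)"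
        using gauss_kernel_nonneg[OF that(2), of "y - x"] that(2) by (simp add: abs_mult mult.commute)
    qed
    show "(\<lambda>y. u y * gauss_kernel \<epsilon> (y - x)) \<in> borel_measurable lborel" by measurable
  qed
  have outer_int: "integrable lborel (\<lambda>x. u x * (LBINT y. u y * gauss_kernel \<epsilon> (y - x)))"
    if u: "integrable lborel u" "\<And>x. 0 \<le> u x" and \<epsilon>: "0 < \<epsilon>" for u \<epsilon>
  proof (rule Bochner_Integration.integrable_bound)
    have [measurable]: "u \<in> borel_measurable borel" using that by auto
    let ?B = "sqrt (2 * pi) / \<epsilon> * (LBINT y. u y)"
    show "integrable lborel (\<lambda>x. u x * ?B)" using that by simp
    show "AE x in lborel. norm (u x * (LBINT y. u y * gauss_kernel \<epsilon> (y - x))) \<le> norm (u x * ?B)"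
    proof (rule AE_I2)
      fix x
      have "(LBINT y. u y * gauss_kernel \<epsilon> (y - x)) \<le> (LBINT y. sqrt (2 * pi) / \<epsilon> * u y)"
      proof (rule integral_mono[OF inner_int[OF u(1) \<epsilon>]])
        show "integrable lborel (\<lambda>y. sqrt (2 * pi) / \<epsilon> * u y)" using u(1) by simp
        fix y
        show "u y * gauss_kernel \<epsilon> (y - x) \<le> sqrt (2 * pi) / \<epsilon> * u y"
          using mult_right_mono[OF gauss_kernel_bound[OF \<epsilon>, of "y - x"] u(2)[of y]] by (simp only: mult.commute)
      qed
      then have "(LBINT y. u y * gauss_kernel \<epsilon> (y - x)) \<le> ?B" by simp
      moreover have "0 \<le> (LBINT y. u y * gauss_kernel \<epsilon> (y - x))"
        using u gauss_kernel_nonneg[OF \<epsilon>] by (intro integral_nonneg_AE) auto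
      ultimately show "norm (u x * (LBINT y. u y * gauss_kernel \<epsilon> (y - x))) \<le> norm (u x * ?B)"
      proof -
        assume b: "(LBINT y. u y * gauss_kernel \<epsilon> (y - x)) \<le> ?B" "0 \<le> (LBINT y. u y * gauss_kernel \<epsilon> (y - x))"
        then have "\<bar>\<integral>y. u y * gauss_kernel \<epsilon> (y - x) \<partial>lborel\<bar> \<le> \<bar>?B\<bar>" by linarith
        then show ?thesis unfolding real_norm_def abs_mult[of "u x"] by (rule mult_left_mono) simp
      qed
    qed
    show "(\<lambda>x. u x * (LBINT y. u y * gauss_kernel \<epsilon> (y - x))) \<in> borel_measurable lborel" by measurable
  qed
  have energy: "gauss_energy \<epsilon> (\<psi> M) \<le> K" if \<epsilon>: "0 < \<epsilon>" for M \<epsilon>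
  proof -
    have "gauss_energy \<epsilon> (\<psi> M) \<le> gauss_energy \<epsilon> \<phi>" unfolding gauss_energy_def
    proof (rule integral_mono[OF outer_int[OF j1 \<psi>(1) \<epsilon>] outer_int[OF i1 nn \<epsilon>]])
      fix x
      have "(LBINT y. \<psi> M y * gauss_kernel \<epsilon> (y - x)) \<le> (LBINT y. \<phi> y * gauss_kernel \<epsilon> (y - x))"
        by (rule integral_mono[OF inner_int[OF j1 \<epsilon>] inner_int[OF i1 \<epsilon>]])
           (use \<psi> gauss_kernel_nonneg[OF \<epsilon>] in \<open>auto intro!: mult_right_mono\<close>)
      moreover have "0 \<le> (LBINT y. \<psi> M y * gauss_kernel \<epsilon> (y - x))"
        using \<psi> gauss_kernel_nonneg[OF \<epsilon>] by (intro integral_nonneg_AE) auto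
      ultimately show "\<psi> M x * (LBINT y. \<psi> M y * gauss_kernel \<epsilon> (y - x)) \<le> \<phi> x * (LBINT y. \<phi> y * gauss_kernel \<epsilon> (y - x))"
        using \<psi> nn by (intro mult_mono) auto
    qed
    also have "... = (LBINT s. (cmod (fourier \<phi> s))^2 * gauss_weight \<epsilon> s)" using weighted_Plancherel(2)[OF i1 \<epsilon>] by simp
    also have "... \<le> K" unfolding K_def
      using weighted_Plancherel(1)[OF i1 \<epsilon>] f2 gauss_weight_bounds by (intro integral_mono) (auto intro!: mult_left_le)
    finally show ?thesis .
  qed
  have bound: "2 * pi * (LBINT x. (\<psi> M x)^2) \<le> K" for M
    by (rule LIMSEQ_le_const2[OF gauss_energy_tendsto[OF j1 j2]]) (use energy in auto)
  have "(\<integral>\<^sup>+x. ennreal ((\<phi> x)^2) \<partial>lborel) \<le> ennreal (K / (2 * pi))"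
  proof -
    have "(\<integral>\<^sup>+x. ennreal ((\<phi> x)^2) \<partial>lborel) \<le> (\<integral>\<^sup>+x. liminf (\<lambda>M. ennreal ((\<psi> M x)^2)) \<partial>lborel)"
    proof (rule nn_integral_mono)
      fix x
      obtain M0 :: nat where "\<phi> x \<le> real M0" using real_arch_simple by blast
      then have "\<psi> M x = \<phi> x" if "M \<ge> M0" for M using that by (simp add: \<psi>_def min_def)
      then have "\<forall>\<^sub>F M in sequentially. ennreal ((\<psi> M x)^2) = ennreal ((\<phi> x)^2)"
        unfolding eventually_sequentially by (intro exI[of _ M0]) simp
      then have "(\<lambda>M. ennreal ((\<psi> M x)^2)) \<longlonglongrightarrow> ennreal ((\<phi> x)^2)" by (rule tendsto_eventually)
      then have "liminf (\<lambda>M. ennreal ((\<psi> M x)^2)) = ennreal ((\<phi> x)^2)" by (intro lim_imp_Liminf) auto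
      then show "ennreal ((\<phi> x)^2) \<le> liminf (\<lambda>M. ennreal ((\<psi> M x)^2))" by simp
    qed
    also have "... \<le> liminf (\<lambda>M. \<integral>\<^sup>+x. ennreal ((\<psi> M x)^2) \<partial>lborel)"
      by (rule nn_integral_liminf) measurable
    also have "... \<le> ennreal (K / (2 * pi))"
    proof -
      have "(\<integral>\<^sup>+x. ennreal ((\<psi> M x)^2) \<partial>lborel) \<le> ennreal (K / (2 * pi))" for M
        using bound[of M] by (subst nn_integral_eq_integral[OF j2]) (auto intro!: ennreal_leI simp: field_simps)
      then show ?thesis by (intro Liminf_le) (auto intro!: always_eventually)
    qed
    finally show ?thesis .
  qed
  then show ?thesis by (intro integrableI_bounded) (auto intro: le_less_trans)
qed

section \<open>Convolution of the two transforms\<close>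

lemma fourier_add: "integrable lborel \<phi> ==> integrable lborel \<psi> ==> fourier (\<lambda>x. \<phi> x + \<psi> x) t = fourier \<phi> t + fourier \<psi> t"
  unfolding fourier_def using fourier_integrand[of \<phi> t] fourier_integrand[of \<psi> t] by (simp add: distrib_left)

lemma fourier_diff: "integrable lborel \<phi> ==> integrable lborel \<psi> ==> fourier (\<lambda>x. \<phi> x - \<psi> x) t = fourier \<phi> t - fourier \<psi> t"
  unfolding fourier_def using fourier_integrand[of \<phi> t] fourier_integrand[of \<psi> t] by (simp add: right_diff_distrib)

text \<open>Polarization of Plancherel's theorem.\<close>
lemma Parseval:
  assumes \<phi>: "integrable lborel \<phi>" "integrable lborel (\<lambda>x. (\<phi> x)^2)"
    and \<psi>: "integrable lborel \<psi>" "integrable lborel (\<lambda>x. (\<psi> x)^2)"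
  shows "(LBINT s. Re (fourier \<phi> s * cnj (fourier \<psi> s))) = 2 * pi * (LBINT x. \<phi> x * \<psi> x)"
proof -
  have [measurable]: "\<phi> \<in> borel_measurable borel" "\<psi> \<in> borel_measurable borel" using \<phi> \<psi> by auto
  have m: "integrable lborel (\<lambda>x. \<phi> x * \<psi> x)" using \<phi> \<psi> by (intro integrable_mult_square) auto
  have s1: "integrable lborel (\<lambda>x. \<phi> x + \<psi> x)" and d1: "integrable lborel (\<lambda>x. \<phi> x - \<psi> x)" using \<phi> \<psi> by auto
  have s2: "integrable lborel (\<lambda>x. (\<phi> x + \<psi> x)^2)" using \<phi> \<psi> m by (simp add: power2_sum mult.assoc)
  have d2: "integrable lborel (\<lambda>x. (\<phi> x - \<psi> x)^2)" using \<phi> \<psi> m by (simp add: power2_diff mult.assoc)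
  have polar: "Re (z * cnj w) = ((cmod (z + w))^2 - (cmod (z - w))\<^sup>2) / 4" for z w
    by (simp add: cmod_power2 power2_sum power2_diff)
  have "(LBINT s. Re (fourier \<phi> s * cnj (fourier \<psi> s))) =
     (LBINT s. ((cmod (fourier (\<lambda>x. \<phi> x + \<psi> x) s))^2 - (cmod (fourier (\<lambda>x. \<phi> x - \<psi> x) s))\<^sup>2) / 4)"
    unfolding polar fourier_add[OF \<phi>(1) \<psi>(1)] fourier_diff[OF \<phi>(1) \<psi>(1)] ..
  also have "... = ((LBINT s. (cmod (fourier (\<lambda>x. \<phi> x + \<psi> x) s))^2) - (LBINT s. (cmod (fourier (\<lambda>x. \<phi> x - \<psi> x) s))^2)) / 4"
    using Plancherel(1)[OF s1 s2] Plancherel(1)[OF d1 d2] by simp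
  also have "... = 2 * pi * ((LBINT x. (\<phi> x + \<psi> x)^2) - (LBINT x. (\<phi> x - \<psi> x)^2)) / 4"
    unfolding Plancherel(2)[OF s1 s2] Plancherel(2)[OF d1 d2] by (simp add: right_diff_distrib)
  also have "(LBINT x. (\<phi> x + \<psi> x)^2) - (LBINT x. (\<phi> x - \<psi> x)^2) = (LBINT x. 4 * (\<phi> x * \<psi> x))"
    unfolding Bochner_Integration.integral_diff[OF s2 d2, symmetric]
    by (rule Bochner_Integration.integral_cong) (auto simp: power2_sum power2_diff)
  finally show ?thesis by simp
qed

lemma fourier_uminus: "fourier \<phi> (- t) = cnj (fourier \<phi> t)"
proof -
  have "fourier \<phi> (- t) = (LBINT x. cnj (iexp (x * t) * complex_of_real (\<phi> x)))"
    unfolding fourier_def by (rule Bochner_Integration.integral_cong) (auto simp: exp_cnj)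
  also have "... = cnj (fourier \<phi> t)" unfolding fourier_def by (rule Bochner_Integration.integral_cnj)
  finally show ?thesis .
qed

lemma integral_reflect:
  fixes u :: "real => 'b::{banach, second_countable_topology}"
  shows "(LBINT x. u (- x)) = (LBINT x. u x)"
  using lborel_integral_real_affine[of "-1" u 0] by simp

lemma fourier_even_real:
  assumes "\<And>x. \<phi> (- x) = \<phi> x"
  shows "Im (fourier \<phi> t) = 0"
proof -
  have "fourier \<phi> (- t) = fourier \<phi> t"
    using integral_reflect[of "\<lambda>x. iexp (x * t) * complex_of_real (\<phi> x)"] assms by (simp add: fourier_def)
  then have "cnj (fourier \<phi> t) = fourier \<phi> t" by (simp add: fourier_uminus)
  then show ?thesis by (metis complex_cnj add.inverse_neutral complex.sel(2) complex_surj equation_minus_iff neg_equal_zero)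
qed

lemma integrable_modulate:
  assumes "integrable lborel g" and c: "\<And>x. \<bar>c x\<bar> \<le> 1" and [measurable]: "c \<in> borel_measurable borel"
  shows "integrable lborel (\<lambda>x. c x * (g x :: real))"
proof (rule Bochner_Integration.integrable_bound[OF assms(1)])
  show "AE x in lborel. norm (c x * g x) \<le> norm (g x)"
  proof (rule AE_I2)
    fix x
    show "norm (c x * g x) \<le> norm (g x)"
      using mult_right_mono[OF c[of x], of "\<bar>g x\<bar>"] by (simp add: abs_mult)
  qed
qed (use assms(1) in auto)

text \<open>Multiplication by a cosine splits the transform into two shifted halves; this is how the shift of \<open>a\<close> under the convolution
integral becomes a modulation of \<open>g\<close>.\<close>
lemma fourier_cos_mult:
  assumes g: "integrable lborel g"
  shows "fourier (\<lambda>x. cos (x * t) * g x) s = (fourier g (s + t) + fourier g (s - t)) / 2"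
proof -
  have "fourier (\<lambda>x. cos (x * t) * g x) s =
     (LBINT x. (iexp (x * (s + t)) * complex_of_real (g x) + iexp (x * (s - t)) * complex_of_real (g x)) / 2)"
    unfolding fourier_def
  proof (rule Bochner_Integration.integral_cong[OF refl])
    fix x
    have c: "complex_of_real (cos (x * t)) = (iexp (x * t) + iexp (- (x * t))) / 2"
      by (simp add: cos_of_real[symmetric] cos_exp_eq)
    have e1: "iexp (x * (s + t)) = iexp (x * s) * iexp (x * t)"
      unfolding exp_add[symmetric] by (simp add: algebra_simps)
    have e2: "iexp (x * (s - t)) = iexp (x * s) * iexp (- (x * t))"
      unfolding exp_add[symmetric] by (simp add: algebra_simps)
    show "iexp (x * s) * complex_of_real (cos (x * t) * g x) =
      (iexp (x * (s + t)) * complex_of_real (g x) + iexp (x * (s - t)) * complex_of_real (g x)) / 2"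
      unfolding of_real_mult[of "cos (x * t)"] c e1 e2 by (simp add: field_simps)
  qed
  also have "... = (fourier g (s + t) + fourier g (s - t)) / 2"
    using fourier_integrand[OF g, of "s + t"] fourier_integrand[OF g, of "s - t"] by (simp add: fourier_def)
  finally show ?thesis .
qed

lemma fourier_sin_mult:
  assumes g: "integrable lborel g"
  shows "fourier (\<lambda>x. sin (x * t) * g x) s = (fourier g (s + t) - fourier g (s - t)) / (2 * \<i>)"
proof -
  have "fourier (\<lambda>x. sin (x * t) * g x) s =
     (LBINT x. (iexp (x * (s + t)) * complex_of_real (g x) - iexp (x * (s - t)) * complex_of_real (g x)) / (2 * \<i>))"
    unfolding fourier_def
  proof (rule Bochner_Integration.integral_cong[OF refl])
    fix x
    have c: "complex_of_real (sin (x * t)) = (iexp (x * t) - iexp (- (x * t))) / (2 * \<i>)"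
      by (simp add: sin_of_real[symmetric] sin_exp_eq)
    have e1: "iexp (x * (s + t)) = iexp (x * s) * iexp (x * t)"
      unfolding exp_add[symmetric] by (simp add: algebra_simps)
    have e2: "iexp (x * (s - t)) = iexp (x * s) * iexp (- (x * t))"
      unfolding exp_add[symmetric] by (simp add: algebra_simps)
    show "iexp (x * s) * complex_of_real (sin (x * t) * g x) =
      (iexp (x * (s + t)) * complex_of_real (g x) - iexp (x * (s - t)) * complex_of_real (g x)) / (2 * \<i>)"
      unfolding of_real_mult[of "sin (x * t)"] c e1 e2 by (simp add: field_simps)
  qed
  also have "... = (fourier g (s + t) - fourier g (s - t)) / (2 * \<i>)"
    using fourier_integrand[OF g, of "s + t"] fourier_integrand[OF g, of "s - t"] by (simp add: fourier_def)
  finally show ?thesis .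
qed

text \<open>A spectral density and a generating function with their (real) transforms.\<close>
locale spectral_pair =
  fixes f g r a :: "real => real"
  assumes f: "integrable lborel f" "\<And>x. 0 \<le> f x" and g: "integrable lborel g" "\<And>x. 0 \<le> g x"
    and r: "\<And>t. fourier f t = complex_of_real (r t)" and a: "\<And>t. fourier g t = complex_of_real (a t)"
    and r2: "integrable lborel (\<lambda>t. (r t)^2)" and a2: "integrable lborel (\<lambda>t. (a t)^2)"
    and fg2: "integrable lborel (\<lambda>x. (f x * g x)^2)"
begin

lemma f2: "integrable lborel (\<lambda>x. (f x)^2)" and g2: "integrable lborel (\<lambda>x. (g x)^2)"
  by (rule square_integrable_of_fourier[OF f]; simp add: r r2)
     (rule square_integrable_of_fourier[OF g]; simp add: a a2)

lemma meas_r [measurable]: "r \<in> borel_measurable borel" and meas_a [measurable]: "a \<in> borel_measurable borel"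
proof -
  have "(\<lambda>t. Re (fourier f t)) \<in> borel_measurable borel" "(\<lambda>t. Re (fourier g t)) \<in> borel_measurable borel"
    using f(1) g(1) by auto
  then show "r \<in> borel_measurable borel" "a \<in> borel_measurable borel" by (simp_all add: r a)
qed

lemma r_even: "r (- t) = r t" and a_even: "a (- t) = a t"
  using fourier_uminus[of f t] fourier_uminus[of g t] by (simp_all add: r a)

lemma fg1: "integrable lborel (\<lambda>x. f x * g x)"
  using f(1) g(1) by (intro integrable_mult_square f2 g2) auto

definition conv :: "real => real" where
  "conv t = (LBINT s. a s * r (t - s))"

lemma modulated_Parseval:
  assumes c: "\<And>x. \<bar>c x\<bar> \<le> 1" and [measurable]: "c \<in> borel_measurable borel"
  shows "(LBINT s. Re (fourier (\<lambda>x. c x * g x) s) * r s) = 2 * pi * (LBINT x. c x * (f x * g x))"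
proof -
  have i1: "integrable lborel (\<lambda>x. c x * g x)" by (rule integrable_modulate[OF g(1) c]) measurable
  have "\<bar>(c x)^2\<bar> \<le> 1" for x using c[of x] by (simp add: abs_square_le_1)
  then have i2: "integrable lborel (\<lambda>x. (c x * g x)^2)"
    unfolding power_mult_distrib by (intro integrable_modulate g2) auto
  show ?thesis using Parseval[OF i1 i2 f(1) f2] by (simp add: r mult_ac)
qed

text \<open>The shift of \<open>a\<close> under the convolution integral is a modulation of \<open>g\<close>, so the convolution theorem is an instance of Parseval's
identity.\<close>
lemma conv_eq_cos: "conv t = 2 * pi * (LBINT x. cos (x * t) * (f x * g x))"
proof -
  have t1: "integrable lborel (\<lambda>s. (a (s + u))^2)" for u by (rule integrable_translate[OF a2])
  have i: "integrable lborel (\<lambda>s. a (s + u) * r s)" for u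
    by (intro integrable_mult_square t1 r2) auto
  have flip: "(LBINT s. a (s + t) * r s) = (LBINT s. a (s - t) * r s)"
  proof -
    have "a (- s + t) = a (s - t)" for s using a_even[of "s - t"] by simp
    then show ?thesis using integral_reflect[of "\<lambda>s. a (s + t) * r s"] by (simp add: r_even)
  qed
  have "2 * pi * (LBINT x. cos (x * t) * (f x * g x)) = (LBINT s. Re (fourier (\<lambda>x. cos (x * t) * g x) s) * r s)"
    by (rule modulated_Parseval[symmetric]) auto
  also have "... = (LBINT s. (a (s + t) * r s + a (s - t) * r s) / 2)"
    by (simp add: fourier_cos_mult[OF g(1)] a distrib_right add_divide_distrib)
  also have "... = (LBINT s. a (s - t) * r s)"
    using i[of t] i[of "- t"] flip by simp
  also have "... = (LBINT s. a s * r (s + t))"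
    using integral_translate[of "\<lambda>s. a (s - t) * r s" t] by simp
  also have "... = (LBINT s. a (- s) * r (- s + t))"
    by (rule integral_reflect[symmetric])
  finally show ?thesis by (simp add: conv_def a_even)
qed

lemma sin_zero: "(LBINT x. sin (x * t) * (f x * g x)) = 0"
proof -
  have "2 * pi * (LBINT x. sin (x * t) * (f x * g x)) = (LBINT s. Re (fourier (\<lambda>x. sin (x * t) * g x) s) * r s)"
    by (rule modulated_Parseval[symmetric]) auto
  also have "... = 0" by (simp add: fourier_sin_mult[OF g(1)] a Re_divide)
  finally show ?thesis by simp
qed

lemma conv_eq_fourier: "complex_of_real (conv t) = 2 * pi * fourier (\<lambda>x. f x * g x) t"
proof -
  note i = fourier_integrand[OF fg1, of t]
  have "Re (fourier (\<lambda>x. f x * g x) t) = (LBINT x. cos (x * t) * (f x * g x))"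
    unfolding fourier_def integral_Re[OF i, symmetric] by (simp add: Re_exp)
  moreover have "Im (fourier (\<lambda>x. f x * g x) t) = (LBINT x. sin (x * t) * (f x * g x))"
    unfolding fourier_def integral_Im[OF i, symmetric] by (simp add: Im_exp)
  ultimately show ?thesis by (simp add: complex_eq_iff conv_eq_cos sin_zero)
qed

lemma conv_even: "conv (- t) = conv t"
  by (simp add: conv_eq_cos)

text \<open>The factor \<open>8 * pi ^ 3\<close> is \<open>(2 * pi)\<^sup>2\<close> from the convolution theorem times \<open>2 * pi\<close> from Plancherel's
theorem.\<close>
theorem integral_conv_square:
  shows "(LBINT t. (conv t)^2) = 8 * pi ^ 3 * (LBINT x. (f x)^2 * (g x)^2)"
proof -
  have "(conv t)^2 = 4 * pi\<^sup>2 * (cmod (fourier (\<lambda>x. f x * g x) t))^2" for t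
  proof -
    have "\<bar>conv t\<bar> = cmod (complex_of_real (conv t))" by simp
    also have "... = 2 * pi * cmod (fourier (\<lambda>x. f x * g x) t)" unfolding conv_eq_fourier by (simp add: norm_mult)
    finally have "\<bar>conv t\<bar>\<^sup>2 = (2 * pi * cmod (fourier (\<lambda>x. f x * g x) t))^2" by simp
    then show ?thesis by (simp add: power_mult_distrib)
  qed
  then have "(LBINT t. (conv t)^2) = 4 * pi\<^sup>2 * (2 * pi * (LBINT x. (f x * g x)^2))"
    using Plancherel(2)[OF fg1 fg2] by simp
  moreover have "4 * pi\<^sup>2 * (2 * pi * c) = 8 * pi ^ 3 * c" for c by (simp add: power2_eq_square power3_eq_cube)
  ultimately show ?thesis by (simp add: power_mult_distrib)
qed

end

section \<open>Young convolution inequality\<close>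

lemma weighted_AM_GM:
  fixes x y :: real
  assumes "0 \<le> x" "0 \<le> y" "0 \<le> l" "0 \<le> m" "l + m = 1"
  shows "x powr l * y powr m \<le> x + y"
proof (cases "x = 0 \<or> y = 0")
  case True then show ?thesis using assms by auto
next
  case False
  then have p: "0 < x" "0 < y" using assms by auto
  have "x powr l * y powr m \<le> (max x y) powr l * (max x y) powr m"
    using p assms by (intro mult_mono powr_mono2) auto
  also have "... = max x y" using p assms by (simp add: powr_add[symmetric])
  also have "... \<le> x + y" using p by simp
  finally show ?thesis .
qed

text \<open>A bounded function in \<open>L\<^sup>p\<close> lies in all the spaces with larger exponent. It allows the exponents to be raised until
the inequality between them becomes an equality.\<close>
lemma in_Lp_bounded_mono:
  assumes h: "h \<in> borel_measurable borel" "integrable lborel (\<lambda>x. \<bar>h x\<bar> powr p)" and b: "\<And>x. \<bar>h x\<bar> \<le> B" and pq: "p \<le> q"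
  shows "integrable lborel (\<lambda>x. \<bar>h x :: real\<bar> powr q)"
proof (rule Bochner_Integration.integrable_bound)
  note [measurable] = h(1)
  show "integrable lborel (\<lambda>x. (B powr (q - p)) * \<bar>h x\<bar> powr p)" using h by simp
  show "(\<lambda>x. \<bar>h x\<bar> powr q) \<in> borel_measurable lborel" by measurable
  show "AE x in lborel. norm (\<bar>h x\<bar> powr q) \<le> norm (B powr (q - p) * \<bar>h x\<bar> powr p)"
  proof (rule AE_I2)
    fix x
    have "\<bar>h x\<bar> powr q = \<bar>h x\<bar> powr (q - p) * \<bar>h x\<bar> powr p" by (simp add: powr_add[symmetric])
    also have "... \<le> B powr (q - p) * \<bar>h x\<bar> powr p"
      using b pq by (intro mult_right_mono powr_mono2) auto
    finally show "norm (\<bar>h x\<bar> powr q) \<le> norm (B powr (q - p) * \<bar>h x\<bar> powr p)" by simp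
  qed
qed

definition econv :: "(real => real) => (real => real) => real => ennreal" where
  "econv u v t = (\<integral>\<^sup>+s. ennreal (\<bar>u s\<bar> * \<bar>v (t - s)\<bar>) \<partial>lborel)"

lemma nn_integral_translate:
  fixes u :: "real => ennreal"
  assumes [measurable]: "u \<in> borel_measurable borel"
  shows "(\<integral>\<^sup>+x. u (x + h) \<partial>lborel) = (\<integral>\<^sup>+x. u x \<partial>lborel)"
  using nn_integral_real_affine[of u 1 h] by (simp add: add.commute)

lemma nn_integral_reflect:
  fixes u :: "real => ennreal"
  assumes [measurable]: "u \<in> borel_measurable borel"
  shows "(\<integral>\<^sup>+x. u (c - x) \<partial>lborel) = (\<integral>\<^sup>+x. u x \<partial>lborel)"
  using nn_integral_real_affine[of u "-1" c] by simp

text \<open>With \<open>1 / p + 1 / q = 3 / 2\<close>, split \<open>\<bar>u\<bar> * \<bar>v\<bar>\<close> into the square roots of \<open>\<bar>u\<bar> powr q * \<bar>v\<bar> powr p\<close> and of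
\<open>\<bar>u\<bar> powr (2 - q) * \<bar>v\<bar> powr (2 - p)\<close>. The weights \<open>2 / q - 1\<close> and \<open>2 / p - 1\<close> add up to one, so the second
product is at most \<open>\<bar>u\<bar> powr q + \<bar>v\<bar> powr p\<close>, and the inequality of Cauchy and Schwarz leaves the convolution of two
integrable functions.\<close>
theorem Young_two:
  fixes u v :: "real => real"
  assumes [measurable]: "u \<in> borel_measurable borel" "v \<in> borel_measurable borel"
    and u: "integrable lborel (\<lambda>x. \<bar>u x\<bar> powr q)" and v: "integrable lborel (\<lambda>x. \<bar>v x\<bar> powr p)"
    and pq: "1 \<le> p" "p \<le> 2" "1 \<le> q" "q \<le> 2" "1 / p + 1 / q = 3 / 2"
  shows "(\<integral>\<^sup>+t. (econv u v t)^2 \<partial>lborel) < \<infinity>"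
proof -
  define U V where "U = (\<integral>\<^sup>+x. ennreal (\<bar>u x\<bar> powr q) \<partial>lborel)" and "V = (\<integral>\<^sup>+x. ennreal (\<bar>v x\<bar> powr p) \<partial>lborel)"
  have UV: "U < \<infinity>" "V < \<infinity>" using u v by (auto simp: U_def V_def real_integrable_def less_top)
  have pt: "(econv u v t)^2 \<le> (\<integral>\<^sup>+s. ennreal (\<bar>u s\<bar> powr q * \<bar>v (t - s)\<bar> powr p) \<partial>lborel) * (U + V)" for t
  proof -
    let ?f = "\<lambda>s. ennreal (\<bar>u s\<bar> powr (q / 2) * \<bar>v (t - s)\<bar> powr (p / 2))"
    let ?g = "\<lambda>s. ennreal (\<bar>u s\<bar> powr (1 - q / 2) * \<bar>v (t - s)\<bar> powr (1 - p / 2))"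
    have "econv u v t \<le> (\<integral>\<^sup>+s. ?f s * ?g s \<partial>lborel)" unfolding econv_def
    proof (rule nn_integral_mono)
      fix s
      have "\<bar>u s\<bar> powr (q / 2) * \<bar>v (t - s)\<bar> powr (p / 2) * (\<bar>u s\<bar> powr (1 - q / 2) * \<bar>v (t - s)\<bar> powr (1 - p / 2))
         = (\<bar>u s\<bar> powr (q / 2) * \<bar>u s\<bar> powr (1 - q / 2)) * (\<bar>v (t - s)\<bar> powr (p / 2) * \<bar>v (t - s)\<bar> powr (1 - p / 2))"
        by (simp only: mult_ac)
      also have "... = \<bar>u s\<bar> * \<bar>v (t - s)\<bar>" unfolding powr_add[symmetric] by simp
      finally show "ennreal (\<bar>u s\<bar> * \<bar>v (t - s)\<bar>) \<le> ?f s * ?g s" by (simp add: ennreal_mult[symmetric])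
    qed
    then have "(econv u v t)^2 \<le> (\<integral>\<^sup>+s. ?f s * ?g s \<partial>lborel)^2" by (rule power_mono) simp
    also have "... \<le> (\<integral>\<^sup>+s. (?f s)^2 \<partial>lborel) * (\<integral>\<^sup>+s. (?g s)^2 \<partial>lborel)" by (rule Cauchy_Schwarz_nn_integral) measurable
    also have "... \<le> (\<integral>\<^sup>+s. ennreal (\<bar>u s\<bar> powr q * \<bar>v (t - s)\<bar> powr p) \<partial>lborel) * (U + V)"
    proof (rule mult_mono)
      have "(x powr y)^2 = x powr (2 * y)" if "0 \<le> x" for x y :: real
        using that by (cases "x = 0") (simp_all add: powr_realpow[symmetric] powr_powr mult.commute)
      note sq = this
      show "(\<integral>\<^sup>+s. (?f s)^2 \<partial>lborel) \<le> (\<integral>\<^sup>+s. ennreal (\<bar>u s\<bar> powr q * \<bar>v (t - s)\<bar> powr p) \<partial>lborel)"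
        by (intro nn_integral_mono) (simp add: ennreal_power power_mult_distrib sq)
      have "(\<integral>\<^sup>+s. (?g s)^2 \<partial>lborel) \<le> (\<integral>\<^sup>+s. ennreal (\<bar>u s\<bar> powr q) + ennreal (\<bar>v (t - s)\<bar> powr p) \<partial>lborel)"
      proof (rule nn_integral_mono)
        fix s
        have "(\<bar>u s\<bar> powr (1 - q / 2) * \<bar>v (t - s)\<bar> powr (1 - p / 2))^2 = \<bar>u s\<bar> powr (2 - q) * \<bar>v (t - s)\<bar> powr (2 - p)"
          by (simp add: power_mult_distrib sq right_diff_distrib)
        also have "... = (\<bar>u s\<bar> powr q) powr (2 / q - 1) * (\<bar>v (t - s)\<bar> powr p) powr (2 / p - 1)"
          using pq by (simp add: powr_powr right_diff_distrib)
        also have "... \<le> \<bar>u s\<bar> powr q + \<bar>v (t - s)\<bar> powr p"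
          using pq by (intro weighted_AM_GM) (auto simp: field_simps)
        finally show "(?g s)^2 \<le> ennreal (\<bar>u s\<bar> powr q) + ennreal (\<bar>v (t - s)\<bar> powr p)"
          by (simp add: ennreal_power ennreal_plus[symmetric] del: ennreal_plus)
      qed
      also have "... = U + (\<integral>\<^sup>+s. ennreal (\<bar>v (t - s)\<bar> powr p) \<partial>lborel)"
        unfolding U_def by (rule nn_integral_add) measurable
      also have "(\<integral>\<^sup>+s. ennreal (\<bar>v (t - s)\<bar> powr p) \<partial>lborel) = V"
        unfolding V_def using nn_integral_reflect[of "\<lambda>s. ennreal (\<bar>v s\<bar> powr p)" t] by simp
      finally show "(\<integral>\<^sup>+s. (?g s)^2 \<partial>lborel) \<le> U + V" .
    qed auto
    finally show ?thesis .
  qed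
  have "(\<integral>\<^sup>+t. (econv u v t)^2 \<partial>lborel) \<le> (\<integral>\<^sup>+t. (\<integral>\<^sup>+s. ennreal (\<bar>u s\<bar> powr q * \<bar>v (t - s)\<bar> powr p) \<partial>lborel) * (U + V) \<partial>lborel)"
    by (intro nn_integral_mono pt)
  also have "... = (\<integral>\<^sup>+t. (\<integral>\<^sup>+s. ennreal (\<bar>u s\<bar> powr q * \<bar>v (t - s)\<bar> powr p) \<partial>lborel) \<partial>lborel) * (U + V)"
    by (rule nn_integral_multc) measurable
  also have "(\<integral>\<^sup>+t. (\<integral>\<^sup>+s. ennreal (\<bar>u s\<bar> powr q * \<bar>v (t - s)\<bar> powr p) \<partial>lborel) \<partial>lborel) =
      (\<integral>\<^sup>+s. (\<integral>\<^sup>+t. ennreal (\<bar>u s\<bar> powr q * \<bar>v (t - s)\<bar> powr p) \<partial>lborel) \<partial>lborel)"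
    by (rule lborel_pair.Fubini') measurable
  also have "... = (\<integral>\<^sup>+s. ennreal (\<bar>u s\<bar> powr q) * V \<partial>lborel)"
  proof (rule nn_integral_cong)
    fix s
    have "(\<integral>\<^sup>+t. ennreal (\<bar>u s\<bar> powr q * \<bar>v (t - s)\<bar> powr p) \<partial>lborel) = ennreal (\<bar>u s\<bar> powr q) * (\<integral>\<^sup>+t. ennreal (\<bar>v (t - s)\<bar> powr p) \<partial>lborel)"
      by (subst nn_integral_cmult[symmetric]) (auto simp: ennreal_mult)
    also have "(\<integral>\<^sup>+t. ennreal (\<bar>v (t - s)\<bar> powr p) \<partial>lborel) = V"
      unfolding V_def using nn_integral_translate[of "\<lambda>t. ennreal (\<bar>v t\<bar> powr p)" "- s"] by simp
    finally show "(\<integral>\<^sup>+t. ennreal (\<bar>u s\<bar> powr q * \<bar>v (t - s)\<bar> powr p) \<partial>lborel) = ennreal (\<bar>u s\<bar> powr q) * V" .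
  qed
  also have "... = U * V" unfolding U_def by (rule nn_integral_multc) measurable
  finally have "(\<integral>\<^sup>+t. (econv u v t)^2 \<partial>lborel) \<le> U * V * (U + V)" .
  also have "... < \<infinity>" using UV by (simp add: ennreal_mult_less_top)
  finally show ?thesis .
qed

locale Toeplitz_pair = spectral_pair +
  fixes p q :: real
  assumes pq: "1 \<le> p" "1 \<le> q" "1 / p + 1 / q \<ge> 3 / 2"
    and rp: "integrable lborel (\<lambda>t. \<bar>r t\<bar> powr p)" and aq: "integrable lborel (\<lambda>t. \<bar>a t\<bar> powr q)"
begin

lemma r_bound: "\<bar>r t\<bar> \<le> (LBINT x. \<bar>f x\<bar>)" and a_bound: "\<bar>a t\<bar> \<le> (LBINT x. \<bar>g x\<bar>)"
  using fourier_bound[OF f(1), of t] fourier_bound[OF g(1), of t] by (simp_all add: r a)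

text \<open>The common majorant of all composed kernels.\<close>
definition H :: "real => real" where
  "H t = (LBINT s. \<bar>a s\<bar> * \<bar>r (t - s)\<bar>)"

lemma H_integrand: "integrable lborel (\<lambda>s. \<bar>a s\<bar> * \<bar>r (t - s)\<bar>)"
proof -
  have "integrable lborel (\<lambda>s. (r (- s + t))^2)"
    using lborel_integrable_real_affine[OF r2, of "-1" t] by simp
  then show ?thesis using a2 by (intro integrable_mult_square) auto
qed

lemma meas_H [measurable]: "H \<in> borel_measurable borel"
  unfolding H_def[abs_def] by measurable

lemma H_nonneg: "0 \<le> H t"
  unfolding H_def by simp

lemma econv_eq_H: "econv a r t = ennreal (H t)"
  unfolding econv_def H_def by (rule nn_integral_eq_integral[OF H_integrand]) simp

lemma H_even: "H (- t) = H t"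
proof -
  have "H (- t) = (LBINT s. \<bar>a (- s)\<bar> * \<bar>r (- t - (- s))\<bar>)" unfolding H_def by (rule integral_reflect[symmetric])
  also have "... = H t" unfolding H_def
  proof (rule Bochner_Integration.integral_cong[OF refl])
    fix s show "\<bar>a (- s)\<bar> * \<bar>r (- t - (- s))\<bar> = \<bar>a s\<bar> * \<bar>r (t - s)\<bar>" using r_even[of "t - s"] by (simp add: a_even)
  qed
  finally show ?thesis .
qed

lemma H_square_integrable: "integrable lborel (\<lambda>t. (H t)^2)"
proof -
  have p2: "p \<le> 2"
  proof -
    have "1 / q \<le> 1" using pq by simp
    then have "1 / 2 \<le> 1 / p" using pq by linarith
    then show ?thesis using pq by (simp add: field_simps)
  qed
  define q' where "q' = 1 / (3 / 2 - 1 / p)"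
  have den: "1 / 2 \<le> 3 / 2 - 1 / p" "3 / 2 - 1 / p \<le> 1"
  proof -
    have "1 / p \<le> 1" using pq by simp
    moreover have "1 / 2 \<le> 1 / p" using p2 pq by (simp add: field_simps)
    ultimately show "1 / 2 \<le> 3 / 2 - 1 / p" "3 / 2 - 1 / p \<le> 1" by linarith+
  qed
  have q': "1 \<le> q'" "q' \<le> 2" "1 / p + 1 / q' = 3 / 2" using den by (auto simp: q'_def field_simps)
  have "q \<le> q'"
  proof -
    have "1 / q' \<le> 1 / q" using q'(3) pq by linarith
    then show ?thesis using pq q' by (simp add: field_simps)
  qed
  then have aq': "integrable lborel (\<lambda>t. \<bar>a t\<bar> powr q')" using a_bound by (intro in_Lp_bounded_mono[OF _ aq]) auto
  have "(\<integral>\<^sup>+t. (econv a r t)^2 \<partial>lborel) < \<infinity>"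
    by (rule Young_two[OF _ _ aq' rp pq(1) p2 q']) auto
  then show ?thesis
    by (intro integrableI_bounded) (auto simp: econv_eq_H ennreal_power H_nonneg)
qed

text \<open>It majorizes the squares of the composed kernels.\<close>
definition J :: "real => real" where "J t = (LBINT s. H s * H (t - s))"

lemma J_integrand: "integrable lborel (\<lambda>s. H s * H (t - s))"
proof -
  have "integrable lborel (\<lambda>s. (H (- s + t))^2)"
    using lborel_integrable_real_affine[OF H_square_integrable, of "-1" t] by simp
  then show ?thesis using H_square_integrable by (intro integrable_mult_square) auto
qed

definition H_energy :: real where "H_energy = (LBINT t. (H t)^2)"

lemma H_energy_nonneg: "0 \<le> H_energy" by (simp add: H_energy_def)

lemma J_nonneg: "0 \<le> J t" unfolding J_def using H_nonneg by simp

lemma meas_J [measurable]: "J \<in> borel_measurable borel"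
  unfolding J_def[abs_def] by measurable

lemma tail_integral_tendsto:
  "(\<lambda>n. \<integral>s. (indicator {s. \<bar>s\<bar> > real n} s * H s)^2 \<partial>lborel) \<longlonglongrightarrow> 0"
proof -
  have "(\<lambda>n. \<integral>s. (indicator {s. \<bar>s\<bar> > real n} s * H s)^2 \<partial>lborel) \<longlonglongrightarrow> (\<integral>s. 0 \<partial>(lborel :: real measure))"
  proof (rule integral_dominated_convergence[where w = "\<lambda>s. (H s)^2"])
    show "AE s in lborel. (\<lambda>n. (indicator {s. \<bar>s\<bar> > real n} s * H s)^2) \<longlonglongrightarrow> 0"
    proof (rule AE_I2)
      fix s :: real
      obtain n0 :: nat where n0: "\<bar>s\<bar> \<le> real n0" using real_arch_simple by blast
      have "\<forall>\<^sub>F n in sequentially. (indicator {s. \<bar>s\<bar> > real n} s * H s)^2 = 0"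
        unfolding eventually_sequentially by (rule exI[of _ n0]) (use n0 in \<open>auto simp: indicator_def\<close>)
      then show "(\<lambda>n. (indicator {s. \<bar>s\<bar> > real n} s * H s)^2) \<longlonglongrightarrow> 0" by (rule tendsto_eventually)
    qed
  qed (use H_square_integrable in \<open>auto simp: indicator_def\<close>)
  then show ?thesis by simp
qed

lemma J_bound: "J t \<le> H_energy"
proof -
  have i: "integrable lborel (\<lambda>s. (H (t - s))^2)"
    using lborel_integrable_real_affine[OF H_square_integrable, of "-1" t] by simp
  have e: "(LBINT s. (H (t - s))^2) = H_energy" unfolding H_energy_def
    using lborel_integral_real_affine[of "-1" "\<lambda>s. (H s)^2" t] by simp
  have "J t \<le> (LBINT s. ((H s)^2 + (H (t - s))^2) / 2)" unfolding J_def
  proof (rule integral_mono[OF J_integrand])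
    fix s
    have "0 \<le> (H s - H (t - s))^2" by simp
    then show "H s * H (t - s) \<le> ((H s)^2 + (H (t - s))^2) / 2" by (simp add: power2_diff)
  qed (use i H_square_integrable in simp)
  also have "... = H_energy" using i H_square_integrable e by (simp add: H_energy_def)
  finally show ?thesis .
qed

text \<open>A convolution of square integrable functions vanishes at infinity: at a point far out one of the two arguments is
large, where only a tail of the \<open>L\<^sup>2\<close> norm is available.\<close>
lemma J_tendsto_zero:
  assumes y: "filterlim (\<lambda>n. \<bar>y n\<bar>) at_top sequentially"
  shows "(\<lambda>n. J (y n)) \<longlonglongrightarrow> 0"
proof (rule LIMSEQ_I)
  fix e :: real assume e: "0 < e"
  \<comment> \<open>The product splits according to whether the first or the second argument is large.\<close>
  define \<delta> where "\<delta> = e / (4 * (H_energy + 1))"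
  have \<delta>: "0 < \<delta>" using e H_energy_nonneg by (simp add: \<delta>_def)
  from LIMSEQ_D[OF tail_integral_tendsto, of "\<delta> * e / 4"] e \<delta> obtain N :: nat where
    "\<bar>\<integral>s. (indicator {s. \<bar>s\<bar> > real N} s * H s)^2 \<partial>lborel\<bar> < \<delta> * e / 4" by auto
  then have N: "(LBINT s. (indicator {s. \<bar>s\<bar> > real N} s * H s)^2) < \<delta> * e / 4" by linarith
  define T where "T s = indicator {s. \<bar>s\<bar> > real N} s * H s" for s
  have [measurable]: "T \<in> borel_measurable borel" unfolding T_def by measurable
  have T0: "0 \<le> T s" for s by (simp add: T_def H_nonneg)
  have iT: "integrable lborel (\<lambda>s. (T s)^2)"
    by (rule Bochner_Integration.integrable_bound[OF H_square_integrable]) (auto simp: T_def indicator_def)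
  have iTt: "integrable lborel (\<lambda>s. (T (t - s))^2)" for t
    using lborel_integrable_real_affine[OF iT, of "-1" t] by simp
  have eT: "(LBINT s. (T (t - s))^2) = (LBINT s. (T s)^2)" for t
    using lborel_integral_real_affine[of "-1" "\<lambda>s. (T s)^2" t] by simp
  have iH: "integrable lborel (\<lambda>s. (H (t - s))^2)" for t
    using lborel_integrable_real_affine[OF H_square_integrable, of "-1" t] by simp
  have eH: "(LBINT s. (H (t - s))^2) = H_energy" for t unfolding H_energy_def
    using lborel_integral_real_affine[of "-1" "\<lambda>s. (H s)^2" t] by simp
  have small: "J t < e" if t: "2 * real N < \<bar>t\<bar>" for t
  proof -
    have "J t \<le> (LBINT s. ((T s)^2 / \<delta> + \<delta> * (H (t - s))^2) + ((T (t - s))^2 / \<delta> + \<delta> * (H s)^2))"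
      unfolding J_def
    proof (rule integral_mono[OF J_integrand])
      show "integrable lborel (\<lambda>s. ((T s)^2 / \<delta> + \<delta> * (H (t - s))^2) + ((T (t - s))^2 / \<delta> + \<delta> * (H s)^2))"
        using iT iTt iH H_square_integrable by simp
      fix s
      have am: "x * z \<le> x\<^sup>2 / \<delta> + \<delta> * z\<^sup>2" if "0 \<le> x" "0 \<le> z" for x z
      proof -
        have "(x - \<delta> * z)^2 = x\<^sup>2 + \<delta> * z\<^sup>2 * \<delta> - 2 * (x * z) * \<delta>" by (simp add: power2_eq_square algebra_simps)
        then have "2 * (x * z) * \<delta> \<le> x\<^sup>2 + \<delta> * z\<^sup>2 * \<delta>" using zero_le_power2[of "x - \<delta> * z"] by linarith
        then have "2 * (x * z) \<le> x\<^sup>2 / \<delta> + \<delta> * z\<^sup>2" using \<delta> by (simp add: field_simps)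
        moreover have "0 \<le> x * z" using that by simp
        ultimately show ?thesis by linarith
      qed
      have nn: "0 \<le> x\<^sup>2 / \<delta> + \<delta> * z\<^sup>2" for x z using \<delta> by simp
      have "\<bar>s\<bar> > real N \<or> \<bar>t - s\<bar> > real N" using t by linarith
      then have "T s = H s \<or> T (t - s) = H (t - s)" by (auto simp: T_def)
      then show "H s * H (t - s) \<le> ((T s)^2 / \<delta> + \<delta> * (H (t - s))^2) + ((T (t - s))^2 / \<delta> + \<delta> * (H s)^2)"
      proof
        assume "T s = H s"
        then show ?thesis using am[OF H_nonneg[of s] H_nonneg[of "t - s"]] nn[of "T (t - s)" "H s"] by simp
      next
        assume "T (t - s) = H (t - s)"
        then show ?thesis using am[OF H_nonneg[of "t - s"] H_nonneg[of s]] nn[of "T s" "H (t - s)"] by (simp add: mult.commute)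
      qed
    qed
    also have "... = ((LBINT s. (T s)^2) / \<delta> + \<delta> * H_energy) + ((LBINT s. (T s)^2) / \<delta> + \<delta> * H_energy)"
      using iT iTt iH H_square_integrable by (simp add: eT eH H_energy_def[symmetric])
    also have "... < e"
    proof -
      have "(LBINT s. (T s)^2) / \<delta> < e / 4" using N \<delta> by (simp add: T_def field_simps)
      moreover have "\<delta> * H_energy \<le> e / 4"
        using e H_energy_nonneg by (simp add: \<delta>_def field_simps)
      ultimately show ?thesis by linarith
    qed
    finally show ?thesis .
  qed
  have "\<forall>\<^sub>F n in sequentially. 2 * real N < \<bar>y n\<bar>" using y unfolding filterlim_at_top_dense by blast
  then obtain n0 where n0: "\<And>n. n \<ge> n0 ==> 2 * real N < \<bar>y n\<bar>" unfolding eventually_sequentially by blast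
  have "norm (J (y n) - 0) < e" if "n \<ge> n0" for n using small[OF n0[OF that]] J_nonneg[of "y n"] by simp
  then show "\<exists>no. \<forall>n\<ge>no. norm (J (y n) - 0) < e" by blast
qed

end

section \<open>Random variables with moments of all orders\<close>

text \<open>The moments of the normal distribution with mean zero and variance \<open>v\<close>, by their recursion. A random variable is
regarded as Gaussian when it has these moments, which covers the degenerate case \<open>v = 0\<close>.\<close>
fun gaussian_moment :: "real => nat => real" where
  "gaussian_moment v 0 = 1"
| "gaussian_moment v (Suc 0) = 0"
| "gaussian_moment v (Suc (Suc k)) = real (Suc k) * v * gaussian_moment v k"

text \<open>Differentiation in the variance lowers the order by two. Applied along a line in the space of linear combinations,
it becomes integration by parts.\<close>
lemma DERIV_gaussian_moment:
  "((\<lambda>v. gaussian_moment v n) has_real_derivative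
     (real n * real (n - 1) / 2 * gaussian_moment v (n - 2))) (at v)"
proof (induction v n rule: gaussian_moment.induct)
  case (3 v k)
  have eq: "v * (real k * real (k - 1) / 2 * gaussian_moment v (k - 2)) = real k / 2 * gaussian_moment v k"
    by (cases "(v, k)" rule: gaussian_moment.cases) auto
  have "((\<lambda>v. real (Suc k) * v * gaussian_moment v k) has_real_derivative
      (real (Suc k) * gaussian_moment v k
        + real (Suc k) * (v * (real k * real (k - 1) / 2 * gaussian_moment v (k - 2))))) (at v)"
    by (rule derivative_eq_intros 3 refl)+ simp
  then show ?case unfolding eq by (simp add: field_simps)
qed auto

definition all_moments :: "'a measure => ('a => real) => bool" where
  "all_moments M Y \<longleftrightarrow> Y \<in> borel_measurable M \<and> (\<forall>n. (\<integral>\<^sup>+w. ennreal (\<bar>Y w\<bar> ^ n) \<partial>M) < \<infinity>)"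

text \<open>A jointly measurable family all of whose absolute moments are bounded uniformly in the index. The class is closed
under sums and products, and integration over a finite measure yields variables with all moments; every use of
Fubini's theorem below is justified in this way.\<close>
definition moment_field :: "'i measure => 'a measure => ('i => 'a => real) => bool" where
  "moment_field K M Y \<longleftrightarrow> (\<lambda>(s, w). Y s w) \<in> borel_measurable (K \<Otimes>\<^sub>M M) \<and>
     (\<forall>n. \<exists>C<\<infinity>. \<forall>s\<in>space K. (\<integral>\<^sup>+w. ennreal (\<bar>Y s w\<bar> ^ n) \<partial>M) \<le> C)"

lemma all_moments_measurable: "all_moments M Y ==> Y \<in> borel_measurable M"
  by (simp add: all_moments_def)

lemma all_moments_integrable_power: "all_moments M Y ==> integrable M (\<lambda>w. Y w ^ n)"
  unfolding all_moments_def
  by (auto intro!: integrableI_bounded simp: power_abs)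

lemma all_moments_integrable: "all_moments M Y ==> integrable M Y"
  using all_moments_integrable_power[of M Y 1] by simp

lemma moment_field_section:
  assumes "moment_field K M Y" "s \<in> space K"
  shows "all_moments M (Y s)"
proof -
  have "(\<lambda>(s, w). Y s w) \<in> borel_measurable (K \<Otimes>\<^sub>M M)"
    using assms(1) by (simp add: moment_field_def)
  from measurable_compose[OF measurable_Pair1'[OF assms(2)] this]
  have "Y s \<in> borel_measurable M" by simp
  then show ?thesis using assms unfolding moment_field_def all_moments_def
    by (meson le_less_trans)
qed

lemma moment_field_const: "all_moments M Y ==> moment_field K M (\<lambda>s. Y)"
  unfolding all_moments_def moment_field_def by (auto intro!: measurable_compose[OF measurable_snd])

lemma all_moments_const_field: "moment_field (count_space {()}) M (\<lambda>_. Y) ==> all_moments M Y"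
  using moment_field_section[of "count_space {()}" M "\<lambda>_. Y" "()"] by simp

lemma abs_add_power_le: "\<bar>x + y\<bar> ^ n \<le> 2 ^ n * (\<bar>x\<bar> ^ n + \<bar>y\<bar> ^ n)" for x y :: real
proof -
  have "\<bar>x + y\<bar> ^ n \<le> (2 * max \<bar>x\<bar> \<bar>y\<bar>) ^ n" by (rule power_mono) auto
  also have "... = 2 ^ n * (max \<bar>x\<bar> \<bar>y\<bar>) ^ n" by (simp add: power_mult_distrib)
  also have "(max \<bar>x\<bar> \<bar>y\<bar>) ^ n \<le> \<bar>x\<bar> ^ n + \<bar>y\<bar> ^ n" by (auto simp: max_def)
  finally show ?thesis by simp
qed

lemma abs_mult_power_le: "\<bar>x * y\<bar> ^ n \<le> \<bar>x\<bar> ^ (2 * n) + \<bar>y\<bar> ^ (2 * n)" for x y :: real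
proof -
  have "0 \<le> \<bar>x\<bar>^n * \<bar>y\<bar>^n" by simp
  moreover have "0 \<le> (\<bar>x\<bar>^n - \<bar>y\<bar>^n)^2" by simp
  then have "2 * (\<bar>x\<bar>^n * \<bar>y\<bar>^n) \<le> (\<bar>x\<bar>^n)^2 + (\<bar>y\<bar>^n)^2" by (simp add: power2_diff)
  ultimately have "\<bar>x\<bar>^n * \<bar>y\<bar>^n \<le> (\<bar>x\<bar>^n)^2 + (\<bar>y\<bar>^n)^2" by linarith
  then show ?thesis
    by (simp add: abs_mult power_mult_distrib power_mult[symmetric] mult.commute[of n 2])
qed

lemma moment_field_add:
  assumes "moment_field K M Y" "moment_field K M Z"
  shows "moment_field K M (\<lambda>s w. Y s w + Z s w)"
proof -
  have [measurable]: "(\<lambda>x. Y (fst x) (snd x)) \<in> borel_measurable (K \<Otimes>\<^sub>M M)"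
     "(\<lambda>x. Z (fst x) (snd x)) \<in> borel_measurable (K \<Otimes>\<^sub>M M)"
    using assms by (simp_all add: moment_field_def case_prod_beta')
  have m: "s \<in> space K ==> Y s \<in> borel_measurable M" "s \<in> space K ==> Z s \<in> borel_measurable M" for s
    using moment_field_section[OF assms(1)] moment_field_section[OF assms(2)] by (auto simp: all_moments_def)
  have "\<exists>C<\<infinity>. \<forall>s\<in>space K. (\<integral>\<^sup>+w. ennreal (\<bar>Y s w + Z s w\<bar> ^ n) \<partial>M) \<le> C" for n
  proof -
    obtain C1 C2 where C: "C1 < \<infinity>" "C2 < \<infinity>"
      "\<And>s. s \<in> space K ==> (\<integral>\<^sup>+w. ennreal (\<bar>Y s w\<bar> ^ n) \<partial>M) \<le> C1"
      "\<And>s. s \<in> space K ==> (\<integral>\<^sup>+w. ennreal (\<bar>Z s w\<bar> ^ n) \<partial>M) \<le> C2"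
      using assms unfolding moment_field_def by meson
    have "(\<integral>\<^sup>+w. ennreal (\<bar>Y s w + Z s w\<bar> ^ n) \<partial>M) \<le> 2^n * (C1 + C2)" if s: "s \<in> space K" for s
    proof -
      note [measurable] = m[OF s]
      have "(\<integral>\<^sup>+w. ennreal (\<bar>Y s w + Z s w\<bar> ^ n) \<partial>M) \<le>
          (\<integral>\<^sup>+w. 2 ^ n * (ennreal (\<bar>Y s w\<bar> ^ n) + ennreal (\<bar>Z s w\<bar> ^ n)) \<partial>M)"
      proof (rule nn_integral_mono)
        fix w
        have "ennreal (\<bar>Y s w + Z s w\<bar> ^ n) \<le> ennreal (2 ^ n * (\<bar>Y s w\<bar> ^ n + \<bar>Z s w\<bar> ^ n))"
          using abs_add_power_le by (rule ennreal_leI)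
        also have "... = 2 ^ n * (ennreal (\<bar>Y s w\<bar> ^ n) + ennreal (\<bar>Z s w\<bar> ^ n))"
          by (simp add: ennreal_mult ennreal_power[symmetric])
        finally show "ennreal (\<bar>Y s w + Z s w\<bar> ^ n) \<le> 2 ^ n * (ennreal (\<bar>Y s w\<bar> ^ n) + ennreal (\<bar>Z s w\<bar> ^ n))" .
      qed
      also have "... = 2^n * ((\<integral>\<^sup>+w. ennreal (\<bar>Y s w\<bar> ^ n) \<partial>M) + (\<integral>\<^sup>+w. ennreal (\<bar>Z s w\<bar> ^ n) \<partial>M))"
        by (simp add: nn_integral_cmult nn_integral_add)
      also have "... \<le> 2^n * (C1 + C2)" using C s by (intro mult_left_mono add_mono) auto
      finally show ?thesis .
    qed
    moreover have "2^n * (C1 + C2) < \<infinity>" using C by (simp add: ennreal_mult_less_top power_less_top_ennreal)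
    ultimately show ?thesis by blast
  qed
  then show ?thesis unfolding moment_field_def by (simp add: case_prod_beta')
qed

lemma moment_field_mult:
  assumes "moment_field K M Y" "moment_field K M Z"
  shows "moment_field K M (\<lambda>s w. Y s w * Z s w)"
proof -
  have [measurable]: "(\<lambda>x. Y (fst x) (snd x)) \<in> borel_measurable (K \<Otimes>\<^sub>M M)"
     "(\<lambda>x. Z (fst x) (snd x)) \<in> borel_measurable (K \<Otimes>\<^sub>M M)"
    using assms by (simp_all add: moment_field_def case_prod_beta')
  have m: "s \<in> space K ==> Y s \<in> borel_measurable M" "s \<in> space K ==> Z s \<in> borel_measurable M" for s
    using moment_field_section[OF assms(1)] moment_field_section[OF assms(2)] by (auto simp: all_moments_def)
  have "\<exists>C<\<infinity>. \<forall>s\<in>space K. (\<integral>\<^sup>+w. ennreal (\<bar>Y s w * Z s w\<bar> ^ n) \<partial>M) \<le> C" for n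
  proof -
    obtain C1 C2 where C: "C1 < \<infinity>" "C2 < \<infinity>"
      "\<And>s. s \<in> space K ==> (\<integral>\<^sup>+w. ennreal (\<bar>Y s w\<bar> ^ (2*n)) \<partial>M) \<le> C1"
      "\<And>s. s \<in> space K ==> (\<integral>\<^sup>+w. ennreal (\<bar>Z s w\<bar> ^ (2*n)) \<partial>M) \<le> C2"
      using assms unfolding moment_field_def by meson
    have "(\<integral>\<^sup>+w. ennreal (\<bar>Y s w * Z s w\<bar> ^ n) \<partial>M) \<le> C1 + C2" if s: "s \<in> space K" for s
    proof -
      note [measurable] = m[OF s]
      have "(\<integral>\<^sup>+w. ennreal (\<bar>Y s w * Z s w\<bar> ^ n) \<partial>M) \<le>
          (\<integral>\<^sup>+w. (ennreal (\<bar>Y s w\<bar> ^ (2*n)) + ennreal (\<bar>Z s w\<bar> ^ (2*n))) \<partial>M)"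
        by (intro nn_integral_mono) (use abs_mult_power_le in \<open>simp add: ennreal_plus[symmetric] del: ennreal_plus\<close>)
      also have "... = ((\<integral>\<^sup>+w. ennreal (\<bar>Y s w\<bar> ^ (2*n)) \<partial>M) + (\<integral>\<^sup>+w. ennreal (\<bar>Z s w\<bar> ^ (2*n)) \<partial>M))"
        by (rule nn_integral_add) measurable
      also have "... \<le> C1 + C2" using C s by (intro add_mono) auto
      finally show ?thesis .
    qed
    moreover have "C1 + C2 < \<infinity>" using C by simp
    ultimately show ?thesis by blast
  qed
  then show ?thesis unfolding moment_field_def by (simp add: case_prod_beta')
qed

lemma (in prob_space) moment_field_bounded:
  assumes [measurable]: "c \<in> borel_measurable K" and "\<And>s. s \<in> space K ==> \<bar>c s\<bar> \<le> B"
  shows "moment_field K M (\<lambda>s w. c s)"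
  unfolding moment_field_def
proof (intro conjI allI)
  fix n
  have "(\<integral>\<^sup>+w. ennreal (\<bar>c s\<bar> ^ n) \<partial>M) \<le> ennreal (B ^ n)" if "s \<in> space K" for s
    using assms(2)[OF that] by (simp add: emeasure_space_1 ennreal_leI power_mono)
  then show "\<exists>C<\<infinity>. \<forall>s\<in>space K. (\<integral>\<^sup>+w. ennreal (\<bar>c s\<bar> ^ n) \<partial>M) \<le> C"
    by (intro exI[of _ "ennreal (B ^ n)"]) auto
qed (simp add: case_prod_beta')

lemma moment_field_comp:
  assumes "moment_field K M Y" and h: "h \<in> measurable K' K"
  shows "moment_field K' M (\<lambda>s. Y (h s))"
proof -
  have [measurable]: "(\<lambda>x. Y (fst x) (snd x)) \<in> borel_measurable (K \<Otimes>\<^sub>M M)"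
    using assms by (simp_all add: moment_field_def case_prod_beta')
  have "(\<lambda>x. (h (fst x), snd x)) \<in> measurable (K' \<Otimes>\<^sub>M M) (K \<Otimes>\<^sub>M M)" using h by measurable
  from measurable_compose[OF this \<open>_ \<in> borel_measurable (K \<Otimes>\<^sub>M M)\<close>]
  have "(\<lambda>x. Y (h (fst x)) (snd x)) \<in> borel_measurable (K' \<Otimes>\<^sub>M M)" by simp
  moreover have "\<exists>C<\<infinity>. \<forall>s\<in>space K'. (\<integral>\<^sup>+w. ennreal (\<bar>Y (h s) w\<bar> ^ n) \<partial>M) \<le> C" for n
  proof -
    obtain C where "C < \<infinity>" "\<forall>s\<in>space K. (\<integral>\<^sup>+w. ennreal (\<bar>Y s w\<bar> ^ n) \<partial>M) \<le> C"
      using assms(1) unfolding moment_field_def by blast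
    then show ?thesis using measurable_space[OF h] by (intro exI[of _ C]) auto
  qed
  ultimately show ?thesis unfolding moment_field_def by (simp add: case_prod_beta')
qed

context prob_space begin

lemma all_moments_const [simp]: "all_moments M (\<lambda>_. c)"
  by (simp add: all_moments_def emeasure_space_1)

lemma all_moments_add: "all_moments M Y ==> all_moments M Z ==> all_moments M (\<lambda>w. Y w + Z w)"
  by (rule all_moments_const_field, rule moment_field_add; rule moment_field_const)

lemma all_moments_mult: "all_moments M Y ==> all_moments M Z ==> all_moments M (\<lambda>w. Y w * Z w)"
  by (rule all_moments_const_field, rule moment_field_mult; rule moment_field_const)

lemma all_moments_cmult: "all_moments M Z ==> all_moments M (\<lambda>w. c * Z w)"
  by (intro all_moments_mult) simp_all

lemma all_moments_minus: "all_moments M Z ==> all_moments M (\<lambda>w. - Z w)"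
  using all_moments_cmult[of Z "-1"] by simp

lemma all_moments_diff: "all_moments M Y ==> all_moments M Z ==> all_moments M (\<lambda>w. Y w - Z w)"
  using all_moments_add[of Y "\<lambda>w. - Z w"] all_moments_minus[of Z] by simp

lemma all_moments_power: "all_moments M Y ==> all_moments M (\<lambda>w. Y w ^ n)"
  by (induction n) (auto intro: all_moments_mult)

lemma all_moments_sum: "(\<And>j. j \<in> J ==> all_moments M (Y j)) ==> all_moments M (\<lambda>w. \<Sum>j\<in>J. Y j w)"
  by (induction J rule: infinite_finite_induct) (auto intro: all_moments_add)

lemmas all_moments_intros = all_moments_add all_moments_mult all_moments_const all_moments_diff
  all_moments_minus all_moments_power all_moments_sum

lemma emeasure_less_top: "finite_measure \<nu> ==> emeasure \<nu> A < \<top>"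
  using finite_measure.emeasure_finite top.not_eq_extremum by blast

lemma moment_field_integrable:
  assumes "finite_measure \<nu>" "moment_field \<nu> M Y"
  shows "integrable (\<nu> \<Otimes>\<^sub>M M) (\<lambda>(s, w). Y s w)"
proof -
  interpret \<nu>: finite_measure \<nu> by fact
  interpret pair_sigma_finite \<nu> M ..
  have m: "(\<lambda>(s, w). Y s w) \<in> borel_measurable (\<nu> \<Otimes>\<^sub>M M)" using assms by (simp add: moment_field_def)
  then have m': "(\<lambda>x. ennreal \<bar>Y (fst x) (snd x)\<bar>) \<in> borel_measurable (\<nu> \<Otimes>\<^sub>M M)" by (simp add: case_prod_beta')
  obtain C where C: "C < \<infinity>" "\<And>s. s \<in> space \<nu> ==> (\<integral>\<^sup>+w. ennreal (\<bar>Y s w\<bar> ^ 1) \<partial>M) \<le> C"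
    using assms unfolding moment_field_def by meson
  have "(\<integral>\<^sup>+x. ennreal \<bar>Y (fst x) (snd x)\<bar> \<partial>(\<nu> \<Otimes>\<^sub>M M)) = (\<integral>\<^sup>+s. \<integral>\<^sup>+w. ennreal \<bar>Y s w\<bar> \<partial>M \<partial>\<nu>)"
    using sigma_finite_measure.nn_integral_fst[OF prob_space_imp_sigma_finite[OF prob_space_axioms] m'] by simp
  also have "... \<le> (\<integral>\<^sup>+s. C \<partial>\<nu>)" using C by (intro nn_integral_mono) auto
  also have "... < \<infinity>" using C emeasure_less_top[OF assms(1)] by (auto simp add: ennreal_mult_less_top)
  finally show ?thesis using m by (intro integrableI_bounded) (auto simp: case_prod_beta')
qed

lemma moment_field_AE_integrable:
  assumes "finite_measure \<nu>" "moment_field \<nu> M Y"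
  shows "AE w in M. integrable \<nu> (\<lambda>s. Y s w)"
proof -
  interpret \<nu>: finite_measure \<nu> by fact
  interpret pair_sigma_finite \<nu> M ..
  show ?thesis using AE_integrable_snd[OF moment_field_integrable[OF assms]] by simp
qed

lemma expectation_moment_field:
  assumes "finite_measure \<nu>" "moment_field \<nu> M Y"
  shows "expectation (\<lambda>w. \<integral>s. Y s w \<partial>\<nu>) = (LINT s|\<nu>. expectation (Y s))"
proof -
  interpret \<nu>: finite_measure \<nu> by fact
  interpret pair_sigma_finite \<nu> M ..
  show ?thesis using Fubini_integral[OF moment_field_integrable[OF assms]] by simp
qed

lemma nn_integral_power2_le:
  assumes [measurable]: "h \<in> borel_measurable \<nu>"
  shows "(\<integral>\<^sup>+x. h x \<partial>\<nu>)^2 \<le> emeasure \<nu> (space \<nu>) * (\<integral>\<^sup>+x. h x ^ 2 \<partial>\<nu>)"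
  using Cauchy_Schwarz_nn_integral[of "\<lambda>_. 1" \<nu> h] by simp

lemma nn_integral_power_le:
  assumes "emeasure \<nu> (space \<nu>) < \<infinity>"
  shows "\<exists>c<\<infinity>. \<forall>h\<in>borel_measurable \<nu>. (\<integral>\<^sup>+x. h x \<partial>\<nu>) ^ (2^j) \<le> c * (\<integral>\<^sup>+x. h x ^ (2 ^ j) \<partial>\<nu>)"
proof (induction j)
  case 0 then show ?case by (intro exI[of _ 1]) auto
next
  case (Suc j)
  then obtain c where c: "c < \<infinity>" "\<And>h. h\<in>borel_measurable \<nu> ==> (\<integral>\<^sup>+x. h x \<partial>\<nu>) ^ (2^j) \<le> c * (\<integral>\<^sup>+x. h x ^ (2 ^ j) \<partial>\<nu>)"
    by blast
  let ?e = "emeasure \<nu> (space \<nu>)"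
  have "(\<integral>\<^sup>+x. h x \<partial>\<nu>) ^ (2^Suc j) \<le> ?e ^ (2^j) * c * (\<integral>\<^sup>+x. h x ^ (2 ^ Suc j) \<partial>\<nu>)"
    if [measurable]: "h \<in> borel_measurable \<nu>" for h
  proof -
    have "(\<integral>\<^sup>+x. h x \<partial>\<nu>) ^ (2^Suc j) = ((\<integral>\<^sup>+x. h x \<partial>\<nu>)^2)^(2^j)" by (simp add: power_mult)
    also have "... \<le> (?e * (\<integral>\<^sup>+x. h x ^ 2 \<partial>\<nu>)) ^ (2^j)"
      by (rule power_mono[OF nn_integral_power2_le]) auto
    also have "... = ?e ^ (2^j) * (\<integral>\<^sup>+x. h x ^ 2 \<partial>\<nu>) ^ (2^j)" by (simp add: power_mult_distrib)
    also have "... \<le> ?e ^ (2^j) * (c * (\<integral>\<^sup>+x. (h x ^ 2) ^ (2 ^ j) \<partial>\<nu>))"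
      by (rule mult_left_mono[OF c(2)]) auto
    also have "... = ?e ^ (2^j) * c * (\<integral>\<^sup>+x. h x ^ (2 ^ Suc j) \<partial>\<nu>)"
      by (simp add: mult.assoc power_mult[symmetric])
    finally show ?thesis .
  qed
  moreover have "?e ^ (2^j) * c < \<infinity>"
    using c assms by (simp add: ennreal_mult_less_top power_less_top_ennreal)
  ultimately show ?case by blast
qed

text \<open>Jensen's inequality in the form of iterated Cauchy-Schwarz inequalities bounds the moments of orders that are powers
of two; other orders are dominated by these.\<close>
lemma all_moments_integral:
  assumes "finite_measure \<nu>" "moment_field \<nu> M Y"
  shows "all_moments M (\<lambda>w. \<integral>s. Y s w \<partial>\<nu>)"
  unfolding all_moments_def
proof (intro conjI allI)
  interpret \<nu>: finite_measure \<nu> by fact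
  interpret P: pair_sigma_finite \<nu> M ..
  have m[measurable]: "(\<lambda>x. Y (fst x) (snd x)) \<in> borel_measurable (\<nu> \<Otimes>\<^sub>M M)"
    using assms by (simp add: moment_field_def case_prod_beta')
  have m'[measurable]: "(\<lambda>x. Y (snd x) (fst x)) \<in> borel_measurable (M \<Otimes>\<^sub>M \<nu>)"
    using measurable_compose[OF _ m, of "\<lambda>x. (snd x, fst x)"] by simp
  show meas[measurable]: "(\<lambda>w. \<integral>s. Y s w \<partial>\<nu>) \<in> borel_measurable M"
    using \<nu>.borel_measurable_lebesgue_integral[of "\<lambda>w s. Y s w" M] m' by (simp add: case_prod_beta')
  fix n :: nat
  obtain j :: nat where j: "n \<le> 2 ^ j" using less_imp_le[OF less_exp[of n]] by blast
  obtain c where c: "c < \<infinity>" "\<And>h. h\<in>borel_measurable \<nu> ==> (\<integral>\<^sup>+x. h x \<partial>\<nu>) ^ (2^j) \<le> c * (\<integral>\<^sup>+x. h x ^ (2 ^ j) \<partial>\<nu>)"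
    using nn_integral_power_le[of \<nu> j] \<nu>.emeasure_finite by (metis infinity_ennreal_def less_top)
  obtain C where C: "C < \<infinity>" "\<And>s. s \<in> space \<nu> ==> (\<integral>\<^sup>+w. ennreal (\<bar>Y s w\<bar> ^ (2^j)) \<partial>M) \<le> C"
    using assms unfolding moment_field_def by meson
  have pt: "ennreal (\<bar>\<integral>s. Y s w \<partial>\<nu>\<bar> ^ n) \<le> 1 + c * (\<integral>\<^sup>+s. ennreal (\<bar>Y s w\<bar> ^ (2^j)) \<partial>\<nu>)" if [simp]: "w \<in> space M" for w
  proof -
    have [measurable]: "(\<lambda>s. Y s w) \<in> borel_measurable \<nu>"
      using measurable_compose[OF measurable_Pair2'[OF that, of \<nu>] m] by simp
    let ?I = "\<bar>\<integral>s. Y s w \<partial>\<nu>\<bar>"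
    have "?I ^ n \<le> 1 + ?I ^ (2^j)"
    proof (cases "?I \<le> 1")
      case True then show ?thesis by (meson abs_ge_zero add_increasing2 power_le_one zero_le_power)
    next
      case False
      then have "1 \<le> ?I" by simp
      from power_increasing[OF j this] show ?thesis by linarith
    qed
    then have "ennreal (?I ^ n) \<le> 1 + ennreal ?I ^ (2^j)"
      by (metis abs_ge_zero ennreal_1 ennreal_leI ennreal_plus ennreal_power zero_le_one zero_le_power)
    also have "ennreal ?I \<le> (\<integral>\<^sup>+s. ennreal \<bar>Y s w\<bar> \<partial>\<nu>)"
      using integral_norm_bound_ennreal[of \<nu> "\<lambda>s. Y s w"]
      by (cases "integrable \<nu> (\<lambda>s. Y s w)") (auto simp: not_integrable_integral_eq)
    also have "(\<integral>\<^sup>+s. ennreal \<bar>Y s w\<bar> \<partial>\<nu>) ^ (2^j) \<le> c * (\<integral>\<^sup>+s. ennreal \<bar>Y s w\<bar> ^ (2^j) \<partial>\<nu>)"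
      by (rule c) measurable
    finally show ?thesis by (auto simp: ennreal_power power_mono add_left_mono)
  qed
  have "(\<integral>\<^sup>+w. ennreal (\<bar>\<integral>s. Y s w \<partial>\<nu>\<bar> ^ n) \<partial>M) \<le> (\<integral>\<^sup>+w. 1 + c * (\<integral>\<^sup>+s. ennreal (\<bar>Y s w\<bar> ^ (2^j)) \<partial>\<nu>) \<partial>M)"
    by (intro nn_integral_mono pt)
  also have "... = 1 + c * (\<integral>\<^sup>+w. (\<integral>\<^sup>+s. ennreal (\<bar>Y s w\<bar> ^ (2^j)) \<partial>\<nu>) \<partial>M)"
    using \<nu>.borel_measurable_nn_integral[of "\<lambda>w s. ennreal (\<bar>Y s w\<bar> ^ (2^j))" M] m'
    by (subst nn_integral_add) (auto simp: emeasure_space_1 nn_integral_cmult case_prod_beta')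
  also have "(\<integral>\<^sup>+w. (\<integral>\<^sup>+s. ennreal (\<bar>Y s w\<bar> ^ (2^j)) \<partial>\<nu>) \<partial>M) = (\<integral>\<^sup>+s. (\<integral>\<^sup>+w. ennreal (\<bar>Y s w\<bar> ^ (2^j)) \<partial>M) \<partial>\<nu>)"
    by (rule P.Fubini'[of "\<lambda>s w. ennreal (\<bar>Y s w\<bar> ^ (2^j))"]) (simp add: case_prod_beta')
  also have "... \<le> (\<integral>\<^sup>+s. C \<partial>\<nu>)" using C by (intro nn_integral_mono) auto
  finally have "(\<integral>\<^sup>+w. ennreal (\<bar>\<integral>s. Y s w \<partial>\<nu>\<bar> ^ n) \<partial>M) \<le> 1 + c * (C * emeasure \<nu> (space \<nu>))"
    by (simp add: add_left_mono mult_left_mono)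
  also have "... < \<infinity>" using C c emeasure_less_top[OF assms(1)] by (auto simp add: ennreal_mult_less_top)
  finally show "(\<integral>\<^sup>+w. ennreal (\<bar>\<integral>s. Y s w \<partial>\<nu>\<bar> ^ n) \<partial>M) < \<infinity>" .
qed

text \<open>Along a line the moments are polynomials in the parameter, by the binomial expansion, so the derivative is the coefficient of
the linear term.\<close>
lemma DERIV_expectation_power:
  assumes "all_moments M L" "all_moments M V" "all_moments M P"
  shows "((\<lambda>s. expectation (\<lambda>w. (L w + s * V w) ^ n * P w)) has_real_derivative
          real n * expectation (\<lambda>w. L w ^ (n - 1) * (V w * P w))) (at 0)"
proof -
  define e where "e j = real (n choose j) * expectation (\<lambda>w. V w ^ j * L w ^ (n - j) * P w)" for j
  have "expectation (\<lambda>w. (L w + s * V w) ^ n * P w) = (\<Sum>j\<le>n. e j * s ^ j)" for s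
  proof -
    have "expectation (\<lambda>w. (L w + s * V w) ^ n * P w) =
        expectation (\<lambda>w. \<Sum>j\<le>n. real (n choose j) * s ^ j * (V w ^ j * L w ^ (n - j) * P w))"
      by (intro Bochner_Integration.integral_cong refl, subst add.commute)
         (simp add: binomial_ring sum_distrib_left sum_distrib_right power_mult_distrib mult_ac)
    also have "... = (\<Sum>j\<le>n. expectation (\<lambda>w. real (n choose j) * s ^ j * (V w ^ j * L w ^ (n - j) * P w)))"
      by (rule Bochner_Integration.integral_sum) (intro all_moments_integrable all_moments_intros assms)
    also have "... = (\<Sum>j\<le>n. real (n choose j) * s ^ j * expectation (\<lambda>w. V w ^ j * L w ^ (n - j) * P w))"
      by (simp only: integral_mult_right_zero)
    also have "... = (\<Sum>j\<le>n. e j * s ^ j)" by (simp only: e_def mult_ac)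
    finally show ?thesis .
  qed
  moreover have "((\<lambda>s. \<Sum>j\<le>n. e j * s ^ j) has_real_derivative (\<Sum>j\<le>n. e j * (real j * 0 ^ (j - 1)))) (at 0)"
    by (auto intro!: derivative_eq_intros sum.cong)
  moreover have "(\<Sum>j\<le>n. e j * (real j * 0 ^ (j - 1))) = real n * expectation (\<lambda>w. L w ^ (n - 1) * (V w * P w))"
  proof (cases n)
    case (Suc m)
    have "(\<Sum>j\<le>n. e j * (real j * 0 ^ (j - 1))) = (\<Sum>j\<in>{1}. e j * (real j * 0 ^ (j - 1)))"
      by (rule sum.mono_neutral_right) (auto simp: Suc power_0_left)
    then show ?thesis by (simp add: e_def Suc mult_ac)
  qed simp
  ultimately show ?thesis by simp
qed

end

section \<open>Gaussian integration by parts\<close>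

locale gaussian_field = prob_space M + index: finite_measure \<mu>
  for M :: "'a measure" and \<mu> :: "'i measure" +
  fixes X :: "'i => 'a => real"
  assumes space_index [simp]: "space \<mu> = UNIV"
    and moment_field_X: "moment_field \<mu> M X"
    and gaussian_combination: "\<And>J c. finite J ==>
      (\<exists>v. \<forall>n. (LINT w|M. (\<Sum>s\<in>J. c s * X s w) ^ n) = gaussian_moment v n)"
begin

definition cov :: "'i => 'i => real" where
  "cov s t = expectation (\<lambda>w. X s w * X t w)"

definition combinations :: "('a => real) set" where
  "combinations = {L. \<exists>J c. finite J \<and> L = (\<lambda>w. \<Sum>s\<in>J. c s * X s w)}"

lemma cov_commute: "cov s t = cov t s"
  by (simp add: cov_def mult.commute)

lemma all_moments_X [intro]: "all_moments M (X s)"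
  using moment_field_section[OF moment_field_X] by simp

lemma all_moments_combination: "L \<in> combinations ==> all_moments M L"
  unfolding combinations_def by (auto intro!: all_moments_intros)

lemma combinations_add:
  assumes "L \<in> combinations"
  shows "(\<lambda>w. L w + s * X v w) \<in> combinations"
proof -
  obtain J c where J: "finite J" "L = (\<lambda>w. \<Sum>s\<in>J. c s * X s w)"
    using assms by (auto simp: combinations_def)
  define c' where "c' u = (if u \<in> J then c u else 0) + (if u = v then s else 0)" for u
  have "L w + s * X v w = (\<Sum>u\<in>insert v J. c' u * X u w)" for w
  proof -
    have "(\<Sum>u\<in>insert v J. c' u * X u w) = (\<Sum>u\<in>insert v J. (if u \<in> J then c u * X u w else 0))
        + (\<Sum>u\<in>insert v J. (if u = v then s * X u w else 0))"
      unfolding sum.distrib[symmetric] by (rule sum.cong) (auto simp: c'_def algebra_simps)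
    also have "(\<Sum>u\<in>insert v J. (if u \<in> J then c u * X u w else 0)) = (\<Sum>u\<in>J. c u * X u w)"
      using J(1) by (intro sum.mono_neutral_cong_right) auto
    also have "(\<Sum>u\<in>insert v J. (if u = v then s * X u w else 0)) = s * X v w"
      using J(1) by (subst sum.delta) auto
    finally show ?thesis by (simp add: J)
  qed
  then show ?thesis using J(1) unfolding combinations_def by blast
qed

lemma combinations_zero: "(\<lambda>w. 0) \<in> combinations"
  unfolding combinations_def by (auto intro!: exI[of _ "{}"])

lemma combinations_X: "X v \<in> combinations"
  using combinations_add[OF combinations_zero, of 1 v] by simp

lemma combination_moment:
  assumes "L \<in> combinations"
  shows "expectation (\<lambda>w. L w ^ n) = gaussian_moment (expectation (\<lambda>w. L w ^ 2)) n"
proof -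
  obtain v where v: "\<And>n. expectation (\<lambda>w. L w ^ n) = gaussian_moment v n"
    using assms gaussian_combination unfolding combinations_def by blast
  from v[of 2] have "expectation (\<lambda>w. L w ^ 2) = v" by (simp add: numeral_2_eq_2)
  then show ?thesis using v by simp
qed

lemma expectation_X [simp]: "expectation (X v) = 0"
  using combination_moment[OF combinations_X, of v 1] by simp

text \<open>The moment of order \<open>k + 1\<close> of \<open>L + s * X t\<close> is a Gaussian moment for each \<open>s\<close>. Differentiating both sides at
\<open>s = 0\<close> gives the identity.\<close>
lemma combination_by_parts:
  assumes L: "L \<in> combinations"
  shows "expectation (\<lambda>w. X t w * L w ^ k) = k * expectation (\<lambda>w. X t w * L w) * expectation (\<lambda>w. L w ^ (k - 1))"
proof -
  note aL = all_moments_combination[OF L]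
  define a b c where "a = expectation (\<lambda>w. L w ^ 2)" and "b = expectation (\<lambda>w. X t w * L w)"
    and "c = expectation (\<lambda>w. X t w ^ 2)"
  define q where "q s = expectation (\<lambda>w. (L w + s * X t w) ^ 2)" for s
  have q: "(q has_real_derivative 2 * b) (at 0)"
    using DERIV_expectation_power[of L "X t" "\<lambda>_. 1" 2] aL all_moments_X
    by (simp add: q_def[abs_def] b_def mult.commute)
  have "((\<lambda>s. gaussian_moment (q s) (Suc k)) has_real_derivative
      (real (Suc k) * real k / 2 * gaussian_moment (q 0) (Suc k - 2)) * (2 * b)) (at 0)"
    using DERIV_chain2[OF DERIV_gaussian_moment[of "Suc k"] q] by simp
  moreover have "gaussian_moment (q s) (Suc k) = expectation (\<lambda>w. (L w + s * X t w) ^ Suc k)" for s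
    unfolding q_def by (rule combination_moment[OF combinations_add[OF L], symmetric])
  moreover have "((\<lambda>s. expectation (\<lambda>w. (L w + s * X t w) ^ Suc k)) has_real_derivative
      real (Suc k) * expectation (\<lambda>w. L w ^ k * X t w)) (at 0)"
    using DERIV_expectation_power[of L "X t" "\<lambda>_. 1" "Suc k"] aL all_moments_X by (simp del: power_Suc)
  ultimately have "real (Suc k) * expectation (\<lambda>w. L w ^ k * X t w) =
     (real (Suc k) * real k / 2 * gaussian_moment (q 0) (Suc k - 2)) * (2 * b)"
    using DERIV_unique by fastforce
  then have "real (Suc k) * expectation (\<lambda>w. L w ^ k * X t w) =
     real (Suc k) * (real k * b * gaussian_moment (q 0) (k - 1))" by simp
  then have "expectation (\<lambda>w. L w ^ k * X t w) = real k * b * gaussian_moment (q 0) (k - 1)"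
    by (subst (asm) mult_left_cancel) auto
  moreover have "gaussian_moment (q 0) (k - 1) = expectation (\<lambda>w. L w ^ (k - 1))"
    unfolding q_def by (simp add: combination_moment[OF L, symmetric])
  ultimately show ?thesis by (simp add: b_def mult.commute)
qed

text \<open>Integration by parts against \<open>X t\<close>, with \<open>D t\<close> in the role of the derivative of \<open>P\<close> in the direction of the covariance
function. The additional factor \<open>L w ^ k\<close> is what keeps the property stable when \<open>P\<close> is multiplied by a
coordinate.\<close>
definition by_parts :: "('a => real) => ('i => 'a => real) => bool" where
  "by_parts P D \<longleftrightarrow> all_moments M P \<and> (\<forall>t. all_moments M (D t)) \<and>
     (\<forall>L\<in>combinations. \<forall>k t. expectation (\<lambda>w. X t w * (L w ^ k * P w)) =
        k * expectation (\<lambda>w. X t w * L w) * expectation (\<lambda>w. L w ^ (k - 1) * P w)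
        + expectation (\<lambda>w. L w ^ k * D t w))"

lemma by_parts_one: "by_parts (\<lambda>_. 1) (\<lambda>_ _. 0)"
  unfolding by_parts_def using combination_by_parts by simp

text \<open>Multiplication by a coordinate is differentiation in the parameter: replace \<open>L\<close> by \<open>L + s * X v\<close> in the identity for \<open>P\<close>
and compare the derivatives at \<open>s = 0\<close>.\<close>
lemma by_parts_mult_X:
  assumes W: "by_parts P D"
  shows "by_parts (\<lambda>w. X v w * P w) (\<lambda>t w. cov t v * P w + X v w * D t w)"
  unfolding by_parts_def
proof (intro conjI ballI allI)
  have P: "all_moments M P" and D: "\<And>t. all_moments M (D t)" using W by (auto simp: by_parts_def)
  show "all_moments M (\<lambda>w. X v w * P w)" by (intro all_moments_intros P all_moments_X)
  show "all_moments M (\<lambda>w. cov t v * P w + X v w * D t w)" for t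
    by (intro all_moments_intros P D all_moments_X)
  fix L k t
  assume L: "L \<in> combinations"
  note aL = all_moments_combination[OF L]
  define b where "b = expectation (\<lambda>w. X t w * L w)"
  note am = all_moments_intros P D all_moments_X aL
  have "expectation (\<lambda>w. X t w * (L w + s * X v w)) = b + s * cov t v" for s
  proof -
    have "expectation (\<lambda>w. X t w * (L w + s * X v w)) = expectation (\<lambda>w. X t w * L w + s * (X t w * X v w))"
      by (simp add: algebra_simps)
    also have "... = b + s * cov t v" unfolding b_def cov_def
      by (subst Bochner_Integration.integral_add) (auto intro!: all_moments_integrable am)
    finally show ?thesis .
  qed
  then have eq: "expectation (\<lambda>w. (L w + s * X v w) ^ Suc k * (X t w * P w)) =
      real (Suc k) * (b + s * cov t v) * expectation (\<lambda>w. (L w + s * X v w) ^ k * P w)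
      + expectation (\<lambda>w. (L w + s * X v w) ^ Suc k * D t w)" for s
    using W combinations_add[OF L, of s v] unfolding by_parts_def
    by (auto simp: mult.left_commute mult.assoc simp del: power_Suc)
  have "((\<lambda>s. expectation (\<lambda>w. (L w + s * X v w) ^ Suc k * (X t w * P w))) has_real_derivative
      real (Suc k) * expectation (\<lambda>w. L w ^ k * (X v w * (X t w * P w)))) (at 0)"
    using DERIV_expectation_power[of L "X v" "\<lambda>w. X t w * P w" "Suc k"] by (simp add: am del: power_Suc)
  moreover
  have D1: "((\<lambda>s. expectation (\<lambda>w. (L w + s * X v w) ^ k * P w)) has_real_derivative
      real k * expectation (\<lambda>w. L w ^ (k - 1) * (X v w * P w))) (at 0)"
    by (rule DERIV_expectation_power) (intro am)+
  have D2: "((\<lambda>s. expectation (\<lambda>w. (L w + s * X v w) ^ Suc k * D t w)) has_real_derivative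
      real (Suc k) * expectation (\<lambda>w. L w ^ k * (X v w * D t w))) (at 0)"
    using DERIV_expectation_power[of L "X v" "D t" "Suc k"] by (simp add: am del: power_Suc)
  have "((\<lambda>s. real (Suc k) * (b + s * cov t v) * expectation (\<lambda>w. (L w + s * X v w) ^ k * P w)
      + expectation (\<lambda>w. (L w + s * X v w) ^ Suc k * D t w)) has_real_derivative
      (real (Suc k) * cov t v * expectation (\<lambda>w. L w ^ k * P w)
       + real (Suc k) * b * (real k * expectation (\<lambda>w. L w ^ (k - 1) * (X v w * P w)))
       + real (Suc k) * expectation (\<lambda>w. L w ^ k * (X v w * D t w)))) (at 0)"
    by (rule D1 D2 derivative_eq_intros refl)+ (simp add: algebra_simps)
  ultimately have "real (Suc k) * expectation (\<lambda>w. L w ^ k * (X v w * (X t w * P w))) =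
      (real (Suc k) * cov t v * expectation (\<lambda>w. L w ^ k * P w)
       + real (Suc k) * b * (real k * expectation (\<lambda>w. L w ^ (k - 1) * (X v w * P w)))
       + real (Suc k) * expectation (\<lambda>w. L w ^ k * (X v w * D t w)))"
    unfolding eq by (rule DERIV_unique)
  then have "real (Suc k) * expectation (\<lambda>w. L w ^ k * (X v w * (X t w * P w))) =
      real (Suc k) * (cov t v * expectation (\<lambda>w. L w ^ k * P w)
       + real k * b * expectation (\<lambda>w. L w ^ (k - 1) * (X v w * P w))
       + expectation (\<lambda>w. L w ^ k * (X v w * D t w)))"
    by (simp only: distrib_left mult_ac)
  then have key: "expectation (\<lambda>w. L w ^ k * (X v w * (X t w * P w))) =
      (cov t v * expectation (\<lambda>w. L w ^ k * P w)
       + real k * b * expectation (\<lambda>w. L w ^ (k - 1) * (X v w * P w))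
       + expectation (\<lambda>w. L w ^ k * (X v w * D t w)))"
    by (subst (asm) mult_left_cancel) auto
  have "expectation (\<lambda>w. L w ^ k * (cov t v * P w + X v w * D t w)) =
     expectation (\<lambda>w. cov t v * (L w ^ k * P w) + L w ^ k * (X v w * D t w))"
    by (simp add: algebra_simps)
  also have "... = cov t v * expectation (\<lambda>w. L w ^ k * P w) + expectation (\<lambda>w. L w ^ k * (X v w * D t w))"
    by (subst Bochner_Integration.integral_add) (auto intro!: all_moments_integrable am)
  finally show "expectation (\<lambda>w. X t w * (L w ^ k * (X v w * P w))) =
        k * expectation (\<lambda>w. X t w * L w) * expectation (\<lambda>w. L w ^ (k - 1) * (X v w * P w))
        + expectation (\<lambda>w. L w ^ k * (cov t v * P w + X v w * D t w))"
    using key by (simp add: b_def mult_ac)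
qed

lemma by_parts_linear:
  assumes "by_parts P D" "by_parts P' D'"
  shows "by_parts (\<lambda>w. a * P w + b * P' w) (\<lambda>t w. a * D t w + b * D' t w)"
  unfolding by_parts_def
proof (intro conjI ballI allI)
  have P: "all_moments M P" "\<And>t. all_moments M (D t)" "all_moments M P'" "\<And>t. all_moments M (D' t)"
    using assms by (auto simp: by_parts_def)
  show "all_moments M (\<lambda>w. a * P w + b * P' w)" by (intro all_moments_intros P)
  show "all_moments M (\<lambda>w. a * D t w + b * D' t w)" for t by (intro all_moments_intros P)
  fix L k t
  assume L: "L \<in> combinations"
  note am = all_moments_intros P all_moments_X all_moments_combination[OF L]
  have lin: "expectation (\<lambda>w. Q w * (a * R w + b * R' w)) = a * expectation (\<lambda>w. Q w * R w) + b * expectation (\<lambda>w. Q w * R' w)"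
    if "all_moments M Q" "all_moments M R" "all_moments M R'" for Q R R'
  proof -
    have "expectation (\<lambda>w. Q w * (a * R w + b * R' w)) = expectation (\<lambda>w. a * (Q w * R w) + b * (Q w * R' w))"
      by (simp add: algebra_simps)
    also have "... = a * expectation (\<lambda>w. Q w * R w) + b * expectation (\<lambda>w. Q w * R' w)"
      by (subst Bochner_Integration.integral_add) (auto intro!: all_moments_integrable all_moments_intros that)
    finally show ?thesis .
  qed
  have "expectation (\<lambda>w. X t w * L w ^ k * (a * P w + b * P' w)) =
     a * expectation (\<lambda>w. X t w * L w ^ k * P w) + b * expectation (\<lambda>w. X t w * L w ^ k * P' w)"
    by (intro lin am)
  then show "expectation (\<lambda>w. X t w * (L w ^ k * (a * P w + b * P' w))) =
        k * expectation (\<lambda>w. X t w * L w) * expectation (\<lambda>w. L w ^ (k - 1) * (a * P w + b * P' w))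
        + expectation (\<lambda>w. L w ^ k * (a * D t w + b * D' t w))"
    using assms L by (simp add: lin am mult.assoc by_parts_def) (simp add: algebra_simps)
qed

text \<open>The identity is linear in \<open>P\<close> and \<open>D\<close>, so it survives integration over an index. This carries it from products
of coordinates to quadratic forms.\<close>
lemma by_parts_integral:
  assumes "finite_measure \<nu>" and P: "moment_field \<nu> M P" and D: "\<And>t. moment_field \<nu> M (\<lambda>s. D s t)"
    and W: "\<And>s. s \<in> space \<nu> ==> by_parts (P s) (D s)"
  shows "by_parts (\<lambda>w. \<integral>s. P s w \<partial>\<nu>) (\<lambda>t w. \<integral>s. D s t w \<partial>\<nu>)"
  unfolding by_parts_def
proof (intro conjI ballI allI)
  show "all_moments M (\<lambda>w. \<integral>s. P s w \<partial>\<nu>)" by (rule all_moments_integral[OF assms(1) P])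
  show "all_moments M (\<lambda>w. \<integral>s. D s t w \<partial>\<nu>)" for t by (rule all_moments_integral[OF assms(1) D])
  fix L k t
  assume L: "L \<in> combinations"
  note am = all_moments_intros all_moments_X all_moments_combination[OF L]
  have sw: "expectation (\<lambda>w. Q w * (LINT s|\<nu>. Y s w)) = (LINT s|\<nu>. expectation (\<lambda>w. Q w * Y s w))"
     and int: "integrable \<nu> (\<lambda>s. expectation (\<lambda>w. Q w * Y s w))"
    if "all_moments M Q" "moment_field \<nu> M Y" for Q Y
  proof -
    interpret \<nu>: finite_measure \<nu> by fact
    interpret pair_sigma_finite \<nu> M ..
    have f: "moment_field \<nu> M (\<lambda>s w. Q w * Y s w)"
      by (intro moment_field_mult moment_field_const that)
    show "expectation (\<lambda>w. Q w * (LINT s|\<nu>. Y s w)) = (LINT s|\<nu>. expectation (\<lambda>w. Q w * Y s w))"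
      using expectation_moment_field[OF assms(1) f] by simp
    show "integrable \<nu> (\<lambda>s. expectation (\<lambda>w. Q w * Y s w))"
      using integrable_fst[OF moment_field_integrable[OF assms(1) f]] by simp
  qed
  have "expectation (\<lambda>w. X t w * L w ^ k * (LINT s|\<nu>. P s w)) = (LINT s|\<nu>. expectation (\<lambda>w. X t w * L w ^ k * P s w))"
    by (intro sw am P)
  also have "... = (LINT s|\<nu>. k * expectation (\<lambda>w. X t w * L w) * expectation (\<lambda>w. L w ^ (k - 1) * P s w)
        + expectation (\<lambda>w. L w ^ k * D s t w))"
    by (intro Bochner_Integration.integral_cong refl) (use W L in \<open>simp add: by_parts_def mult.assoc\<close>)
  also have "... = k * expectation (\<lambda>w. X t w * L w) * (LINT s|\<nu>. expectation (\<lambda>w. L w ^ (k - 1) * P s w))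
        + (LINT s|\<nu>. expectation (\<lambda>w. L w ^ k * D s t w))"
    by (subst Bochner_Integration.integral_add) (auto intro!: int am P D)
  also have "... = k * expectation (\<lambda>w. X t w * L w) * expectation (\<lambda>w. L w ^ (k - 1) * (LINT s|\<nu>. P s w))
        + expectation (\<lambda>w. L w ^ k * (LINT s|\<nu>. D s t w))"
    by (simp add: sw am P D)
  finally show "expectation (\<lambda>w. X t w * (L w ^ k * (LINT s|\<nu>. P s w))) =
        k * expectation (\<lambda>w. X t w * L w) * expectation (\<lambda>w. L w ^ (k - 1) * (LINT s|\<nu>. P s w))
        + expectation (\<lambda>w. L w ^ k * (LINT s|\<nu>. D s t w))"
    by (simp add: mult.assoc)
qed

lemma by_parts_cong_AE:
  assumes W: "by_parts P D" and D: "\<And>t. D' t \<in> borel_measurable M" "\<And>t. AE w in M. D t w = D' t w"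
  shows "by_parts P D'"
proof -
  have a: "all_moments M (D t)" for t using W by (simp add: by_parts_def)
  have "all_moments M (D' t)" for t
  proof -
    have "(\<integral>\<^sup>+w. ennreal (\<bar>D' t w\<bar> ^ n) \<partial>M) = (\<integral>\<^sup>+w. ennreal (\<bar>D t w\<bar> ^ n) \<partial>M)" for n
      using D(2)[of t] by (intro nn_integral_cong_AE) auto
    then show ?thesis using a[of t] D(1)[of t] by (simp add: all_moments_def)
  qed
  moreover have "expectation (\<lambda>w. L w ^ k * D' t w) = expectation (\<lambda>w. L w ^ k * D t w)" if "L \<in> combinations" for L k t
    using all_moments_measurable[OF all_moments_combination[OF that]] D(1)[of t] all_moments_measurable[OF a[of t]] D(2)[of t]
    by (intro Bochner_Integration.integral_cong_AE) auto
  ultimately show ?thesis using W by (simp add: by_parts_def)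
qed

end

section \<open>Kernels and centered quadratic forms\<close>

text \<open>Boundedness is required everywhere, not almost everywhere, which makes compositions of kernels pointwise
defined.\<close>
definition bounded_kernel :: "'i measure => ('i => 'i => real) => bool" where
  "bounded_kernel \<mu> A \<longleftrightarrow> (\<lambda>(u, v). A u v) \<in> borel_measurable (\<mu> \<Otimes>\<^sub>M \<mu>) \<and> (\<exists>C. \<forall>u v. \<bar>A u v\<bar> \<le> C)"

definition kernel_comp :: "'i measure => ('i => 'i => real) => ('i => 'i => real) => 'i => 'i => real" where
  "kernel_comp \<mu> A B u v = (LINT w|\<mu>. A u w * B w v)"

context finite_measure begin

lemma bounded_integrable:
  fixes h :: "'a => real"
  assumes "h \<in> borel_measurable M" "\<And>x. \<bar>h x\<bar> \<le> C"
  shows "integrable M h"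
  using assms by (intro integrable_const_bound[of _ C]) auto

lemma finite_measure_pair: "finite_measure (M \<Otimes>\<^sub>M M)"
  by (rule finite_measure_pair_measure) unfold_locales

lemma bounded_kernel_integrable_pair:
  "bounded_kernel M A ==> integrable (M \<Otimes>\<^sub>M M) (\<lambda>(u, v). A u v)"
  unfolding bounded_kernel_def
  by (auto intro!: finite_measure.bounded_integrable[OF finite_measure_pair])

lemma bounded_kernel_measurable:
  "bounded_kernel M A ==> f \<in> measurable N M ==> g \<in> measurable N M ==> (\<lambda>x. A (f x) (g x)) \<in> borel_measurable N"
  unfolding bounded_kernel_def
  using measurable_compose[of "\<lambda>x. (f x, g x)" N "M \<Otimes>\<^sub>M M" "\<lambda>(u,v). A u v" borel] by simp

lemma bounded_kernel_mult: "bounded_kernel M A ==> bounded_kernel M B ==> bounded_kernel M (\<lambda>u v. A u v * B u v)"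
  unfolding bounded_kernel_def
proof (elim conjE exE, intro conjI)
  fix C C' assume "\<forall>u v. \<bar>A u v\<bar> \<le> C" "\<forall>u v. \<bar>B u v\<bar> \<le> C'"
  then have "\<bar>A u v * B u v\<bar> \<le> C * C'" for u v
    unfolding abs_mult by (intro mult_mono) (auto intro: order_trans[OF abs_ge_zero])
  then show "\<exists>C. \<forall>u v. \<bar>A u v * B u v\<bar> \<le> C" by blast
qed (auto simp: case_prod_beta')

lemma bounded_kernel_swap: "bounded_kernel M A ==> bounded_kernel M (\<lambda>u v. A v u)"
  unfolding bounded_kernel_def by auto

lemma bounded_kernel_compose:
  assumes A: "bounded_kernel M A" and B: "bounded_kernel M B"
  shows "bounded_kernel M (kernel_comp M A B)"
  unfolding bounded_kernel_def
proof
  have "(\<lambda>x. A (fst (fst x)) (snd x) * B (snd x) (snd (fst x))) \<in> borel_measurable ((M \<Otimes>\<^sub>M M) \<Otimes>\<^sub>M M)"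
    by (intro borel_measurable_times bounded_kernel_measurable[OF A] bounded_kernel_measurable[OF B]) measurable
  then show "(\<lambda>(u, v). kernel_comp M A B u v) \<in> borel_measurable (M \<Otimes>\<^sub>M M)"
    using borel_measurable_lebesgue_integral[of "\<lambda>x w. A (fst x) w * B w (snd x)" "M \<Otimes>\<^sub>M M"]
    by (simp add: kernel_comp_def case_prod_beta')
  obtain C C' where C: "\<And>u v. \<bar>A u v\<bar> \<le> C" "\<And>u v. \<bar>B u v\<bar> \<le> C'"
    using A B unfolding bounded_kernel_def by blast
  then have b: "\<bar>A u w * B w v\<bar> \<le> C * C'" for u v w
    unfolding abs_mult by (intro mult_mono) (auto intro: order_trans[OF abs_ge_zero])
  have "\<bar>kernel_comp M A B u v\<bar> \<le> C * C' * measure M (space M)" for u v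
  proof -
    have "\<bar>kernel_comp M A B u v\<bar> \<le> (LINT w|M. \<bar>A u w * B w v\<bar>)" unfolding kernel_comp_def by (rule integral_abs_bound)
    also have "... \<le> (LINT w|M. C * C')"
    proof (cases "integrable M (\<lambda>w. \<bar>A u w * B w v\<bar>)")
      case True then show ?thesis by (intro integral_mono b) auto
    next
      case False
      have "0 \<le> C * C'" using b order_trans[OF abs_ge_zero] by blast
      then show ?thesis unfolding not_integrable_integral_eq[OF False] by (intro Bochner_Integration.integral_nonneg)
    qed
    finally show ?thesis by (simp only: lebesgue_integral_const real_scaleR_def mult.commute[of _ "C * C'"])
  qed
  then show "\<exists>C. \<forall>u v. \<bar>kernel_comp M A B u v\<bar> \<le> C" by blast
qed

lemma integral_pair:
  assumes "bounded_kernel M A"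
  shows "(\<integral>x. A (fst x) (snd x) \<partial>(M \<Otimes>\<^sub>M M)) = (LINT u|M. (LINT v|M. A u v))"
proof -
  interpret pair_sigma_finite M M ..
  show ?thesis using integral_fst[OF bounded_kernel_integrable_pair[OF assms]] by (simp add: case_prod_beta')
qed

lemma integral_swap:
  assumes "bounded_kernel M A"
  shows "(LINT u|M. (LINT v|M. A u v)) = (LINT v|M. (LINT u|M. A u v))"
proof -
  interpret pair_sigma_finite M M ..
  show ?thesis using Fubini_integral[OF bounded_kernel_integrable_pair[OF assms]] by simp
qed

end

context gaussian_field begin

abbreviation "\<nu> \<equiv> \<mu> \<Otimes>\<^sub>M \<mu>"

lemma finite_nu: "finite_measure \<nu>"
  by (rule index.finite_measure_pair)

lemma moment_field_fst: "moment_field \<nu> M (\<lambda>x. X (fst x))"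
  by (rule moment_field_comp[OF moment_field_X]) measurable

lemma moment_field_snd: "moment_field \<nu> M (\<lambda>x. X (snd x))"
  by (rule moment_field_comp[OF moment_field_X]) measurable

lemma moment_field_kernel: "bounded_kernel \<mu> A ==> moment_field \<nu> M (\<lambda>x w. A (fst x) (snd x))"
  unfolding bounded_kernel_def by (elim conjE exE, rule moment_field_bounded) (auto simp: case_prod_beta')

lemma bounded_kernel_expectation:
  assumes "moment_field \<nu> M (\<lambda>x. Y (fst x) (snd x))"
  shows "bounded_kernel \<mu> (\<lambda>u v. expectation (Y u v))"
  unfolding bounded_kernel_def
proof
  have m: "(\<lambda>x. Y (fst (fst x)) (snd (fst x)) (snd x)) \<in> borel_measurable (\<nu> \<Otimes>\<^sub>M M)"
    using assms unfolding moment_field_def by (simp add: case_prod_beta')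
  then show "(\<lambda>(u, v). expectation (Y u v)) \<in> borel_measurable (\<mu> \<Otimes>\<^sub>M \<mu>)"
    using borel_measurable_lebesgue_integral[of "\<lambda>x w. Y (fst x) (snd x) w" \<nu>] by (simp add: case_prod_beta')
  obtain C where C: "C < \<infinity>" "\<forall>s\<in>space \<nu>. (\<integral>\<^sup>+w. ennreal (\<bar>Y (fst s) (snd s) w\<bar> ^ 1) \<partial>M) \<le> C"
    using assms unfolding moment_field_def by meson
  obtain c where c: "C = ennreal c" "0 \<le> c" using C(1) by (cases C) auto
  have "\<bar>expectation (Y u v)\<bar> \<le> c" for u v
  proof -
    have "integrable M (Y u v)"
      using all_moments_integrable[OF moment_field_section[OF assms, of "(u, v)"]] by (simp add: space_pair_measure)
    then have "ennreal \<bar>expectation (Y u v)\<bar> \<le> (\<integral>\<^sup>+w. ennreal \<bar>Y u v w\<bar> \<partial>M)"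
      using integral_norm_bound_ennreal[of M "Y u v"] by simp
    also have "... \<le> C" using C(2) by (auto simp: space_pair_measure)
    finally show ?thesis using c by simp
  qed
  then show "\<exists>C. \<forall>u v. \<bar>expectation (Y u v)\<bar> \<le> C" by blast
qed

lemma bounded_kernel_cov: "bounded_kernel \<mu> cov"
  using bounded_kernel_expectation[of "\<lambda>u v w. X u w * X v w", OF moment_field_mult[OF moment_field_fst moment_field_snd]]
  by (simp add: cov_def[abs_def])

text \<open>The quadratic form with kernel \<open>A\<close>, centered at its expectation.\<close>
definition quad :: "('i => 'i => real) => 'a => real" where
  "quad A w = (LINT x|\<nu>. A (fst x) (snd x) * (X (fst x) w * X (snd x) w - cov (fst x) (snd x)))"

text \<open>The derivative of the quadratic form in the direction of \<open>cov t\<close>.\<close>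
definition quad_deriv :: "('i => 'i => real) => 'i => 'a => real" where
  "quad_deriv A t w = (LINT x|\<nu>. A (fst x) (snd x) * (cov t (fst x) * X (snd x) w + X (fst x) w * cov t (snd x)))"

lemma moment_field_diff:
  assumes "moment_field K M Y" "moment_field K M Z"
  shows "moment_field K M (\<lambda>s w. Y s w - Z s w)"
  using moment_field_add[OF assms(1) moment_field_mult[OF moment_field_bounded[of "\<lambda>_. -1" _ 1] assms(2)]] by simp

lemma moment_field_covt: "moment_field \<nu> M (\<lambda>x w. cov t (fst x))" "moment_field \<nu> M (\<lambda>x w. cov t (snd x))"
proof -
  obtain C where C: "\<And>u v. \<bar>cov u v\<bar> \<le> C" using bounded_kernel_cov unfolding bounded_kernel_def by blast
  show "moment_field \<nu> M (\<lambda>x w. cov t (fst x))" "moment_field \<nu> M (\<lambda>x w. cov t (snd x))"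
    by (rule moment_field_bounded[OF index.bounded_kernel_measurable[OF bounded_kernel_cov] C], measurable)+
qed

lemmas moment_field_intros = moment_field_add moment_field_mult moment_field_diff moment_field_covt
  moment_field_const moment_field_kernel moment_field_fst moment_field_snd bounded_kernel_cov

lemma all_moments_quad: "bounded_kernel \<mu> A ==> all_moments M (quad A)"
  unfolding quad_def[abs_def]
  by (intro all_moments_integral[OF finite_nu] moment_field_intros)

lemma all_moments_quad_deriv: "bounded_kernel \<mu> A ==> all_moments M (quad_deriv A t)"
  unfolding quad_deriv_def[abs_def]
  by (intro all_moments_integral[OF finite_nu] moment_field_intros)

lemma by_parts_mult_quad:
  assumes A: "bounded_kernel \<mu> A" and W: "by_parts P D"
  shows "by_parts (\<lambda>w. quad A w * P w) (\<lambda>t w. quad_deriv A t w * P w + quad A w * D t w)"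
proof -
  have P: "all_moments M P" and D: "\<And>t. all_moments M (D t)" using W by (auto simp: by_parts_def)
  let ?a = "\<lambda>x. A (fst x) (snd x)" and ?r = "\<lambda>x. cov (fst x) (snd x)"
  define PP where "PP x w = ?a x * (X (fst x) w * (X (snd x) w * P w)) + - (?a x * ?r x) * P w" for x w
  define DD where "DD x t w = ?a x * (cov t (fst x) * (X (snd x) w * P w) + X (fst x) w *
      (cov t (snd x) * P w + X (snd x) w * D t w)) + - (?a x * ?r x) * D t w" for x t w
  have W1: "by_parts (PP x) (DD x)" for x
    unfolding PP_def[abs_def] DD_def[abs_def]
    by (intro by_parts_linear by_parts_mult_X W)
  have "by_parts (\<lambda>w. \<integral>x. PP x w \<partial>\<nu>) (\<lambda>t w. \<integral>x. DD x t w \<partial>\<nu>)"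
  proof (rule by_parts_integral[OF finite_nu _ _ W1])
    have "moment_field \<nu> M (\<lambda>x w. ?a x * (X (fst x) w * (X (snd x) w * P w)) - (?a x * ?r x) * P w)"
      by (intro moment_field_intros P A)
    then show "moment_field \<nu> M PP" by (simp add: PP_def[abs_def])
    have "moment_field \<nu> M (\<lambda>x w. ?a x * (cov t (fst x) * (X (snd x) w * P w) + X (fst x) w *
      (cov t (snd x) * P w + X (snd x) w * D t w)) - (?a x * ?r x) * D t w)" for t
      by (intro moment_field_intros P D A)
    then show "moment_field \<nu> M (\<lambda>x. DD x t)" for t by (simp add: DD_def[abs_def])
  qed
  moreover have "(LINT x|\<nu>. PP x w) = quad A w * P w" for w
    unfolding PP_def quad_def integral_mult_left_zero[symmetric]
    by (rule Bochner_Integration.integral_cong) (auto simp: algebra_simps)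
  moreover have "AE w in M. (LINT x|\<nu>. DD x t w) = quad_deriv A t w * P w + quad A w * D t w" for t
  proof -
    have f1: "moment_field \<nu> M (\<lambda>x w. ?a x * (cov t (fst x) * X (snd x) w + X (fst x) w * cov t (snd x)) * P w)"
      by (intro moment_field_intros A P)
    have f2: "moment_field \<nu> M (\<lambda>x w. ?a x * (X (fst x) w * X (snd x) w - ?r x) * D t w)"
      by (intro moment_field_intros A D)
    show ?thesis using moment_field_AE_integrable[OF finite_nu f1] moment_field_AE_integrable[OF finite_nu f2]
    proof eventually_elim
      case (elim w)
      show ?case unfolding DD_def quad_def quad_deriv_def integral_mult_left_zero[symmetric]
        unfolding Bochner_Integration.integral_add[OF elim, symmetric]
        by (rule Bochner_Integration.integral_cong) (auto simp: algebra_simps)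
    qed
  qed
  moreover have "(\<lambda>w. quad_deriv A t w * P w + quad A w * D t w) \<in> borel_measurable M" for t
    by (intro borel_measurable_add borel_measurable_times all_moments_measurable all_moments_quad all_moments_quad_deriv A P D)
  ultimately show ?thesis
    using by_parts_cong_AE[of "\<lambda>w. \<integral>x. PP x w \<partial>\<nu>" "\<lambda>t w. \<integral>x. DD x t w \<partial>\<nu>"] by simp
qed

lemma by_parts_quad_power:
  assumes A: "bounded_kernel \<mu> A"
  shows "by_parts (\<lambda>w. quad A w ^ k) (\<lambda>t w. k * (quad A w ^ (k - 1) * quad_deriv A t w))"
proof (induction k)
  case 0 then show ?case using by_parts_one by simp
next
  case (Suc k)
  have "quad_deriv A t w * quad A w ^ k + quad A w * (k * (quad A w ^ (k - 1) * quad_deriv A t w))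
    = Suc k * (quad A w ^ (Suc k - 1) * quad_deriv A t w)" for t w
    by (cases k) (auto simp: algebra_simps)
  then show ?case using by_parts_mult_quad[OF A Suc] by simp
qed

end

section \<open>Moments of quadratic forms\<close>

lemma Cauchy_Schwarz_integral:
  fixes f g :: "'a => real"
  assumes f: "integrable M (\<lambda>x. (f x)^2)" and g: "integrable M (\<lambda>x. (g x)^2)" and fg: "integrable M (\<lambda>x. f x * g x)"
  shows "(LINT x|M. f x * g x)^2 \<le> (LINT x|M. (f x)^2) * (LINT x|M. (g x)^2)"
proof -
  define a b c where "a = (LINT x|M. (f x)^2)" and "b = (LINT x|M. (g x)^2)" and "c = (LINT x|M. f x * g x)"
  have q: "0 \<le> s\<^sup>2 * a - 2 * s * t * c + t\<^sup>2 * b" for s t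
  proof -
    have "0 \<le> (LINT x|M. (s * f x - t * g x)^2)" by (rule integral_nonneg_AE) auto
    also have "... = (LINT x|M. s\<^sup>2 * (f x)^2 - 2 * s * t * (f x * g x) + t\<^sup>2 * (g x)^2)"
      by (rule Bochner_Integration.integral_cong) (auto simp: power2_eq_square algebra_simps)
    also have "... = s\<^sup>2 * a - 2 * s * t * c + t\<^sup>2 * b"
      using f g fg by (simp add: a_def b_def c_def)
    finally show ?thesis .
  qed
  have b0: "0 \<le> b" using q[of 0 1] by simp
  show ?thesis
  proof (cases "b = 0")
    case True
    have "c = 0"
    proof (rule ccontr)
      assume "c \<noteq> 0"
      then show False using q[of 1 "(a + 1) / (2 * c)"] True by (simp add: field_simps)
    qed
    then show ?thesis using True by (simp add: a_def b_def c_def)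
  next
    case False
    have "0 \<le> b * (a * b - c\<^sup>2)" using q[of b c] by (simp add: power2_eq_square algebra_simps)
    moreover have "0 < b" using False b0 by simp
    ultimately have "0 \<le> a * b - c\<^sup>2" by (simp only: zero_le_mult_iff) auto
    then show ?thesis by (simp add: a_def b_def c_def)
  qed
qed

text \<open>The trace of the composition of the integral operators with kernels \<open>A\<close> and \<open>B\<close>.\<close>
definition trace_pair :: "'i measure => ('i => 'i => real) => ('i => 'i => real) => real" where
  "trace_pair \<mu> A B = (LINT u|\<mu>. (LINT v|\<mu>. A u v * B v u))"

text \<open>The square of the Hilbert-Schmidt norm.\<close>
definition norm2 :: "'i measure => ('i => 'i => real) => real" where
  "norm2 \<mu> A = (LINT u|\<mu>. (LINT v|\<mu>. (A u v)^2))"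

lemma norm2_nonneg: "0 \<le> norm2 \<mu> A"
  unfolding norm2_def by simp

context finite_measure begin

lemma bounded_kernel_section:
  assumes "bounded_kernel M A" "u \<in> space M"
  shows "integrable M (A u)" "integrable M (\<lambda>w. A w u)"
proof -
  obtain C where C: "\<And>u v. \<bar>A u v\<bar> \<le> C" using assms unfolding bounded_kernel_def by blast
  show "integrable M (A u)" "integrable M (\<lambda>w. A w u)"
    by (rule bounded_integrable[OF bounded_kernel_measurable[OF assms(1)] C]; use assms(2) in measurable)+
qed

lemma bounded_kernel_integral:
  assumes "bounded_kernel M A"
  shows "integrable M (\<lambda>u. \<integral>v. A u v \<partial>M)"
proof -
  interpret pair_sigma_finite M M ..
  show ?thesis using integrable_fst[OF bounded_kernel_integrable_pair[OF assms]] by simp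
qed

lemma triple_measurable:
  assumes A: "bounded_kernel M A" and B: "bounded_kernel M B" and u: "u \<in> space M" "v \<in> space M"
    and C: "bounded_kernel M C"
  shows "bounded_kernel M (\<lambda>x w. A u x * B x w * C w v)"
  unfolding bounded_kernel_def
proof
  show "(\<lambda>(x, w). A u x * B x w * C w v) \<in> borel_measurable (M \<Otimes>\<^sub>M M)"
    unfolding case_prod_beta'
    by (intro borel_measurable_times bounded_kernel_measurable[OF A] bounded_kernel_measurable[OF B]
        bounded_kernel_measurable[OF C]) (use u in measurable)
  obtain c where c: "\<And>u v. \<bar>A u v\<bar> \<le> c" using A unfolding bounded_kernel_def by blast
  obtain c' where c': "\<And>u v. \<bar>B u v\<bar> \<le> c'" using B unfolding bounded_kernel_def by blast
  obtain c'' where c'': "\<And>u v. \<bar>C u v\<bar> \<le> c''" using C unfolding bounded_kernel_def by blast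
  have "\<bar>A u x * B x w * C w v\<bar> \<le> c * c' * c''" for x w
    unfolding abs_mult
    by (intro mult_mono c c' c'' mult_nonneg_nonneg) (auto intro: order_trans[OF abs_ge_zero c] order_trans[OF abs_ge_zero c'])
  then show "\<exists>C'. \<forall>x w. \<bar>A u x * B x w * C w v\<bar> \<le> C'" by blast
qed

lemma compose_assoc:
  assumes "bounded_kernel M A" "bounded_kernel M B" "bounded_kernel M C" "u \<in> space M" "v \<in> space M"
  shows "kernel_comp M (kernel_comp M A B) C u v = kernel_comp M A (kernel_comp M B C) u v"
  using integral_swap[OF triple_measurable[OF assms(1,2,4,5,3)]]
  unfolding kernel_comp_def integral_mult_left_zero[symmetric] integral_mult_right_zero[symmetric] mult.assoc
  by simp

lemma trace_pair_compose:
  assumes "bounded_kernel M A" "bounded_kernel M B" "bounded_kernel M C"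
  shows "trace_pair M A (kernel_comp M B C) = trace_pair M (kernel_comp M A B) C"
  unfolding trace_pair_def
proof (rule Bochner_Integration.integral_cong[OF refl])
  fix u assume u: "u \<in> space M"
  show "(LINT v|M. A u v * kernel_comp M B C v u) = (LINT v|M. kernel_comp M A B u v * C v u)"
    using compose_assoc[OF assms u u] by (simp add: kernel_comp_def)
qed

lemma trace_pair_commute:
  assumes "bounded_kernel M A" "bounded_kernel M B"
  shows "trace_pair M A B = trace_pair M B A"
  using integral_swap[OF bounded_kernel_mult[OF assms(1) bounded_kernel_swap[OF assms(2)]]]
  by (simp add: trace_pair_def mult.commute)

lemma bounded_kernel_power2: "bounded_kernel M A ==> bounded_kernel M (\<lambda>u v. (A u v)^2)"
  unfolding power2_eq_square by (rule bounded_kernel_mult)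

lemma trace_pair_le_norm2:
  assumes A: "bounded_kernel M A"
  shows "\<bar>trace_pair M A A\<bar> \<le> norm2 M A"
proof -
  note sq = bounded_kernel_power2[OF A]
  have "\<bar>trace_pair M A A\<bar> \<le> (LINT u|M. (LINT v|M. ((A u v)^2 + (A v u)^2) / 2))"
    unfolding trace_pair_def
  proof (rule order_trans[OF integral_abs_bound], rule integral_mono)
    show "integrable M (\<lambda>u. \<bar>\<integral>v. A u v * A v u \<partial>M\<bar>)"
      by (intro integrable_abs bounded_kernel_integral bounded_kernel_mult A bounded_kernel_swap)
    have "integrable M (\<lambda>u. ((LINT v|M. (A u v)^2) + (LINT v|M. (A v u)^2)) / 2)"
      by (intro integrable_divide Bochner_Integration.integrable_add bounded_kernel_integral sq bounded_kernel_swap[OF sq])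
    then show "integrable M (\<lambda>u. \<integral>v. ((A u v)^2 + (A v u)^2) / 2 \<partial>M)"
      by (rule Bochner_Integration.integrable_cong[THEN iffD1, rotated -1])
         (use bounded_kernel_section[OF sq] in auto)
    fix u assume u: "u \<in> space M"
    show "\<bar>\<integral>v. A u v * A v u \<partial>M\<bar> \<le> (LINT v|M. ((A u v)^2 + (A v u)^2) / 2)"
    proof (rule order_trans[OF integral_abs_bound], rule integral_mono)
      show "integrable M (\<lambda>v. \<bar>A u v * A v u\<bar>)"
        using bounded_kernel_section(1)[OF bounded_kernel_mult[OF A bounded_kernel_swap[OF A]] u] by (rule integrable_abs)
      show "integrable M (\<lambda>v. ((A u v)^2 + (A v u)^2) / 2)"
        using bounded_kernel_section[OF sq u] by simp
      fix v
      have "0 \<le> (\<bar>A u v\<bar> - \<bar>A v u\<bar>)^2" by simp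
      then show "\<bar>A u v * A v u\<bar> \<le> ((A u v)^2 + (A v u)^2) / 2"
        by (simp add: power2_diff abs_mult)
    qed
  qed
  also have "... = (LINT u|M. ((LINT v|M. (A u v)^2) + (LINT v|M. (A v u)^2)) / 2)"
    by (rule Bochner_Integration.integral_cong) (use bounded_kernel_section[OF sq] in auto)
  also have "... = norm2 M A"
    using integral_swap[OF sq] bounded_kernel_integral[OF sq] bounded_kernel_integral[OF bounded_kernel_swap[OF sq]]
    by (simp add: norm2_def)
  finally show ?thesis .
qed

lemma norm2_compose_le:
  assumes A: "bounded_kernel M A" and B: "bounded_kernel M B"
  shows "norm2 M (kernel_comp M A B) \<le> norm2 M A * norm2 M B"
proof -
  note sA = bounded_kernel_power2[OF A] and sB = bounded_kernel_power2[OF B]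
  have "norm2 M (kernel_comp M A B) \<le> (LINT u|M. (LINT v|M. (LINT w|M. (A u w)^2) * (LINT w|M. (B w v)^2)))"
    unfolding norm2_def
  proof (rule integral_mono)
    show "integrable M (\<lambda>u. \<integral>v. (kernel_comp M A B u v)^2 \<partial>M)"
      by (intro bounded_kernel_integral bounded_kernel_power2 bounded_kernel_compose A B)
    show "integrable M (\<lambda>u. \<integral>v. (LINT w|M. (A u w)^2) * (LINT w|M. (B w v)^2) \<partial>M)"
      using bounded_kernel_integral[OF sA] by simp
    fix u assume u: "u \<in> space M"
    show "(LINT v|M. (kernel_comp M A B u v)^2) \<le> (LINT v|M. (LINT w|M. (A u w)^2) * (LINT w|M. (B w v)^2))"
    proof (rule integral_mono)
      show "integrable M (\<lambda>v. (kernel_comp M A B u v)^2)"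
        by (intro bounded_kernel_section(1)[OF bounded_kernel_power2] bounded_kernel_compose A B u)
      show "integrable M (\<lambda>v. (LINT w|M. (A u w)^2) * (LINT w|M. (B w v)^2))"
        using bounded_kernel_integral[OF bounded_kernel_swap[OF sB]] by simp
      fix v assume v: "v \<in> space M"
      obtain a b where ab: "\<And>u v. \<bar>A u v\<bar> \<le> a" "\<And>u v. \<bar>B u v\<bar> \<le> b"
        using A B unfolding bounded_kernel_def by blast
      have "integrable M (\<lambda>w. A u w * B w v)"
      proof (rule bounded_integrable)
        show "(\<lambda>w. A u w * B w v) \<in> borel_measurable M"
          by (intro borel_measurable_times bounded_kernel_measurable[OF A] bounded_kernel_measurable[OF B]) (use u v in measurable)
        show "\<bar>A u w * B w v\<bar> \<le> a * b" for w
          unfolding abs_mult by (intro mult_mono ab) (auto intro: order_trans[OF abs_ge_zero ab(1)])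
      qed
      then show "(kernel_comp M A B u v)^2 \<le> (LINT w|M. (A u w)^2) * (LINT w|M. (B w v)^2)"
        unfolding kernel_comp_def
        by (intro Cauchy_Schwarz_integral bounded_kernel_section(1)[OF sA u] bounded_kernel_section(2)[OF sB v])
    qed
  qed
  also have "... = norm2 M A * norm2 M B"
    using integral_swap[OF sB] by (simp add: norm2_def)
  finally show ?thesis .
qed

end

text \<open>The recursion is the one produced by the induction step of the moment bound.\<close>
primrec moment_const :: "nat => real" where
  "moment_const 0 = 2"
| "moment_const (Suc j) = (4 * (4 * 2 ^ Suc j - 2)) ^ 2 ^ Suc j * (1 + moment_const j)"

lemma moment_const_nonneg: "0 \<le> moment_const j"
  by (induction j) auto

context gaussian_field begin

lemma moment_kernel:
  assumes "all_moments M P"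
  shows "bounded_kernel \<mu> (\<lambda>u v. expectation (\<lambda>w. X u w * X v w * P w))"
  by (rule bounded_kernel_expectation) (intro moment_field_intros assms)

lemma expectation_quad_mult:
  assumes A: "bounded_kernel \<mu> A" and P: "all_moments M P"
  shows "expectation (\<lambda>w. quad A w * P w) =
     (LINT u|\<mu>. (LINT v|\<mu>. A u v * (expectation (\<lambda>w. X u w * X v w * P w) - cov u v * expectation P)))"
proof -
  have "expectation (\<lambda>w. quad A w * P w) =
      expectation (\<lambda>w. \<integral>x. A (fst x) (snd x) * (X (fst x) w * X (snd x) w - cov (fst x) (snd x)) * P w \<partial>\<nu>)"
    by (simp add: quad_def)
  also have "... = (LINT x|\<nu>. expectation (\<lambda>w. A (fst x) (snd x) * (X (fst x) w * X (snd x) w - cov (fst x) (snd x)) * P w))"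
    by (intro expectation_moment_field finite_nu moment_field_intros A P)
  also have "... = (LINT x|\<nu>. A (fst x) (snd x) * (expectation (\<lambda>w. X (fst x) w * X (snd x) w * P w) - cov (fst x) (snd x) * expectation P))"
  proof (rule Bochner_Integration.integral_cong[OF refl])
    fix x
    have "expectation (\<lambda>w. A (fst x) (snd x) * (X (fst x) w * X (snd x) w - cov (fst x) (snd x)) * P w)
      = expectation (\<lambda>w. A (fst x) (snd x) * (X (fst x) w * X (snd x) w * P w - cov (fst x) (snd x) * P w))"
      by (simp add: algebra_simps)
    also have "... = A (fst x) (snd x) * expectation (\<lambda>w. X (fst x) w * X (snd x) w * P w - cov (fst x) (snd x) * P w)"
      by simp
    also have "expectation (\<lambda>w. X (fst x) w * X (snd x) w * P w - cov (fst x) (snd x) * P w) =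
       expectation (\<lambda>w. X (fst x) w * X (snd x) w * P w) - cov (fst x) (snd x) * expectation P"
      by (subst Bochner_Integration.integral_diff) (auto intro!: all_moments_integrable all_moments_intros P)
    finally show "expectation (\<lambda>w. A (fst x) (snd x) * (X (fst x) w * X (snd x) w - cov (fst x) (snd x)) * P w) =
       A (fst x) (snd x) * (expectation (\<lambda>w. X (fst x) w * X (snd x) w * P w) - cov (fst x) (snd x) * expectation P)" .
  qed
  also have "... = (LINT u|\<mu>. (LINT v|\<mu>. A u v * (expectation (\<lambda>w. X u w * X v w * P w) - cov u v * expectation P)))"
  proof (rule index.integral_pair[of "\<lambda>u v. A u v * (expectation (\<lambda>w. X u w * X v w * P w) - cov u v * expectation P)"])
    have "bounded_kernel \<mu> (\<lambda>u v. A u v * expectation (\<lambda>w. X u w * X v w * P w - cov u v * P w))"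
      by (intro index.bounded_kernel_mult A bounded_kernel_expectation moment_field_intros P)
    moreover have "expectation (\<lambda>w. X u w * X v w * P w - cov u v * P w) =
       expectation (\<lambda>w. X u w * X v w * P w) - cov u v * expectation P" for u v
      by (subst Bochner_Integration.integral_diff) (auto intro!: all_moments_integrable all_moments_intros P)
    ultimately show "bounded_kernel \<mu> (\<lambda>u v. A u v * (expectation (\<lambda>w. X u w * X v w * P w) - cov u v * expectation P))"
      by simp
  qed
  finally show ?thesis .
qed

lemma expectation_quad_deriv_mult:
  assumes A: "bounded_kernel \<mu> A" and sym: "\<And>u v. A u v = A v u" and P: "all_moments M P"
  shows "expectation (\<lambda>w. X v w * (P w * quad_deriv A u w)) =
     2 * kernel_comp \<mu> (kernel_comp \<mu> cov A) (\<lambda>s t. expectation (\<lambda>w. X s w * X t w * P w)) u v"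
proof -
  define m where "m s t = expectation (\<lambda>w. X s w * X t w * P w)" for s t
  have m: "bounded_kernel \<mu> m" unfolding m_def by (rule moment_kernel[OF P])
  have m_sym: "m s t = m t s" for s t by (simp add: m_def mult_ac)
  note k1 = index.triple_measurable[OF bounded_kernel_cov A _ _ m, of u v]
  have "expectation (\<lambda>w. X v w * (P w * quad_deriv A u w)) =
     expectation (\<lambda>w. \<integral>x. A (fst x) (snd x) * (cov u (fst x) * X (snd x) w + X (fst x) w * cov u (snd x)) * (X v w * P w) \<partial>\<nu>)"
    by (simp add: quad_deriv_def mult_ac)
  also have "... = (LINT x|\<nu>. expectation (\<lambda>w. A (fst x) (snd x) * (cov u (fst x) * X (snd x) w + X (fst x) w * cov u (snd x)) * (X v w * P w)))"
    by (intro expectation_moment_field finite_nu moment_field_intros A all_moments_X P)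
  also have "... = (LINT x|\<nu>. cov u (fst x) * A (fst x) (snd x) * m (snd x) v + cov u (snd x) * A (snd x) (fst x) * m (fst x) v)"
  proof (rule Bochner_Integration.integral_cong[OF refl])
    fix x
    have "expectation (\<lambda>w. A (fst x) (snd x) * (cov u (fst x) * X (snd x) w + X (fst x) w * cov u (snd x)) * (X v w * P w))
      = expectation (\<lambda>w. (cov u (fst x) * A (fst x) (snd x)) * (X (snd x) w * X v w * P w) +
                   (cov u (snd x) * A (fst x) (snd x)) * (X (fst x) w * X v w * P w))"
      by (simp add: algebra_simps)
    also have "... = cov u (fst x) * A (fst x) (snd x) * m (snd x) v + cov u (snd x) * A (fst x) (snd x) * m (fst x) v"
      unfolding m_def
      by (subst Bochner_Integration.integral_add) (auto intro!: all_moments_integrable all_moments_intros P)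
    finally show "expectation (\<lambda>w. A (fst x) (snd x) * (cov u (fst x) * X (snd x) w + X (fst x) w * cov u (snd x)) * (X v w * P w))
       = cov u (fst x) * A (fst x) (snd x) * m (snd x) v + cov u (snd x) * A (snd x) (fst x) * m (fst x) v"
      using sym[of "fst x" "snd x"] by simp
  qed
  also have "... = (LINT x|\<nu>. cov u (fst x) * A (fst x) (snd x) * m (snd x) v) + (LINT x|\<nu>. cov u (snd x) * A (snd x) (fst x) * m (fst x) v)"
    using index.bounded_kernel_integrable_pair[OF k1] index.bounded_kernel_integrable_pair[OF index.bounded_kernel_swap[OF k1]]
    by (intro Bochner_Integration.integral_add) (auto simp: case_prod_beta')
  also have "... = 2 * (LINT s|\<mu>. (LINT t|\<mu>. cov u s * A s t * m t v))"
    using index.integral_pair[OF k1] index.integral_pair[OF index.bounded_kernel_swap[OF k1]] index.integral_swap[OF k1] by simp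
  also have "(LINT s|\<mu>. (LINT t|\<mu>. cov u s * A s t * m t v)) = kernel_comp \<mu> cov (kernel_comp \<mu> A m) u v"
    by (simp add: kernel_comp_def mult.assoc)
  also have "... = kernel_comp \<mu> (kernel_comp \<mu> cov A) m u v"
    by (rule index.compose_assoc[symmetric]) (auto intro: bounded_kernel_cov A m)
  finally show ?thesis by (simp add: m_def[abs_def])
qed

text \<open>The kernel whose composition with the covariance is the square of the composed kernel of \<open>A\<close>; its quadratic form appears
when the derivative of a quadratic form is paired with the process.\<close>
definition chain :: "('i => 'i => real) => 'i => 'i => real" where
  "chain A = kernel_comp \<mu> (kernel_comp \<mu> A cov) A"

lemma bounded_kernel_chain: "bounded_kernel \<mu> A ==> bounded_kernel \<mu> (chain A)"
  unfolding chain_def by (intro index.bounded_kernel_compose bounded_kernel_cov)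

lemma chain_sym:
  assumes A: "bounded_kernel \<mu> A" and sym: "\<And>u v. A u v = A v u"
  shows "chain A u v = chain A v u"
proof -
  have "chain A u v = kernel_comp \<mu> A (kernel_comp \<mu> cov A) u v"
    unfolding chain_def by (rule index.compose_assoc) (auto intro: bounded_kernel_cov A)
  also have "... = chain A v u"
  proof -
    have "cov x w * A w v = A v w * cov w x" for x w using cov_commute[of x w] sym[of w v] by simp
    then have i: "(LINT w|\<mu>. cov x w * A w v) = (LINT w|\<mu>. A v w * cov w x)" for x by simp
    have "A u x * (LINT w|\<mu>. cov x w * A w v) = (LINT w|\<mu>. A v w * cov w x) * A x u" for x
      unfolding i sym[of u x] by (rule mult.commute)
    then show ?thesis unfolding chain_def kernel_comp_def by simp
  qed
  finally show ?thesis .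
qed

lemma compose_chain_cov:
  assumes A: "bounded_kernel \<mu> A"
  shows "kernel_comp \<mu> (chain A) cov = kernel_comp \<mu> (kernel_comp \<mu> A cov) (kernel_comp \<mu> A cov)"
  unfolding chain_def
  by (intro ext index.compose_assoc index.bounded_kernel_compose bounded_kernel_cov A) auto

lemma trace_pair_chain:
  assumes A: "bounded_kernel \<mu> A"
  shows "trace_pair \<mu> (chain A) cov = trace_pair \<mu> (kernel_comp \<mu> A cov) (kernel_comp \<mu> A cov)"
  unfolding chain_def
  by (intro index.trace_pair_compose[symmetric] index.bounded_kernel_compose bounded_kernel_cov A)

text \<open>Write one factor \<open>quad A\<close> as an integral of products \<open>X u * X v\<close> and integrate by parts twice. Derivatives falling on
the remaining power produce the trace and the quadratic form of \<open>chain A\<close>; the pairing of the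
two coordinates with each other cancels against the centering.\<close>
theorem quad_moment_recursion:
  assumes A: "bounded_kernel \<mu> A" and sym: "\<And>u v. A u v = A v u"
  shows "expectation (\<lambda>w. quad A w ^ Suc k) =
    2 * k * (trace_pair \<mu> (kernel_comp \<mu> A cov) (kernel_comp \<mu> A cov) * expectation (\<lambda>w. quad A w ^ (k - 1))
             + expectation (\<lambda>w. quad (chain A) w * quad A w ^ (k - 1)))"
proof -
  define P where "P w = quad A w ^ (k - 1)" for w
  have P: "all_moments M P" unfolding P_def by (intro all_moments_intros all_moments_quad A)
  define m where "m s t = expectation (\<lambda>w. X s w * X t w * P w)" for s t
  have m: "bounded_kernel \<mu> m" unfolding m_def by (rule moment_kernel[OF P])
  have m_sym: "m s t = m t s" for s t by (simp add: m_def mult_ac)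
  have Ak: "all_moments M (\<lambda>w. quad A w ^ k)" by (intro all_moments_intros all_moments_quad A)
  have "expectation (\<lambda>w. X u w * X v w * quad A w ^ k) - cov u v * expectation (\<lambda>w. quad A w ^ k)
      = k * (2 * kernel_comp \<mu> (kernel_comp \<mu> cov A) m u v)" for u v
  proof -
    have bp: "expectation (\<lambda>w. X t w * (L w ^ i * quad A w ^ k)) =
        i * expectation (\<lambda>w. X t w * L w) * expectation (\<lambda>w. L w ^ (i - 1) * quad A w ^ k)
        + expectation (\<lambda>w. L w ^ i * (k * (quad A w ^ (k - 1) * quad_deriv A t w)))"
      if "L \<in> combinations" for L t i
      using by_parts_quad_power[OF A, of k] that unfolding by_parts_def by blast
    have "expectation (\<lambda>w. X u w * (X v w * quad A w ^ k)) =
       cov u v * expectation (\<lambda>w. quad A w ^ k) + expectation (\<lambda>w. X v w * (k * (P w * quad_deriv A u w)))"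
      using bp[OF combinations_X[of v], of u 1] by (simp add: P_def cov_def)
    also have "expectation (\<lambda>w. X v w * (k * (P w * quad_deriv A u w))) =
        k * expectation (\<lambda>w. X v w * (P w * quad_deriv A u w))"
      by (simp add: mult.left_commute)
    also have "expectation (\<lambda>w. X v w * (P w * quad_deriv A u w)) = 2 * kernel_comp \<mu> (kernel_comp \<mu> cov A) m u v"
      unfolding m_def by (rule expectation_quad_deriv_mult[OF A sym P])
    finally show ?thesis by (simp add: mult.assoc)
  qed
  then have "expectation (\<lambda>w. quad A w * quad A w ^ k) =
     (LINT u|\<mu>. (LINT v|\<mu>. A u v * (k * (2 * kernel_comp \<mu> (kernel_comp \<mu> cov A) m u v))))"
    unfolding expectation_quad_mult[OF A Ak] by simp
  also have "... = (LINT u|\<mu>. (LINT v|\<mu>. 2 * k * (kernel_comp \<mu> (kernel_comp \<mu> cov A) m u v * A v u)))"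
  proof -
    have e: "A u v * (k * (2 * kernel_comp \<mu> (kernel_comp \<mu> cov A) m u v)) =
      2 * k * (kernel_comp \<mu> (kernel_comp \<mu> cov A) m u v * A v u)" for u v
      using sym[of u v] by simp
    show ?thesis by (simp only: e)
  qed
  also have "... = 2 * k * trace_pair \<mu> (kernel_comp \<mu> (kernel_comp \<mu> cov A) m) A"
    by (simp add: trace_pair_def)
  also have "trace_pair \<mu> (kernel_comp \<mu> (kernel_comp \<mu> cov A) m) A = trace_pair \<mu> A (kernel_comp \<mu> (kernel_comp \<mu> cov A) m)"
    by (intro index.trace_pair_commute index.bounded_kernel_compose bounded_kernel_cov A m)
  also have "... = trace_pair \<mu> (kernel_comp \<mu> A (kernel_comp \<mu> cov A)) m"
    by (intro index.trace_pair_compose index.bounded_kernel_compose bounded_kernel_cov A m)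
  also have "kernel_comp \<mu> A (kernel_comp \<mu> cov A) = chain A"
    unfolding chain_def by (intro ext index.compose_assoc[symmetric]) (auto intro: bounded_kernel_cov A)
  also have "trace_pair \<mu> (chain A) m = trace_pair \<mu> (chain A) cov * expectation P + expectation (\<lambda>w. quad (chain A) w * P w)"
  proof -
    note B = bounded_kernel_chain[OF A]
    note k1 = index.bounded_kernel_mult[OF B m]
    note k2 = index.bounded_kernel_mult[OF B bounded_kernel_cov]
    have "expectation (\<lambda>w. quad (chain A) w * P w) =
      (LINT u|\<mu>. (LINT v|\<mu>. chain A u v * (m u v - cov u v * expectation P)))"
      unfolding m_def by (rule expectation_quad_mult[OF B P])
    also have "... = (LINT u|\<mu>. (LINT v|\<mu>. chain A u v * m u v) - (LINT v|\<mu>. chain A u v * cov u v) * expectation P)"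
    proof (rule Bochner_Integration.integral_cong[OF refl])
      fix u
      have "(LINT v|\<mu>. chain A u v * (m u v - cov u v * expectation P)) =
          (LINT v|\<mu>. chain A u v * m u v - chain A u v * cov u v * expectation P)"
        by (rule Bochner_Integration.integral_cong) (auto simp: right_diff_distrib)
      also have "... = (LINT v|\<mu>. chain A u v * m u v) - (LINT v|\<mu>. chain A u v * cov u v) * expectation P"
        using index.bounded_kernel_section(1)[OF k1, of u] index.bounded_kernel_section(1)[OF k2, of u]
        by (subst Bochner_Integration.integral_diff) auto
      finally show "(LINT v|\<mu>. chain A u v * (m u v - cov u v * expectation P)) =
        (LINT v|\<mu>. chain A u v * m u v) - (LINT v|\<mu>. chain A u v * cov u v) * expectation P" .
    qed
    also have "... = (LINT u|\<mu>. (LINT v|\<mu>. chain A u v * m u v)) - (LINT u|\<mu>. (LINT v|\<mu>. chain A u v * cov u v)) * expectation P"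
      using index.bounded_kernel_integral[OF k1] index.bounded_kernel_integral[OF k2]
      by (subst Bochner_Integration.integral_diff) auto
    also have "... = trace_pair \<mu> (chain A) m - trace_pair \<mu> (chain A) cov * expectation P"
      unfolding trace_pair_def by (simp add: m_sym cov_commute)
    finally show ?thesis by simp
  qed
  also note trace_pair_chain[OF A]
  finally show ?thesis by (simp add: P_def[abs_def])
qed

lemma expectation_quad: "bounded_kernel \<mu> A ==> expectation (quad A) = 0"
proof -
  assume A: "bounded_kernel \<mu> A"
  have "expectation (\<lambda>w. quad A w * 1) =
    (LINT u|\<mu>. (LINT v|\<mu>. A u v * (expectation (\<lambda>w. X u w * X v w * 1) - cov u v * expectation (\<lambda>_. 1))))"
    by (rule expectation_quad_mult[OF A all_moments_const])
  also have "... = (LINT u|\<mu>. (LINT v|\<mu>. A u v * (cov u v - cov u v * 1)))"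
    by (simp only: mult_1_right prob_space lebesgue_integral_const cov_def[symmetric]) (simp add: prob_space)
  finally show ?thesis by simp
qed

lemma quad_variance:
  assumes A: "bounded_kernel \<mu> A" and sym: "\<And>u v. A u v = A v u"
  shows "expectation (\<lambda>w. quad A w ^ 2) = 2 * trace_pair \<mu> (kernel_comp \<mu> A cov) (kernel_comp \<mu> A cov)"
proof -
  have "expectation (\<lambda>w. quad A w ^ Suc 1) =
    2 * real 1 * (trace_pair \<mu> (kernel_comp \<mu> A cov) (kernel_comp \<mu> A cov) * expectation (\<lambda>w. quad A w ^ (1 - 1))
             + expectation (\<lambda>w. quad (chain A) w * quad A w ^ (1 - 1)))"
    by (rule quad_moment_recursion[OF A sym])
  then show ?thesis using expectation_quad[OF bounded_kernel_chain[OF A]]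
    by (simp add: prob_space Suc_1[symmetric] del: Suc_1)
qed

text \<open>The inequality between the arithmetic and geometric mean, arranged so that half of the highest power can be
absorbed.\<close>
lemma weighted_power_le:
  fixes K G y :: real
  assumes "0 \<le> K" "0 \<le> y" "0 < m"
  shows "K * G * y ^ (m - 1) \<le> y ^ m / 2 + (2 * K * \<bar>G\<bar>) ^ m / 2"
proof -
  obtain n where n: "m = Suc n" using assms(3) gr0_implies_Suc by blast
  have "K * G * y ^ n \<le> K * \<bar>G\<bar> * y ^ n" using assms by (intro mult_right_mono mult_left_mono) auto
  also have "... \<le> y ^ m / 2 + (2 * K * \<bar>G\<bar>) ^ m / 2"
  proof (cases "2 * (K * \<bar>G\<bar>) \<le> y")
    case True
    then have "K * \<bar>G\<bar> * y ^ n \<le> y / 2 * y ^ n" using assms by (intro mult_right_mono) auto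
    then show ?thesis using assms by (simp add: n add_increasing2)
  next
    case False
    then have "y ^ n \<le> (2 * K * \<bar>G\<bar>) ^ n" using assms by (intro power_mono) auto
    then have "K * \<bar>G\<bar> * y ^ n \<le> K * \<bar>G\<bar> * (2 * K * \<bar>G\<bar>) ^ n" using assms by (intro mult_left_mono) auto
    also have "... = (2 * K * \<bar>G\<bar>) ^ m / 2" by (simp add: n)
    finally show ?thesis using assms by (simp add: add_increasing)
  qed
  finally show ?thesis by (simp add: n)
qed

text \<open>With \<open>m = 2 ^ Suc j\<close>, the recursion bounds the moment of order \<open>2 * m\<close> by a moment of \<open>G * (quad A)\<^sup>2 ^ (m - 1)\<close>, where
\<open>G\<close> is the trace plus the quadratic form of \<open>chain A\<close>. Half of the highest moment is
absorbed, and the moment of order \<open>m\<close> of \<open>G\<close> is covered by the induction hypothesis, since the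
Hilbert-Schmidt norm is submultiplicative.\<close>
theorem quad_moment_bound:
  assumes A: "bounded_kernel \<mu> A" and sym: "\<And>u v. A u v = A v u"
  shows "expectation (\<lambda>w. quad A w ^ 2 ^ Suc j) \<le> moment_const j * norm2 \<mu> (kernel_comp \<mu> A cov) ^ 2 ^ j"
  using A sym
proof (induction j arbitrary: A)
  case 0
  have "trace_pair \<mu> (kernel_comp \<mu> A cov) (kernel_comp \<mu> A cov) \<le> norm2 \<mu> (kernel_comp \<mu> A cov)"
    using index.trace_pair_le_norm2[OF index.bounded_kernel_compose[OF 0(1) bounded_kernel_cov]] by linarith
  then show ?case using quad_variance[OF 0] by simp
next
  case (Suc j)
  define m where "m = (2::nat) ^ Suc j"
  define K where "K = 2 * real (2 * m - 1)"
  define h where "h = norm2 \<mu> (kernel_comp \<mu> A cov)"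
  define tr where "tr = trace_pair \<mu> (kernel_comp \<mu> A cov) (kernel_comp \<mu> A cov)"
  define G where "G w = tr + quad (chain A) w" for w
  have m: "0 < m" "even m" by (auto simp: m_def)
  have K: "0 \<le> K" unfolding K_def by (intro mult_nonneg_nonneg of_nat_0_le_iff zero_le_numeral)
  have h: "0 \<le> h" by (simp add: h_def norm2_nonneg)
  have tr: "\<bar>tr\<bar> \<le> h" unfolding tr_def h_def
    using index.trace_pair_le_norm2[OF index.bounded_kernel_compose[OF Suc(2) bounded_kernel_cov]] .
  note am = all_moments_intros all_moments_quad bounded_kernel_chain Suc(2)
  have aG: "all_moments M G" unfolding G_def by (intro am)
  have B: "expectation (\<lambda>w. quad (chain A) w ^ m) \<le> moment_const j * h ^ m"
  proof -
    have "expectation (\<lambda>w. quad (chain A) w ^ 2 ^ Suc j) \<le> moment_const j * norm2 \<mu> (kernel_comp \<mu> (chain A) cov) ^ 2 ^ j"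
      by (rule Suc.IH[OF bounded_kernel_chain[OF Suc(2)] chain_sym[OF Suc(2,3)]])
    also have "... \<le> moment_const j * (h * h) ^ 2 ^ j"
    proof (intro mult_left_mono power_mono norm2_nonneg moment_const_nonneg)
      show "norm2 \<mu> (kernel_comp \<mu> (chain A) cov) \<le> h * h" unfolding h_def compose_chain_cov[OF Suc(2)]
        by (intro index.norm2_compose_le index.bounded_kernel_compose bounded_kernel_cov Suc)
    qed
    also have "(h * h) ^ 2 ^ j = h ^ m" by (simp add: m_def power_mult power2_eq_square)
    finally show ?thesis by (simp add: m_def)
  qed
  have G: "expectation (\<lambda>w. \<bar>G w\<bar> ^ m) \<le> 2 ^ m * (h ^ m + moment_const j * h ^ m)"
  proof -
    have "expectation (\<lambda>w. \<bar>G w\<bar> ^ m) \<le> expectation (\<lambda>w. 2 ^ m * (h ^ m + quad (chain A) w ^ m))"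
    proof (rule integral_mono)
      show "integrable M (\<lambda>w. \<bar>G w\<bar> ^ m)" using all_moments_integrable_power[OF aG, of m] m
        by (simp add: power_even_abs)
      show "integrable M (\<lambda>w. 2 ^ m * (h ^ m + quad (chain A) w ^ m))"
        by (intro all_moments_integrable am)
      fix w
      have "\<bar>G w\<bar> ^ m \<le> 2 ^ m * (\<bar>tr\<bar> ^ m + \<bar>quad (chain A) w\<bar> ^ m)" unfolding G_def by (rule abs_add_power_le)
      also have "... \<le> 2 ^ m * (h ^ m + quad (chain A) w ^ m)"
      proof -
        have "\<bar>tr\<bar> ^ m \<le> h ^ m" using tr by (intro power_mono) auto
        moreover have "\<bar>quad (chain A) w\<bar> ^ m = quad (chain A) w ^ m" using m by (simp add: power_even_abs)
        ultimately show ?thesis by simp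
      qed
      finally show "\<bar>G w\<bar> ^ m \<le> 2 ^ m * (h ^ m + quad (chain A) w ^ m)" .
    qed
    also have "... = 2 ^ m * (h ^ m + expectation (\<lambda>w. quad (chain A) w ^ m))"
      by (subst integral_mult_right_zero, subst Bochner_Integration.integral_add)
         (auto intro!: all_moments_integrable am simp: prob_space)
    also have "... \<le> 2 ^ m * (h ^ m + moment_const j * h ^ m)" using B by simp
    finally show ?thesis .
  qed
  have E: "expectation (\<lambda>w. quad A w ^ (2 * m)) = expectation (\<lambda>w. K * G w * quad A w ^ (2 * m - 2))"
  proof -
    have "expectation (\<lambda>w. quad A w ^ (2 * m)) = expectation (\<lambda>w. quad A w ^ Suc (2 * m - 1))" using m by simp
    also have "... = K * (tr * expectation (\<lambda>w. quad A w ^ (2 * m - 2)) + expectation (\<lambda>w. quad (chain A) w * quad A w ^ (2 * m - 2)))"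
      unfolding quad_moment_recursion[OF Suc(2,3)] K_def tr_def by (simp add: numeral_2_eq_2)
    also have "... = expectation (\<lambda>w. K * (tr * quad A w ^ (2 * m - 2) + quad (chain A) w * quad A w ^ (2 * m - 2)))"
      by (subst integral_mult_right_zero, subst Bochner_Integration.integral_add)
         (auto intro!: all_moments_integrable am)
    finally show ?thesis by (simp add: G_def algebra_simps)
  qed
  also have "... \<le> expectation (\<lambda>w. quad A w ^ (2 * m) / 2 + (2 * K) ^ m / 2 * \<bar>G w\<bar> ^ m)"
  proof (rule integral_mono)
    show "integrable M (\<lambda>w. K * G w * quad A w ^ (2 * m - 2))"
      by (intro all_moments_integrable am aG)
    have "integrable M (\<lambda>w. (1/2) * quad A w ^ (2 * m) + (2 * K) ^ m / 2 * G w ^ m)"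
      by (intro all_moments_integrable am aG)
    then show "integrable M (\<lambda>w. quad A w ^ (2 * m) / 2 + (2 * K) ^ m / 2 * \<bar>G w\<bar> ^ m)"
      using m by (simp add: power_even_abs)
    fix w
    have "K * G w * ((quad A w)^2) ^ (m - 1) \<le> ((quad A w)^2) ^ m / 2 + (2 * K * \<bar>G w\<bar>) ^ m / 2"
      by (rule weighted_power_le) (auto simp: K m)
    then show "K * G w * quad A w ^ (2 * m - 2) \<le> quad A w ^ (2 * m) / 2 + (2 * K) ^ m / 2 * \<bar>G w\<bar> ^ m"
      by (simp add: power_mult[symmetric] power_mult_distrib right_diff_distrib')
  qed
  also have "... = expectation (\<lambda>w. quad A w ^ (2 * m)) / 2 + (2 * K) ^ m / 2 * expectation (\<lambda>w. \<bar>G w\<bar> ^ m)"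
  proof -
    have "integrable M (\<lambda>w. quad A w ^ (2 * m))" "integrable M (\<lambda>w. G w ^ m)"
      by (intro all_moments_integrable am aG)+
    then show ?thesis using m by (simp add: power_even_abs)
  qed
  finally have "expectation (\<lambda>w. quad A w ^ (2 * m)) \<le> (2 * K) ^ m * expectation (\<lambda>w. \<bar>G w\<bar> ^ m)" by simp
  also have "... \<le> (2 * K) ^ m * (2 ^ m * (h ^ m + moment_const j * h ^ m))"
    using G K by (intro mult_left_mono) auto
  also have "... = (2 * K * 2) ^ m * (1 + moment_const j) * h ^ m"
    unfolding power_mult_distrib[of "2 * K" 2] by (simp only: distrib_left distrib_right mult_1 mult_ac)
  also have "2 * K * 2 = 4 * (4 * 2 ^ Suc j - 2)"
  proof -
    have "1 \<le> 2 * m" using m by simp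
    then have "K = 2 * (2 * real m - 1)" unfolding K_def by (subst of_nat_diff) auto
    then show ?thesis by (simp add: m_def)
  qed
  finally show ?case by (simp add: m_def h_def)
qed

end

section \<open>Central limit theorem for quadratic forms\<close>

lemma gaussian_moment_even: "gaussian_moment v (2 * j) / fact (2 * j) = (v / 2) ^ j / fact j"
proof (induction j)
  case (Suc j)
  have "gaussian_moment v (2 * Suc j) / fact (2 * Suc j) =
     (real (2 * j + 1) * v * gaussian_moment v (2 * j)) / (real (2 * j + 2) * real (2 * j + 1) * fact (2 * j))"
    by (simp add: field_simps)
  also have "... = v / real (2 * j + 2) * (gaussian_moment v (2 * j) / fact (2 * j))"
    by (simp add: divide_simps)
  also have "... = (v / 2) ^ Suc j / fact (Suc j)"
    unfolding Suc by (simp add: field_simps)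
  finally show ?case .
qed simp

lemma gaussian_moment_odd: "gaussian_moment v (Suc (2 * j)) = 0"
  by (induction j) auto

lemma gaussian_moment_char_sum:
  "(\<Sum>k\<le>2 * J. (\<i> * complex_of_real 1) ^ k / fact k * complex_of_real (gaussian_moment v k)) =
   complex_of_real (\<Sum>j\<le>J. (- v / 2) ^ j / fact j)"
proof (induction J)
  case (Suc J)
  have "(\<i> * complex_of_real 1) ^ (2 * Suc J) / fact (2 * Suc J) * complex_of_real (gaussian_moment v (2 * Suc J))
      = (-1) ^ Suc J * complex_of_real (gaussian_moment v (2 * Suc J) / fact (2 * Suc J))"
    by (simp only: power_mult power2_i of_real_1 mult_1_right of_real_divide of_real_fact) simp
  also have "... = complex_of_real ((- v / 2) ^ Suc J / fact (Suc J))"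
    unfolding gaussian_moment_even by (simp add: power_minus[of "v/2"] power_divide)
  finally have e: "(\<i> * complex_of_real 1) ^ (2 * Suc J) / fact (2 * Suc J) * complex_of_real (gaussian_moment v (2 * Suc J))
     = complex_of_real ((- v / 2) ^ Suc J / fact (Suc J))" .
  have "{..2 * Suc J} = insert (2 * Suc J) (insert (Suc (2 * J)) {..2 * J})" by auto
  then have "(\<Sum>k\<le>2 * Suc J. (\<i> * complex_of_real 1) ^ k / fact k * complex_of_real (gaussian_moment v k)) =
     (\<i> * complex_of_real 1) ^ (2 * Suc J) / fact (2 * Suc J) * complex_of_real (gaussian_moment v (2 * Suc J)) +
     (\<Sum>k\<le>2 * J. (\<i> * complex_of_real 1) ^ k / fact k * complex_of_real (gaussian_moment v k))"
    using gaussian_moment_odd[of v J] by (simp del: gaussian_moment.simps)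
  then show ?case unfolding e Suc by simp
qed simp

text \<open>The method of moments for a normal limit. The error of a Taylor polynomial of the exponential is controlled by an even
moment divided by a factorial, and for the normal moments this quotient tends to zero as the degree increases.\<close>
lemma (in prob_space) char_limit_of_moments:
  assumes mom: "\<And>n. all_moments M (Y n)" and v: "0 \<le> v"
    and lim: "\<And>k. (\<lambda>n. expectation (\<lambda>w. Y n w ^ k)) \<longlonglongrightarrow> gaussian_moment v k"
  shows "(\<lambda>n. expectation (\<lambda>w. iexp (Y n w))) \<longlonglongrightarrow> complex_of_real (exp (- v / 2))"
proof (rule LIMSEQ_I)
  fix \<epsilon> :: real assume "0 < \<epsilon>"
  have scaled: "x ^ n /\<^sub>R fact n = x ^ n / fact n" for x :: real and n
    by (simp add: field_simps)
  have s: "(\<lambda>J. \<Sum>j\<le>J. (- v / 2) ^ j / fact j) \<longlonglongrightarrow> exp (- v / 2)"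
    using exp_converges[of "- v / 2"] unfolding scaled sums_def_le .
  have t: "(\<lambda>J. (v / 2) ^ J / fact J) \<longlonglongrightarrow> 0"
    using summable_LIMSEQ_zero[OF sums_summable[OF exp_converges[of "v / 2"]]] unfolding scaled .
  from LIMSEQ_D[OF s, of "\<epsilon>/4"] \<open>0 < \<epsilon>\<close> obtain J1 where
    J1: "\<And>J. J \<ge> J1 ==> \<bar>(\<Sum>j\<le>J. (- v / 2) ^ j / fact j) - exp (- v / 2)\<bar> < \<epsilon>/4" by auto
  from LIMSEQ_D[OF t, of "\<epsilon>/16"] \<open>0 < \<epsilon>\<close> obtain J2 where
    J2: "\<And>J. J \<ge> J2 ==> \<bar>(v / 2) ^ J / fact J\<bar> < \<epsilon>/16" by auto
  define J where "J = max J1 J2"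
  define S where "S n = (\<Sum>k\<le>2 * J. (\<i> * complex_of_real 1) ^ k / fact k * complex_of_real (expectation (\<lambda>w. Y n w ^ k)))" for n
  have Slim: "S \<longlonglongrightarrow> complex_of_real (\<Sum>j\<le>J. (- v / 2) ^ j / fact j)"
    unfolding S_def gaussian_moment_char_sum[symmetric]
    by (intro tendsto_sum tendsto_mult tendsto_const tendsto_of_real lim)
  have approx: "cmod (expectation (\<lambda>w. iexp (Y n w)) - S n) \<le> 2 / fact (2 * J) * expectation (\<lambda>w. Y n w ^ (2 * J))" for n
  proof -
    have [measurable]: "Y n \<in> borel_measurable M" using mom by (rule all_moments_measurable)
    have "cmod (char (distr M borel (Y n)) 1 - S n) \<le> 2 * \<bar>1\<bar> ^ (2 * J) / fact (2 * J) * expectation (\<lambda>w. \<bar>Y n w\<bar> ^ (2 * J))"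
      unfolding S_def
      by (rule char_approx1') (auto intro: all_moments_integrable_power mom)
    moreover have "char (distr M borel (Y n)) 1 = expectation (\<lambda>w. iexp (Y n w))"
      unfolding char_def by (subst integral_distr) auto
    ultimately show ?thesis by (simp add: power_even_abs)
  qed
  have "(\<lambda>n. 2 / fact (2 * J) * expectation (\<lambda>w. Y n w ^ (2 * J))) \<longlonglongrightarrow> 2 / fact (2 * J) * gaussian_moment v (2 * J)"
    by (intro tendsto_intros lim)
  also have "2 / fact (2 * J) * gaussian_moment v (2 * J) = 2 * ((v / 2) ^ J / fact J)"
    unfolding gaussian_moment_even[symmetric] by simp
  finally have lim2: "(\<lambda>n. 2 / fact (2 * J) * expectation (\<lambda>w. Y n w ^ (2 * J))) \<longlonglongrightarrow> 2 * ((v / 2) ^ J / fact J)" .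
  have "\<bar>(v / 2) ^ J / fact J\<bar> < \<epsilon> / 16" by (rule J2) (simp add: J_def)
  then have "2 * ((v / 2) ^ J / fact J) < \<epsilon> / 4" using \<open>0 < \<epsilon>\<close> by linarith
  from order_tendstoD(2)[OF lim2 this]
  obtain N1 where N1: "\<And>n. n \<ge> N1 ==> 2 / fact (2 * J) * expectation (\<lambda>w. Y n w ^ (2 * J)) < \<epsilon> / 4"
    unfolding eventually_sequentially by blast
  from LIMSEQ_D[OF Slim, of "\<epsilon>/4"] \<open>0 < \<epsilon>\<close> obtain N2 where
    N2: "\<And>n. n \<ge> N2 ==> cmod (S n - complex_of_real (\<Sum>j\<le>J. (- v / 2) ^ j / fact j)) < \<epsilon>/4" by auto
  have "cmod (expectation (\<lambda>w. iexp (Y n w)) - complex_of_real (exp (- v / 2))) < \<epsilon>" if n: "n \<ge> max N1 N2" for n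
  proof -
    let ?s = "\<Sum>j\<le>J. (- v / 2) ^ j / fact j"
    have "cmod (complex_of_real ?s - complex_of_real (exp (- v / 2))) < \<epsilon> / 4"
      using J1[of J] unfolding of_real_diff[symmetric] norm_of_real by (simp add: J_def)
    moreover have "cmod (expectation (\<lambda>w. iexp (Y n w)) - complex_of_real (exp (- v / 2))) \<le>
      cmod (expectation (\<lambda>w. iexp (Y n w)) - S n) + cmod (S n - complex_of_real ?s) + cmod (complex_of_real ?s - complex_of_real (exp (- v / 2)))"
      by norm
    moreover have "n \<ge> N1" "n \<ge> N2" using n by auto
    ultimately show ?thesis using approx[of n] N1[of n] N2[of n] \<open>0 < \<epsilon>\<close> by linarith
  qed
  then show "\<exists>no. \<forall>n\<ge>no. cmod (expectation (\<lambda>w. iexp (Y n w)) - complex_of_real (exp (- v / 2))) < \<epsilon>" by blast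
qed

lemma (in prob_space) expectation_mult_le:
  assumes "all_moments M Y" "all_moments M Z"
  shows "\<bar>expectation (\<lambda>w. Y w * Z w)\<bar> \<le> sqrt (expectation (\<lambda>w. Y w ^ 2)) * sqrt (expectation (\<lambda>w. Z w ^ 2))"
proof -
  have "(expectation (\<lambda>w. Y w * Z w))^2 \<le> expectation (\<lambda>w. (Y w)^2) * expectation (\<lambda>w. (Z w)^2)"
    by (intro Cauchy_Schwarz_integral all_moments_integrable all_moments_intros assms)
  then show ?thesis by (metis real_le_rsqrt real_sqrt_abs real_sqrt_le_iff real_sqrt_mult)
qed

text \<open>In the moment recursion the mixed moment is at most the \<open>L\<^sup>2\<close> norm of the quadratic form of the chained kernel times a
bounded moment, hence negligible. The recursion that remains is that of the normal moments with variance \<open>v\<close>.\<close>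
theorem quad_central_limit:
  assumes field: "\<And>n. gaussian_field M (\<mu> n) X"
    and A: "\<And>n. bounded_kernel (\<mu> n) (A n)" and sym: "\<And>n u v. A n u v = A n v u"
    and K: "\<And>n. K n = kernel_comp (\<mu> n) (A n) (gaussian_field.cov M X)"
    and bound: "\<And>n. norm2 (\<mu> n) (K n) \<le> C"
    and variance: "(\<lambda>n. 2 * trace_pair (\<mu> n) (K n) (K n)) \<longlonglongrightarrow> v"
    and square: "(\<lambda>n. norm2 (\<mu> n) (kernel_comp (\<mu> n) (K n) (K n))) \<longlonglongrightarrow> 0"
  shows "(\<lambda>n. LINT w|M. iexp (gaussian_field.quad M (\<mu> n) X (A n) w)) \<longlonglongrightarrow> complex_of_real (exp (- v / 2))"
proof -
  interpret M: prob_space M using field[of 0] by (rule gaussian_field.axioms)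
  define Y where "Y n = gaussian_field.quad M (\<mu> n) X (A n)" for n
  define G where "G n = gaussian_field.quad M (\<mu> n) X (gaussian_field.chain M (\<mu> n) X (A n))" for n
  define tr where "tr n = trace_pair (\<mu> n) (K n) (K n)" for n
  have cov: "gaussian_field.cov M X = gaussian_field.cov M X" ..
  have Ym: "all_moments M (Y n)" for n
    unfolding Y_def using gaussian_field.all_moments_quad[OF field A] .
  have Gm: "all_moments M (G n)" for n
    unfolding G_def using gaussian_field.all_moments_quad[OF field gaussian_field.bounded_kernel_chain[OF field A]] .
  have C: "0 \<le> C" using bound[of 0] norm2_nonneg[of "\<mu> 0" "K 0"] by linarith
  have Gvar: "M.expectation (\<lambda>w. G n w ^ 2) \<le> 2 * norm2 (\<mu> n) (kernel_comp (\<mu> n) (K n) (K n))" for n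
  proof -
    interpret gaussian_field M "\<mu> n" X by (rule field)
    have B: "bounded_kernel (\<mu> n) (chain (A n))" by (rule bounded_kernel_chain[OF A])
    have "M.expectation (\<lambda>w. G n w ^ 2) =
      2 * trace_pair (\<mu> n) (kernel_comp (\<mu> n) (chain (A n)) cov) (kernel_comp (\<mu> n) (chain (A n)) cov)"
      unfolding G_def by (rule quad_variance[OF B chain_sym[OF A sym]])
    also have "... \<le> 2 * norm2 (\<mu> n) (kernel_comp (\<mu> n) (chain (A n)) cov)"
      using index.trace_pair_le_norm2[OF index.bounded_kernel_compose[OF B bounded_kernel_cov]] by simp
    also have "kernel_comp (\<mu> n) (chain (A n)) cov = kernel_comp (\<mu> n) (K n) (K n)"
      unfolding K by (rule compose_chain_cov[OF A])
    finally show ?thesis .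
  qed
  have ybound: "M.expectation (\<lambda>w. Y n w ^ 2 ^ Suc j) \<le> moment_const j * C ^ 2 ^ j" for n j
  proof -
    interpret gaussian_field M "\<mu> n" X by (rule field)
    have "M.expectation (\<lambda>w. Y n w ^ 2 ^ Suc j) \<le> moment_const j * norm2 (\<mu> n) (K n) ^ 2 ^ j"
      unfolding Y_def K by (rule quad_moment_bound[OF A sym])
    also have "... \<le> moment_const j * C ^ 2 ^ j"
      by (intro mult_left_mono power_mono bound norm2_nonneg moment_const_nonneg)
    finally show ?thesis .
  qed
  have ybound2: "\<exists>c. \<forall>n. M.expectation (\<lambda>w. Y n w ^ (2 * k)) \<le> c" for k
  proof -
    define j where "j = 2 * k"
    have j: "2 * k \<le> 2 ^ Suc j"
    proof -
      have "2 * k < 2 ^ j" unfolding j_def by (rule less_exp)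
      then show ?thesis unfolding power_Suc by linarith
    qed
    have "M.expectation (\<lambda>w. Y n w ^ (2 * k)) \<le> 1 + moment_const j * C ^ 2 ^ j" for n
    proof -
      have "M.expectation (\<lambda>w. Y n w ^ (2 * k)) \<le> M.expectation (\<lambda>w. 1 + Y n w ^ 2 ^ Suc j)"
      proof (rule integral_mono)
        show "integrable M (\<lambda>w. Y n w ^ (2 * k))" "integrable M (\<lambda>w. 1 + Y n w ^ 2 ^ Suc j)"
          by (intro all_moments_integrable M.all_moments_intros Ym)+
        fix w
        have "\<bar>Y n w\<bar> ^ (2 * k) \<le> 1 + \<bar>Y n w\<bar> ^ 2 ^ Suc j"
        proof (cases "\<bar>Y n w\<bar> \<le> 1")
          case True then show ?thesis by (meson abs_ge_zero add_increasing2 power_le_one zero_le_power)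
        next
          case False
          then have "1 \<le> \<bar>Y n w\<bar>" by simp
          from power_increasing[OF j this] show ?thesis by linarith
        qed
        then show "Y n w ^ (2 * k) \<le> 1 + Y n w ^ 2 ^ Suc j" by (simp add: power_even_abs)
      qed
      also have "... = 1 + M.expectation (\<lambda>w. Y n w ^ 2 ^ Suc j)"
        using all_moments_integrable_power[OF Ym] by (simp add: M.prob_space)
      finally show ?thesis using ybound[of n j] by simp
    qed
    then show ?thesis by blast
  qed
  have v: "0 \<le> v"
  proof (rule LIMSEQ_le_const[OF variance], intro exI allI impI)
    fix n
    have "0 \<le> M.expectation (\<lambda>w. Y n w ^ 2)" by simp
    also have "... = 2 * trace_pair (\<mu> n) (K n) (K n)"
      unfolding Y_def K by (rule gaussian_field.quad_variance[OF field A sym])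
    finally show "0 \<le> 2 * trace_pair (\<mu> n) (K n) (K n)" .
  qed
  have rec: "M.expectation (\<lambda>w. Y n w ^ Suc k) = 2 * k * (tr n * M.expectation (\<lambda>w. Y n w ^ (k - 1))
             + M.expectation (\<lambda>w. G n w * Y n w ^ (k - 1)))" for n k
    unfolding Y_def G_def tr_def K by (rule gaussian_field.quad_moment_recursion[OF field A sym])
  have cross: "(\<lambda>n. M.expectation (\<lambda>w. G n w * Y n w ^ k)) \<longlonglongrightarrow> 0" for k
  proof -
    obtain c where c: "\<And>n. M.expectation (\<lambda>w. Y n w ^ (2 * k)) \<le> c" using ybound2[of k] by blast
    have "(\<lambda>n. sqrt (2 * norm2 (\<mu> n) (kernel_comp (\<mu> n) (K n) (K n))) * sqrt c) \<longlonglongrightarrow> sqrt (2 * 0) * sqrt c"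
      by (intro tendsto_intros square)
    then have l: "(\<lambda>n. sqrt (2 * norm2 (\<mu> n) (kernel_comp (\<mu> n) (K n) (K n))) * sqrt c) \<longlonglongrightarrow> 0" by simp
    show ?thesis
    proof (rule Lim_null_comparison[OF _ l], rule always_eventually, rule allI)
      fix n
      have "\<bar>M.expectation (\<lambda>w. G n w * Y n w ^ k)\<bar> \<le>
        sqrt (M.expectation (\<lambda>w. G n w ^ 2)) * sqrt (M.expectation (\<lambda>w. (Y n w ^ k) ^ 2))"
        by (intro M.expectation_mult_le Gm M.all_moments_intros Ym)
      also have "... \<le> sqrt (2 * norm2 (\<mu> n) (kernel_comp (\<mu> n) (K n) (K n))) * sqrt c"
        using Gvar[of n] c[of n]
        by (intro mult_mono) (auto simp: power_mult[symmetric] mult.commute[of k] norm2_nonneg)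
      finally show "norm (M.expectation (\<lambda>w. G n w * Y n w ^ k)) \<le> ..." by simp
    qed
  qed
  have "(\<lambda>n. M.expectation (\<lambda>w. Y n w ^ k)) \<longlonglongrightarrow> gaussian_moment v k" for k
  proof (induction k rule: induct_nat_012)
    case 0 then show ?case by (simp add: M.prob_space)
  next
    case 1
    have "M.expectation (\<lambda>w. Y n w ^ Suc 0) = 0" for n using rec[of n 0] by simp
    then show ?case by simp
  next
    case (ge2 k)
    have "(\<lambda>n. 2 * real (Suc k) * (tr n * M.expectation (\<lambda>w. Y n w ^ k) + M.expectation (\<lambda>w. G n w * Y n w ^ k)))
      \<longlonglongrightarrow> 2 * real (Suc k) * (v / 2 * gaussian_moment v k + 0)"
    proof (intro tendsto_intros ge2 cross)
      show "tr \<longlonglongrightarrow> v / 2" using tendsto_divide[OF variance tendsto_const[of 2]] by (simp add: tr_def[abs_def])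
    qed
    also have "2 * real (Suc k) * (v / 2 * gaussian_moment v k + 0) = gaussian_moment v (Suc (Suc k))" by simp
    finally show ?case unfolding rec[of _ "Suc k"] by simp
  qed
  then show ?thesis
    using M.char_limit_of_moments[OF Ym v] by (simp add: Y_def)
qed

section \<open>Continuous paths and dyadic interpolation\<close>

lemma mspace_C01: "mspace C01 = {f. f \<in> extensional {0..1} \<and> continuous_on {0..1} f}"
proof -
  have "compact ((f :: real => real) ` {0..1})" if "continuous_on {0..1} f" for f
    using that by (rule compact_continuous_image) simp
  then show ?thesis unfolding C01_def
    by (auto simp: mspace_cfunspace compact_imp_bounded)
qed

lemma restrict_in_C01:
  assumes "continuous_on {0..1} h"
  shows "restrict h {0..1} \<in> mspace C01"
proof -
  have "continuous_on {0..1} (restrict h {0..1})"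
    by (rule continuous_on_eq[OF assms]) simp
  then show ?thesis by (simp only: mspace_C01 mem_Collect_eq restrict_extensional)
qed

lemma C01_mdist_le:
  assumes "f \<in> mspace C01" "g \<in> mspace C01"
  shows "mdist C01 f g \<le> a \<longleftrightarrow> (\<forall>t\<in>{0..1}. \<bar>f t - g t\<bar> \<le> a)"
  using assms unfolding C01_def by (subst cfunspace_mdist_le) (auto simp: dist_real_def)

definition hat :: "real => real" where "hat x = max 0 (1 - \<bar>x\<bar>)"

text \<open>At each point at most two neighbouring hats are nonzero, and their values add up to one.\<close>
lemma hat_partition_of_unity:
  assumes "0 \<le> x" "x \<le> real N" "0 < N"
  shows "(\<Sum>k\<le>N. hat (x - real k)) = 1"
proof -
  define j where "j = (if x = real N then N - 1 else nat \<lfloor>x\<rfloor>)"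
  have j: "real j \<le> x" "x \<le> real j + 1" "j < N"
    using assms unfolding j_def by (auto simp: of_nat_diff) linarith+
  have "(\<Sum>k\<le>N. hat (x - real k)) = (\<Sum>k\<in>{j, Suc j}. hat (x - real k))"
  proof (rule sum.mono_neutral_right)
    show "\<forall>k\<in>{..N} - {j, Suc j}. hat (x - real k) = 0"
    proof
      fix k assume "k \<in> {..N} - {j, Suc j}"
      then have "k < j \<or> Suc j < k" by auto
      then have "real k + 1 \<le> real j \<or> real j + 2 \<le> real k" by linarith
      then have "1 \<le> \<bar>x - real k\<bar>" using j by linarith
      then show "hat (x - real k) = 0" by (simp add: hat_def)
    qed
  qed (use j in auto)
  also have "... = 1" using j by (simp add: hat_def)
  finally show ?thesis .
qed

text \<open>The piecewise linear function with values \<open>v k\<close> at the points \<open>k / 2 ^ n\<close>.\<close>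
definition interp :: "nat => (nat => real) => real => real" where
  "interp n v = (\<lambda>t\<in>{0..1}. \<Sum>k\<le>2^n. v k * hat (2^n * t - real k))"

lemma interp_in_C01: "interp n v \<in> mspace C01"
proof -
  have "continuous_on {0..1} (\<lambda>t. \<Sum>k\<le>2^n. v k * hat (2^n * t - real k))"
    unfolding hat_def by (intro continuous_intros)
  then show ?thesis unfolding interp_def by (rule restrict_in_C01)
qed

lemma interp_mdist_le: "mdist C01 (interp n v) (interp n w) \<le> (\<Sum>k\<le>2^n. \<bar>v k - w k\<bar>)"
  unfolding C01_mdist_le[OF interp_in_C01 interp_in_C01]
proof
  fix t :: real assume t: "t \<in> {0..1}"
  have "\<bar>interp n v t - interp n w t\<bar> = \<bar>\<Sum>k\<le>2^n. (v k - w k) * hat (2^n * t - real k)\<bar>"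
    using t by (simp add: interp_def sum_subtractf[symmetric] left_diff_distrib)
  also have "... \<le> (\<Sum>k\<le>2^n. \<bar>(v k - w k) * hat (2^n * t - real k)\<bar>)" by (rule sum_abs)
  also have "... \<le> (\<Sum>k\<le>2^n. \<bar>v k - w k\<bar>)"
    by (intro sum_mono) (auto simp: abs_mult hat_def intro!: mult_left_le)
  finally show "\<bar>interp n v t - interp n w t\<bar> \<le> (\<Sum>k\<le>2^n. \<bar>v k - w k\<bar>)" .
qed

text \<open>An interpolated value is an average of the values at the neighbouring nodes.\<close>
lemma interp_error:
  assumes t: "t \<in> {0..1}" and w: "\<And>k. k \<le> 2 ^ n ==> \<bar>2 ^ n * t - real k\<bar> < 1 ==> \<bar>c - v k\<bar> \<le> w"
  shows "\<bar>c - interp n v t\<bar> \<le> w"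
proof -
  have one: "(\<Sum>k\<le>2^n. hat (2^n * t - real k)) = 1"
    using t by (intro hat_partition_of_unity) auto
  have "\<bar>c - interp n v t\<bar> = \<bar>c * (\<Sum>k\<le>2^n. hat (2^n * t - real k)) - (\<Sum>k\<le>2^n. v k * hat (2^n * t - real k))\<bar>"
    using t by (simp add: one interp_def)
  also have "... = \<bar>\<Sum>k\<le>2^n. (c - v k) * hat (2^n * t - real k)\<bar>"
    by (simp add: sum_distrib_left sum_subtractf[symmetric] left_diff_distrib)
  also have "... \<le> (\<Sum>k\<le>2^n. \<bar>(c - v k) * hat (2^n * t - real k)\<bar>)" by (rule sum_abs)
  also have "... \<le> (\<Sum>k\<le>2^n. w * hat (2^n * t - real k))"
  proof (rule sum_mono)
    fix k assume k: "k \<in> {..(2::nat)^n}"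
    show "\<bar>(c - v k) * hat (2^n * t - real k)\<bar> \<le> w * hat (2^n * t - real k)"
    proof (cases "\<bar>2 ^ n * t - real k\<bar> < 1")
      case True
      then show ?thesis using w[of k] k by (auto simp: abs_mult hat_def intro!: mult_right_mono)
    qed (simp add: hat_def)
  qed
  also have "... = w" using one by (simp add: sum_distrib_left[symmetric])
  finally show ?thesis .
qed

lemma open_interp_vimage:
  assumes U: "openin (mtopology_of C01) U"
  shows "open (interp n -` U)"
proof (rule Topological_Spaces.openI)
  fix v assume "v \<in> interp n -` U"
  then have "interp n v \<in> U" by simp
  then obtain r where r: "0 < r" "mball_of C01 (interp n v) r \<subseteq> U"
    using U by (metis Metric_space.openin_mtopology Metric_space_mspace_mdist mball_of_def mtopology_of_def)
  define W where "W = {w::nat=>real. (\<Sum>k\<le>2^n. \<bar>v k - w k\<bar>) < r}"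
  have "open W" unfolding W_def
    by (intro open_Collect_less continuous_intros continuous_on_product_coordinates)
  moreover have "v \<in> W" using r by (simp add: W_def)
  moreover have "W \<subseteq> interp n -` U"
  proof
    fix w assume "w \<in> W"
    then have "mdist C01 (interp n v) (interp n w) < r"
      using interp_mdist_le[of n v w] by (simp add: W_def)
    then show "w \<in> interp n -` U" using r interp_in_C01
      by (auto simp: mball_of_def Metric_space.in_mball[OF Metric_space_mspace_mdist])
  qed
  ultimately show "\<exists>T. open T \<and> v \<in> T \<and> T \<subseteq> interp n -` U" by blast
qed

lemma dyadic_unit: "k \<le> 2 ^ n ==> real k / 2 ^ n \<in> {0..1}"
proof -
  assume "k \<le> 2 ^ n"
  then have "real k \<le> 2 ^ n" by (metis of_nat_le_iff of_nat_numeral of_nat_power)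
  then show "real k / 2 ^ n \<in> {0..1}" by simp
qed

lemma continuous_interp_tendsto:
  assumes y: "continuous_on {0..1} y" "y' \<in> mspace C01" "\<And>t. t \<in> {0..1} ==> y' t = y t" and e: "0 < e"
  shows "\<forall>\<^sub>F n in sequentially. mdist C01 y' (interp n (\<lambda>k. y (real k / 2^n))) \<le> e"
proof -
  have "uniformly_continuous_on {0..1} y" using y(1) by (rule compact_uniformly_continuous) simp
  then obtain d where d: "0 < d" "\<And>s t. s \<in> {0..1} ==> t \<in> {0..1} ==> \<bar>s - t\<bar> < d ==> \<bar>y s - y t\<bar> < e"
    using e unfolding uniformly_continuous_on_def dist_real_def by metis
  have "(\<lambda>n. (1/2::real) ^ n) \<longlonglongrightarrow> 0" by (rule LIMSEQ_realpow_zero) auto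
  then have "\<forall>\<^sub>F n in sequentially. (1/2) ^ n < d" using d(1) by (rule order_tendstoD)
  then show ?thesis
  proof eventually_elim
    case (elim n)
    show ?case unfolding C01_mdist_le[OF y(2) interp_in_C01]
    proof
      fix t :: real assume t: "t \<in> {0..1}"
      show "\<bar>y' t - interp n (\<lambda>k. y (real k / 2 ^ n)) t\<bar> \<le> e" unfolding y(3)[OF t]
      proof (rule interp_error[OF t])
        fix k :: nat assume k: "k \<le> 2 ^ n" "\<bar>2 ^ n * t - real k\<bar> < 1"
        have "\<bar>t - real k / 2 ^ n\<bar> = \<bar>2 ^ n * t - real k\<bar> / 2 ^ n"
        proof -
          have "t - real k / 2 ^ n = (2 ^ n * t - real k) / 2 ^ n" by (simp add: field_simps)
          then show ?thesis by (simp add: abs_divide)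
        qed
        also have "... < 1 / 2 ^ n" using k by (intro divide_strict_right_mono) auto
        also have "... < d" using elim by (simp add: power_divide)
        finally have "\<bar>t - real k / 2 ^ n\<bar> < d" .
        moreover have "real k / 2 ^ n \<in> {0..1}" using dyadic_unit[OF k(1)] .
        ultimately show "\<bar>y t - y (real k / 2 ^ n)\<bar> \<le> e" using d(2)[OF t] by (simp add: less_imp_le)
      qed
    qed
  qed
qed

locale C01_process =
  fixes M :: "'a measure" and Y :: "real => 'a => real"
  assumes measurable_Y: "\<And>t. t \<in> {0..1} ==> Y t \<in> borel_measurable M"
    and continuous_Y: "\<And>w. w \<in> space M ==> continuous_on {0..1} (\<lambda>t. Y t w)"
begin

definition skeleton :: "nat => 'a => nat => real" where
  "skeleton n w k = (if k \<le> 2 ^ n then Y (real k / 2 ^ n) w else 0)"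

lemma measurable_skeleton_coordinate [measurable]: "(\<lambda>w. skeleton n w k) \<in> borel_measurable M"
  unfolding skeleton_def using measurable_Y[OF dyadic_unit] by (cases "k \<le> 2 ^ n") simp_all

lemma measurable_skeleton [measurable]: "skeleton n \<in> borel_measurable M"
  by (rule measurable_coordinatewise_then_product) measurable

lemma interp_skeleton: "interp n (skeleton n w) = interp n (\<lambda>k. Y (real k / 2 ^ n) w)"
  unfolding interp_def skeleton_def by (intro restrict_ext sum.cong) auto

lemma path_in_C01: "w \<in> space M ==> path01 Y w \<in> mspace C01"
  unfolding path01_def by (intro restrict_in_C01 continuous_Y)

lemma path_interp_tendsto:
  assumes "w \<in> space M" "0 < e"
  shows "\<forall>\<^sub>F n in sequentially. mdist C01 (path01 Y w) (interp n (skeleton n w)) \<le> e"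
  unfolding interp_skeleton
  by (rule continuous_interp_tendsto[OF continuous_Y path_in_C01]) (use assms in \<open>auto simp: path01_def\<close>)

lemma interp_skeleton_vimage:
  assumes "openin (mtopology_of C01) U"
  shows "{w\<in>space M. interp n (skeleton n w) \<in> U} \<in> sets M"
proof -
  have "skeleton n -` (interp n -` U) \<inter> space M \<in> sets M"
    by (rule measurable_sets[OF measurable_skeleton]) (use open_interp_vimage[OF assms] in auto)
  also have "skeleton n -` (interp n -` U) \<inter> space M = {w\<in>space M. interp n (skeleton n w) \<in> U}" by auto
  finally show ?thesis .
qed

text \<open>A path is the uniform limit of its interpolations, each of which depends continuously on finitely many coordinates.
So the preimage of an open set is a countable combination of preimages under the interpolations.\<close>
lemma measurable_path: "path01 Y \<in> measurable M (metric_borel C01)"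
  unfolding metric_borel_def
proof (rule measurable_measure_of)
  show "{U. openin (mtopology_of C01) U} \<subseteq> Pow (mspace C01)"
    using openin_subset by fastforce
  show "path01 Y \<in> space M \<rightarrow> mspace C01" using path_in_C01 by auto
  fix U assume "U \<in> {U. openin (mtopology_of C01) U}"
  then have U: "openin (mtopology_of C01) U" by simp
  interpret C: Metric_space "mspace C01" "mdist C01" by (rule Metric_space_mspace_mdist)
  have top: "mtopology_of C01 = C.mtopology" by (simp add: mtopology_of_def)
  \<comment> \<open>An exhaustion of \<open>U\<close> by points with a margin of more than \<open>1 / (j + 1)\<close>, which absorbs the error of the interpolation.\<close>
  define V where "V j = {x \<in> mspace C01. \<exists>r > 1 / real (Suc j). C.mball x r \<subseteq> U}" for j
  have Vopen: "openin (mtopology_of C01) (V j)" for j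
    unfolding top C.openin_mtopology
  proof (intro conjI allI impI)
    fix x assume "x \<in> V j"
    then obtain r where x: "x \<in> mspace C01" and r: "r > 1 / real (Suc j)" "C.mball x r \<subseteq> U" by (auto simp: V_def)
    define e where "e = (r - 1 / real (Suc j)) / 2"
    have "C.mball x e \<subseteq> V j"
    proof
      fix y assume y: "y \<in> C.mball x e"
      have "C.mball y (r - e) \<subseteq> C.mball x r"
      proof
        fix z assume z: "z \<in> C.mball y (r - e)"
        have "mdist C01 x z \<le> mdist C01 x y + mdist C01 y z" using y z by (intro C.triangle) auto
        then show "z \<in> C.mball x r" using y z by auto
      qed
      moreover have "r - e > 1 / real (Suc j)"
      proof -
        have "2 * e = r - 1 / real (Suc j)" by (simp only: e_def) simp
        moreover have "0 < e" using r by (simp add: e_def)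
        ultimately show ?thesis by linarith
      qed
      ultimately have "r - e > 1 / real (Suc j) \<and> C.mball y (r - e) \<subseteq> U" using r by blast
      moreover have "y \<in> mspace C01" using y by simp
      ultimately show "y \<in> V j" unfolding V_def by blast
    qed
    moreover have "0 < e" using r by (simp add: e_def)
    ultimately show "\<exists>r>0. C.mball x r \<subseteq> V j" by blast
  qed (auto simp: V_def)
  have "path01 Y w \<in> U \<longleftrightarrow> (\<exists>j. \<exists>n0. \<forall>n\<ge>n0. interp n (skeleton n w) \<in> V j)" if w: "w \<in> space M" for w
  proof
    assume "path01 Y w \<in> U"
    then obtain r where r: "0 < r" "C.mball (path01 Y w) r \<subseteq> U" using U unfolding top C.openin_mtopology by blast
    obtain j where j: "1 / real (Suc j) < r / 2" using r(1) nat_approx_posE[of "r/2"] by (auto simp: inverse_eq_divide)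
    obtain n0 where n0: "\<And>n. n \<ge> n0 ==> mdist C01 (path01 Y w) (interp n (skeleton n w)) \<le> r / 4"
      using path_interp_tendsto[OF w, of "r/4"] r(1) unfolding eventually_sequentially by auto
    have "interp n (skeleton n w) \<in> V j" if n: "n \<ge> n0" for n
    proof -
      have "C.mball (interp n (skeleton n w)) (r / 2) \<subseteq> C.mball (path01 Y w) r"
      proof
        fix z assume z: "z \<in> C.mball (interp n (skeleton n w)) (r / 2)"
        have "mdist C01 (path01 Y w) z \<le> mdist C01 (path01 Y w) (interp n (skeleton n w)) + mdist C01 (interp n (skeleton n w)) z"
          using z path_in_C01[OF w] interp_in_C01 by (intro C.triangle) auto
        then show "z \<in> C.mball (path01 Y w) r" using n0[OF n] z path_in_C01[OF w] r(1) by auto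
      qed
      then have "r / 2 > 1 / real (Suc j) \<and> C.mball (interp n (skeleton n w)) (r / 2) \<subseteq> U" using j r by blast
      then show ?thesis using interp_in_C01 unfolding V_def by blast
    qed
    then show "\<exists>j. \<exists>n0. \<forall>n\<ge>n0. interp n (skeleton n w) \<in> V j" by blast
  next
    assume "\<exists>j. \<exists>n0. \<forall>n\<ge>n0. interp n (skeleton n w) \<in> V j"
    then obtain j n0 where n0: "\<And>n. n \<ge> n0 ==> interp n (skeleton n w) \<in> V j" by blast
    obtain n1 where n1: "\<And>n. n \<ge> n1 ==> mdist C01 (path01 Y w) (interp n (skeleton n w)) \<le> 1 / real (Suc j)"
      using path_interp_tendsto[OF w, of "1 / real (Suc j)"] unfolding eventually_sequentially by auto
    define n where "n = max n0 n1"
    obtain r where r: "r > 1 / real (Suc j)" "C.mball (interp n (skeleton n w)) r \<subseteq> U"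
      using n0[of n] by (auto simp: V_def n_def)
    have "path01 Y w \<in> C.mball (interp n (skeleton n w)) r"
      using n1[of n] r(1) path_in_C01[OF w] interp_in_C01 by (auto simp: n_def C.commute)
    then show "path01 Y w \<in> U" using r by blast
  qed
  then have "path01 Y -` U \<inter> space M = {w\<in>space M. \<exists>j. \<exists>n0. \<forall>n. n \<ge> n0 \<longrightarrow> interp n (skeleton n w) \<in> V j}"
    by auto
  also have "... \<in> sets M"
    by (intro sets.sets_Collect_countable_Ex sets.sets_Collect_countable_All sets.sets_Collect_imp
        sets.sets_Collect_const interp_skeleton_vimage Vopen)
  finally show "path01 Y -` U \<inter> space M \<in> sets M" .
qed

end

section \<open>Convergence in distribution of finitely many coordinates\<close>

text \<open>The real trigonometric polynomials, of arbitrary real frequencies, in the coordinates up to \<open>m\<close>.\<close>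
inductive_set trig_polys :: "nat => ((nat => real) => real) set" for m where
  trig_cos: "(\<lambda>v. cos (\<Sum>k\<le>m. d k * v k)) \<in> trig_polys m"
| trig_sin: "(\<lambda>v. sin (\<Sum>k\<le>m. d k * v k)) \<in> trig_polys m"
| trig_add: "P \<in> trig_polys m ==> Q \<in> trig_polys m ==> (\<lambda>v. P v + Q v) \<in> trig_polys m"
| trig_cmult: "P \<in> trig_polys m ==> (\<lambda>v. c * P v) \<in> trig_polys m"

lemma trig_const: "(\<lambda>v. c) \<in> trig_polys m"
  using trig_cmult[OF trig_cos[where d = "\<lambda>_. 0"], of c] by simp

lemma trig_mult_basic:
  assumes "P \<in> trig_polys m"
  shows "(\<lambda>v. P v * cos (\<Sum>k\<le>m. d k * v k)) \<in> trig_polys m \<and> (\<lambda>v. P v * sin (\<Sum>k\<le>m. d k * v k)) \<in> trig_polys m"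
  using assms
proof induction
  case (trig_cos e)
  have a: "(\<lambda>v. cos (\<Sum>k\<le>m. (e k - d k) * v k)) \<in> trig_polys m" "(\<lambda>v. cos (\<Sum>k\<le>m. (e k + d k) * v k)) \<in> trig_polys m"
    "(\<lambda>v. sin (\<Sum>k\<le>m. (e k - d k) * v k)) \<in> trig_polys m" "(\<lambda>v. sin (\<Sum>k\<le>m. (e k + d k) * v k)) \<in> trig_polys m"
    by (rule trig_polys.trig_cos trig_polys.trig_sin)+
  have e: "(\<Sum>k\<le>m. (e k - d k) * v k) = (\<Sum>k\<le>m. e k * v k) - (\<Sum>k\<le>m. d k * v k)"
    "(\<Sum>k\<le>m. (e k + d k) * v k) = (\<Sum>k\<le>m. e k * v k) + (\<Sum>k\<le>m. d k * v k)" for v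
    by (simp_all add: algebra_simps sum.distrib sum_subtractf)
  have "(\<lambda>v. (1/2) * cos (\<Sum>k\<le>m. (e k - d k) * v k) + (1/2) * cos (\<Sum>k\<le>m. (e k + d k) * v k)) \<in> trig_polys m"
    by (intro trig_polys.trig_add trig_polys.trig_cmult a)
  moreover have "(\<lambda>v. (1/2) * sin (\<Sum>k\<le>m. (e k + d k) * v k) + (-1/2) * sin (\<Sum>k\<le>m. (e k - d k) * v k)) \<in> trig_polys m"
    by (intro trig_polys.trig_add trig_polys.trig_cmult a)
  ultimately show ?case unfolding e by (simp add: cos_times_cos cos_times_sin diff_divide_distrib add_divide_distrib)
next
  case (trig_sin e)
  have a: "(\<lambda>v. cos (\<Sum>k\<le>m. (e k - d k) * v k)) \<in> trig_polys m" "(\<lambda>v. cos (\<Sum>k\<le>m. (e k + d k) * v k)) \<in> trig_polys m"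
    "(\<lambda>v. sin (\<Sum>k\<le>m. (e k - d k) * v k)) \<in> trig_polys m" "(\<lambda>v. sin (\<Sum>k\<le>m. (e k + d k) * v k)) \<in> trig_polys m"
    by (rule trig_polys.trig_cos trig_polys.trig_sin)+
  have e: "(\<Sum>k\<le>m. (e k - d k) * v k) = (\<Sum>k\<le>m. e k * v k) - (\<Sum>k\<le>m. d k * v k)"
    "(\<Sum>k\<le>m. (e k + d k) * v k) = (\<Sum>k\<le>m. e k * v k) + (\<Sum>k\<le>m. d k * v k)" for v
    by (simp_all add: algebra_simps sum.distrib sum_subtractf)
  have "(\<lambda>v. (1/2) * sin (\<Sum>k\<le>m. (e k + d k) * v k) + (1/2) * sin (\<Sum>k\<le>m. (e k - d k) * v k)) \<in> trig_polys m"
    by (intro trig_polys.trig_add trig_polys.trig_cmult a)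
  moreover have "(\<lambda>v. (1/2) * cos (\<Sum>k\<le>m. (e k - d k) * v k) + (-1/2) * cos (\<Sum>k\<le>m. (e k + d k) * v k)) \<in> trig_polys m"
    by (intro trig_polys.trig_add trig_polys.trig_cmult a)
  ultimately show ?case unfolding e by (simp add: sin_times_cos sin_times_sin diff_divide_distrib add_divide_distrib)
next
  case (trig_add P Q)
  then show ?case unfolding distrib_right by (intro conjI trig_polys.trig_add) auto
next
  case (trig_cmult P c)
  then show ?case unfolding mult.assoc by (intro conjI trig_polys.trig_cmult) auto
qed

lemma trig_mult:
  assumes Q: "Q \<in> trig_polys m" and P: "P \<in> trig_polys m"
  shows "(\<lambda>v. P v * Q v) \<in> trig_polys m"
  using Q
proof induction
  case (trig_add Q Q')
  then show ?case unfolding distrib_left by (intro trig_polys.trig_add)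
next
  case (trig_cmult Q c)
  then show ?case unfolding mult.left_commute[of _ c] by (intro trig_polys.trig_cmult)
qed (use trig_mult_basic[OF P] in auto)

lemma trig_polys_continuous: "P \<in> trig_polys m ==> continuous_on UNIV P"
  by (induction rule: trig_polys.induct) (auto intro!: continuous_intros continuous_on_product_coordinates)

lemma trig_polys_bounded: "P \<in> trig_polys m ==> \<exists>B. \<forall>v. \<bar>P v\<bar> \<le> B"
proof (induction rule: trig_polys.induct)
  case (trig_cos d) show ?case by (intro exI[of _ 1]) simp
next
  case (trig_sin d) show ?case by (intro exI[of _ 1]) simp
next
  case (trig_add P Q)
  then obtain a b where "\<And>v. \<bar>P v\<bar> \<le> a" "\<And>v. \<bar>Q v\<bar> \<le> b" by blast
  then have "\<bar>P v + Q v\<bar> \<le> a + b" for v by (meson abs_triangle_ineq add_mono order_trans)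
  then show ?case by blast
next
  case (trig_cmult P c)
  then obtain a where "\<And>v. \<bar>P v\<bar> \<le> a" by blast
  then have "\<bar>c * P v\<bar> \<le> \<bar>c\<bar> * a" for v by (simp add: abs_mult mult_left_mono)
  then show ?case by blast
qed

lemma continuous_on_bounded_integrable:
  assumes "prob_space M" and V: "V \<in> borel_measurable M" and \<psi>: "continuous_on UNIV \<psi>" "\<And>v. \<bar>\<psi> v\<bar> \<le> (B::real)"
  shows "integrable M (\<lambda>w. \<psi> (V w))"
proof -
  interpret prob_space M by fact
  have "(\<lambda>w. \<psi> (V w)) \<in> borel_measurable M"
    by (rule measurable_compose[OF V borel_measurable_continuous_onI[OF \<psi>(1)]])
  then show ?thesis by (rule integrable_const_bound[of _ B, rotated]) (simp add: \<psi>)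
qed

lemma iexp_parts:
  assumes "prob_space M" and s: "s \<in> borel_measurable M"
  shows "integrable M (\<lambda>w. iexp (s w))"
    and "Re (LINT w|M. iexp (s w)) = (LINT w|M. cos (s w))"
    and "Im (LINT w|M. iexp (s w)) = (LINT w|M. sin (s w))"
proof -
  interpret prob_space M by fact
  note [measurable] = s
  show i: "integrable M (\<lambda>w. iexp (s w))"
    by (rule integrable_const_bound[of _ 1]) auto
  show "Re (LINT w|M. iexp (s w)) = (LINT w|M. cos (s w))"
    using integral_Re[OF i] by (simp add: Re_exp)
  show "Im (LINT w|M. iexp (s w)) = (LINT w|M. sin (s w))"
    using integral_Im[OF i] by (simp add: Im_exp)
qed

text \<open>Convergence of characteristic functions of vectors with \<open>m + 1\<close> coordinates, padded by zeros.\<close>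
locale char_convergence =
  fixes M :: "nat => 'a measure" and N :: "'b measure" and V :: "nat => 'a => nat => real" and W :: "'b => nat => real"
    and m :: nat and C :: real
  assumes prob_M: "\<And>i. prob_space (M i)" and prob_N: "prob_space N"
    and meas_V: "\<And>i. V i \<in> borel_measurable (M i)" and meas_W: "W \<in> borel_measurable N"
    and zero_V: "\<And>i w k. m < k ==> V i w k = 0" and zero_W: "\<And>w k. m < k ==> W w k = 0"
    and char: "\<And>d. (\<lambda>i. LINT w|M i. iexp (\<Sum>k\<le>m. d k * V i w k)) \<longlonglongrightarrow> (LINT w|N. iexp (\<Sum>k\<le>m. d k * W w k))"
    and second_V: "\<And>i k. k \<le> m ==> (\<integral>\<^sup>+w. ennreal ((V i w k)^2) \<partial>M i) \<le> ennreal C"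
    and second_W: "\<And>k. k \<le> m ==> (\<integral>\<^sup>+w. ennreal ((W w k)^2) \<partial>N) \<le> ennreal C"
    and C_nonneg: "0 \<le> C"
begin

lemma trig_convergence:
  assumes "P \<in> trig_polys m"
  shows "(\<lambda>i. LINT w|M i. P (V i w)) \<longlonglongrightarrow> (LINT w|N. P (W w))"
  using assms
proof induction
  have meas: "(\<lambda>w. \<Sum>k\<le>m. d k * U w k) \<in> borel_measurable M'" if "U \<in> borel_measurable M'"
    for M' :: "'c measure" and U :: "'c => nat => real" and d
  proof -
    have c: "continuous_on UNIV (\<lambda>v. \<Sum>k\<le>m. d k * v k)" by (intro continuous_intros continuous_on_product_coordinates)
    show ?thesis
      using measurable_compose[OF that borel_measurable_continuous_onI[OF c]] by simp
  qed
  note parts_V = iexp_parts(2,3)[OF prob_M meas[OF meas_V]] and parts_W = iexp_parts(2,3)[OF prob_N meas[OF meas_W]]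
  {
    case (trig_cos d)
    have "(\<lambda>i. Re (LINT w|M i. iexp (\<Sum>k\<le>m. d k * V i w k))) \<longlonglongrightarrow> Re (LINT w|N. iexp (\<Sum>k\<le>m. d k * W w k))"
      by (intro tendsto_Re char)
    then show ?case unfolding parts_V parts_W .
  next
    case (trig_sin d)
    have "(\<lambda>i. Im (LINT w|M i. iexp (\<Sum>k\<le>m. d k * V i w k))) \<longlonglongrightarrow> Im (LINT w|N. iexp (\<Sum>k\<le>m. d k * W w k))"
      by (intro tendsto_Im char)
    then show ?case unfolding parts_V parts_W .
  next
    case (trig_add P Q)
    obtain a where a: "\<And>v. \<bar>P v\<bar> \<le> a" using trig_polys_bounded[OF trig_add(1)] by blast
    obtain b where b: "\<And>v. \<bar>Q v\<bar> \<le> b" using trig_polys_bounded[OF trig_add(2)] by blast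
    note ab = a b
    note iP = continuous_on_bounded_integrable[OF _ _ trig_polys_continuous[OF trig_add(1)] ab(1)]
    note iQ = continuous_on_bounded_integrable[OF _ _ trig_polys_continuous[OF trig_add(2)] ab(2)]
    have "(\<lambda>i. (LINT w|M i. P (V i w)) + (LINT w|M i. Q (V i w))) \<longlonglongrightarrow> (LINT w|N. P (W w)) + (LINT w|N. Q (W w))"
      by (intro tendsto_add trig_add)
    moreover have "(LINT w|M i. P (V i w) + Q (V i w)) = (LINT w|M i. P (V i w)) + (LINT w|M i. Q (V i w))" for i
      by (intro Bochner_Integration.integral_add iP iQ prob_M meas_V)
    moreover have "(LINT w|N. P (W w) + Q (W w)) = (LINT w|N. P (W w)) + (LINT w|N. Q (W w))"
      by (intro Bochner_Integration.integral_add iP iQ prob_N meas_W)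
    ultimately show ?case by simp
  next
    case (trig_cmult P c)
    then have "(\<lambda>i. c * (LINT w|M i. P (V i w))) \<longlonglongrightarrow> c * (LINT w|N. P (W w))"
      by (intro tendsto_mult tendsto_const)
    then show ?case by simp
  }
qed

text \<open>The coordinates \<open>sin (v k / R)\<close> map all vectors into a compact box, and polynomials in them are trigonometric
polynomials; the inverse \<open>R * arcsin\<close> recovers \<open>v\<close> as long as \<open>v\<close> is not large compared to \<open>R\<close>.\<close>
definition cut :: "real => (nat => real) => nat => real" where
  "cut R v k = (if k \<le> m then sin (v k / R) else 0)"

definition box :: "(nat => real) set" where
  "box = (\<Pi>\<^sub>E k\<in>UNIV. if k \<le> m then {-1..1} else {0})"

lemma compact_box: "compact box"
proof -
  have "compactin (product_topology (\<lambda>i. euclidean) UNIV) box"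
    unfolding box_def by (subst compactin_PiE) auto
  then show ?thesis by (simp add: euclidean_product_topology)
qed

lemma cut_in_box: "cut R v \<in> box"
  by (auto simp: cut_def box_def)

text \<open>The functions on the box whose pull-back is a trigonometric polynomial form a separating algebra, so the
Stone-Weierstrass theorem applies.\<close>
lemma trig_approximation:
  assumes \<Psi>: "continuous_on box \<Psi>" and e: "0 < e" and R: "0 < R"
  obtains P where "P \<in> trig_polys m" "\<And>v. \<bar>\<Psi> (cut R v) - P v\<bar> < e"
proof -
  define Rg where "Rg = {G. continuous_on box G \<and> (\<lambda>v. G (cut R v)) \<in> trig_polys m}"
  interpret function_ring_on Rg box
  proof
    show "compact box" by (rule compact_box)
    show "\<And>f. f \<in> Rg ==> continuous_on box f" by (simp add: Rg_def)
    have RgI: "G \<in> Rg" if "continuous_on box G" "(\<lambda>v. G (cut R v)) \<in> trig_polys m" for G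
      unfolding Rg_def mem_Collect_eq using that by (rule conjI)
    have RgD: "continuous_on box G" "(\<lambda>v. G (cut R v)) \<in> trig_polys m" if "G \<in> Rg" for G
      using that unfolding Rg_def mem_Collect_eq by (rule conjunct1, rule conjunct2)
    show "(\<lambda>x. f x + g x) \<in> Rg" if "f \<in> Rg" "g \<in> Rg" for f g
      by (rule RgI[OF continuous_on_add[OF RgD(1)[OF that(1)] RgD(1)[OF that(2)]]
            trig_polys.trig_add[OF RgD(2)[OF that(1)] RgD(2)[OF that(2)]]])
    show "(\<lambda>x. f x * g x) \<in> Rg" if "f \<in> Rg" "g \<in> Rg" for f g
      by (rule RgI[OF continuous_on_mult[OF RgD(1)[OF that(1)] RgD(1)[OF that(2)]]
            trig_mult[OF RgD(2)[OF that(2)] RgD(2)[OF that(1)]]])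
    show "\<And>c. (\<lambda>_. c) \<in> Rg" unfolding Rg_def mem_Collect_eq by (intro conjI continuous_on_const trig_const)
    fix x y assume xy: "x \<in> box" "y \<in> box" "x \<noteq> y"
    then obtain k where k: "x k \<noteq> y k" by auto
    have "k \<le> m"
    proof (rule ccontr)
      assume "\<not> k \<le> m"
      then have "x k = 0" "y k = 0"
        using PiE_mem[OF xy(1)[unfolded box_def], of k] PiE_mem[OF xy(2)[unfolded box_def], of k] by simp_all
      then show False using k by simp
    qed
    have eq: "(\<lambda>v. sin (v k / R)) = (\<lambda>v. sin (\<Sum>j\<le>m. (if j = k then 1 / R else 0) * v j))"
    proof
      fix v :: "nat => real"
      have "(\<Sum>j\<le>m. (if j = k then 1 / R else 0) * v j) = (\<Sum>j\<le>m. if j = k then v j / R else 0)"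
        by (rule sum.cong) auto
      also have "... = v k / R" using \<open>k \<le> m\<close> by simp
      finally show "sin (v k / R) = sin (\<Sum>j\<le>m. (if j = k then 1 / R else 0) * v j)" by simp
    qed
    have "(\<lambda>v. sin (v k / R)) \<in> trig_polys m" unfolding eq by (rule trig_sin)
    then have "(\<lambda>v. cut R v k) \<in> trig_polys m" using \<open>k \<le> m\<close> by (simp add: cut_def)
    moreover have "continuous_on box (\<lambda>w. w k)"
      by (rule continuous_on_subset[OF continuous_on_product_coordinates subset_UNIV])
    ultimately have kRg: "(\<lambda>w. w k) \<in> Rg" using RgI by simp
    show "\<exists>f\<in>Rg. f x \<noteq> f y" by (rule bexI[of "\<lambda>f. f x \<noteq> f y" "\<lambda>w. w k", OF k kRg])
  qed
  have "\<exists>G\<in>Rg. \<forall>x\<in>box. \<bar>\<Psi> x - G x\<bar> < e" by (rule Stone_Weierstrass_basic[OF \<Psi> e])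
  then obtain G where G: "G \<in> Rg" "\<forall>x\<in>box. \<bar>\<Psi> x - G x\<bar> < e" ..
  have 1: "(\<lambda>v. G (cut R v)) \<in> trig_polys m" using G(1) by (simp only: Rg_def mem_Collect_eq)
  have 2: "\<bar>\<Psi> (cut R v) - G (cut R v)\<bar> < e" for v by (rule bspec[OF G(2) cut_in_box])
  show ?thesis by (rule that[OF 1 2])
qed

text \<open>The two arguments of \<open>\<psi>\<close> differ only if some coordinate exceeds \<open>R\<close>, in which case the sum of the squares is at
least \<open>R\<^sup>2\<close>.\<close>
lemma cut_error:
  assumes \<psi>: "\<And>v. \<bar>\<psi> v\<bar> \<le> (B::real)" and v: "\<And>k. m < k ==> v k = 0" and R: "0 < R"
  shows "\<bar>\<psi> v - \<psi> (\<lambda>k. R * arcsin (cut R v k))\<bar> \<le> 2 * B / R\<^sup>2 * (\<Sum>k\<le>m. (v k)^2)"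
proof (cases "\<forall>k\<le>m. \<bar>v k\<bar> \<le> R")
  case True
  have B: "0 \<le> B" using \<psi>[of v] by linarith
  have "R * arcsin (cut R v k) = v k" for k
  proof (cases "k \<le> m")
    case k: True
    have "\<bar>v k / R\<bar> \<le> 1" using True k R by (simp add: abs_divide)
    then have "- (pi/2) \<le> v k / R" "v k / R \<le> pi/2" using pi_gt3 by linarith+
    then show ?thesis using k R by (simp add: cut_def arcsin_sin)
  qed (simp add: cut_def v)
  then have "(\<lambda>k. R * arcsin (cut R v k)) = v" by auto
  then show ?thesis using B by (simp add: sum_nonneg)
next
  case False
  then obtain k where k: "k \<le> m" "R < \<bar>v k\<bar>" by auto
  have B: "0 \<le> B" using \<psi>[of v] by linarith
  have "\<bar>\<psi> v - \<psi> (\<lambda>k. R * arcsin (cut R v k))\<bar> \<le> 2 * B" using \<psi>[of v] \<psi>[of "\<lambda>k. R * arcsin (cut R v k)"] by linarith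
  also have "2 * B \<le> 2 * B * ((v k)^2 / R\<^sup>2)"
  proof -
    have "R\<^sup>2 \<le> (v k)^2" using power_mono[of R "\<bar>v k\<bar>" 2] k(2) R by simp
    then have "1 \<le> (v k)^2 / R\<^sup>2" using R by simp
    then show ?thesis using B mult_left_mono[of 1 "(v k)^2 / R\<^sup>2" "2 * B"] by simp
  qed
  also have "... = 2 * B / R\<^sup>2 * (v k)^2" by simp
  also have "... \<le> 2 * B / R\<^sup>2 * (\<Sum>k\<le>m. (v k)^2)"
    using B k(1) by (intro mult_left_mono member_le_sum) auto
  finally show ?thesis .
qed

lemma cut_expectation_error:
  fixes U :: "'c => nat => real"
  assumes M': "prob_space M'" and U: "U \<in> borel_measurable M'" "\<And>w k. m < k ==> U w k = 0"
    and second: "\<And>k. k \<le> m ==> (\<integral>\<^sup>+w. ennreal ((U w k)^2) \<partial>M') \<le> ennreal C"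
    and \<psi>: "continuous_on UNIV \<psi>" "\<And>v. \<bar>\<psi> v\<bar> \<le> (B::real)" and R: "0 < R"
    and P: "P \<in> trig_polys m" "\<And>v. \<bar>\<psi> (\<lambda>k. R * arcsin (cut R v k)) - P v\<bar> < e"
  shows "\<bar>(LINT w|M'. \<psi> (U w)) - (LINT w|M'. P (U w))\<bar> \<le> e + 2 * B / R\<^sup>2 * (real (Suc m) * C)"
proof -
  interpret prob_space M' by fact
  obtain b where b: "\<And>v. \<bar>P v\<bar> \<le> b" using trig_polys_bounded[OF P(1)] by blast
  have B: "0 \<le> B" using \<psi>(2)[of "\<lambda>_. 0"] by linarith
  have [measurable]: "(\<lambda>w. U w k) \<in> borel_measurable M'" for k
    using measurable_compose[OF U(1) borel_measurable_continuous_onI[OF continuous_on_product_coordinates]] by simp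
  have i1: "integrable M' (\<lambda>w. \<psi> (U w))" by (rule continuous_on_bounded_integrable[OF M' U(1) \<psi>])
  have i2: "integrable M' (\<lambda>w. P (U w))"
    by (rule continuous_on_bounded_integrable[OF M' U(1) trig_polys_continuous[OF P(1)] b])
  have sq: "integrable M' (\<lambda>w. (U w k)^2)" "(LINT w|M'. (U w k)^2) \<le> C" if k: "k \<le> m" for k
  proof -
    show "integrable M' (\<lambda>w. (U w k)^2)"
      by (rule integrableI_bounded) (use second[OF k] in \<open>auto intro: le_less_trans\<close>)
    then have "ennreal (LINT w|M'. (U w k)^2) \<le> ennreal C"
      using second[OF k] by (simp add: nn_integral_eq_integral)
    then show "(LINT w|M'. (U w k)^2) \<le> C" using C_nonneg by (simp add: ennreal_le_iff)
  qed
  have "\<bar>(LINT w|M'. \<psi> (U w)) - (LINT w|M'. P (U w))\<bar> = \<bar>LINT w|M'. \<psi> (U w) - P (U w)\<bar>"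
    using i1 i2 by simp
  also have "... \<le> (LINT w|M'. \<bar>\<psi> (U w) - P (U w)\<bar>)" by (rule integral_abs_bound)
  also have "... \<le> (LINT w|M'. e + 2 * B / R\<^sup>2 * (\<Sum>k\<le>m. (U w k)^2))"
  proof (rule integral_mono)
    show "integrable M' (\<lambda>w. \<bar>\<psi> (U w) - P (U w)\<bar>)" using i1 i2 by simp
    show "integrable M' (\<lambda>w. e + 2 * B / R\<^sup>2 * (\<Sum>k\<le>m. (U w k)^2))"
      by (intro Bochner_Integration.integrable_add integrable_const integrable_mult_right Bochner_Integration.integrable_sum sq) simp
    fix w
    show "\<bar>\<psi> (U w) - P (U w)\<bar> \<le> e + 2 * B / R\<^sup>2 * (\<Sum>k\<le>m. (U w k)^2)"
      using cut_error[of \<psi> B "U w", OF \<psi>(2) U(2) R] P(2)[of "U w"] by linarith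
  qed
  also have "... = e + 2 * B / R\<^sup>2 * (\<Sum>k\<le>m. LINT w|M'. (U w k)^2)"
  proof -
    have "(LINT w|M'. e + 2 * B / R\<^sup>2 * (\<Sum>k\<le>m. (U w k)^2)) =
        (LINT w|M'. e) + (LINT w|M'. 2 * B / R\<^sup>2 * (\<Sum>k\<le>m. (U w k)^2))"
      by (intro Bochner_Integration.integral_add integrable_const integrable_mult_right Bochner_Integration.integrable_sum sq) simp
    also have "(LINT w|M'. 2 * B / R\<^sup>2 * (\<Sum>k\<le>m. (U w k)^2)) = 2 * B / R\<^sup>2 * (LINT w|M'. (\<Sum>k\<le>m. (U w k)^2))"
      by (rule integral_mult_right_zero)
    also have "(LINT w|M'. (\<Sum>k\<le>m. (U w k)^2)) = (\<Sum>k\<le>m. LINT w|M'. (U w k)^2)"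
      by (intro Bochner_Integration.integral_sum sq) simp
    finally show ?thesis by (simp add: prob_space)
  qed
  also have "... \<le> e + 2 * B / R\<^sup>2 * (\<Sum>k\<le>m. C)"
    using sq B by (intro add_left_mono mult_left_mono sum_mono) auto
  finally show ?thesis by simp
qed

text \<open>Levy's continuity theorem in finite dimension, for vectors with bounded second moments: these give tightness
directly and allow \<open>\<psi>\<close> to be replaced by a trigonometric polynomial.\<close>
theorem convergence_of_bounded_continuous:
  assumes \<psi>: "continuous_on UNIV \<psi>" "\<And>v. \<bar>\<psi> v\<bar> \<le> (B::real)"
  shows "(\<lambda>i. LINT \<omega>|M i. \<psi> (V i \<omega>)) \<longlonglongrightarrow> (LINT \<omega>|N. \<psi> (W \<omega>))"
proof (rule LIMSEQ_I)
  fix e :: real assume e: "0 < e"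
  have B: "0 \<le> B" using \<psi>(2)[of "\<lambda>_. 0"] by linarith
  define K where "K = 2 * B * (real (Suc m) * C)"
  have K: "0 \<le> K" using B C_nonneg by (simp add: K_def)
  define R where "R = 1 + 6 * K / e"
  have R: "1 \<le> R" "0 < R" using K e by (auto simp: R_def add_pos_nonneg)
  have KR: "2 * B / R\<^sup>2 * (real (Suc m) * C) \<le> e / 6"
  proof -
    have "R \<le> R\<^sup>2" using R by (simp add: power2_eq_square)
    then have "6 * K / e \<le> R\<^sup>2" unfolding R_def by linarith
    then have "K \<le> e / 6 * R\<^sup>2" using e by (simp add: field_simps)
    then have "K / R\<^sup>2 \<le> e / 6" using R by (simp add: field_simps)
    then show ?thesis by (simp add: K_def)
  qed
  have "continuous_on box (\<lambda>w. \<psi> (\<lambda>k. R * arcsin (w k)))"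
  proof (rule continuous_on_compose2[OF \<psi>(1)])
    show "continuous_on box (\<lambda>w k. R * arcsin (w k))"
    proof (rule continuous_on_coordinatewise_then_product)
      fix k
      have "continuous_on box (\<lambda>w. arcsin (w k))"
      proof (rule continuous_on_compose2[OF continuous_on_arcsin'])
        show "continuous_on box (\<lambda>w. w k)" by (rule continuous_on_subset[OF continuous_on_product_coordinates]) simp
        show "(\<lambda>w. w k) ` box \<subseteq> {-1..1}"
        proof (safe; simp)
          fix w assume "w \<in> box"
          then have "w k \<in> (if k \<le> m then {-1..1} else {0})" unfolding box_def by (rule PiE_mem) simp
          then show "-1 \<le> w k \<and> w k \<le> 1" by (auto split: if_splits)
        qed
      qed
      then show "continuous_on box (\<lambda>w. R * arcsin (w k))" by (rule continuous_on_mult_left)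
    qed
  qed simp
  then obtain P where P: "P \<in> trig_polys m" "\<And>v. \<bar>\<psi> (\<lambda>k. R * arcsin (cut R v k)) - P v\<bar> < e / 6"
    using trig_approximation[of "\<lambda>w. \<psi> (\<lambda>k. R * arcsin (w k))" "e/6" R] e R by auto
  have 1: "\<bar>(LINT \<omega>|M i. \<psi> (V i \<omega>)) - (LINT \<omega>|M i. P (V i \<omega>))\<bar> \<le> e / 3" for i
    using cut_expectation_error[OF prob_M meas_V zero_V second_V \<psi> R(2) P, of i] KR by simp
  have 2: "\<bar>(LINT \<omega>|N. \<psi> (W \<omega>)) - (LINT \<omega>|N. P (W \<omega>))\<bar> \<le> e / 3"
    using cut_expectation_error[OF prob_N meas_W zero_W second_W \<psi> R(2) P] KR by simp
  obtain i0 where i0: "\<And>i. i \<ge> i0 ==> \<bar>(LINT \<omega>|M i. P (V i \<omega>)) - (LINT \<omega>|N. P (W \<omega>))\<bar> < e / 3"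
    using LIMSEQ_D[OF trig_convergence[OF P(1)], of "e/3"] e by auto
  have "\<bar>(LINT \<omega>|M i. \<psi> (V i \<omega>)) - (LINT \<omega>|N. \<psi> (W \<omega>))\<bar> < e" if "i \<ge> i0" for i
    using 1[of i] 2 i0[OF that] by linarith
  then show "\<exists>no. \<forall>n\<ge>no. norm ((LINT \<omega>|M n. \<psi> (V n \<omega>)) - (LINT \<omega>|N. \<psi> (W \<omega>))) < e" by auto
qed

end

section \<open>Chaining\<close>

lemma dyadic_step:
  assumes t: "(0::real) \<le> t" "t \<le> 1"
  shows "nat \<lfloor>2 ^ Suc m * t\<rfloor> = 2 * nat \<lfloor>2 ^ m * t\<rfloor> \<or>
    (nat \<lfloor>2 ^ Suc m * t\<rfloor> = Suc (2 * nat \<lfloor>2 ^ m * t\<rfloor>) \<and> 2 * nat \<lfloor>2 ^ m * t\<rfloor> < 2 ^ Suc m)"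
proof -
  define x where "x = 2 ^ m * t"
  have x: "0 \<le> x" "x \<le> 2 ^ m" using t by (auto simp: x_def)
  define j where "j = \<lfloor>x\<rfloor>"
  have j: "real_of_int j \<le> x" "x < real_of_int j + 1" "0 \<le> j" using x by (auto simp: j_def)
  have "\<lfloor>2 * x\<rfloor> = 2 * j \<or> \<lfloor>2 * x\<rfloor> = 2 * j + 1" using j(1,2) by linarith
  then show ?thesis
  proof
    assume "\<lfloor>2 * x\<rfloor> = 2 * j"
    then show ?thesis using j(3) by (simp add: x_def j_def nat_mult_distrib mult.assoc)
  next
    assume a: "\<lfloor>2 * x\<rfloor> = 2 * j + 1"
    then have "2 * real_of_int j + 1 \<le> 2 * x" by linarith
    then have "real_of_int j < 2 ^ m" using x by linarith
    then have "j < 2 ^ m" by (metis of_int_less_iff of_int_numeral of_int_power)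
    then have "2 * nat j < 2 ^ Suc m" using j(3) by (simp add: nat_less_iff)
    moreover have "nat \<lfloor>2 * x\<rfloor> = Suc (2 * nat j)" using a j(3) by (simp add: nat_mult_distrib nat_add_distrib)
    ultimately show ?thesis by (simp add: x_def j_def mult.assoc)
  qed
qed

text \<open>Follow the dyadic approximations of \<open>t\<close> from level \<open>n\<close> downwards: passing to the next level moves by at most one dyadic
interval of that level.\<close>
lemma chaining:
  fixes y :: "real => real"
  assumes y: "continuous_on {0..1} y"
    and D: "\<And>m k. k < 2 ^ m ==> \<bar>y (real (Suc k) / 2 ^ m) - y (real k / 2 ^ m)\<bar> \<le> D m"
    and D0: "\<And>m. 0 \<le> D m" and sm: "summable D"
    and t: "t \<in> {0..1}" and k: "k \<le> 2 ^ n" "\<bar>2 ^ n * t - real k\<bar> < 1"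
  shows "\<bar>y t - y (real k / 2 ^ n)\<bar> \<le> (\<Sum>m. D (m + n))"
proof -
  define u where "u m = real (nat \<lfloor>2 ^ m * t\<rfloor>) / 2 ^ m" for m :: nat
  have t01: "0 \<le> t" "t \<le> 1" using t by auto
  have u: "u m \<le> t" "t < u m + 1 / 2 ^ m" "0 \<le> u m" for m
  proof -
    have "real (nat \<lfloor>2 ^ m * t\<rfloor>) \<le> 2 ^ m * t" "2 ^ m * t < real (nat \<lfloor>2 ^ m * t\<rfloor>) + 1"
      using t01 by (auto simp: zero_le_mult_iff)
    then show "u m \<le> t" "t < u m + 1 / 2 ^ m" "0 \<le> u m" by (auto simp: u_def field_simps)
  qed
  have u01: "u m \<in> {0..1}" for m using u[of m] t01 by auto
  have step: "\<bar>y (u (Suc m)) - y (u m)\<bar> \<le> D (Suc m)" for m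
    using dyadic_step[OF t01, of m]
  proof (elim disjE conjE)
    assume "nat \<lfloor>2 ^ Suc m * t\<rfloor> = 2 * nat \<lfloor>2 ^ m * t\<rfloor>"
    then have "u (Suc m) = u m" by (simp add: u_def)
    then show ?thesis using D0 by simp
  next
    assume a: "nat \<lfloor>2 ^ Suc m * t\<rfloor> = Suc (2 * nat \<lfloor>2 ^ m * t\<rfloor>)" "2 * nat \<lfloor>2 ^ m * t\<rfloor> < 2 ^ Suc m"
    have "u m = real (2 * nat \<lfloor>2 ^ m * t\<rfloor>) / 2 ^ Suc m" by (simp add: u_def)
    moreover have "u (Suc m) = real (Suc (2 * nat \<lfloor>2 ^ m * t\<rfloor>)) / 2 ^ Suc m" using a(1) by (simp only: u_def)
    ultimately show ?thesis using D[OF a(2)] by simp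
  qed
  have "(\<lambda>m. t - (1 / 2) ^ m) \<longlonglongrightarrow> t - 0"
    by (rule tendsto_diff[OF tendsto_const LIMSEQ_realpow_zero]) auto
  then have low: "(\<lambda>m. t - (1 / 2) ^ m) \<longlonglongrightarrow> t" by simp
  have lb: "t - (1 / 2) ^ m \<le> u m" for m using u(2)[of m] by (simp add: power_one_over)
  have "u \<longlonglongrightarrow> t"
  proof (rule tendsto_sandwich[OF _ _ low tendsto_const])
    show "\<forall>\<^sub>F m in sequentially. t - (1 / 2) ^ m \<le> u m" using lb by (rule always_eventually[OF allI])
    show "\<forall>\<^sub>F m in sequentially. u m \<le> t" using u(1) by (rule always_eventually[OF allI])
  qed
  then have yl: "(\<lambda>m. y (u (m + n))) \<longlonglongrightarrow> y t"
    using continuous_on_tendsto_compose[OF y LIMSEQ_ignore_initial_segment[of u t n] t] u01 by simp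
  have sn: "summable (\<lambda>m. D (m + n))" using sm by (rule summable_ignore_initial_segment)
  have part: "\<bar>y (u (m + n)) - y (u n)\<bar> \<le> (\<Sum>i<m. D (Suc i + n))" for m
  proof (induction m)
    case (Suc m)
    then show ?case using step[of "m + n"] by simp
  qed simp
  have snn: "summable (\<lambda>i. D (Suc i + n))" using sm summable_iff_shift[of D "Suc n"] by simp
  have "\<bar>y t - y (u n)\<bar> \<le> (\<Sum>i. D (Suc i + n))"
  proof (rule LIMSEQ_le_const2)
    show "(\<lambda>m. \<bar>y (u (m + n)) - y (u n)\<bar>) \<longlonglongrightarrow> \<bar>y t - y (u n)\<bar>"
      by (rule tendsto_rabs[OF tendsto_diff[OF yl tendsto_const]])
    show "\<exists>N. \<forall>m\<ge>N. \<bar>y (u (m + n)) - y (u n)\<bar> \<le> (\<Sum>i. D (Suc i + n))"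
      using order_trans[OF part sum_le_suminf[OF snn]] D0 by auto
  qed
  moreover have "\<bar>y (u n) - y (real k / 2 ^ n)\<bar> \<le> D n"
  proof -
    define j where "j = nat \<lfloor>2 ^ n * t\<rfloor>"
    have j: "real j \<le> 2 ^ n * t" "2 ^ n * t < real j + 1" using t01 by (auto simp: j_def zero_le_mult_iff)
    have "k = j \<or> k = Suc j" using k(2) j by linarith
    then show ?thesis
    proof
      assume "k = j" then show ?thesis using D0 by (simp add: u_def j_def)
    next
      assume "k = Suc j"
      then have "\<bar>y (real k / 2 ^ n) - y (real j / 2 ^ n)\<bar> \<le> D n" using D[of j n] k(1) by simp
      moreover have "u n = real j / 2 ^ n" by (simp add: u_def j_def)
      ultimately show ?thesis by (simp only: abs_minus_commute)
    qed
  qed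
  moreover have "(\<Sum>m. D (m + n)) = D n + (\<Sum>i. D (Suc i + n))"
    using suminf_split_head[OF sn] by simp
  ultimately show ?thesis by linarith
qed

text \<open>This weak form of Young's inequality replaces a maximum of increments by a sum of fourth powers, at the cost of
the additive term \<open>l\<close>.\<close>
lemma fourth_power_bound: "\<bar>x\<bar> \<le> l + x ^ 4 / l ^ 3" if "0 < l" for x l :: real
proof (cases "\<bar>x\<bar> \<le> l")
  case True
  have "0 \<le> x ^ 4 / l ^ 3" using that by simp
  then show ?thesis using True by linarith
next
  case False
  then have "l ^ 3 \<le> \<bar>x\<bar> ^ 3" using that by (intro power_mono) auto
  then have "\<bar>x\<bar> * l ^ 3 \<le> \<bar>x\<bar> * \<bar>x\<bar> ^ 3" by (rule mult_left_mono) simp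
  also have "... = x ^ 4" by (simp add: power_even_abs flip: power_Suc)
  finally have "\<bar>x\<bar> \<le> x ^ 4 / l ^ 3" using that by (simp add: field_simps)
  then show ?thesis using that by linarith
qed

text \<open>The fourth root balances the two terms of \<open>osc\<close>: there are \<open>2 ^ m\<close> increments, each with fourth moment of order
\<open>(1/4) ^ m\<close>, so the sum of their fourth powers is of order \<open>(1/2) ^ m\<close>, the fourth power of
\<open>chain_rate ^ m\<close>.\<close>
definition chain_rate :: real where "chain_rate = root 4 (1/2)"

text \<open>The fourth root balances the two terms of \<open>osc\<close>: there are \<open>2 ^ m\<close> increments, each with fourth moment of order
\<open>(1/4) ^ m\<close>, so the sum of their fourth powers is of order \<open>(1/2) ^ m\<close>, the fourth power of
\<open>chain_rate ^ m\<close>.\<close>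
lemma chain_rate: "0 < chain_rate" "chain_rate < 1" "chain_rate ^ 4 = 1 / 2"
proof -
  show p: "0 < chain_rate" by (simp add: chain_rate_def)
  show q: "chain_rate ^ 4 = 1 / 2" by (simp add: chain_rate_def)
  show "chain_rate < 1"
  proof (rule ccontr)
    assume "\<not> chain_rate < 1"
    then have "1 \<le> chain_rate ^ 4" by (intro one_le_power) simp
    then show False using q by simp
  qed
qed

text \<open>Kolmogorov's continuity criterion with exponents four and two, as a quantitative hypothesis.\<close>
locale Kolmogorov_process = C01_process + prob_space M +
  fixes C :: real
  assumes C_nonneg: "0 \<le> C"
    and fourth_moment: "\<And>s t. s \<in> {0..1} ==> t \<in> {0..1} ==>
      (\<integral>\<^sup>+w. ennreal ((Y t w - Y s w) ^ 4) \<partial>M) \<le> ennreal (C * (t - s)^2)"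
begin

text \<open>An integrable majorant of the increments over the dyadic intervals of level \<open>m\<close>.\<close>
definition osc :: "'a => nat => real" where
  "osc w m = chain_rate ^ m + (\<Sum>k<2^m. (Y (real (Suc k) / 2 ^ m) w - Y (real k / 2 ^ m) w) ^ 4) / (chain_rate ^ m) ^ 3"

lemma osc_nonneg: "0 \<le> osc w m"
  unfolding osc_def using chain_rate by (intro add_nonneg_nonneg divide_nonneg_nonneg sum_nonneg) auto

lemma osc_bound:
  assumes "k < 2 ^ m"
  shows "\<bar>Y (real (Suc k) / 2 ^ m) w - Y (real k / 2 ^ m) w\<bar> \<le> osc w m"
proof -
  have "(Y (real (Suc k) / 2 ^ m) w - Y (real k / 2 ^ m) w) ^ 4 \<le>
      (\<Sum>k<2^m. (Y (real (Suc k) / 2 ^ m) w - Y (real k / 2 ^ m) w) ^ 4)"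
    using assms by (intro member_le_sum) auto
  then have "(Y (real (Suc k) / 2 ^ m) w - Y (real k / 2 ^ m) w) ^ 4 / (chain_rate ^ m) ^ 3 \<le>
      (\<Sum>k<2^m. (Y (real (Suc k) / 2 ^ m) w - Y (real k / 2 ^ m) w) ^ 4) / (chain_rate ^ m) ^ 3"
    using chain_rate by (intro divide_right_mono) auto
  then show ?thesis
    using fourth_power_bound[of "chain_rate ^ m" "Y (real (Suc k) / 2 ^ m) w - Y (real k / 2 ^ m) w"] chain_rate(1)
    unfolding osc_def by simp
qed

lemma measurable_osc [measurable]: "(\<lambda>w. osc w m) \<in> borel_measurable M"
proof -
  have "(\<lambda>w. Y (real (Suc k) / 2 ^ m) w) \<in> borel_measurable M" "(\<lambda>w. Y (real k / 2 ^ m) w) \<in> borel_measurable M"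
    if "k < 2 ^ m" for k
    using that by (intro measurable_Y dyadic_unit; simp)+
  then show ?thesis unfolding osc_def
    by (intro borel_measurable_add borel_measurable_const borel_measurable_divide borel_measurable_sum
         borel_measurable_power borel_measurable_diff) auto
qed

lemma expectation_osc: "(\<integral>\<^sup>+w. ennreal (osc w m) \<partial>M) \<le> ennreal ((1 + C) * chain_rate ^ m)"
proof -
  let ?l = "chain_rate ^ m"
  have l: "0 < ?l" using chain_rate by simp
  have l4: "?l ^ 4 = 1 / 2 ^ m" by (metis chain_rate(3) mult.commute power_mult power_one_over)
  let ?d = "\<lambda>k w. (Y (real (Suc k) / 2 ^ m) w - Y (real k / 2 ^ m) w) ^ 4"
  have md: "?d k \<in> borel_measurable M" if "k < 2 ^ m" for k
    using that by (intro borel_measurable_power borel_measurable_diff measurable_Y dyadic_unit; simp)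
  have "(\<integral>\<^sup>+w. ennreal (osc w m) \<partial>M) = (\<integral>\<^sup>+w. ennreal ?l + ennreal (1 / ?l ^ 3) * (\<Sum>k<2^m. ennreal (?d k w)) \<partial>M)"
  proof (rule nn_integral_cong)
    fix w
    have "osc w m = ?l + 1 / ?l ^ 3 * (\<Sum>k<2^m. ?d k w)" by (simp add: osc_def)
    then show "ennreal (osc w m) = ennreal ?l + ennreal (1 / ?l ^ 3) * (\<Sum>k<2^m. ennreal (?d k w))"
      using l by (simp add: ennreal_plus ennreal_mult sum_nonneg sum_ennreal del: times_divide_eq_left)
  qed
  also have "... = ennreal ?l + ennreal (1 / ?l ^ 3) * (\<Sum>k<2^m. \<integral>\<^sup>+w. ennreal (?d k w) \<partial>M)"
  proof -
    have [measurable]: "(\<lambda>w. ennreal (?d k w)) \<in> borel_measurable M" if "k \<in> {..<2^m}" for k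
      using measurable_compose[OF md measurable_ennreal] that by simp
    then have [measurable]: "(\<lambda>w. \<Sum>k<2^m. ennreal (?d k w)) \<in> borel_measurable M" by (rule borel_measurable_sum)
    have "(\<integral>\<^sup>+w. (\<Sum>k<2^m. ennreal (?d k w)) \<partial>M) = (\<Sum>k<2^m. \<integral>\<^sup>+w. ennreal (?d k w) \<partial>M)"
      by (rule nn_integral_sum) measurable
    then show ?thesis
      by (subst nn_integral_add, measurable) (simp del: sum_ennreal of_nat_Suc add: nn_integral_cmult emeasure_space_1)
  qed
  also have "... \<le> ennreal ?l + ennreal (1 / ?l ^ 3) * (\<Sum>k<(2::nat)^m. ennreal (C * (1 / 2 ^ m)^2))"
  proof (intro add_left_mono mult_left_mono sum_mono)
    fix k :: nat assume "k \<in> {..<2^m}"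
    then have k: "k < 2 ^ m" by simp
    have "real (Suc k) / 2 ^ m - real k / 2 ^ m = 1 / 2 ^ m" by (simp add: diff_divide_distrib[symmetric])
    then show "(\<integral>\<^sup>+w. ennreal (?d k w) \<partial>M) \<le> ennreal (C * (1 / 2 ^ m)^2)"
      using fourth_moment[OF dyadic_unit[of k m] dyadic_unit[of "Suc k" m]] k by simp
  qed simp
  also have "... = ennreal (?l + 1 / ?l ^ 3 * (2 ^ m * (C * (1 / 2 ^ m)^2)))"
    using l C_nonneg by (simp add: ennreal_plus ennreal_mult[symmetric] ennreal_of_nat_eq_real_of_nat del: times_divide_eq_left)
  also have "1 / ?l ^ 3 * (2 ^ m * (C * (1 / 2 ^ m)^2)) = C * ?l"
  proof -
    have "1 / ?l ^ 3 * (2 ^ m * (C * (1 / 2 ^ m)^2)) = C * (1 / 2 ^ m) / ?l ^ 3"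
      by (simp add: power2_eq_square)
    also have "... = C * ?l" unfolding l4[symmetric] using l by (simp add: eval_nat_numeral)
    finally show ?thesis .
  qed
  finally show ?thesis by (simp add: algebra_simps)
qed

lemma interp_path_error:
  assumes w: "w \<in> space M" and sm: "summable (osc w)"
  shows "mdist C01 (path01 Y w) (interp n (skeleton n w)) \<le> (\<Sum>m. osc w (m + n))"
  unfolding interp_skeleton C01_mdist_le[OF path_in_C01[OF w] interp_in_C01]
proof
  fix t :: real assume t: "t \<in> {0..1}"
  have "\<bar>Y t w - interp n (\<lambda>k. Y (real k / 2 ^ n) w) t\<bar> \<le> (\<Sum>m. osc w (m + n))"
    by (rule interp_error[OF t], rule chaining[OF continuous_Y[OF w] osc_bound osc_nonneg sm t])
  then show "\<bar>path01 Y w t - interp n (\<lambda>k. Y (real k / 2 ^ n) w) t\<bar> \<le> (\<Sum>m. osc w (m + n))"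
    using t by (simp add: path01_def)
qed

text \<open>The expected chaining sum is a geometric series, so the error of the interpolation is exponentially small in \<open>n\<close>,
with constants depending only on \<open>L\<close> and \<open>C\<close>. This uniformity is the tightness.\<close>
lemma Lipschitz_interp_error:
  assumes L: "\<And>x y. x \<in> mspace C01 ==> y \<in> mspace C01 ==> \<bar>\<phi> x - \<phi> y\<bar> \<le> L * mdist C01 x y" and L0: "0 < L"
  shows "(\<integral>\<^sup>+w. ennreal \<bar>\<phi> (path01 Y w) - \<phi> (interp n (skeleton n w))\<bar> \<partial>M) \<le>
     ennreal (L * ((1 + C) * chain_rate ^ n / (1 - chain_rate)))"
proof -
  have "(\<integral>\<^sup>+w. ennreal \<bar>\<phi> (path01 Y w) - \<phi> (interp n (skeleton n w))\<bar> \<partial>M) \<le>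
      (\<integral>\<^sup>+w. ennreal L * (\<Sum>m. ennreal (osc w (m + n))) \<partial>M)"
  proof (rule nn_integral_mono)
    fix w assume w: "w \<in> space M"
    show "ennreal \<bar>\<phi> (path01 Y w) - \<phi> (interp n (skeleton n w))\<bar> \<le> ennreal L * (\<Sum>m. ennreal (osc w (m + n)))"
    proof (cases "(\<Sum>m. ennreal (osc w (m + n))) = \<top>")
      case True then show ?thesis using L0 by (simp add: ennreal_mult_top)
    next
      case False
      then have "summable (\<lambda>m. osc w (m + n))" using osc_nonneg by (intro summable_suminf_not_top) auto
      then have sm: "summable (osc w)" and s: "summable (\<lambda>m. osc w (m + n))" using summable_iff_shift by auto
      have "\<bar>\<phi> (path01 Y w) - \<phi> (interp n (skeleton n w))\<bar> \<le> L * mdist C01 (path01 Y w) (interp n (skeleton n w))"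
        by (intro L path_in_C01 interp_in_C01 w)
      also have "... \<le> L * (\<Sum>m. osc w (m + n))"
        using interp_path_error[OF w sm] L0 by (intro mult_left_mono) auto
      finally have "ennreal \<bar>\<phi> (path01 Y w) - \<phi> (interp n (skeleton n w))\<bar> \<le> ennreal (L * (\<Sum>m. osc w (m + n)))"
        by (rule ennreal_leI)
      also have "... = ennreal L * (\<Sum>m. ennreal (osc w (m + n)))"
        using L0 osc_nonneg by (simp add: ennreal_mult suminf_nonneg[OF s] suminf_ennreal2[OF _ s])
      finally show ?thesis .
    qed
  qed
  also have "... = ennreal L * (\<Sum>m. \<integral>\<^sup>+w. ennreal (osc w (m + n)) \<partial>M)"
    by (simp add: nn_integral_cmult nn_integral_suminf)
  also have "... \<le> ennreal L * (\<Sum>m. ennreal ((1 + C) * chain_rate ^ (m + n)))"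
    by (intro mult_left_mono suminf_le expectation_osc) auto
  also have "(\<Sum>m. ennreal ((1 + C) * chain_rate ^ (m + n))) = ennreal (\<Sum>m. (1 + C) * chain_rate ^ (m + n))"
    using chain_rate C_nonneg
    by (intro suminf_ennreal2) (auto simp: power_add intro!: summable_mult summable_mult2 summable_geometric)
  also have "(\<Sum>m. (1 + C) * chain_rate ^ (m + n)) = (1 + C) * chain_rate ^ n / (1 - chain_rate)"
  proof -
    have "(\<Sum>m. (1 + C) * chain_rate ^ n * chain_rate ^ m) = (1 + C) * chain_rate ^ n * (\<Sum>m. chain_rate ^ m)"
      using chain_rate by (intro suminf_mult summable_geometric) simp
    also have "(\<Sum>m. chain_rate ^ m) = 1 / (1 - chain_rate)" using chain_rate by (intro suminf_geometric) simp
    finally show ?thesis by (simp add: power_add mult_ac)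
  qed
  also have "ennreal L * ennreal ((1 + C) * chain_rate ^ n / (1 - chain_rate)) = ennreal (L * ((1 + C) * chain_rate ^ n / (1 - chain_rate)))"
    using L0 chain_rate C_nonneg by (intro ennreal_mult[symmetric]) auto
  finally show ?thesis .
qed

end

interpretation C01: Metric_space "mspace C01" "mdist C01"
  by (rule Metric_space_mspace_mdist)

section \<open>Weak convergence of continuous processes\<close>

lemma continuous_map_C01_measurable:
  assumes "continuous_map (mtopology_of C01) euclideanreal \<phi>"
  shows "\<phi> \<in> borel_measurable (metric_borel C01)"
proof (rule borel_measurableI)
  fix S :: "real set" assume "open S"
  have sub: "{U. openin (mtopology_of C01) U} \<subseteq> Pow (mspace C01)" using openin_subset by fastforce
  then have sp: "space (metric_borel C01) = mspace C01" by (simp add: metric_borel_def)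
  have "openin (mtopology_of C01) {x \<in> topspace (mtopology_of C01). \<phi> x \<in> S}"
    using assms \<open>open S\<close> by (intro openin_continuous_map_preimage) auto
  moreover have "{x \<in> topspace (mtopology_of C01). \<phi> x \<in> S} = \<phi> -` S \<inter> space (metric_borel C01)"
    by (auto simp: sp)
  ultimately show "\<phi> -` S \<inter> space (metric_borel C01) \<in> sets (metric_borel C01)"
    using sub unfolding metric_borel_def by simp
qed

lemma continuous_comp_interp:
  assumes "continuous_map (mtopology_of C01) euclideanreal \<phi>"
  shows "continuous_on UNIV (\<lambda>v. \<phi> (interp n v))"
  unfolding continuous_on_open_vimage[OF open_UNIV]
proof (intro allI impI)
  fix S :: "real set" assume "open S"
  then have "openin (mtopology_of C01) {x \<in> topspace (mtopology_of C01). \<phi> x \<in> S}"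
    using assms by (intro openin_continuous_map_preimage) auto
  from open_interp_vimage[OF this, of n]
  have "open (interp n -` {x \<in> topspace (mtopology_of C01). \<phi> x \<in> S})" .
  also have "interp n -` {x \<in> topspace (mtopology_of C01). \<phi> x \<in> S} = (\<lambda>v. \<phi> (interp n v)) -` S \<inter> UNIV"
    using interp_in_C01 by auto
  finally show "open ((\<lambda>v. \<phi> (interp n v)) -` S \<inter> UNIV)" .
qed

lemma Lipschitz_continuous_map:
  assumes L: "\<And>x y. x \<in> mspace C01 ==> y \<in> mspace C01 ==> \<bar>\<phi> x - \<phi> y\<bar> \<le> L * mdist C01 x y" and L0: "0 < L"
  shows "continuous_map (mtopology_of C01) euclideanreal \<phi>"
  unfolding continuous_map_def
proof (intro conjI allI impI)
  fix U :: "real set" assume "openin euclideanreal U"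
  then have U: "open U" by simp
  show "openin (mtopology_of C01) {x \<in> topspace (mtopology_of C01). \<phi> x \<in> U}"
    unfolding mtopology_of_def C01.openin_mtopology
  proof (intro conjI allI impI)
    fix x assume "x \<in> {x \<in> topspace C01.mtopology. \<phi> x \<in> U}"
    then have x: "x \<in> mspace C01" "\<phi> x \<in> U" by auto
    obtain e where e: "0 < e" "\<And>z. \<bar>z - \<phi> x\<bar> < e ==> z \<in> U"
      using U x(2) unfolding open_dist dist_real_def by blast
    have "C01.mball x (e / L) \<subseteq> {x \<in> topspace C01.mtopology. \<phi> x \<in> U}"
    proof
      fix y assume y: "y \<in> C01.mball x (e / L)"
      then have "L * mdist C01 x y < e" using L0 by (simp add: field_simps)
      then have "\<bar>\<phi> y - \<phi> x\<bar> < e" using L[of x y] x y by (simp add: abs_minus_commute)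
      then show "y \<in> {x \<in> topspace C01.mtopology. \<phi> x \<in> U}" using e(2) y by simp
    qed
    then show "\<exists>r>0. C01.mball x r \<subseteq> {x \<in> topspace C01.mtopology. \<phi> x \<in> U}" using e(1) L0 by (intro exI[of _ "e / L"]) simp
  qed auto
qed simp

text \<open>Processes whose characteristic functions at the dyadic points converge, with moment bounds that do not depend on
the index.\<close>
locale C01_convergence =
  fixes M :: "nat => 'a measure" and Y :: "nat => real => 'a => real"
    and N :: "'b measure" and Z :: "real => 'b => real" and C :: real
  assumes process_Y: "\<And>i. Kolmogorov_process (M i) (Y i) C"
    and process_Z: "Kolmogorov_process N Z C"
    and char: "\<And>n d. (\<lambda>i. LINT w|M i. iexp (\<Sum>k\<le>2^n. d k * Y i (real k / 2^n) w)) \<longlonglongrightarrow>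
      (LINT w|N. iexp (\<Sum>k\<le>2^n. d k * Z (real k / 2^n) w))"
    and second_Y: "\<And>i t. t \<in> {0..1} ==> (\<integral>\<^sup>+w. ennreal ((Y i t w)^2) \<partial>M i) \<le> ennreal C"
    and second_Z: "\<And>t. t \<in> {0..1} ==> (\<integral>\<^sup>+w. ennreal ((Z t w)^2) \<partial>N) \<le> ennreal C"
begin

lemma C01_Y: "C01_process (M i) (Y i)" and prob_Y: "prob_space (M i)"
  using process_Y[of i] by (auto dest: Kolmogorov_process.axioms)

lemma C01_Z: "C01_process N Z" and prob_Z: "prob_space N"
  using process_Z by (auto dest: Kolmogorov_process.axioms)

lemma integrable_functional:
  assumes "prob_space P" "C01_process P U" "continuous_map (mtopology_of C01) euclideanreal \<phi>"
    and "\<And>x. x \<in> mspace C01 ==> \<bar>\<phi> x\<bar> \<le> (B::real)"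
  shows "integrable P (\<lambda>w. \<phi> (path01 U w))"
proof -
  interpret prob_space P by fact
  interpret C01_process P U by fact
  show ?thesis
  proof (rule integrable_const_bound[of _ B])
    show "AE w in P. norm (\<phi> (path01 U w)) \<le> B" using assms(4) path_in_C01 by auto
    show "(\<lambda>w. \<phi> (path01 U w)) \<in> borel_measurable P"
      by (rule measurable_compose[OF measurable_path continuous_map_C01_measurable[OF assms(3)]])
  qed
qed

lemma skeleton_error:
  assumes P: "Kolmogorov_process P U C"
    and L: "\<And>x y. x \<in> mspace C01 ==> y \<in> mspace C01 ==> \<bar>\<phi> x - \<phi> y\<bar> \<le> L * mdist C01 x y" and L0: "0 < L"
    and B: "\<And>x. x \<in> mspace C01 ==> \<bar>\<phi> x\<bar> \<le> (B::real)"
  shows "\<bar>(LINT w|P. \<phi> (path01 U w)) - (LINT w|P. \<phi> (interp n (C01_process.skeleton U n w)))\<bar> \<le>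
    L * ((1 + C) * chain_rate ^ n / (1 - chain_rate))"
proof -
  interpret Kolmogorov_process P U C by fact
  note cont = Lipschitz_continuous_map[OF L L0]
  have i1: "integrable P (\<lambda>w. \<phi> (path01 U w))"
    by (rule integrable_functional[OF _ _ cont B]) unfold_locales
  have i2: "integrable P (\<lambda>w. \<phi> (interp n (skeleton n w)))"
    by (rule continuous_on_bounded_integrable[OF _ measurable_skeleton continuous_comp_interp[OF cont]])
       (use B interp_in_C01 prob_space_axioms in auto)
  have "ennreal \<bar>LINT w|P. \<phi> (path01 U w) - \<phi> (interp n (skeleton n w))\<bar> \<le>
     (\<integral>\<^sup>+w. ennreal \<bar>\<phi> (path01 U w) - \<phi> (interp n (skeleton n w))\<bar> \<partial>P)"
    using integral_norm_bound_ennreal[OF Bochner_Integration.integrable_diff[OF i1 i2]] by simp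
  also have "... \<le> ennreal (L * ((1 + C) * chain_rate ^ n / (1 - chain_rate)))"
    by (rule Lipschitz_interp_error[OF L L0])
  finally have "\<bar>LINT w|P. \<phi> (path01 U w) - \<phi> (interp n (skeleton n w))\<bar> \<le> L * ((1 + C) * chain_rate ^ n / (1 - chain_rate))"
    using L0 C_nonneg chain_rate by (subst (asm) ennreal_le_iff) auto
  then show ?thesis using i1 i2 by simp
qed

lemma skeleton_convergence:
  assumes \<psi>: "continuous_on UNIV \<psi>" "\<And>v. \<bar>\<psi> v\<bar> \<le> (B::real)"
  shows "(\<lambda>i. LINT w|M i. \<psi> (C01_process.skeleton (Y i) n w)) \<longlonglongrightarrow> (LINT w|N. \<psi> (C01_process.skeleton Z n w))"
proof -
  note sk_Y = C01_process.skeleton_def[OF C01_Y] and sk_Z = C01_process.skeleton_def[OF C01_Z]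
  have e: "(\<Sum>k\<le>2^n. d k * C01_process.skeleton (Y i) n w k) = (\<Sum>k\<le>2^n. d k * Y i (real k / 2 ^ n) w)"
    "(\<Sum>k\<le>2^n. d k * C01_process.skeleton Z n w' k) = (\<Sum>k\<le>2^n. d k * Z (real k / 2 ^ n) w')" for d i w w'
    by (auto intro!: sum.cong simp: sk_Y sk_Z)
  interpret char_convergence M N "\<lambda>i. C01_process.skeleton (Y i) n" "C01_process.skeleton Z n" "2 ^ n" C
  proof (rule char_convergence.intro)
    show "prob_space (M i)" for i by (rule prob_Y)
    show "prob_space N" by (rule prob_Z)
    show "C01_process.skeleton (Y i) n \<in> borel_measurable (M i)" for i by (rule C01_process.measurable_skeleton[OF C01_Y])
    show "C01_process.skeleton Z n \<in> borel_measurable N" by (rule C01_process.measurable_skeleton[OF C01_Z])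
    show "C01_process.skeleton (Y i) n w k = 0" if "2 ^ n < k" for i w k using that by (simp add: sk_Y)
    show "C01_process.skeleton Z n w k = 0" if "2 ^ n < k" for w k using that by (simp add: sk_Z)
    show "(\<lambda>i. LINT w|M i. iexp (\<Sum>k\<le>2^n. d k * C01_process.skeleton (Y i) n w k)) \<longlonglongrightarrow>
        (LINT w|N. iexp (\<Sum>k\<le>2^n. d k * C01_process.skeleton Z n w k))" for d unfolding e by (rule char)
    show "(\<integral>\<^sup>+w. ennreal ((C01_process.skeleton (Y i) n w k)^2) \<partial>M i) \<le> ennreal C" if "k \<le> 2 ^ n" for i k
      using second_Y[OF dyadic_unit[OF that]] that by (simp add: sk_Y)
    show "(\<integral>\<^sup>+w. ennreal ((C01_process.skeleton Z n w k)^2) \<partial>N) \<le> ennreal C" if "k \<le> 2 ^ n" for k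
      using second_Z[OF dyadic_unit[OF that]] that by (simp add: sk_Z)
    show "0 \<le> C" by (rule Kolmogorov_process.C_nonneg[OF process_Z])
  qed
  show ?thesis by (rule convergence_of_bounded_continuous[OF \<psi>])
qed

text \<open>Compare both sides with their interpolations at level \<open>n\<close>, which are functions of finitely many coordinates, then let
\<open>n\<close> tend to infinity.\<close>
lemma Lipschitz_convergence:
  assumes L: "\<And>x y. x \<in> mspace C01 ==> y \<in> mspace C01 ==> \<bar>\<phi> x - \<phi> y\<bar> \<le> L * mdist C01 x y" and L0: "0 < L"
    and B: "\<And>x. x \<in> mspace C01 ==> \<bar>\<phi> x\<bar> \<le> (B::real)"
  shows "(\<lambda>i. LINT w|M i. \<phi> (path01 (Y i) w)) \<longlonglongrightarrow> (LINT w|N. \<phi> (path01 Z w))"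
proof (rule LIMSEQ_I)
  fix e :: real assume e: "0 < e"
  have "(\<lambda>n. L * ((1 + C) * chain_rate ^ n / (1 - chain_rate))) \<longlonglongrightarrow> L * ((1 + C) * 0 / (1 - chain_rate))"
    by (rule tendsto_mult[OF tendsto_const tendsto_divide[OF tendsto_mult[OF tendsto_const LIMSEQ_realpow_zero] tendsto_const]])
       (use chain_rate in auto)
  then have "(\<lambda>n. L * ((1 + C) * chain_rate ^ n / (1 - chain_rate))) \<longlonglongrightarrow> 0" by simp
  from LIMSEQ_D[OF this, of "e/3"] e obtain n where "\<bar>L * ((1 + C) * chain_rate ^ n / (1 - chain_rate))\<bar> < e / 3" by auto
  then have n: "L * ((1 + C) * chain_rate ^ n / (1 - chain_rate)) < e / 3" by linarith
  have "(\<lambda>i. LINT w|M i. \<phi> (interp n (C01_process.skeleton (Y i) n w))) \<longlonglongrightarrow> (LINT w|N. \<phi> (interp n (C01_process.skeleton Z n w)))"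
  proof (rule skeleton_convergence)
    show "continuous_on UNIV (\<lambda>v. \<phi> (interp n v))"
      by (rule continuous_comp_interp[OF Lipschitz_continuous_map[OF L L0]])
    show "\<bar>\<phi> (interp n v)\<bar> \<le> B" for v by (rule B[OF interp_in_C01])
  qed
  from LIMSEQ_D[OF this, of "e/3"] e obtain i0 where i0: "\<And>i. i \<ge> i0 ==>
     \<bar>(LINT w|M i. \<phi> (interp n (C01_process.skeleton (Y i) n w))) - (LINT w|N. \<phi> (interp n (C01_process.skeleton Z n w)))\<bar> < e / 3" by auto
  have "\<bar>(LINT w|M i. \<phi> (path01 (Y i) w)) - (LINT w|N. \<phi> (path01 Z w))\<bar> < e" if "i \<ge> i0" for i
    using skeleton_error[OF process_Y[of i] L L0 B, of n] skeleton_error[OF process_Z L L0 B, of n] n i0[OF that] by linarith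
  then show "\<exists>no. \<forall>i\<ge>no. norm ((LINT w|M i. \<phi> (path01 (Y i) w)) - (LINT w|N. \<phi> (path01 Z w))) < e" by auto
qed

text \<open>The inf-convolutions \<open>\<Phi> k x\<close>, the infima over \<open>y\<close> of \<open>\<phi> y + (k + 1) * d x y\<close>, are Lipschitz, bounded and increase to \<open>\<phi>\<close>. They are
below \<open>\<phi>\<close>, so the convergence for Lipschitz functions gives the lower bound.\<close>
lemma lower_semicontinuity:
  assumes \<phi>: "continuous_map (mtopology_of C01) euclideanreal \<phi>" and B: "\<And>x. x \<in> mspace C01 ==> \<bar>\<phi> x\<bar> \<le> (B::real)"
    and e: "0 < e"
  shows "\<forall>\<^sub>F i in sequentially. (LINT w|M i. \<phi> (path01 (Y i) w)) > (LINT w|N. \<phi> (path01 Z w)) - e"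
proof -
  \<comment> \<open>The slope is \<open>k + 1\<close> rather than \<open>k\<close> so that each \<open>\<Phi> k\<close> has a positive Lipschitz constant.\<close>
  define \<Phi> where "\<Phi> k x = (INF y\<in>mspace C01. \<phi> y + real (Suc k) * mdist C01 x y)" for k x
  have ne: "mspace C01 \<noteq> {}" using interp_in_C01 by blast
  have lb: "- B \<le> \<phi> y + real (Suc k) * mdist C01 x y" if "y \<in> mspace C01" for x y k
    using B[OF that] C01.nonneg[of x y] by (smt (verit) mult_nonneg_nonneg of_nat_0_le_iff)
  have bdd: "bdd_below ((\<lambda>y. \<phi> y + real (Suc k) * mdist C01 x y) ` mspace C01)" for k x
    by (rule bdd_belowI2[of _ "- B"]) (rule lb)
  have \<Phi>_le: "\<Phi> k x \<le> \<phi> x" if "x \<in> mspace C01" for k x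
    using cINF_lower[OF bdd that, of k x] that by (simp add: \<Phi>_def)
  have \<Phi>_ge: "- B \<le> \<Phi> k x" for k x unfolding \<Phi>_def using ne lb by (intro cINF_greatest) auto
  have \<Phi>_bd: "\<bar>\<Phi> k x\<bar> \<le> B" if "x \<in> mspace C01" for k x
    using \<Phi>_le[OF that, of k] \<Phi>_ge[of k x] B[OF that] by linarith
  have one: "\<Phi> k x \<le> \<Phi> k z + real (Suc k) * mdist C01 x z" if "x \<in> mspace C01" "z \<in> mspace C01" for k x z
  proof -
    have "\<Phi> k x - real (Suc k) * mdist C01 x z \<le> \<Phi> k z" unfolding \<Phi>_def[of k z]
    proof (rule cINF_greatest[OF ne])
      fix y assume y: "y \<in> mspace C01"
      have "\<Phi> k x \<le> \<phi> y + real (Suc k) * mdist C01 x y" unfolding \<Phi>_def by (rule cINF_lower[OF bdd y])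
      also have "... \<le> \<phi> y + real (Suc k) * (mdist C01 x z + mdist C01 z y)"
        using C01.triangle[OF that y] by (intro add_left_mono mult_left_mono) auto
      finally show "\<Phi> k x - real (Suc k) * mdist C01 x z \<le> \<phi> y + real (Suc k) * mdist C01 z y" by (simp add: algebra_simps)
    qed
    then show ?thesis by linarith
  qed
  have Lip: "\<bar>\<Phi> k x - \<Phi> k z\<bar> \<le> real (Suc k) * mdist C01 x z" if "x \<in> mspace C01" "z \<in> mspace C01" for k x z
    using one[OF that, of k] one[OF that(2,1), of k] C01.commute[of x z] by (simp add: abs_le_iff)
  have lim: "(\<lambda>k. \<Phi> k x) \<longlonglongrightarrow> \<phi> x" if x: "x \<in> mspace C01" for x
  proof (rule LIMSEQ_I)
    fix r :: real assume r: "0 < r"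
    have "openin (mtopology_of C01) {y \<in> topspace (mtopology_of C01). \<phi> y \<in> {\<phi> x - r/2<..}}"
      using \<phi> by (intro openin_continuous_map_preimage) auto
    moreover have "x \<in> {y \<in> topspace (mtopology_of C01). \<phi> y \<in> {\<phi> x - r/2<..}}" using x r by simp
    ultimately obtain d where d: "0 < d" "C01.mball x d \<subseteq> {y \<in> topspace (mtopology_of C01). \<phi> y \<in> {\<phi> x - r/2<..}}"
      unfolding mtopology_of_def C01.openin_mtopology by blast
    obtain k0 :: nat where k0: "2 * B / d < real k0" using reals_Archimedean2 by blast
    have "\<bar>\<Phi> k x - \<phi> x\<bar> < r" if k: "k \<ge> k0" for k
    proof -
      have "\<phi> x - r/2 \<le> \<Phi> k x" unfolding \<Phi>_def
      proof (rule cINF_greatest[OF ne])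
        fix y assume y: "y \<in> mspace C01"
        show "\<phi> x - r/2 \<le> \<phi> y + real (Suc k) * mdist C01 x y"
        proof (cases "mdist C01 x y < d")
          case True
          then have "\<phi> x - r/2 < \<phi> y" using d(2) x y by auto
          moreover have "0 \<le> real (Suc k) * mdist C01 x y" by simp
          ultimately show ?thesis by linarith
        next
          case False
          have "2 * B < real k0 * d" using k0 d(1) by (simp add: field_simps)
          also have "... \<le> real (Suc k) * mdist C01 x y" using False k d(1) by (intro mult_mono) auto
          finally show ?thesis using B[OF x] B[OF y] r by linarith
        qed
      qed
      then show ?thesis using \<Phi>_le[OF x, of k] r by linarith
    qed
    then show "\<exists>no. \<forall>k\<ge>no. norm (\<Phi> k x - \<phi> x) < r" by auto
  qed
  have cont: "continuous_map (mtopology_of C01) euclideanreal (\<Phi> k)" for k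
    by (rule Lipschitz_continuous_map[OF Lip]) auto
  have "(\<lambda>k. LINT w|N. \<Phi> k (path01 Z w)) \<longlonglongrightarrow> (LINT w|N. \<phi> (path01 Z w))"
  proof (rule integral_dominated_convergence)
    show "(\<lambda>w. \<phi> (path01 Z w)) \<in> borel_measurable N"
      by (rule borel_measurable_integrable[OF integrable_functional[OF prob_Z C01_Z \<phi> B]])
    show "(\<lambda>w. \<Phi> k (path01 Z w)) \<in> borel_measurable N" for k
      by (rule borel_measurable_integrable[OF integrable_functional[OF prob_Z C01_Z cont \<Phi>_bd]])
    show "integrable N (\<lambda>w. B)" using prob_Z by (simp add: prob_space.finite_measure finite_measure.integrable_const)
    show "AE w in N. (\<lambda>k. \<Phi> k (path01 Z w)) \<longlonglongrightarrow> \<phi> (path01 Z w)"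
      by (rule AE_I2) (rule lim[OF C01_process.path_in_C01[OF C01_Z]])
    show "AE w in N. norm (\<Phi> k (path01 Z w)) \<le> B" for k
      by (rule AE_I2) (use \<Phi>_bd[OF C01_process.path_in_C01[OF C01_Z]] in simp)
  qed
  from LIMSEQ_D[OF this, of "e/2"] e obtain k where
    k: "\<bar>(LINT w|N. \<Phi> k (path01 Z w)) - (LINT w|N. \<phi> (path01 Z w))\<bar> < e / 2" by auto
  have "(\<lambda>i. LINT w|M i. \<Phi> k (path01 (Y i) w)) \<longlonglongrightarrow> (LINT w|N. \<Phi> k (path01 Z w))"
    by (rule Lipschitz_convergence[OF Lip _ \<Phi>_bd]) auto
  moreover have "(LINT w|N. \<phi> (path01 Z w)) - e < (LINT w|N. \<Phi> k (path01 Z w))" using k e by linarith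
  ultimately have "\<forall>\<^sub>F i in sequentially. (LINT w|N. \<phi> (path01 Z w)) - e < (LINT w|M i. \<Phi> k (path01 (Y i) w))"
    by (rule order_tendstoD(1))
  then show ?thesis
  proof eventually_elim
    case (elim i)
    have "(LINT w|M i. \<Phi> k (path01 (Y i) w)) \<le> (LINT w|M i. \<phi> (path01 (Y i) w))"
      by (rule integral_mono[OF integrable_functional[OF prob_Y C01_Y cont \<Phi>_bd] integrable_functional[OF prob_Y C01_Y \<phi> B]])
         (auto intro: \<Phi>_le C01_process.path_in_C01[OF C01_Y])
    then show ?case using elim by linarith
  qed
qed

text \<open>Apply the lower bound to \<open>\<phi>\<close> and to \<open>- \<phi>\<close>.\<close>
theorem weak_convergence:
  assumes \<phi>: "continuous_map (mtopology_of C01) euclideanreal \<phi>" and bd: "bounded (\<phi> ` mspace C01)"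
  shows "(\<lambda>i. LINT w|M i. \<phi> (path01 (Y i) w)) \<longlonglongrightarrow> (LINT w|N. \<phi> (path01 Z w))"
proof -
  obtain B where B: "\<And>x. x \<in> mspace C01 ==> \<bar>\<phi> x\<bar> \<le> B" using bd unfolding bounded_iff by auto
  have \<phi>': "continuous_map (mtopology_of C01) euclideanreal (\<lambda>x. - \<phi> x)"
    using \<phi> by (rule continuous_map_minus)
  show ?thesis
  proof (rule order_tendstoI)
    fix a assume "a < (LINT w|N. \<phi> (path01 Z w))"
    then show "\<forall>\<^sub>F i in sequentially. a < (LINT w|M i. \<phi> (path01 (Y i) w))"
      using lower_semicontinuity[OF \<phi> B, of "(LINT w|N. \<phi> (path01 Z w)) - a"] by simp
  next
    fix a assume a: "(LINT w|N. \<phi> (path01 Z w)) < a"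
    have "\<forall>\<^sub>F i in sequentially. (LINT w|M i. - \<phi> (path01 (Y i) w)) > (LINT w|N. - \<phi> (path01 Z w)) - (a - (LINT w|N. \<phi> (path01 Z w)))"
      by (rule lower_semicontinuity[OF \<phi>', of B]) (use B a in auto)
    then show "\<forall>\<^sub>F i in sequentially. (LINT w|M i. \<phi> (path01 (Y i) w)) < a" by simp
  qed
qed

end

section \<open>Truncated Toeplitz kernels\<close>

definition win :: "real => real => real" where
  "win c u = (if 0 \<le> u \<and> u \<le> c then 1 else 0)"

lemma measurable_win [measurable]: "win c \<in> borel_measurable borel"
  unfolding win_def[abs_def] by measurable

lemma win_bounds: "0 \<le> win c u" "win c u \<le> 1" "\<bar>win c u\<bar> \<le> 1" "win c u * win c u = win c u"
  by (auto simp: win_def)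

lemma win_mult: "s \<le> t ==> win t u * win s u = win s u"
  by (auto simp: win_def)

text \<open>Lebesgue measure on \<open>{0..T}\<close>, as a finite measure on the whole line: it serves as the index measure of the
Gaussian field, whose index space is the whole type.\<close>
definition window :: "real => real measure" where
  "window T = density lborel (\<lambda>x. ennreal (win T x))"

lemma space_window [simp]: "space (window T) = UNIV" by (simp add: window_def)

lemma sets_window [simp, measurable_cong]: "sets (window T) = sets borel" by (simp add: window_def)

lemma nn_integral_window:
  assumes [measurable]: "h \<in> borel_measurable borel"
  shows "(\<integral>\<^sup>+x. h x \<partial>window T) = (\<integral>\<^sup>+x. ennreal (win T x) * h x \<partial>lborel)"
  unfolding window_def by (rule nn_integral_density) measurable

lemma integral_window:
  fixes h :: "real => real"
  assumes [measurable]: "h \<in> borel_measurable borel"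
  shows "(LINT x|window T. h x) = (LBINT x. win T x * h x)"
  unfolding window_def by (subst integral_density) (auto simp: win_bounds)

lemma emeasure_window: "emeasure (window T) UNIV = ennreal T"
proof -
  have "emeasure (window T) UNIV = (\<integral>\<^sup>+x. 1 \<partial>window T)" by simp
  also have "... = (\<integral>\<^sup>+x. indicator {0..T} x \<partial>lborel)"
    unfolding nn_integral_window[OF borel_measurable_const] by (intro nn_integral_cong) (auto simp: win_def indicator_def)
  also have "... = ennreal T" by (cases "0 \<le> T") (auto simp: ennreal_neg)
  finally show ?thesis .
qed

lemma finite_window: "finite_measure (window T)"
  by (rule finite_measureI) (simp add: emeasure_window)

lemma bounded_kernel_windowI:
  assumes "(\<lambda>x. A (fst x) (snd x)) \<in> borel_measurable (borel \<Otimes>\<^sub>M borel)" "\<And>u v. \<bar>A u v\<bar> \<le> C"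
  shows "bounded_kernel (window T) A"
proof -
  have "sets (window T \<Otimes>\<^sub>M window T) = sets (borel \<Otimes>\<^sub>M (borel :: real measure))"
    by (intro sets_pair_measure_cong) auto
  then have "borel_measurable (window T \<Otimes>\<^sub>M window T) = (borel_measurable (borel \<Otimes>\<^sub>M borel) :: (real \<times> real => real) set)"
    by (intro measurable_cong_sets) auto
  then show ?thesis using assms unfolding bounded_kernel_def case_prod_beta' by auto
qed

lemma norm2_eq_nn_integral:
  assumes "finite_measure \<mu>" and A: "bounded_kernel \<mu> A"
  shows "ennreal (norm2 \<mu> A) = (\<integral>\<^sup>+u. (\<integral>\<^sup>+v. ennreal ((A u v)^2) \<partial>\<mu>) \<partial>\<mu>)"
proof -
  interpret finite_measure \<mu> by fact
  note sq = bounded_kernel_power2[OF A]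
  have "(\<integral>\<^sup>+u. (\<integral>\<^sup>+v. ennreal ((A u v)^2) \<partial>\<mu>) \<partial>\<mu>) = (\<integral>\<^sup>+u. ennreal (LINT v|\<mu>. (A u v)^2) \<partial>\<mu>)"
    by (intro nn_integral_cong nn_integral_eq_integral bounded_kernel_section(1)[OF sq]) auto
  also have "... = ennreal (norm2 \<mu> A)" unfolding norm2_def
    by (intro nn_integral_eq_integral bounded_kernel_integral[OF sq]) auto
  finally show ?thesis by simp
qed

text \<open>Bounds on Hilbert-Schmidt norms are computed as nonnegative integrals, where the order of integration can be changed
freely.\<close>
lemma norm2_window_le:
  assumes A: "bounded_kernel (window T) A" and c: "0 \<le> c"
    and m: "(\<lambda>x. B (fst x) (snd x)) \<in> borel_measurable (borel \<Otimes>\<^sub>M borel)"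
    and AB: "\<And>u v. (A u v)^2 \<le> B u v"
    and B: "(\<integral>\<^sup>+u. ennreal (win T u) * (\<integral>\<^sup>+v. ennreal (win T v) * ennreal (B u v) \<partial>lborel) \<partial>lborel) \<le> ennreal c"
  shows "norm2 (window T) A \<le> c"
proof -
  have [measurable]: "(\<lambda>x. B (fst x) (snd x)) \<in> borel_measurable (borel \<Otimes>\<^sub>M borel)" by (rule m)
  have [measurable]: "B u \<in> borel_measurable borel" for u using measurable_compose[OF measurable_Pair1'[of u borel borel] m] by simp
  have "ennreal (norm2 (window T) A) \<le> (\<integral>\<^sup>+u. (\<integral>\<^sup>+v. ennreal (B u v) \<partial>window T) \<partial>window T)"
    unfolding norm2_eq_nn_integral[OF finite_window A] by (intro nn_integral_mono ennreal_leI AB)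
  also have "... = (\<integral>\<^sup>+u. (\<integral>\<^sup>+v. ennreal (win T v) * ennreal (B u v) \<partial>lborel) \<partial>window T)"
    by (intro nn_integral_cong nn_integral_window) measurable
  also have "... = (\<integral>\<^sup>+u. ennreal (win T u) * (\<integral>\<^sup>+v. ennreal (win T v) * ennreal (B u v) \<partial>lborel) \<partial>lborel)"
    by (rule nn_integral_window) measurable
  finally have "ennreal (norm2 (window T) A) \<le> ennreal c" using B by (rule order_trans)
  then show ?thesis using c by (simp add: ennreal_le_iff)
qed

context Toeplitz_pair begin

text \<open>The covariance kernel.\<close>
definition R :: "real => real => real" where "R u v = r (u - v)"

text \<open>The kernel of the Toeplitz functional at time \<open>t\<close>.\<close>
definition block :: "real => real => real => real => real" where
  "block T t u v = win (T * t) u * win (T * t) v * a (u - v)"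

text \<open>The composition of \<open>block\<close> with the covariance kernel.\<close>
definition trunc :: "real => real => real => real => real" where
  "trunc T t u v = win (T * t) u * (LBINT w. win (T * t) w * (a (u - w) * r (w - v)))"

lemma block_bound: "\<bar>block T t u v\<bar> \<le> (LBINT x. \<bar>g x\<bar>)"
proof -
  have "\<bar>block T t u v\<bar> \<le> \<bar>a (u - v)\<bar>" by (auto simp: block_def win_def)
  then show ?thesis using a_bound[of "u - v"] by linarith
qed

lemma meas_block: "(\<lambda>x. block T t (fst x) (snd x)) \<in> borel_measurable (borel \<Otimes>\<^sub>M borel)"
  unfolding block_def by measurable

lemma bounded_kernel_block: "bounded_kernel (window T') (block T t)"
  by (rule bounded_kernel_windowI[OF meas_block block_bound])

lemma bounded_kernel_R: "bounded_kernel (window T) R"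
proof (rule bounded_kernel_windowI)
  show "(\<lambda>x. R (fst x) (snd x)) \<in> borel_measurable (borel \<Otimes>\<^sub>M borel)" unfolding R_def by measurable
  show "\<bar>R u v\<bar> \<le> (LBINT x. \<bar>f x\<bar>)" for u v unfolding R_def by (rule r_bound)
qed

lemma H_shift_integrand: "integrable lborel (\<lambda>w. \<bar>a (u - w)\<bar> * \<bar>r (w - v)\<bar>)"
  and H_shift: "(LBINT w. \<bar>a (u - w)\<bar> * \<bar>r (w - v)\<bar>) = H (u - v)"
proof -
  have "\<bar>r (u - v - (u - w))\<bar> = \<bar>r (w - v)\<bar>" for w by (simp add: algebra_simps)
  then have e: "\<bar>a (u + -1 * w)\<bar> * \<bar>r (u - v - (u + -1 * w))\<bar> = \<bar>a (u - w)\<bar> * \<bar>r (w - v)\<bar>" for w by simp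
  show "integrable lborel (\<lambda>w. \<bar>a (u - w)\<bar> * \<bar>r (w - v)\<bar>)"
    using lborel_integrable_real_affine[OF H_integrand[of "u - v"], of "-1" u] unfolding e by simp
  show "(LBINT w. \<bar>a (u - w)\<bar> * \<bar>r (w - v)\<bar>) = H (u - v)"
    using lborel_integral_real_affine[of "-1" "\<lambda>s. \<bar>a s\<bar> * \<bar>r (u - v - s)\<bar>" u] unfolding e by (simp add: H_def)
qed

lemma trunc_integrand: "integrable lborel (\<lambda>w. win c w * (a (u - w) * r (w - v)))"
  by (rule Bochner_Integration.integrable_bound[OF H_shift_integrand[of u v]]) (auto simp: win_def abs_mult)

lemma trunc_bound: "\<bar>trunc T t u v\<bar> \<le> H (u - v)"
proof -
  have "\<bar>trunc T t u v\<bar> \<le> \<bar>\<integral>w. win (T * t) w * (a (u - w) * r (w - v)) \<partial>lborel\<bar>"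
    by (auto simp: trunc_def win_def)
  also have "... \<le> (LBINT w. \<bar>win (T * t) w * (a (u - w) * r (w - v))\<bar>)" by (rule integral_abs_bound)
  also have "... \<le> (LBINT w. \<bar>a (u - w)\<bar> * \<bar>r (w - v)\<bar>)"
    by (intro integral_mono integrable_abs trunc_integrand H_shift_integrand) (auto simp: win_def abs_mult)
  finally show ?thesis by (simp add: H_shift)
qed

lemma comp_block:
  assumes "0 \<le> T" "t \<le> 1"
  shows "kernel_comp (window T) (block T t) R u v = trunc T t u v"
proof -
  have Tt: "T * t \<le> T" using assms mult_left_le by blast
  have "kernel_comp (window T) (block T t) R u v = (LBINT w. win T w * (block T t u w * R w v))"
    unfolding kernel_comp_def block_def R_def by (rule integral_window) measurable
  also have "... = (LBINT w. win (T * t) u * (win (T * t) w * (a (u - w) * r (w - v))))"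
  proof (rule Bochner_Integration.integral_cong[OF refl])
    fix w
    have "win T w * (block T t u w * R w v) = (win T w * win (T * t) w) * (win (T * t) u * (a (u - w) * r (w - v)))"
      by (simp add: block_def R_def mult_ac)
    also have "win T w * win (T * t) w = win (T * t) w" by (rule win_mult[OF Tt])
    finally show "win T w * (block T t u w * R w v) = win (T * t) u * (win (T * t) w * (a (u - w) * r (w - v)))" by (simp add: mult_ac)
  qed
  finally show ?thesis by (simp add: trunc_def)
qed

lemma bounded_kernel_trunc:
  assumes "0 \<le> T" "t \<le> 1" shows "bounded_kernel (window T) (trunc T t)"
proof -
  interpret finite_measure "window T" by (rule finite_window)
  have "trunc T t = kernel_comp (window T) (block T t) R" using comp_block[OF assms] by (intro ext) simp
  then show ?thesis using bounded_kernel_compose[OF bounded_kernel_block bounded_kernel_R] by simp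
qed

text \<open>A point \<open>T * x\<close> in the interior of the window moves infinitely far away from both ends of the window, so that the truncation
disappears in the limit.\<close>
lemma trunc_limit:
  assumes T: "filterlim T at_top sequentially" and x: "0 < x" "x < s"
  shows "(\<lambda>n. \<integral>z. win (T n * s) (T n * x - b - z) * (a z * r (y - z)) \<partial>lborel) \<longlonglongrightarrow> conv y"
  unfolding conv_def
proof (rule integral_dominated_convergence[where w = "\<lambda>z. \<bar>a z\<bar> * \<bar>r (y - z)\<bar>"])
  show "AE z in lborel. (\<lambda>n. win (T n * s) (T n * x - b - z) * (a z * r (y - z))) \<longlonglongrightarrow> a z * r (y - z)"
  proof (rule AE_I2)
    fix z
    have "\<forall>\<^sub>F n in sequentially. T n > \<bar>b + z\<bar> / x" "\<forall>\<^sub>F n in sequentially. T n > \<bar>b + z\<bar> / (s - x)"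
      using T unfolding filterlim_at_top_dense by auto
    then have "\<forall>\<^sub>F n in sequentially. win (T n * s) (T n * x - b - z) * (a z * r (y - z)) = a z * r (y - z)"
    proof eventually_elim
      case (elim n)
      then have "\<bar>b + z\<bar> < T n * x" "\<bar>b + z\<bar> < T n * (s - x)" using x by (auto simp: field_simps)
      then have "0 \<le> T n * x - b - z" "T n * x - b - z \<le> T n * s" unfolding right_diff_distrib by linarith+
      then show ?case by (simp add: win_def)
    qed
    then show "(\<lambda>n. win (T n * s) (T n * x - b - z) * (a z * r (y - z))) \<longlonglongrightarrow> a z * r (y - z)" by (rule tendsto_eventually)
  qed
qed (use H_integrand in \<open>auto simp: win_def abs_mult\<close>)

lemma trunc_shift: "trunc T t (z0 - b) v = win (T * t) (z0 - b) * (LBINT z. win (T * t) (z0 - b - z) * (a z * r (z0 - b - v - z)))"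
proof -
  have "(LBINT w. win (T * t) w * (a (z0 - b - w) * r (w - v))) =
     (LBINT z. win (T * t) (z0 - b + -1 * z) * (a (z0 - b - (z0 - b + -1 * z)) * r (z0 - b + -1 * z - v)))"
    using lborel_integral_real_affine[of "-1" "\<lambda>w. win (T * t) w * (a (z0 - b - w) * r (w - v))" "z0 - b"] by simp
  also have "... = (LBINT z. win (T * t) (z0 - b - z) * (a z * r (z0 - b - v - z)))"
    by (rule Bochner_Integration.integral_cong) (auto simp: algebra_simps)
  finally show ?thesis by (simp add: trunc_def)
qed

lemma meas_trunc [measurable]: "(\<lambda>x. trunc T t (fst x) (snd x)) \<in> borel_measurable (borel \<Otimes>\<^sub>M borel)"
  unfolding trunc_def by measurable

lemma meas_trunc' [measurable (raw)]:
  assumes "f1 \<in> borel_measurable N" "f2 \<in> borel_measurable N"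
  shows "(\<lambda>x. trunc T t (f1 x) (f2 x)) \<in> borel_measurable N"
  using measurable_compose[OF measurable_Pair[OF assms] meas_trunc] by simp

text \<open>Substitute \<open>u = T * x\<close> and \<open>v = u - y\<close>: the macroscopic variable \<open>x\<close> ranges over the unit interval and the microscopic
variable \<open>y\<close> over the line.\<close>
lemma trace_trunc_scaled:
  assumes T: "0 < T"
  shows "trace_pair (window T) (trunc T s) (trunc T t) / T =
    (LBINT x. win 1 x * (LBINT y. win T (T * x - y) * (trunc T s (T * x) (T * x - y) * trunc T t (T * x - y) (T * x))))"
proof -
  have "trace_pair (window T) (trunc T s) (trunc T t) = (LINT u|window T. (LBINT v. win T v * (trunc T s u v * trunc T t v u)))"
    unfolding trace_pair_def by (intro Bochner_Integration.integral_cong refl integral_window) measurable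
  also have "... = (LBINT u. win T u * (LBINT v. win T v * (trunc T s u v * trunc T t v u)))"
    by (rule integral_window) measurable
  also have "... = T * (LBINT x. win T (T * x) * (LBINT v. win T v * (trunc T s (T * x) v * trunc T t v (T * x))))"
    using lborel_integral_real_affine[of T "\<lambda>u. win T u * (LBINT v. win T v * (trunc T s u v * trunc T t v u))" 0] T by simp
  also have "(LBINT x. win T (T * x) * (LBINT v. win T v * (trunc T s (T * x) v * trunc T t v (T * x)))) =
    (LBINT x. win 1 x * (LBINT y. win T (T * x - y) * (trunc T s (T * x) (T * x - y) * trunc T t (T * x - y) (T * x))))"
  proof (rule Bochner_Integration.integral_cong[OF refl])
    fix x
    have "win T (T * x) = win 1 x" using T by (auto simp: win_def zero_le_mult_iff)
    moreover have "(LBINT v. win T v * (trunc T s (T * x) v * trunc T t v (T * x))) =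
      (LBINT y. win T (T * x - y) * (trunc T s (T * x) (T * x - y) * trunc T t (T * x - y) (T * x)))"
      using lborel_integral_real_affine[of "-1" "\<lambda>v. win T v * (trunc T s (T * x) v * trunc T t v (T * x))" "T * x"] by simp
    ultimately show "win T (T * x) * (LBINT v. win T v * (trunc T s (T * x) v * trunc T t v (T * x))) =
      win 1 x * (LBINT y. win T (T * x - y) * (trunc T s (T * x) (T * x - y) * trunc T t (T * x - y) (T * x)))" by simp
  qed
  finally show ?thesis using T by simp
qed

definition conv_energy :: real where "conv_energy = (LBINT y. (conv y)^2)"

text \<open>In the rescaled integral the integrand is dominated by \<open>(H y)\<^sup>2\<close>. For \<open>x < min s t\<close> it converges to
\<open>conv y * conv (- y)\<close>, and for \<open>x > min s t\<close> one of the factors vanishes eventually.\<close>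
lemma trace_trunc_tendsto:
  assumes T: "filterlim T at_top sequentially" "\<And>n. 0 < T n" and st: "0 \<le> s" "s \<le> 1" "0 \<le> t" "t \<le> 1"
  shows "(\<lambda>n. trace_pair (window (T n)) (trunc (T n) s) (trunc (T n) t) / T n) \<longlonglongrightarrow> min s t * conv_energy"
proof -
  define F where "F n x y = win (T n) (T n * x - y) * (trunc (T n) s (T n * x) (T n * x - y) * trunc (T n) t (T n * x - y) (T n * x))" for n x y
  have F_meas: "(\<lambda>x. F n (fst x) (snd x)) \<in> borel_measurable (borel \<Otimes>\<^sub>M borel)" for n unfolding F_def by measurable
  have F_meas': "F n x \<in> borel_measurable borel" for n x unfolding F_def by measurable
  have F_bound: "\<bar>F n x y\<bar> \<le> (H y)^2" for n x y
  proof -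
    have "\<bar>F n x y\<bar> \<le> \<bar>trunc (T n) s (T n * x) (T n * x - y)\<bar> * \<bar>trunc (T n) t (T n * x - y) (T n * x)\<bar>"
      by (auto simp: F_def win_def abs_mult)
    also have "... \<le> H (T n * x - (T n * x - y)) * H (T n * x - y - T n * x)"
      by (intro mult_mono trunc_bound H_nonneg) auto
    also have "... = (H y)^2" using H_even[of y] by (simp add: power2_eq_square)
    finally show ?thesis .
  qed
  have inner: "(\<lambda>n. \<integral>y. F n x y \<partial>lborel) \<longlonglongrightarrow> (if x < s \<and> x < t then conv_energy else 0)" if x: "0 < x" "x < 1" "x \<noteq> s" "x \<noteq> t" for x
  proof -
    have "(\<lambda>n. \<integral>y. F n x y \<partial>lborel) \<longlonglongrightarrow> (LBINT y. (if x < s \<and> x < t then (conv y)^2 else 0))"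
    proof (rule integral_dominated_convergence[where w = "\<lambda>y. (H y)^2"])
      show "AE y in lborel. (\<lambda>n. F n x y) \<longlonglongrightarrow> (if x < s \<and> x < t then (conv y)^2 else 0)"
      proof (rule AE_I2)
        fix y
        show "(\<lambda>n. F n x y) \<longlonglongrightarrow> (if x < s \<and> x < t then (conv y)^2 else 0)"
        proof (cases "x < s \<and> x < t")
          case True
          define c1 where "c1 n = (LBINT z. win (T n * s) (T n * x - 0 - z) * (a z * r (y - z)))" for n
          define c2 where "c2 n = (LBINT z. win (T n * t) (T n * x - y - z) * (a z * r (- y - z)))" for n
          have l1: "c1 \<longlonglongrightarrow> conv y" unfolding c1_def by (rule trunc_limit[OF T(1) x(1)]) (use True in auto)
          have l2: "c2 \<longlonglongrightarrow> conv (- y)" unfolding c2_def by (rule trunc_limit[OF T(1) x(1)]) (use True in auto)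
          have "\<forall>\<^sub>F n in sequentially. T n > \<bar>y\<bar> / x" "\<forall>\<^sub>F n in sequentially. T n > \<bar>y\<bar> / (t - x)" "\<forall>\<^sub>F n in sequentially. T n > \<bar>y\<bar> / (1 - x)"
            using T unfolding filterlim_at_top_dense by auto
          then have "\<forall>\<^sub>F n in sequentially. c1 n * c2 n = F n x y"
          proof eventually_elim
            case (elim n)
            then have b: "\<bar>y\<bar> < T n * x" "\<bar>y\<bar> < T n * (t - x)" "\<bar>y\<bar> < T n * (1 - x)" using x True by (auto simp: field_simps)
            have "0 \<le> T n * x - y" "T n * x - y \<le> T n * t" "T n * x - y \<le> T n * 1"
              using b unfolding right_diff_distrib by linarith+
            moreover have "0 \<le> T n * x" "T n * x \<le> T n * s" using T(2)[of n] x True by auto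
            ultimately have w: "win (T n) (T n * x - y) = 1" "win (T n * t) (T n * x - y) = 1" "win (T n * s) (T n * x - 0) = 1" by (auto simp: win_def)
            show ?case using trunc_shift[of "T n" s "T n * x" 0 "T n * x - y"] trunc_shift[of "T n" t "T n * x" y "T n * x"] w
              by (simp add: F_def c1_def c2_def)
          qed
          moreover have "(\<lambda>n. c1 n * c2 n) \<longlonglongrightarrow> conv y * conv (- y)" by (rule tendsto_mult[OF l1 l2])
          ultimately show ?thesis using True by (auto intro: Lim_transform_eventually simp: conv_even power2_eq_square)
        next
          case False
          then have "s < x \<or> t < x" using x by linarith
          then have "\<forall>\<^sub>F n in sequentially. F n x y = 0"
          proof
            assume "s < x"
            then have "T n * s < T n * x" for n using T(2)[of n] by simp
            then have "win (T n * s) (T n * x) = 0" for n by (auto simp: win_def not_le)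
            then show ?thesis by (simp add: F_def trunc_def)
          next
            assume tx: "t < x"
            have "\<forall>\<^sub>F n in sequentially. T n > \<bar>y\<bar> / (x - t)" using T unfolding filterlim_at_top_dense by auto
            then show ?thesis
            proof eventually_elim
              case (elim n)
              then have "\<bar>y\<bar> < T n * (x - t)" using tx by (simp add: field_simps)
              then have "T n * t < T n * x - y" unfolding right_diff_distrib by linarith
              then have "win (T n * t) (T n * x - y) = 0" by (auto simp: win_def)
              then show ?case by (simp add: F_def trunc_def)
            qed
          qed
          then show ?thesis unfolding if_not_P[OF False] by (rule tendsto_eventually)
        qed
      qed
      show "(\<lambda>y. if x < s \<and> x < t then (conv y)^2 else 0) \<in> borel_measurable lborel" unfolding conv_def by measurable
      show "AE y in lborel. norm (F n x y) \<le> (H y)^2" for n using F_bound by simp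
      show "F n x \<in> borel_measurable lborel" for n using F_meas' by simp
    qed (rule H_square_integrable)
    also have "(LBINT y. (if x < s \<and> x < t then (conv y)^2 else 0)) = (if x < s \<and> x < t then conv_energy else 0)"
    proof (cases "x < s \<and> x < t")
      case True show ?thesis unfolding if_P[OF True] conv_energy_def by (rule refl)
    next
      case False show ?thesis unfolding if_not_P[OF False] by simp
    qed
    finally show ?thesis .
  qed
  have lim: "(\<lambda>n. \<integral>x. win 1 x * (LBINT y. F n x y) \<partial>lborel) \<longlonglongrightarrow> (LBINT x. win (min s t) x * conv_energy)"
  proof (rule integral_dominated_convergence[where w = "\<lambda>x. win 1 x * H_energy"])
    show "(\<lambda>x. win 1 x * (LBINT y. F n x y)) \<in> borel_measurable lborel" for n
      using F_meas[of n] by (intro borel_measurable_times) (auto intro!: lborel.borel_measurable_lebesgue_integral simp: case_prod_beta')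
    have "integrable lborel (\<lambda>x. indicator {0..1::real} x * H_energy)"
      by (intro integrable_mult_left) simp
    moreover have "indicator {0..1} x = win 1 x" for x by (simp add: win_def indicator_def)
    ultimately show "integrable lborel (\<lambda>x. win 1 x * H_energy)" by simp
    show "AE x in lborel. norm (win 1 x * (LBINT y. F n x y)) \<le> win 1 x * H_energy" for n
    proof (rule AE_I2)
      fix x
      have "\<bar>\<integral>y. F n x y \<partial>lborel\<bar> \<le> H_energy"
      proof -
        have iF: "integrable lborel (F n x)"
          by (rule Bochner_Integration.integrable_bound[OF H_square_integrable]) (use F_meas' F_bound in auto)
        have "\<bar>\<integral>y. F n x y \<partial>lborel\<bar> \<le> (LBINT y. \<bar>F n x y\<bar>)" by (rule integral_abs_bound)
        also have "... \<le> (LBINT y. (H y)^2)" by (intro integral_mono integrable_abs iF H_square_integrable F_bound)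
        finally show ?thesis by (simp add: H_energy_def)
      qed
      then show "norm (win 1 x * (LBINT y. F n x y)) \<le> win 1 x * H_energy"
        by (auto simp: win_def)
    qed
    have ne: "AE x in lborel. x \<noteq> c" for c :: real by (rule AE_lborel_singleton)
    show "AE x in lborel. (\<lambda>n. win 1 x * (LBINT y. F n x y)) \<longlonglongrightarrow> win (min s t) x * conv_energy"
      using ne[of 0] ne[of 1] ne[of s] ne[of t]
    proof eventually_elim
      case (elim x)
      show ?case
      proof (cases "0 < x \<and> x < 1")
        case True
        have "(\<lambda>n. \<integral>y. F n x y \<partial>lborel) \<longlonglongrightarrow> (if x < s \<and> x < t then conv_energy else 0)" using True elim by (intro inner) auto
        moreover have "win 1 x = 1" using True by (simp add: win_def)
        moreover have "win (min s t) x * conv_energy = (if x < s \<and> x < t then conv_energy else 0)"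
          using True elim by (auto simp: win_def)
        ultimately show ?thesis by simp
      next
        case False
        then have "win 1 x = 0" "win (min s t) x = 0" using elim st by (auto simp: win_def)
        then show ?thesis by simp
      qed
    qed
  qed simp
  have rhs: "(LBINT x. win (min s t) x * conv_energy) = min s t * conv_energy"
  proof -
    have "(LBINT x. win (min s t) x * conv_energy) = (LBINT x. indicator {0..min s t} x * conv_energy)"
      by (rule Bochner_Integration.integral_cong) (auto simp: win_def indicator_def)
    then show ?thesis using st by simp
  qed
  have lhs: "trace_pair (window (T n)) (trunc (T n) s) (trunc (T n) t) / T n = (LBINT x. win 1 x * (LBINT y. F n x y))" for n
    unfolding F_def by (rule trace_trunc_scaled[OF T(2)])
  show ?thesis unfolding lhs rhs[symmetric] by (rule lim)
qed

end

section \<open>Linear combinations of truncated kernels\<close>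

lemma integral_double_sum:
  fixes F :: "nat => nat => 'x => real"
  assumes i: "\<And>j k. j \<le> m ==> k \<le> m ==> integrable N (F j k)"
  shows "(LINT x|N. (\<Sum>j\<le>m. \<Sum>k\<le>m. c j k * F j k x)) = (\<Sum>j\<le>m. \<Sum>k\<le>m. c j k * (LINT x|N. F j k x))"
proof -
  have i1: "integrable N (\<lambda>x. c j k * F j k x)" if "j \<in> {..m}" "k \<in> {..m}" for j k
    using i[of j k] that by simp
  have "(LINT x|N. (\<Sum>j\<le>m. \<Sum>k\<le>m. c j k * F j k x)) = (\<Sum>j\<le>m. \<integral>x. (\<Sum>k\<le>m. c j k * F j k x) \<partial>N)"
    by (rule Bochner_Integration.integral_sum, rule Bochner_Integration.integrable_sum, rule i1)
  also have "... = (\<Sum>j\<le>m. \<Sum>k\<le>m. c j k * (LINT x|N. F j k x))"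
  proof (rule sum.cong[OF refl])
    fix j assume j: "j \<in> {..m}"
    have "(LINT x|N. (\<Sum>k\<le>m. c j k * F j k x)) = (\<Sum>k\<le>m. \<integral>x. c j k * F j k x \<partial>N)"
      by (rule Bochner_Integration.integral_sum, rule i1[OF j])
    then show "(LINT x|N. (\<Sum>k\<le>m. c j k * F j k x)) = (\<Sum>k\<le>m. c j k * (LINT x|N. F j k x))"
      by (simp only: integral_mult_right_zero)
  qed
  finally show ?thesis .
qed

context Toeplitz_pair begin

text \<open>The kernel of a linear combination of normalized functionals at the times \<open>\<tau> k\<close>.\<close>
definition combo :: "real => nat => (nat => real) => (nat => real) => real => real => real" where
  "combo T m e \<tau> u v = T powr (- 1 / 2) * (\<Sum>k\<le>m. e k * block T (\<tau> k) u v)"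

text \<open>The composition of \<open>combo\<close> with the covariance kernel.\<close>
definition combo_cov :: "real => nat => (nat => real) => (nat => real) => real => real => real" where
  "combo_cov T m e \<tau> u v = T powr (- 1 / 2) * (\<Sum>k\<le>m. e k * trunc T (\<tau> k) u v)"

lemma combo_sym: "combo T m e \<tau> u v = combo T m e \<tau> v u"
proof -
  have "a (v - u) = a (u - v)" using a_even[of "u - v"] by simp
  then have "block T t v u = block T t u v" for t unfolding block_def by (simp only: mult_ac)
  then show ?thesis unfolding combo_def by simp
qed

lemma bounded_kernel_combo: "bounded_kernel (window T) (combo T m e \<tau>)"
proof (rule bounded_kernel_windowI)
  show "(\<lambda>x. combo T m e \<tau> (fst x) (snd x)) \<in> borel_measurable (borel \<Otimes>\<^sub>M borel)"
    unfolding combo_def using meas_block by measurable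
  fix u v
  have "\<bar>\<Sum>k\<le>m. e k * block T (\<tau> k) u v\<bar> \<le> (\<Sum>k\<le>m. \<bar>e k\<bar> * (LBINT x. \<bar>g x\<bar>))"
    by (rule order_trans[OF sum_abs]) (auto intro!: sum_mono mult_left_mono block_bound simp: abs_mult)
  then show "\<bar>combo T m e \<tau> u v\<bar> \<le> T powr (- 1 / 2) * (\<Sum>k\<le>m. \<bar>e k\<bar> * (LBINT x. \<bar>g x\<bar>))"
    unfolding combo_def abs_mult by (auto intro!: mult_left_mono)
qed

lemma kernel_comp_combo:
  assumes T: "0 \<le> T" and \<tau>: "\<And>k. k \<le> m ==> \<tau> k \<le> 1"
  shows "kernel_comp (window T) (combo T m e \<tau>) R = combo_cov T m e \<tau>"
proof (intro ext)
  fix u v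
  interpret finite_measure "window T" by (rule finite_window)
  obtain C1 C2 where C: "\<And>u v. \<bar>R u v\<bar> \<le> C2" using bounded_kernel_R[of T] unfolding bounded_kernel_def by blast
  have int: "integrable (window T) (\<lambda>w. block T t u w * R w v)" for t
  proof (rule bounded_integrable)
    show "(\<lambda>w. block T t u w * R w v) \<in> borel_measurable (window T)" unfolding block_def R_def by measurable
    show "\<bar>block T t u w * R w v\<bar> \<le> (LBINT x. \<bar>g x\<bar>) * C2" for w
      unfolding abs_mult by (intro mult_mono block_bound C) auto
  qed
  have "kernel_comp (window T) (combo T m e \<tau>) R u v =
     (LINT w|window T. T powr (- 1 / 2) * (\<Sum>k\<le>m. e k * (block T (\<tau> k) u w * R w v)))"
    unfolding kernel_comp_def combo_def by (simp add: sum_distrib_right mult.assoc)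
  also have "... = T powr (- 1 / 2) * (\<Sum>k\<le>m. e k * (LINT w|window T. block T (\<tau> k) u w * R w v))"
    using int by simp
  also have "(\<Sum>k\<le>m. e k * (LINT w|window T. block T (\<tau> k) u w * R w v)) = (\<Sum>k\<le>m. e k * trunc T (\<tau> k) u v)"
    by (intro sum.cong refl) (use comp_block[OF T \<tau>] in \<open>simp add: kernel_comp_def\<close>)
  finally show "kernel_comp (window T) (combo T m e \<tau>) R u v = combo_cov T m e \<tau> u v" by (simp add: combo_cov_def)
qed

lemma powr_half_square: "0 < T ==> (T powr (- 1 / 2))^2 = 1 / (T :: real)"
  by (simp add: power2_eq_square powr_add[symmetric] powr_minus_divide)

lemma bounded_kernel_combo_cov:
  assumes "0 \<le> T" "\<And>k. k \<le> m ==> \<tau> k \<le> 1"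
  shows "bounded_kernel (window T) (combo_cov T m e \<tau>)"
proof -
  interpret finite_measure "window T" by (rule finite_window)
  have "bounded_kernel (window T) (kernel_comp (window T) (combo T m e \<tau>) R)"
    by (rule bounded_kernel_compose[OF bounded_kernel_combo bounded_kernel_R])
  moreover have "kernel_comp (window T) (combo T m e \<tau>) R = combo_cov T m e \<tau>"
    by (rule kernel_comp_combo) (use assms in auto)
  ultimately show ?thesis by (simp only:)
qed

lemma combo_cov_bound: "\<bar>combo_cov T m e \<tau> u v\<bar> \<le> T powr (- 1 / 2) * ((\<Sum>k\<le>m. \<bar>e k\<bar>) * H (u - v))"
proof -
  have "\<bar>\<Sum>k\<le>m. e k * trunc T (\<tau> k) u v\<bar> \<le> (\<Sum>k\<le>m. \<bar>e k\<bar> * H (u - v))"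
    by (rule order_trans[OF sum_abs]) (auto intro!: sum_mono mult_left_mono trunc_bound simp: abs_mult)
  then show ?thesis unfolding combo_cov_def abs_mult by (auto intro!: mult_left_mono simp: sum_distrib_right)
qed

lemma trace_combo:
  assumes T: "0 < T" and \<tau>: "\<And>k. k \<le> m ==> \<tau> k \<le> 1"
  shows "trace_pair (window T) (combo_cov T m e \<tau>) (combo_cov T m e \<tau>) =
    (\<Sum>j\<le>m. \<Sum>k\<le>m. e j * e k * (trace_pair (window T) (trunc T (\<tau> j)) (trunc T (\<tau> k)) / T))"
proof -
  interpret finite_measure "window T" by (rule finite_window)
  have bk: "bounded_kernel (window T) (\<lambda>u v. trunc T (\<tau> j) u v * trunc T (\<tau> k) v u)" if "j \<le> m" "k \<le> m" for j k
    by (rule bounded_kernel_mult[OF bounded_kernel_trunc bounded_kernel_swap[OF bounded_kernel_trunc]]) (use T \<tau> that in auto)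
  have "combo_cov T m e \<tau> u v * combo_cov T m e \<tau> v u =
     (\<Sum>j\<le>m. \<Sum>k\<le>m. (e j * e k / T) * (trunc T (\<tau> j) u v * trunc T (\<tau> k) v u))" for u v
  proof -
    have "combo_cov T m e \<tau> u v * combo_cov T m e \<tau> v u =
      (T powr (- 1 / 2))^2 * ((\<Sum>k\<le>m. e k * trunc T (\<tau> k) u v) * (\<Sum>k\<le>m. e k * trunc T (\<tau> k) v u))"
      unfolding combo_cov_def power2_eq_square by (simp only: mult_ac)
    also have "... = (\<Sum>j\<le>m. \<Sum>k\<le>m. (e j * e k / T) * (trunc T (\<tau> j) u v * trunc T (\<tau> k) v u))"
    proof -
      have e: "1 / T * (x * y * (z * w)) = (x * z / T) * (y * w)" for x y z w :: real by simp
      show ?thesis unfolding powr_half_square[OF T] sum_product unfolding sum_distrib_left e by (rule refl)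
    qed
    finally show ?thesis .
  qed
  then have "trace_pair (window T) (combo_cov T m e \<tau>) (combo_cov T m e \<tau>) =
    (LINT u|window T. (LINT v|window T. (\<Sum>j\<le>m. \<Sum>k\<le>m. (e j * e k / T) * (trunc T (\<tau> j) u v * trunc T (\<tau> k) v u))))"
    unfolding trace_pair_def by (simp only:)
  also have "... = (LINT u|window T. (\<Sum>j\<le>m. \<Sum>k\<le>m. (e j * e k / T) * (LINT v|window T. trunc T (\<tau> j) u v * trunc T (\<tau> k) v u)))"
    by (rule Bochner_Integration.integral_cong[OF refl], rule integral_double_sum, rule bounded_kernel_section(1)[OF bk])
  also have "... = (\<Sum>j\<le>m. \<Sum>k\<le>m. (e j * e k / T) * (LINT u|window T. (LINT v|window T. trunc T (\<tau> j) u v * trunc T (\<tau> k) v u)))"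
    by (rule integral_double_sum, rule bounded_kernel_integral[OF bk])
  finally show ?thesis unfolding trace_pair_def by (simp only: times_divide_eq_left times_divide_eq_right)
qed

lemma trace_combo_tendsto:
  assumes T: "filterlim T at_top sequentially" "\<And>n. 0 < T n" and \<tau>: "\<And>k. k \<le> m ==> 0 \<le> \<tau> k \<and> \<tau> k \<le> 1"
  shows "(\<lambda>n. trace_pair (window (T n)) (combo_cov (T n) m e \<tau>) (combo_cov (T n) m e \<tau>)) \<longlonglongrightarrow>
    (\<Sum>j\<le>m. \<Sum>k\<le>m. e j * e k * (min (\<tau> j) (\<tau> k) * conv_energy))"
proof -
  have "(\<lambda>n. \<Sum>j\<le>m. \<Sum>k\<le>m. e j * e k * (trace_pair (window (T n)) (trunc (T n) (\<tau> j)) (trunc (T n) (\<tau> k)) / T n)) \<longlonglongrightarrow>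
    (\<Sum>j\<le>m. \<Sum>k\<le>m. e j * e k * (min (\<tau> j) (\<tau> k) * conv_energy))"
    by (rule tendsto_sum, rule tendsto_sum, rule tendsto_mult[OF tendsto_const], rule trace_trunc_tendsto[OF T]) (use \<tau> in auto)
  moreover have "trace_pair (window (T n)) (combo_cov (T n) m e \<tau>) (combo_cov (T n) m e \<tau>) =
    (\<Sum>j\<le>m. \<Sum>k\<le>m. e j * e k * (trace_pair (window (T n)) (trunc (T n) (\<tau> j)) (trunc (T n) (\<tau> k)) / T n))" for n
    by (rule trace_combo[OF T(2)]) (use \<tau> in auto)
  ultimately show ?thesis by (simp only:)
qed

lemma nn_integral_H_square: "(\<integral>\<^sup>+v. ennreal ((H (u - v))^2) \<partial>lborel) = ennreal H_energy"
proof -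
  have "(\<integral>\<^sup>+v. ennreal ((H (u - v))^2) \<partial>lborel) = (\<integral>\<^sup>+v. ennreal ((H v)^2) \<partial>lborel)"
    by (rule nn_integral_reflect) measurable
  also have "... = ennreal H_energy" unfolding H_energy_def
    by (rule nn_integral_eq_integral[OF H_square_integrable]) simp
  finally show ?thesis .
qed

lemma nn_integral_win: "0 \<le> T ==> (\<integral>\<^sup>+u. ennreal (win T u) \<partial>lborel) = ennreal T"
  using emeasure_window[of T] nn_integral_window[of "\<lambda>_. 1" T] by simp

text \<open>The normalization \<open>1 / T\<close> compensates the length of the window in the one direction in which \<open>H (u - v)\<close> is not
square integrable.\<close>
lemma norm2_combo_cov:
  assumes T: "0 < T" and \<tau>: "\<And>k. k \<le> m ==> \<tau> k \<le> 1"
  shows "norm2 (window T) (combo_cov T m e \<tau>) \<le> (\<Sum>k\<le>m. \<bar>e k\<bar>)^2 * H_energy"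
proof (rule norm2_window_le)
  define E where "E = (\<Sum>k\<le>m. \<bar>e k\<bar>)"
  show "bounded_kernel (window T) (combo_cov T m e \<tau>)" using T \<tau> by (intro bounded_kernel_combo_cov) auto
  show "0 \<le> (\<Sum>k\<le>m. \<bar>e k\<bar>)^2 * H_energy" using H_energy_nonneg by simp
  show "(\<lambda>x. E\<^sup>2 / T * (H (fst x - snd x))^2) \<in> borel_measurable (borel \<Otimes>\<^sub>M borel)" by measurable
  show "(combo_cov T m e \<tau> u v)^2 \<le> E\<^sup>2 / T * (H (u - v))^2" for u v
  proof -
    have "(combo_cov T m e \<tau> u v)^2 \<le> (T powr (- 1 / 2) * (E * H (u - v)))^2"
      using power_mono[OF combo_cov_bound[of T m e \<tau> u v], of 2] by (simp add: E_def)
    then show ?thesis using powr_half_square[OF T] by (simp add: power_mult_distrib)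
  qed
  have "(\<integral>\<^sup>+u. ennreal (win T u) * (\<integral>\<^sup>+v. ennreal (win T v) * ennreal (E\<^sup>2 / T * (H (u - v))^2) \<partial>lborel) \<partial>lborel)
     \<le> (\<integral>\<^sup>+u. ennreal (win T u) * (\<integral>\<^sup>+v. ennreal (E\<^sup>2 / T) * ennreal ((H (u - v))^2) \<partial>lborel) \<partial>lborel)"
  proof (intro nn_integral_mono mult_left_mono)
    fix u v
    have "ennreal (win T v) * ennreal (E\<^sup>2 / T * (H (u - v))^2) \<le> ennreal (E\<^sup>2 / T * (H (u - v))^2)" by (simp add: win_def)
    also have "... = ennreal (E\<^sup>2 / T) * ennreal ((H (u - v))^2)" using T by (intro ennreal_mult) auto
    finally show "ennreal (win T v) * ennreal (E\<^sup>2 / T * (H (u - v))^2) \<le> ennreal (E\<^sup>2 / T) * ennreal ((H (u - v))^2)" .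
  qed simp
  also have "... = (\<integral>\<^sup>+u. ennreal (win T u) * (ennreal (E\<^sup>2 / T) * ennreal H_energy) \<partial>lborel)"
    by (subst nn_integral_cmult) (auto simp: nn_integral_H_square)
  also have "... = ennreal T * (ennreal (E\<^sup>2 / T) * ennreal H_energy)"
    using T by (subst nn_integral_multc) (auto simp: nn_integral_win)
  also have "... = ennreal (E\<^sup>2 * H_energy)"
    using T H_energy_nonneg by (simp add: ennreal_mult[symmetric])
  finally show "(\<integral>\<^sup>+u. ennreal (win T u) * (\<integral>\<^sup>+v. ennreal (win T v) * ennreal (E\<^sup>2 / T * (H (u - v))^2) \<partial>lborel) \<partial>lborel)
     \<le> ennreal ((\<Sum>k\<le>m. \<bar>e k\<bar>)^2 * H_energy)" by (simp add: E_def)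
qed

lemma J_shift_integrand: "integrable lborel (\<lambda>w. H (u - w) * H (w - v))"
  and J_shift: "(LBINT w. H (u - w) * H (w - v)) = J (u - v)"
proof -
  have e: "H (u + -1 * w) * H (u - v - (u + -1 * w)) = H (u - w) * H (w - v)" for w by (simp add: algebra_simps)
  show "integrable lborel (\<lambda>w. H (u - w) * H (w - v))"
    using lborel_integrable_real_affine[OF J_integrand[of "u - v"], of "-1" u] unfolding e by simp
  show "(LBINT w. H (u - w) * H (w - v)) = J (u - v)"
    using lborel_integral_real_affine[of "-1" "\<lambda>s. H s * H (u - v - s)" u] unfolding e by (simp add: J_def)
qed

lemma combo_cov_comp_bound:
  assumes T: "0 < T" and \<tau>: "\<And>k. k \<le> m ==> \<tau> k \<le> 1"
  shows "\<bar>kernel_comp (window T) (combo_cov T m e \<tau>) (combo_cov T m e \<tau>) u v\<bar> \<le> (\<Sum>k\<le>m. \<bar>e k\<bar>)^2 / T * J (u - v)"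
proof -
  define E where "E = (\<Sum>k\<le>m. \<bar>e k\<bar>)"
  let ?K = "combo_cov T m e \<tau>"
  have [measurable]: "(\<lambda>w. ?K u w) \<in> borel_measurable borel" "(\<lambda>w. ?K w v) \<in> borel_measurable borel"
    unfolding combo_cov_def by measurable
  have b: "\<bar>win T w * (?K u w * ?K w v)\<bar> \<le> E\<^sup>2 / T * (H (u - w) * H (w - v))" for w
  proof -
    have "\<bar>win T w * (?K u w * ?K w v)\<bar> \<le> \<bar>?K u w\<bar> * \<bar>?K w v\<bar>" by (auto simp: win_def abs_mult)
    also have "... \<le> (T powr (- 1 / 2) * (E * H (u - w))) * (T powr (- 1 / 2) * (E * H (w - v)))"
      unfolding E_def by (intro mult_mono combo_cov_bound mult_nonneg_nonneg H_nonneg sum_nonneg) auto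
    also have "... = (T powr (- 1 / 2))^2 * (E\<^sup>2 * (H (u - w) * H (w - v)))" unfolding power2_eq_square by (simp only: mult_ac)
    also have "... = E\<^sup>2 / T * (H (u - w) * H (w - v))" unfolding powr_half_square[OF T] by simp
    finally show ?thesis .
  qed
  have dom: "integrable lborel (\<lambda>w. E\<^sup>2 / T * (H (u - w) * H (w - v)))" using J_shift_integrand by simp
  have i: "integrable lborel (\<lambda>w. win T w * (?K u w * ?K w v))"
  proof (rule Bochner_Integration.integrable_bound[OF dom])
    show "AE w in lborel. norm (win T w * (?K u w * ?K w v)) \<le> norm (E\<^sup>2 / T * (H (u - w) * H (w - v)))"
      by (intro AE_I2) (unfold real_norm_def, rule order_trans[OF b abs_ge_self])
  qed measurable
  have "\<bar>kernel_comp (window T) ?K ?K u v\<bar> = \<bar>\<integral>w. win T w * (?K u w * ?K w v) \<partial>lborel\<bar>"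
    unfolding kernel_comp_def by (subst integral_window) auto
  also have "... \<le> (LBINT w. \<bar>win T w * (?K u w * ?K w v)\<bar>)" by (rule integral_abs_bound)
  also have "... \<le> (LBINT w. E\<^sup>2 / T * (H (u - w) * H (w - v)))" by (intro integral_mono integrable_abs i dom b)
  also have "... = E\<^sup>2 / T * J (u - v)" by (simp only: integral_mult_right_zero J_shift)
  finally show ?thesis by (simp add: E_def)
qed

text \<open>The squared Hilbert-Schmidt norm of the square of the composed kernel, in rescaled coordinates and up to a
constant.\<close>
definition J_mean :: "real => real" where
  "J_mean T = norm2 (window 1) (\<lambda>x y. J (T * (x - y)))"

lemma bounded_kernel_J: "bounded_kernel (window 1) (\<lambda>x y. J (T * (x - y)))"
proof (rule bounded_kernel_windowI)
  show "(\<lambda>x. J (T * (fst x - snd x))) \<in> borel_measurable (borel \<Otimes>\<^sub>M borel)" by measurable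
  show "\<bar>J (T * (u - v))\<bar> \<le> H_energy" for u v using J_bound J_nonneg by simp
qed

text \<open>Off the diagonal \<open>T * (x - y)\<close> tends to infinity, where \<open>J\<close> vanishes; boundedness of \<open>J\<close> permits dominated
convergence.\<close>
lemma J_mean_tendsto:
  assumes T: "filterlim T at_top sequentially" "\<And>n. 0 < T n"
  shows "(\<lambda>n. J_mean (T n)) \<longlonglongrightarrow> 0"
proof -
  interpret finite_measure "window 1" by (rule finite_window)
  have sq: "\<bar>(J t)^2\<bar> \<le> H_energy\<^sup>2" for t using J_bound[of t] J_nonneg[of t] by (simp add: power_mono)
  have m: "(\<lambda>x. (J (T n * (fst x - snd x)))^2) \<in> borel_measurable (borel \<Otimes>\<^sub>M borel)" for n by measurable
  have ne: "AE y in window 1. y \<noteq> x" for x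
    unfolding window_def by (subst AE_density) (use AE_lborel_singleton[of x] in auto)
  have inner: "(\<lambda>n. \<integral>y. (J (T n * (x - y)))^2 \<partial>window 1) \<longlonglongrightarrow> (LINT y|window 1. 0)" for x
  proof (rule integral_dominated_convergence[where w = "\<lambda>_. H_energy\<^sup>2"])
    show "AE y in window 1. (\<lambda>n. (J (T n * (x - y)))^2) \<longlonglongrightarrow> 0" using ne[of x]
    proof eventually_elim
      case (elim y)
      have "filterlim (\<lambda>n. \<bar>T n * (x - y)\<bar>) at_top sequentially"
      proof -
        have "filterlim (\<lambda>n. \<bar>x - y\<bar> * T n) at_top sequentially"
          using elim by (intro filterlim_tendsto_pos_mult_at_top[OF tendsto_const _ T(1)]) auto
        moreover have "\<bar>x - y\<bar> * T n = \<bar>T n * (x - y)\<bar>" for n using T(2)[of n] by (simp add: abs_mult mult.commute)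
        ultimately show ?thesis by simp
      qed
      from tendsto_power[OF J_tendsto_zero[OF this], of 2] show ?case by simp
    qed
  qed (use sq in auto)
  have "(\<lambda>n. \<integral>x. (LINT y|window 1. (J (T n * (x - y)))^2) \<partial>window 1) \<longlonglongrightarrow> (LINT x|window 1. 0)"
  proof (rule integral_dominated_convergence[where w = "\<lambda>_. H_energy\<^sup>2 * measure (window 1) UNIV"])
    show "AE x in window 1. (\<lambda>n. \<integral>y. (J (T n * (x - y)))^2 \<partial>window 1) \<longlonglongrightarrow> 0" using inner by simp
    show "(\<lambda>x. \<integral>y. (J (T n * (x - y)))^2 \<partial>window 1) \<in> borel_measurable (window 1)" for n
      using bounded_kernel_integral[OF bounded_kernel_power2[OF bounded_kernel_J]] by (rule borel_measurable_integrable)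
    show "AE x in window 1. norm (LINT y|window 1. (J (T n * (x - y)))^2) \<le> H_energy\<^sup>2 * measure (window 1) UNIV" for n
    proof (rule AE_I2)
      fix x
      have "(LINT y|window 1. (J (T n * (x - y)))^2) \<le> (LINT y|window 1. H_energy\<^sup>2)"
        using sq bounded_kernel_section(1)[OF bounded_kernel_power2[OF bounded_kernel_J], of x] by (intro integral_mono) auto
      then show "norm (LINT y|window 1. (J (T n * (x - y)))^2) \<le> H_energy\<^sup>2 * measure (window 1) UNIV"
        by (simp add: mult.commute)
    qed
  qed auto
  then show ?thesis by (simp add: J_mean_def norm2_def)
qed

lemma norm2_combo_cov_comp:
  assumes T: "0 < T" and \<tau>: "\<And>k. k \<le> m ==> \<tau> k \<le> 1"
  shows "norm2 (window T) (kernel_comp (window T) (combo_cov T m e \<tau>) (combo_cov T m e \<tau>)) \<le> (\<Sum>k\<le>m. \<bar>e k\<bar>) ^ 4 * J_mean T"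
proof (rule norm2_window_le)
  define E where "E = (\<Sum>k\<le>m. \<bar>e k\<bar>)"
  interpret finite_measure "window T" by (rule finite_window)
  show "bounded_kernel (window T) (kernel_comp (window T) (combo_cov T m e \<tau>) (combo_cov T m e \<tau>))"
    using T \<tau> by (intro bounded_kernel_compose bounded_kernel_combo_cov) auto
  show "0 \<le> (\<Sum>k\<le>m. \<bar>e k\<bar>) ^ 4 * J_mean T" by (simp add: J_mean_def norm2_nonneg)
  show "(\<lambda>x. E ^ 4 / T\<^sup>2 * (J (fst x - snd x))^2) \<in> borel_measurable (borel \<Otimes>\<^sub>M borel)" by measurable
  show "(kernel_comp (window T) (combo_cov T m e \<tau>) (combo_cov T m e \<tau>) u v)^2 \<le> E ^ 4 / T\<^sup>2 * (J (u - v))^2" for u v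
  proof -
    have "\<bar>kernel_comp (window T) (combo_cov T m e \<tau>) (combo_cov T m e \<tau>) u v\<bar> \<le> E\<^sup>2 / T * J (u - v)"
      unfolding E_def by (rule combo_cov_comp_bound[OF T \<tau>])
    from power_mono[OF this, of 2] have "(kernel_comp (window T) (combo_cov T m e \<tau>) (combo_cov T m e \<tau>) u v)^2 \<le> (E\<^sup>2 / T * J (u - v))^2"
      by simp
    then show ?thesis by (simp add: power_mult_distrib power_divide power_mult[symmetric])
  qed
  have "(\<integral>\<^sup>+u. ennreal (win T u) * (\<integral>\<^sup>+v. ennreal (win T v) * ennreal (E ^ 4 / T\<^sup>2 * (J (u - v))^2) \<partial>lborel) \<partial>lborel)
    = ennreal T * (\<integral>\<^sup>+x. ennreal (win T (0 + T * x)) * (\<integral>\<^sup>+v. ennreal (win T v) * ennreal (E ^ 4 / T\<^sup>2 * (J (0 + T * x - v))^2) \<partial>lborel) \<partial>lborel)"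
    using T by (subst nn_integral_real_affine[of _ T 0]) (auto simp: nn_integral_cmult)
  also have "... = ennreal T * (\<integral>\<^sup>+x. ennreal (win 1 x) * (ennreal (E ^ 4 / T) * (\<integral>\<^sup>+y. ennreal (win 1 y) * ennreal ((J (T * (x - y)))^2) \<partial>lborel)) \<partial>lborel)"
  proof (intro arg_cong[where f = "\<lambda>z. ennreal T * z"] nn_integral_cong)
    fix x
    have w: "win T (0 + T * x) = win 1 x" for x using T by (auto simp: win_def zero_le_mult_iff)
    have "(\<integral>\<^sup>+v. ennreal (win T v) * ennreal (E ^ 4 / T\<^sup>2 * (J (0 + T * x - v))^2) \<partial>lborel) =
      ennreal T * (\<integral>\<^sup>+y. ennreal (win T (0 + T * y)) * ennreal (E ^ 4 / T\<^sup>2 * (J (0 + T * x - (0 + T * y)))^2) \<partial>lborel)"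
      using T by (subst nn_integral_real_affine[of _ T 0]) (auto simp: nn_integral_cmult)
    also have "... = (\<integral>\<^sup>+y. ennreal T * (ennreal (win T (0 + T * y)) * ennreal (E ^ 4 / T\<^sup>2 * (J (0 + T * x - (0 + T * y)))^2)) \<partial>lborel)"
      by (rule nn_integral_cmult[symmetric]) measurable
    also have "... = (\<integral>\<^sup>+y. ennreal (E ^ 4 / T) * (ennreal (win 1 y) * ennreal ((J (T * (x - y)))^2)) \<partial>lborel)"
    proof (rule nn_integral_cong)
      fix y
      have "T * (win 1 y * (E ^ 4 / T\<^sup>2 * (J (T * (x - y)))^2)) = E ^ 4 / T * (win 1 y * (J (T * (x - y)))^2)"
        using T by (simp add: power2_eq_square)
      then show "ennreal T * (ennreal (win T (0 + T * y)) * ennreal (E ^ 4 / T\<^sup>2 * (J (0 + T * x - (0 + T * y)))^2)) =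
        ennreal (E ^ 4 / T) * (ennreal (win 1 y) * ennreal ((J (T * (x - y)))^2))"
        unfolding w using T by (simp add: ennreal_mult[symmetric] win_bounds right_diff_distrib)
    qed
    also have "... = ennreal (E ^ 4 / T) * (\<integral>\<^sup>+y. ennreal (win 1 y) * ennreal ((J (T * (x - y)))^2) \<partial>lborel)"
      by (rule nn_integral_cmult) measurable
    finally show "ennreal (win T (0 + T * x)) * (\<integral>\<^sup>+v. ennreal (win T v) * ennreal (E ^ 4 / T\<^sup>2 * (J (0 + T * x - v))^2) \<partial>lborel)
      = ennreal (win 1 x) * (ennreal (E ^ 4 / T) * (\<integral>\<^sup>+y. ennreal (win 1 y) * ennreal ((J (T * (x - y)))^2) \<partial>lborel))"
      by (simp only: w)
  qed
  also have "... = ennreal T * (ennreal (E ^ 4 / T) * (\<integral>\<^sup>+x. ennreal (win 1 x) * (\<integral>\<^sup>+y. ennreal (win 1 y) * ennreal ((J (T * (x - y)))^2) \<partial>lborel) \<partial>lborel))"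
    by (subst nn_integral_cmult[symmetric], measurable) (simp add: mult.left_commute)
  also have "(\<integral>\<^sup>+x. ennreal (win 1 x) * (\<integral>\<^sup>+y. ennreal (win 1 y) * ennreal ((J (T * (x - y)))^2) \<partial>lborel) \<partial>lborel) = ennreal (J_mean T)"
  proof -
    have "ennreal (J_mean T) = (\<integral>\<^sup>+x. (\<integral>\<^sup>+y. ennreal ((J (T * (x - y)))^2) \<partial>window 1) \<partial>window 1)"
      unfolding J_mean_def by (rule norm2_eq_nn_integral[OF finite_window bounded_kernel_J])
    also have "... = (\<integral>\<^sup>+x. (\<integral>\<^sup>+y. ennreal (win 1 y) * ennreal ((J (T * (x - y)))^2) \<partial>lborel) \<partial>window 1)"
      by (intro nn_integral_cong nn_integral_window) measurable
    also have "... = (\<integral>\<^sup>+x. ennreal (win 1 x) * (\<integral>\<^sup>+y. ennreal (win 1 y) * ennreal ((J (T * (x - y)))^2) \<partial>lborel) \<partial>lborel)"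
      by (rule nn_integral_window) measurable
    finally show ?thesis by simp
  qed
  also have "ennreal T * (ennreal (E ^ 4 / T) * ennreal (J_mean T)) = ennreal (E ^ 4 * J_mean T)"
    using T by (simp add: ennreal_mult[symmetric] J_mean_def norm2_nonneg)
  finally show "(\<integral>\<^sup>+u. ennreal (win T u) * (\<integral>\<^sup>+v. ennreal (win T v) * ennreal (E ^ 4 / T\<^sup>2 * (J (u - v))^2) \<partial>lborel) \<partial>lborel)
     \<le> ennreal ((\<Sum>k\<le>m. \<bar>e k\<bar>) ^ 4 * J_mean T)" by (simp add: E_def)
qed

end

section \<open>Kernels of increments\<close>

context Toeplitz_pair begin

text \<open>Integrating one of the two copies of \<open>H (u - v)\<close> as a chain \<open>u, w, v\<close> with \<open>w\<close> held fixed still gives the full energy, by translation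
invariance. It follows that restricting the intermediate point \<open>w\<close> to a set multiplies the energy by the measure of the
set.\<close>
lemma energy_through:
  "(\<integral>\<^sup>+u. (\<integral>\<^sup>+v. ennreal (\<bar>a (u - w)\<bar> * \<bar>r (w - v)\<bar>) * ennreal (H (u - v)) \<partial>lborel) \<partial>lborel) = ennreal H_energy"
proof -
  have "(\<integral>\<^sup>+u. (\<integral>\<^sup>+v. ennreal (\<bar>a (u - w)\<bar> * \<bar>r (w - v)\<bar>) * ennreal (H (u - v)) \<partial>lborel) \<partial>lborel)
    = (\<integral>\<^sup>+u. (\<integral>\<^sup>+x. ennreal (\<bar>a (u - w)\<bar> * \<bar>r (w - (u - x))\<bar>) * ennreal (H (u - (u - x))) \<partial>lborel) \<partial>lborel)"
    by (intro nn_integral_cong nn_integral_reflect[symmetric]) measurable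
  also have "... = (\<integral>\<^sup>+u. (\<integral>\<^sup>+x. ennreal (\<bar>a (u + w - w)\<bar> * \<bar>r (w - (u + w - x))\<bar>) * ennreal (H (u + w - (u + w - x))) \<partial>lborel) \<partial>lborel)"
    by (rule nn_integral_translate[symmetric]) measurable
  also have "... = (\<integral>\<^sup>+u. (\<integral>\<^sup>+x. ennreal (\<bar>a u\<bar> * \<bar>r (x - u)\<bar>) * ennreal (H x) \<partial>lborel) \<partial>lborel)"
    by (simp add: algebra_simps)
  also have "... = (\<integral>\<^sup>+x. (\<integral>\<^sup>+u. ennreal (\<bar>a u\<bar> * \<bar>r (x - u)\<bar>) * ennreal (H x) \<partial>lborel) \<partial>lborel)"
    by (rule lborel_pair.Fubini') measurable
  also have "... = (\<integral>\<^sup>+x. ennreal ((H x)^2) \<partial>lborel)"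
  proof (rule nn_integral_cong)
    fix x
    have "(\<integral>\<^sup>+u. ennreal (\<bar>a u\<bar> * \<bar>r (x - u)\<bar>) * ennreal (H x) \<partial>lborel) = econv a r x * ennreal (H x)"
      unfolding econv_def by (rule nn_integral_multc) measurable
    then show "(\<integral>\<^sup>+u. ennreal (\<bar>a u\<bar> * \<bar>r (x - u)\<bar>) * ennreal (H x) \<partial>lborel) = ennreal ((H x)^2)"
      by (simp add: econv_eq_H ennreal_mult[symmetric] H_nonneg power2_eq_square)
  qed
  also have "... = ennreal H_energy" unfolding H_energy_def
    by (rule nn_integral_eq_integral[OF H_square_integrable]) simp
  finally show ?thesis .
qed

text \<open>The indicator of the interval between \<open>T * s\<close> and \<open>T * t\<close>.\<close>
definition strip :: "real => real => real => real => real" where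
  "strip T s t w = win (T * t) w - win (T * s) w"

text \<open>The part of \<open>H (u - v)\<close> that comes from intermediate points in the strip.\<close>
definition strip_conv :: "real => real => real => real => real => real" where
  "strip_conv T s t u v = (LBINT w. strip T s t w * (\<bar>a (u - w)\<bar> * \<bar>r (w - v)\<bar>))"

lemma meas_strip [measurable]: "strip T s t \<in> borel_measurable borel"
  unfolding strip_def[abs_def] by measurable

lemma strip_01:
  assumes "0 < T" "s \<le> t"
  shows "strip T s t w = 0 \<or> strip T s t w = 1"
proof -
  have "T * s \<le> T * t" using assms by simp
  then show ?thesis by (auto simp: strip_def win_def)
qed

lemma strip_conv_integrand:
  assumes "0 < T" "s \<le> t"
  shows "integrable lborel (\<lambda>w. strip T s t w * (\<bar>a (u - w)\<bar> * \<bar>r (w - v)\<bar>))"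
proof (rule Bochner_Integration.integrable_bound[OF H_shift_integrand[of u v]])
  show "AE w in lborel. norm (strip T s t w * (\<bar>a (u - w)\<bar> * \<bar>r (w - v)\<bar>)) \<le> norm (\<bar>a (u - w)\<bar> * \<bar>r (w - v)\<bar>)"
  proof (rule AE_I2)
    fix w show "norm (strip T s t w * (\<bar>a (u - w)\<bar> * \<bar>r (w - v)\<bar>)) \<le> norm (\<bar>a (u - w)\<bar> * \<bar>r (w - v)\<bar>)"
      using strip_01[OF assms, of w] by (elim disjE) simp_all
  qed
qed measurable

lemma strip_conv_nonneg:
  assumes "0 < T" "s \<le> t" shows "0 \<le> strip_conv T s t u v"
  unfolding strip_conv_def
proof (rule integral_nonneg_AE, rule AE_I2)
  fix w show "0 \<le> strip T s t w * (\<bar>a (u - w)\<bar> * \<bar>r (w - v)\<bar>)"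
    using strip_01[OF assms, of w] by (elim disjE) simp_all
qed

lemma strip_conv_le:
  assumes "0 < T" "s \<le> t" shows "strip_conv T s t u v \<le> H (u - v)"
  unfolding strip_conv_def H_shift[symmetric]
proof (intro integral_mono strip_conv_integrand[OF assms] H_shift_integrand)
  fix w show "strip T s t w * (\<bar>a (u - w)\<bar> * \<bar>r (w - v)\<bar>) \<le> \<bar>a (u - w)\<bar> * \<bar>r (w - v)\<bar>"
    using strip_01[OF assms, of w] by (elim disjE) simp_all
qed

text \<open>The kernel of an increment sees the strip either in its first argument or in the intermediate point.\<close>
lemma trunc_diff_bound:
  assumes "0 < T" "s \<le> t"
  shows "\<bar>trunc T t u v - trunc T s u v\<bar> \<le> strip T s t u * H (u - v) + strip_conv T s t u v"
proof -
  define k where "k w = a (u - w) * r (w - v)" for w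
  define I where "I c = (LBINT w. win c w * k w)" for c
  have i: "integrable lborel (\<lambda>w. win c w * k w)" for c unfolding k_def by (rule trunc_integrand)
  have I: "\<bar>I c\<bar> \<le> H (u - v)" for c
  proof -
    have "\<bar>I c\<bar> \<le> (LBINT w. \<bar>win c w * k w\<bar>)" unfolding I_def by (rule integral_abs_bound)
    also have "... \<le> (LBINT w. \<bar>a (u - w)\<bar> * \<bar>r (w - v)\<bar>)"
      by (intro integral_mono integrable_abs i H_shift_integrand) (auto simp: k_def win_def abs_mult)
    finally show ?thesis by (simp add: H_shift)
  qed
  have D: "\<bar>I (T * t) - I (T * s)\<bar> \<le> strip_conv T s t u v"
  proof -
    have "I (T * t) - I (T * s) = (LBINT w. strip T s t w * k w)"
      unfolding I_def Bochner_Integration.integral_diff[OF i i, symmetric] by (simp add: strip_def left_diff_distrib)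
    also have "\<bar>...\<bar> \<le> (LBINT w. \<bar>strip T s t w * k w\<bar>)" by (rule integral_abs_bound)
    also have "... = strip_conv T s t u v" unfolding strip_conv_def
    proof (rule Bochner_Integration.integral_cong[OF refl])
      fix w show "\<bar>strip T s t w * k w\<bar> = strip T s t w * (\<bar>a (u - w)\<bar> * \<bar>r (w - v)\<bar>)"
        using strip_01[OF assms, of w] by (elim disjE) (simp_all add: k_def abs_mult)
    qed
    finally show ?thesis .
  qed
  have "trunc T t u v - trunc T s u v = strip T s t u * I (T * t) + win (T * s) u * (I (T * t) - I (T * s))"
    unfolding trunc_def strip_def I_def k_def by (simp add: algebra_simps)
  also have "\<bar>...\<bar> \<le> \<bar>strip T s t u * I (T * t)\<bar> + \<bar>win (T * s) u * (I (T * t) - I (T * s))\<bar>" by (rule abs_triangle_ineq)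
  also have "... \<le> strip T s t u * H (u - v) + strip_conv T s t u v"
  proof (rule add_mono)
    show "\<bar>strip T s t u * I (T * t)\<bar> \<le> strip T s t u * H (u - v)"
      using strip_01[OF assms, of u] I[of "T * t"] by (elim disjE) simp_all
    show "\<bar>win (T * s) u * (I (T * t) - I (T * s))\<bar> \<le> strip_conv T s t u v"
      using D strip_conv_nonneg[OF assms, of u v] by (simp add: win_def)
  qed
  finally show ?thesis .
qed

lemma nn_integral_strip:
  assumes "0 < T" "0 \<le> s" "s \<le> t"
  shows "(\<integral>\<^sup>+w. ennreal (strip T s t w) \<partial>lborel) = ennreal (T * (t - s))"
proof -
  have Ts: "0 \<le> T * s" "T * s \<le> T * t" using assms by auto
  have "(\<integral>\<^sup>+w. ennreal (strip T s t w) \<partial>lborel) = (\<integral>\<^sup>+w. indicator {T * s<..T * t} w \<partial>lborel)"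
    by (rule nn_integral_cong) (use Ts in \<open>auto simp: strip_def win_def indicator_def\<close>)
  also have "... = ennreal (T * (t - s))" using Ts by (simp add: right_diff_distrib)
  finally show ?thesis .
qed

lemma meas_strip_conv: "(\<lambda>x. strip_conv T s t (fst x) (snd x)) \<in> borel_measurable (borel \<Otimes>\<^sub>M borel)"
  unfolding strip_conv_def by measurable

lemma strip_conv_energy:
  assumes T: "0 < T" "0 \<le> s" "s \<le> t"
  shows "(\<integral>\<^sup>+u. (\<integral>\<^sup>+v. ennreal (strip_conv T s t u v * H (u - v)) \<partial>lborel) \<partial>lborel) = ennreal (T * (t - s) * H_energy)"
proof -
  define F where "F u v w = ennreal (strip T s t w) * (ennreal (\<bar>a (u - w)\<bar> * \<bar>r (w - v)\<bar>) * ennreal (H (u - v)))" for u v w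
  have s0: "0 \<le> strip T s t w" for w using strip_01[OF T(1,3), of w] by (elim disjE) simp_all
  have "(\<integral>\<^sup>+u. (\<integral>\<^sup>+v. ennreal (strip_conv T s t u v * H (u - v)) \<partial>lborel) \<partial>lborel) =
    (\<integral>\<^sup>+u. (\<integral>\<^sup>+v. (\<integral>\<^sup>+w. F u v w \<partial>lborel) \<partial>lborel) \<partial>lborel)"
  proof (intro nn_integral_cong)
    fix u v
    have "ennreal (strip_conv T s t u v) = (\<integral>\<^sup>+w. ennreal (strip T s t w * (\<bar>a (u - w)\<bar> * \<bar>r (w - v)\<bar>)) \<partial>lborel)"
      unfolding strip_conv_def
      by (rule nn_integral_eq_integral[symmetric, OF strip_conv_integrand[OF T(1,3)]]) (use s0 in auto)
    then have "ennreal (strip_conv T s t u v * H (u - v)) =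
       (\<integral>\<^sup>+w. ennreal (strip T s t w * (\<bar>a (u - w)\<bar> * \<bar>r (w - v)\<bar>)) \<partial>lborel) * ennreal (H (u - v))"
      using strip_conv_nonneg[OF T(1,3), of u v] H_nonneg by (simp add: ennreal_mult)
    also have "... = (\<integral>\<^sup>+w. ennreal (strip T s t w * (\<bar>a (u - w)\<bar> * \<bar>r (w - v)\<bar>)) * ennreal (H (u - v)) \<partial>lborel)"
      by (rule nn_integral_multc[symmetric]) measurable
    also have "... = (\<integral>\<^sup>+w. F u v w \<partial>lborel)"
      unfolding F_def by (rule nn_integral_cong) (simp add: ennreal_mult s0 mult.assoc)
    finally show "ennreal (strip_conv T s t u v * H (u - v)) = (\<integral>\<^sup>+w. F u v w \<partial>lborel)" .
  qed
  also have "... = (\<integral>\<^sup>+u. (\<integral>\<^sup>+w. (\<integral>\<^sup>+v. F u v w \<partial>lborel) \<partial>lborel) \<partial>lborel)"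
    unfolding F_def by (intro nn_integral_cong lborel_pair.Fubini') measurable
  also have "... = (\<integral>\<^sup>+w. (\<integral>\<^sup>+u. (\<integral>\<^sup>+v. F u v w \<partial>lborel) \<partial>lborel) \<partial>lborel)"
    unfolding F_def by (intro lborel_pair.Fubini') measurable
  also have "... = (\<integral>\<^sup>+w. ennreal (strip T s t w) * ennreal H_energy \<partial>lborel)"
  proof (rule nn_integral_cong)
    fix w
    have "(\<integral>\<^sup>+u. (\<integral>\<^sup>+v. F u v w \<partial>lborel) \<partial>lborel) =
      (\<integral>\<^sup>+u. ennreal (strip T s t w) * (\<integral>\<^sup>+v. ennreal (\<bar>a (u - w)\<bar> * \<bar>r (w - v)\<bar>) * ennreal (H (u - v)) \<partial>lborel) \<partial>lborel)"
      unfolding F_def by (intro nn_integral_cong nn_integral_cmult) measurable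
    also have "... = ennreal (strip T s t w) * ennreal H_energy"
      unfolding energy_through[of w, symmetric] by (rule nn_integral_cmult) measurable
    finally show "(\<integral>\<^sup>+u. (\<integral>\<^sup>+v. F u v w \<partial>lborel) \<partial>lborel) = ennreal (strip T s t w) * ennreal H_energy" .
  qed
  also have "... = ennreal (T * (t - s)) * ennreal H_energy"
    unfolding nn_integral_strip[OF T, symmetric] by (rule nn_integral_multc) measurable
  also have "... = ennreal (T * (t - s) * H_energy)" using T H_energy_nonneg by (simp add: ennreal_mult)
  finally show ?thesis .
qed

text \<open>Each of the two terms of the increment kernel has energy proportional to the length \<open>T * (t - s)\<close> of the strip. For the second
term one factor \<open>strip_conv\<close> is estimated by \<open>H\<close>, the other one keeps the restriction of the intermediate point. The
coefficients encode the difference of the values at \<open>t\<close> and at \<open>s\<close>.\<close>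
lemma norm2_increment:
  assumes T: "0 < T" and st: "0 \<le> s" "s \<le> t" "t \<le> 1"
  shows "norm2 (window T) (combo_cov T 1 (\<lambda>k. if k = 0 then 1 else - 1) (\<lambda>k. if k = 0 then t else s)) \<le> 4 * H_energy * (t - s)"
    (is "norm2 _ ?K \<le> _")
proof (rule norm2_window_le)
  define B where "B u v = 2 / T * (strip T s t u * (H (u - v))^2 + strip_conv T s t u v * H (u - v))" for u v
  have s0: "0 \<le> strip T s t w" for w using strip_01[OF T st(2), of w] by (elim disjE) simp_all
  show "bounded_kernel (window T) ?K" using T st by (intro bounded_kernel_combo_cov) auto
  show "0 \<le> 4 * H_energy * (t - s)" using st H_energy_nonneg by simp
  have [measurable]: "(\<lambda>x. strip_conv T s t (fst x) (snd x)) \<in> borel_measurable (borel \<Otimes>\<^sub>M borel)" by (rule meas_strip_conv)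
  have [measurable]: "strip_conv T s t u \<in> borel_measurable borel" for u
    using measurable_compose[OF measurable_Pair1'[of u borel borel] meas_strip_conv] by simp
  show mB: "(\<lambda>x. B (fst x) (snd x)) \<in> borel_measurable (borel \<Otimes>\<^sub>M borel)" unfolding B_def by measurable
  show "(?K u v)^2 \<le> B u v" for u v
  proof -
    define x where "x = strip T s t u * H (u - v)"
    define y where "y = strip_conv T s t u v"
    have y: "0 \<le> y" "y \<le> H (u - v)" unfolding y_def by (rule strip_conv_nonneg[OF T st(2)], rule strip_conv_le[OF T st(2)])
    have x: "0 \<le> x" unfolding x_def using s0 H_nonneg by simp
    have "\<bar>trunc T t u v - trunc T s u v\<bar> \<le> x + y" unfolding x_def y_def by (rule trunc_diff_bound[OF T st(2)])
    from power_mono[OF this, of 2] have "(trunc T t u v - trunc T s u v)^2 \<le> (x + y)^2" by simp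
    also have "... \<le> 2 * (x\<^sup>2 + y\<^sup>2)" using sum_squares_bound[of x y] by (simp add: power2_sum)
    also have "y\<^sup>2 \<le> y * H (u - v)" unfolding power2_eq_square using y by (intro mult_left_mono)
    also have "x\<^sup>2 = strip T s t u * (H (u - v))^2" unfolding x_def power_mult_distrib
      using strip_01[OF T st(2), of u] by (elim disjE) simp_all
    finally have le: "(trunc T t u v - trunc T s u v)^2 \<le> 2 * (strip T s t u * (H (u - v))^2 + y * H (u - v))" by simp
    have "(?K u v)^2 = 1 / T * (trunc T t u v - trunc T s u v)^2"
      unfolding combo_cov_def power_mult_distrib powr_half_square[OF T] by simp
    also have "... \<le> 1 / T * (2 * (strip T s t u * (H (u - v))^2 + y * H (u - v)))"
      using le T by (intro mult_left_mono) auto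
    finally show ?thesis by (simp add: B_def y_def)
  qed
  have "(\<integral>\<^sup>+u. ennreal (win T u) * (\<integral>\<^sup>+v. ennreal (win T v) * ennreal (B u v) \<partial>lborel) \<partial>lborel)
     \<le> (\<integral>\<^sup>+u. (\<integral>\<^sup>+v. ennreal (B u v) \<partial>lborel) \<partial>lborel)"
  proof (rule nn_integral_mono)
    fix u
    have "ennreal (win T u) * (\<integral>\<^sup>+v. ennreal (win T v) * ennreal (B u v) \<partial>lborel) \<le> (\<integral>\<^sup>+v. ennreal (win T v) * ennreal (B u v) \<partial>lborel)"
      by (simp add: win_def)
    also have "... \<le> (\<integral>\<^sup>+v. ennreal (B u v) \<partial>lborel)" by (rule nn_integral_mono) (simp add: win_def)
    finally show "ennreal (win T u) * (\<integral>\<^sup>+v. ennreal (win T v) * ennreal (B u v) \<partial>lborel) \<le> (\<integral>\<^sup>+v. ennreal (B u v) \<partial>lborel)" .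
  qed
  also have "... = (\<integral>\<^sup>+u. ennreal (2 / T) * (ennreal (strip T s t u) * ennreal H_energy +
     (\<integral>\<^sup>+v. ennreal (strip_conv T s t u v * H (u - v)) \<partial>lborel)) \<partial>lborel)"
  proof (rule nn_integral_cong)
    fix u
    have n: "0 \<le> strip_conv T s t u v * H (u - v)" for v using strip_conv_nonneg[OF T st(2)] H_nonneg by simp
    have "(\<integral>\<^sup>+v. ennreal (B u v) \<partial>lborel) = (\<integral>\<^sup>+v. ennreal (2 / T) * (ennreal (strip T s t u) * ennreal ((H (u - v))^2) +
        ennreal (strip_conv T s t u v * H (u - v))) \<partial>lborel)"
      unfolding B_def using T s0 n by (intro nn_integral_cong) (simp add: ennreal_mult[symmetric] ennreal_plus[symmetric] del: ennreal_plus)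
    also have "... = ennreal (2 / T) * (\<integral>\<^sup>+v. (ennreal (strip T s t u) * ennreal ((H (u - v))^2) +
        ennreal (strip_conv T s t u v * H (u - v))) \<partial>lborel)" by (rule nn_integral_cmult) measurable
    also have "(\<integral>\<^sup>+v. (ennreal (strip T s t u) * ennreal ((H (u - v))^2) + ennreal (strip_conv T s t u v * H (u - v))) \<partial>lborel) =
       (\<integral>\<^sup>+v. ennreal (strip T s t u) * ennreal ((H (u - v))^2) \<partial>lborel) + (\<integral>\<^sup>+v. ennreal (strip_conv T s t u v * H (u - v)) \<partial>lborel)"
      by (rule nn_integral_add) measurable
    also have "(\<integral>\<^sup>+v. ennreal (strip T s t u) * ennreal ((H (u - v))^2) \<partial>lborel) = ennreal (strip T s t u) * ennreal H_energy"
      unfolding nn_integral_H_square[of u, symmetric] by (rule nn_integral_cmult) measurable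
    finally show "(\<integral>\<^sup>+v. ennreal (B u v) \<partial>lborel) = ennreal (2 / T) * (ennreal (strip T s t u) * ennreal H_energy +
     (\<integral>\<^sup>+v. ennreal (strip_conv T s t u v * H (u - v)) \<partial>lborel))" .
  qed
  also have "... = ennreal (2 / T) * (\<integral>\<^sup>+u. (ennreal (strip T s t u) * ennreal H_energy +
     (\<integral>\<^sup>+v. ennreal (strip_conv T s t u v * H (u - v)) \<partial>lborel)) \<partial>lborel)" by (rule nn_integral_cmult) measurable
  also have "(\<integral>\<^sup>+u. (ennreal (strip T s t u) * ennreal H_energy + (\<integral>\<^sup>+v. ennreal (strip_conv T s t u v * H (u - v)) \<partial>lborel)) \<partial>lborel)
    = (\<integral>\<^sup>+u. ennreal (strip T s t u) * ennreal H_energy \<partial>lborel) + ennreal (T * (t - s) * H_energy)"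
    unfolding strip_conv_energy[OF T st(1,2), symmetric] by (rule nn_integral_add) measurable
  also have "(\<integral>\<^sup>+u. ennreal (strip T s t u) * ennreal H_energy \<partial>lborel) = ennreal (T * (t - s)) * ennreal H_energy"
    unfolding nn_integral_strip[OF T st(1,2), symmetric] by (rule nn_integral_multc) measurable
  also have "ennreal (2 / T) * (ennreal (T * (t - s)) * ennreal H_energy + ennreal (T * (t - s) * H_energy)) = ennreal (4 * H_energy * (t - s))"
  proof -
    have "ennreal (2 / T) * (ennreal (T * (t - s)) * ennreal H_energy + ennreal (T * (t - s) * H_energy)) =
      ennreal (2 / T * (T * (t - s) * H_energy + T * (t - s) * H_energy))"
      using T st H_energy_nonneg by (simp add: ennreal_mult[symmetric] ennreal_plus[symmetric] del: ennreal_plus)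
    also have "2 / T * (T * (t - s) * H_energy + T * (t - s) * H_energy) = 4 * H_energy * (t - s)"
      using T by (simp add: field_simps)
    finally show ?thesis .
  qed
  finally show "(\<integral>\<^sup>+u. ennreal (win T u) * (\<integral>\<^sup>+v. ennreal (win T v) * ennreal (B u v) \<partial>lborel) \<partial>lborel) \<le> ennreal (4 * H_energy * (t - s))" .
qed

end

section \<open>Normal variables and Brownian motion\<close>

lemma iexp_integral_cong_AE:
  fixes U V :: "'a => real"
  assumes [measurable]: "U \<in> borel_measurable M" "V \<in> borel_measurable M" and e: "AE w in M. U w = V w"
  shows "(LINT w|M. iexp (U w)) = (LINT w|M. iexp (V w))"
proof (rule integral_cong_AE)
  show "AE w in M. iexp (U w) = iexp (V w)" using e by eventually_elim (simp only:)
qed measurable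

lemma (in prob_space) normal_moments:
  assumes Y: "distributed M lborel Y (normal_density 0 s)" and s: "0 < s"
  shows "integrable M (\<lambda>w. \<bar>Y w\<bar> ^ n)" and "expectation (\<lambda>w. Y w ^ n) = gaussian_moment (s\<^sup>2) n"
proof -
  show "integrable M (\<lambda>w. \<bar>Y w\<bar> ^ n)"
    using distributed_integrable[OF Y, of "\<lambda>x. \<bar>x\<bar> ^ n"] integrable_normal_moment_abs[OF s, of 0 n] by simp
  have e: "expectation (\<lambda>w. Y w ^ n) = (LBINT x. normal_density 0 s x * x ^ n)"
    using distributed_integral[OF Y, of "\<lambda>x. x ^ n"] by simp
  show "expectation (\<lambda>w. Y w ^ n) = gaussian_moment (s\<^sup>2) n"
  proof (cases "even n")
    case True
    then obtain k where n: "n = 2 * k" by (rule evenE)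
    have "gaussian_moment (s\<^sup>2) (2 * k) = fact (2 * k) * (s\<^sup>2 / 2) ^ k / fact k"
      using gaussian_moment_even[of "s\<^sup>2" k] by (simp add: field_simps)
    moreover have "expectation (\<lambda>w. Y w ^ n) = fact (2 * k) / ((2 / s\<^sup>2) ^ k * fact k)"
      unfolding e unfolding n using integral_normal_moment_even[OF s, of 0 k] by simp
    moreover have "fact (2 * k) / ((2 / s\<^sup>2) ^ k * fact k) = fact (2 * k) * (s\<^sup>2 / 2) ^ k / (fact k :: real)"
      using s by (simp add: power_divide)
    ultimately show ?thesis unfolding n by (simp only:)
  next
    case False
    then obtain k where n: "n = 2 * k + 1" by (rule oddE)
    show ?thesis unfolding e unfolding n using integral_normal_moment_odd[OF s, of 0 k] gaussian_moment_odd[of "s\<^sup>2" k] by simp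
  qed
qed

lemma gaussian_moment_degenerate: "gaussian_moment 0 n = 0 ^ n"
  by (induction "0 :: real" n rule: gaussian_moment.induct) auto

text \<open>An almost surely constant variable with mean zero has the Gaussian moments of variance zero.\<close>
lemma (in prob_space) centered_gaussian_moments:
  assumes Y: "gaussian_rv M Y" and mean: "expectation Y = 0"
  shows "integrable M (\<lambda>w. \<bar>Y w\<bar> ^ n)" and "\<exists>v. \<forall>n. expectation (\<lambda>w. Y w ^ n) = gaussian_moment v n"
proof -
  have [measurable]: "Y \<in> borel_measurable M" using Y by (simp add: gaussian_rv_def)
  have "(\<exists>s>0. distributed M lborel Y (normal_density 0 s)) \<or> (AE w in M. Y w = 0)"
  proof -
    consider m s where "s > 0" "distributed M lborel Y (normal_density m s)" | m where "AE w in M. Y w = m"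
      using Y unfolding gaussian_rv_def by auto
    then show ?thesis
    proof cases
      case 1
      have "expectation Y = (LBINT x. normal_density m s x * x)"
        using distributed_integral[OF 1(2), of "\<lambda>x. x"] by simp
      then have "m = 0" using integral_normal_moment_nz_1[OF 1(1), of m] mean by simp
      then show ?thesis using 1 by auto
    next
      case 2
      have "expectation Y = expectation (\<lambda>w. m)" by (rule integral_cong_AE) (use 2 in auto)
      then have "m = 0" using mean by (simp add: prob_space)
      then show ?thesis using 2 by auto
    qed
  qed
  then have "(\<forall>n. integrable M (\<lambda>w. \<bar>Y w\<bar> ^ n)) \<and> (\<exists>v. \<forall>n. expectation (\<lambda>w. Y w ^ n) = gaussian_moment v n)"
  proof (elim disjE exE conjE)
    fix s :: real assume "0 < s" "distributed M lborel Y (normal_density 0 s)"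
    then show ?thesis using normal_moments[of Y s] by blast
  next
    assume z: "AE w in M. Y w = 0"
    have "integrable M (\<lambda>w. \<bar>Y w\<bar> ^ n)" for n
    proof (subst integrable_cong_AE)
      show "AE w in M. \<bar>Y w\<bar> ^ n = 0 ^ n" using z by eventually_elim simp
    qed auto
    moreover have "expectation (\<lambda>w. Y w ^ n) = gaussian_moment 0 n" for n
    proof -
      have "expectation (\<lambda>w. Y w ^ n) = expectation (\<lambda>w. 0 ^ n)"
      proof (rule integral_cong_AE)
        show "AE w in M. Y w ^ n = 0 ^ n" using z by eventually_elim simp
      qed auto
      then show ?thesis by (simp add: prob_space gaussian_moment_degenerate)
    qed
    ultimately show ?thesis by blast
  qed
  then show "integrable M (\<lambda>w. \<bar>Y w\<bar> ^ n)" and "\<exists>v. \<forall>n. expectation (\<lambda>w. Y w ^ n) = gaussian_moment v n" by auto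
qed

lemma (in prob_space) char_centered_normal:
  assumes Y: "distributed M lborel Y (normal_density 0 s)" and s: "0 < s"
  shows "char (distr M borel (\<lambda>w. c * Y w)) 1 = complex_of_real (exp (- ((c * s)^2) / 2))"
proof -
  have [measurable]: "Y \<in> borel_measurable M" using distributed_measurable[OF Y] by simp
  have D: "distributed M lborel (\<lambda>w. Y w / s) std_normal_density"
    using Y normal_standard_normal_convert[OF s, of Y 0] by simp
  have "distr M borel (\<lambda>w. Y w / s) = std_normal_distribution"
    using distributed_distr_eq_density[OF D] distr_cong[of M M lborel borel] by (metis distr_cong sets_lborel)
  then have "char (distr M borel (\<lambda>w. Y w / s)) (c * s) = complex_of_real (exp (- ((c * s)^2) / 2))"
    by (simp add: char_std_normal_distribution)
  moreover have "char (distr M borel (\<lambda>w. Y w / s)) (c * s) = char (distr M borel (\<lambda>w. c * Y w)) 1"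
    unfolding char_def using s by (simp add: integral_distr)
  ultimately show ?thesis by simp
qed

lemma min_as_sum: "j \<le> m ==> k \<le> m ==> real (min j k) = (\<Sum>i<m. of_bool (i < j) * of_bool (i < k))"
proof -
  assume jk: "j \<le> m" "k \<le> m"
  have "(\<Sum>i<m. of_bool (i < j) * of_bool (i < k)) = (\<Sum>i<m. of_bool (i < min j k) :: real)"
    by (rule sum.cong) auto
  also have "... = real (card {i. i < m \<and> i < min j k})"
    by (simp add: sum.If_cases of_bool_def Int_def)
  also have "{i. i < m \<and> i < min j k} = {..<min j k}" using jk by auto
  finally show ?thesis by simp
qed

lemma sum_of_bool_less: "k \<le> (m :: nat) ==> (\<Sum>i<m. of_bool (i < k) * h i) = (\<Sum>i<k. h i :: real)"
proof -
  assume "k \<le> m"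
  have "(\<Sum>i<k. h i) = (\<Sum>i<k. of_bool (i < k) * h i)" by (rule sum.cong) auto
  also have "... = (\<Sum>i<m. of_bool (i < k) * h i)" by (rule sum.mono_neutral_left) (use \<open>k \<le> m\<close> in auto)
  finally show ?thesis by simp
qed

locale brownian =
  fixes N :: "'b measure" and B :: "real => 'b => real"
  assumes standard: "standard_brownian_motion01 N B"

sublocale brownian \<subseteq> prob_space N
  using standard by (simp add: standard_brownian_motion01_def)

context brownian begin

lemma measurable_B: "t \<in> {0..1} ==> B t \<in> borel_measurable N"
  and continuous_B: "w \<in> space N ==> continuous_on {0..1} (\<lambda>t. B t w)"
  and B_0: "AE w in N. B 0 w = 0"
  and normal_increment: "0 \<le> s ==> s < t ==> t \<le> 1 ==> distributed N lborel (\<lambda>w. B t w - B s w) (normal_density 0 (sqrt (t - s)))"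
  using standard by (simp_all add: standard_brownian_motion01_def)

lemma indep_increments:
  assumes "\<And>i. i \<le> n ==> \<tau> i \<in> {0..1}" "\<And>i. i < n ==> \<tau> i \<le> \<tau> (Suc i)"
  shows "indep_vars (\<lambda>_. borel) (\<lambda>i w. B (\<tau> (Suc i)) w - B (\<tau> i) w) {..<n}"
proof -
  have "\<forall>(n::nat) \<tau>. (\<forall>i\<le>n. \<tau> i \<in> {0..1}) \<and> (\<forall>i<n. \<tau> i \<le> \<tau> (Suc i)) \<longrightarrow>
        indep_vars (\<lambda>_. borel) (\<lambda>i w. B (\<tau> (Suc i)) w - B (\<tau> i) w) {..<n}"
    using standard by (simp add: standard_brownian_motion01_def)
  then show ?thesis using assms by blast
qed

lemma increment_moments:
  assumes "0 \<le> s" "s < t" "t \<le> 1"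
  shows "integrable N (\<lambda>w. \<bar>B t w - B s w\<bar> ^ n)"
    and "expectation (\<lambda>w. (B t w - B s w) ^ n) = gaussian_moment (t - s) n"
  using normal_moments[OF normal_increment[OF assms], of n] assms by simp_all

lemma nn_increment_even:
  assumes st: "0 \<le> s" "s < t" "t \<le> 1" and n: "even n"
  shows "(\<integral>\<^sup>+w. ennreal ((c * B t w - c * B s w) ^ n) \<partial>N) = ennreal (c ^ n * gaussian_moment (t - s) n)"
proof -
  have e: "(c * B t w - c * B s w) ^ n = c ^ n * (B t w - B s w) ^ n" for w
    by (simp add: power_mult_distrib[symmetric] right_diff_distrib)
  have "integrable N (\<lambda>w. (B t w - B s w) ^ n)"
    using increment_moments(1)[OF st, of n] n by (simp add: power_even_abs)
  then have "(\<integral>\<^sup>+w. ennreal (c ^ n * (B t w - B s w) ^ n) \<partial>N) = ennreal (expectation (\<lambda>w. c ^ n * (B t w - B s w) ^ n))"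
    using n by (intro nn_integral_eq_integral) (auto simp: zero_le_even_power)
  then show ?thesis unfolding e using increment_moments(2)[OF st, of n] by simp
qed

lemma C01_scaled: "C01_process N (\<lambda>t w. \<sigma> * B t w)"
proof
  show "(\<lambda>w. \<sigma> * B t w) \<in> borel_measurable N" if "t \<in> {0..1}" for t using measurable_B[OF that] by measurable
  show "continuous_on {0..1} (\<lambda>t. \<sigma> * B t w)" if "w \<in> space N" for w
    by (intro continuous_on_mult_left continuous_B[OF that])
qed

lemma Kolmogorov_scaled:
  assumes C: "3 * \<sigma> ^ 4 \<le> C"
  shows "Kolmogorov_process N (\<lambda>t w. \<sigma> * B t w) C"
proof -
  have ineq: "(\<integral>\<^sup>+w. ennreal ((\<sigma> * B t w - \<sigma> * B s w) ^ 4) \<partial>N) \<le> ennreal (C * (t - s)^2)" if "0 \<le> s" "s < t" "t \<le> 1" for s t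
  proof -
    have "gaussian_moment (t - s) 4 = 3 * (t - s)^2" by (simp add: numeral_eq_Suc power2_eq_square)
    then have "\<sigma> ^ 4 * gaussian_moment (t - s) 4 = 3 * \<sigma> ^ 4 * (t - s)^2" by simp
    also have "... \<le> C * (t - s)^2" using C by (intro mult_right_mono) auto
    finally show ?thesis using nn_increment_even[OF that, of 4 \<sigma>] by (simp add: ennreal_leI)
  qed
  have "0 \<le> 3 * \<sigma> ^ 4" by simp
  then have "0 \<le> C" using C by linarith
  have sym: "(\<integral>\<^sup>+w. ennreal ((\<sigma> * B t w - \<sigma> * B s w) ^ 4) \<partial>N) \<le> ennreal (C * (t - s)^2)" if "s \<in> {0..1}" "t \<in> {0..1}" for s t
  proof -
    consider "s < t" | "s = t" | "t < s" by linarith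
    then show ?thesis
    proof cases
      case 1 then show ?thesis using ineq[of s t] that by simp
    next
      case 2 then show ?thesis by simp
    next
      case 3
      have "(\<sigma> * B t w - \<sigma> * B s w) ^ 4 = (\<sigma> * B s w - \<sigma> * B t w) ^ 4" for w
        using power_minus_even[of 4 "\<sigma> * B t w - \<sigma> * B s w"] by simp
      moreover have "(t - s)^2 = (s - t)^2" by (rule power2_commute)
      ultimately show ?thesis using ineq[of t s] 3 that by simp
    qed
  qed
  show ?thesis
    by (intro Kolmogorov_process.intro C01_scaled prob_space_axioms Kolmogorov_process_axioms.intro \<open>0 \<le> C\<close> sym)
qed

lemma second_moment_scaled:
  assumes t: "t \<in> {0..1}" shows "(\<integral>\<^sup>+w. ennreal ((\<sigma> * B t w)^2) \<partial>N) \<le> ennreal (\<sigma>\<^sup>2)"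
proof -
  have "(\<integral>\<^sup>+w. ennreal ((\<sigma> * B t w)^2) \<partial>N) = (\<integral>\<^sup>+w. ennreal ((\<sigma> * B t w - \<sigma> * B 0 w) ^ 2) \<partial>N)"
    by (rule nn_integral_cong_AE) (use B_0 in eventually_elim, simp)
  also have "... \<le> ennreal (\<sigma>\<^sup>2)"
  proof (cases "t = 0")
    case False
    then have "(\<integral>\<^sup>+w. ennreal ((\<sigma> * B t w - \<sigma> * B 0 w) ^ 2) \<partial>N) = ennreal (\<sigma>\<^sup>2 * t)"
      using nn_increment_even[of 0 t 2 \<sigma>] t by (simp add: numeral_2_eq_2)
    also have "... \<le> ennreal (\<sigma>\<^sup>2)" using t by (intro ennreal_leI) (simp add: mult_left_le)
    finally show ?thesis .
  qed simp
  finally show ?thesis .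
qed

text \<open>Summation by parts rewrites the combination of values as a combination of the independent increments over the grid;
the variances then recombine to the covariance \<open>min\<close> because \<open>min j k\<close> counts the increments common
to both values.\<close>
lemma char_scaled:
  assumes m: "0 < m"
  shows "(LINT w|N. iexp (\<Sum>k\<le>m. d k * (\<sigma> * B (real k / real m) w))) =
    complex_of_real (exp (- (\<sigma>\<^sup>2 * (\<Sum>j\<le>m. \<Sum>k\<le>m. d j * d k * min (real j / real m) (real k / real m))) / 2))"
proof -
  define \<xi> where "\<xi> i w = B (real (Suc i) / real m) w - B (real i / real m) w" for i w
  define D where "D i = (\<Sum>k\<le>m. d k * of_bool (i < k))" for i
  have unit: "real k / real m \<in> {0..1}" if "k \<le> m" for k using that m by simp
  have ind: "indep_vars (\<lambda>_. borel) \<xi> {..<m}"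
    unfolding \<xi>_def[abs_def] by (rule indep_increments[of m "\<lambda>i. real i / real m"]) (use unit m in \<open>auto simp: divide_right_mono\<close>)
  have ind': "indep_vars (\<lambda>_. borel) (\<lambda>i w. \<sigma> * D i * \<xi> i w) {..<m}"
    using indep_vars_compose2[OF ind, of "\<lambda>i x. \<sigma> * D i * x" "\<lambda>_. borel"] by simp
  have nor: "distributed N lborel (\<xi> i) (normal_density 0 (sqrt (1 / real m)))" if "i < m" for i
  proof -
    have "real (Suc i) / real m - real i / real m = 1 / real m" by (simp add: diff_divide_distrib[symmetric])
    then show ?thesis using normal_increment[of "real i / real m" "real (Suc i) / real m"] that m
      unfolding \<xi>_def[abs_def] by (simp add: divide_strict_right_mono)
  qed
  have meas: "(\<lambda>w. \<Sum>i<m. \<sigma> * D i * \<xi> i w) \<in> borel_measurable N"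
    unfolding \<xi>_def by (intro borel_measurable_sum borel_measurable_times borel_measurable_diff measurable_B unit) auto
  have "AE w in N. (\<Sum>k\<le>m. d k * (\<sigma> * B (real k / real m) w)) = (\<Sum>i<m. \<sigma> * D i * \<xi> i w)"
    using B_0
  proof eventually_elim
    case (elim w)
    have tel: "B (real k / real m) w = (\<Sum>i<m. of_bool (i < k) * \<xi> i w)" if "k \<le> m" for k
    proof -
      have "(\<Sum>i<k. \<xi> i w) = B (real k / real m) w - B (real 0 / real m) w"
        unfolding \<xi>_def by (rule sum_lessThan_telescope)
      then show ?thesis using elim sum_of_bool_less[OF that, of "\<lambda>i. \<xi> i w"] by simp
    qed
    have "(\<Sum>k\<le>m. d k * (\<sigma> * B (real k / real m) w)) = (\<Sum>k\<le>m. \<Sum>i<m. \<sigma> * (d k * of_bool (i < k)) * \<xi> i w)"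
    proof (rule sum.cong[OF refl])
      fix k assume "k \<in> {..m}"
      then have k: "k \<le> m" by simp
      have "d k * (\<sigma> * (of_bool (i < k) * \<xi> i w)) = \<sigma> * (d k * of_bool (i < k)) * \<xi> i w" for i by (simp only: mult_ac)
      then show "d k * (\<sigma> * B (real k / real m) w) = (\<Sum>i<m. \<sigma> * (d k * of_bool (i < k)) * \<xi> i w)"
        unfolding tel[OF k] sum_distrib_left by (simp only:)
    qed
    also have "... = (\<Sum>i<m. \<Sum>k\<le>m. \<sigma> * (d k * of_bool (i < k)) * \<xi> i w)" by (rule sum.swap)
    also have "... = (\<Sum>i<m. \<sigma> * D i * \<xi> i w)" unfolding D_def sum_distrib_left sum_distrib_right by (rule refl)
    finally show ?case .
  qed
  moreover have mB: "(\<lambda>w. \<Sum>k\<le>m. d k * (\<sigma> * B (real k / real m) w)) \<in> borel_measurable N"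
    by (intro borel_measurable_sum borel_measurable_times borel_measurable_const measurable_B unit) auto
  ultimately have "(LINT w|N. iexp (\<Sum>k\<le>m. d k * (\<sigma> * B (real k / real m) w))) = (LINT w|N. iexp (\<Sum>i<m. \<sigma> * D i * \<xi> i w))"
    using meas by (intro iexp_integral_cong_AE) (simp_all only:)
  also have "... = char (distr N borel (\<lambda>w. \<Sum>i<m. \<sigma> * D i * \<xi> i w)) 1"
    unfolding char_def using meas by (subst integral_distr) auto
  also have "... = (\<Prod>i<m. char (distr N borel (\<lambda>w. \<sigma> * D i * \<xi> i w)) 1)" by (rule char_distr_sum[OF ind'])
  also have "... = (\<Prod>i<m. complex_of_real (exp (- ((\<sigma> * D i * sqrt (1 / real m))^2) / 2)))"
    by (rule prod.cong[OF refl], rule char_centered_normal[OF nor]) (use m in auto)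
  also have "... = complex_of_real (exp (\<Sum>i<m. - ((\<sigma> * D i * sqrt (1 / real m))^2) / 2))"
    by (simp only: of_real_prod[symmetric] exp_sum[symmetric] finite_lessThan)
  also have "(\<Sum>i<m. - ((\<sigma> * D i * sqrt (1 / real m))^2) / 2) = - (\<sigma>\<^sup>2 * ((\<Sum>i<m. (D i)^2) / real m)) / 2"
  proof -
    have "- ((\<sigma> * D i * sqrt (1 / real m))^2) / 2 = (- (\<sigma>\<^sup>2) / (2 * real m)) * (D i)^2" for i
      using m by (simp add: power_mult_distrib)
    then have "(\<Sum>i<m. - ((\<sigma> * D i * sqrt (1 / real m))^2) / 2) = (- (\<sigma>\<^sup>2) / (2 * real m)) * (\<Sum>i<m. (D i)^2)"
      unfolding sum_distrib_left by (simp only:)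
    then show ?thesis by simp
  qed
  also have "(\<Sum>i<m. (D i)^2) / real m = (\<Sum>j\<le>m. \<Sum>k\<le>m. d j * d k * min (real j / real m) (real k / real m))"
  proof -
    have "(\<Sum>i<m. (D i)^2) = (\<Sum>i<m. \<Sum>j\<le>m. \<Sum>k\<le>m. d j * d k * (of_bool (i < j) * of_bool (i < k)))"
    proof (rule sum.cong[OF refl])
      fix i
      show "(D i)^2 = (\<Sum>j\<le>m. \<Sum>k\<le>m. d j * d k * (of_bool (i < j) * of_bool (i < k)))"
        unfolding D_def power2_eq_square sum_product by (simp add: mult_ac)
    qed
    also have "... = (\<Sum>j\<le>m. \<Sum>i<m. \<Sum>k\<le>m. d j * d k * (of_bool (i < j) * of_bool (i < k)))" by (rule sum.swap)
    also have "... = (\<Sum>j\<le>m. \<Sum>k\<le>m. \<Sum>i<m. d j * d k * (of_bool (i < j) * of_bool (i < k)))"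
      by (rule sum.cong[OF refl], rule sum.swap)
    also have "... = (\<Sum>j\<le>m. \<Sum>k\<le>m. d j * d k * real (min j k))"
    proof (intro sum.cong refl)
      fix j k assume "j \<in> {..m}" "k \<in> {..m}"
      then have "real (min j k) = (\<Sum>i<m. of_bool (i < j) * of_bool (i < k))" by (intro min_as_sum) auto
      then show "(\<Sum>i<m. d j * d k * (of_bool (i < j) * of_bool (i < k))) = d j * d k * real (min j k)"
        by (simp only: sum_distrib_left)
    qed
    finally have "(\<Sum>i<m. (D i)^2) / real m = (\<Sum>j\<le>m. \<Sum>k\<le>m. d j * d k * real (min j k) / real m)"
      by (simp add: sum_divide_distrib)
    also have "... = (\<Sum>j\<le>m. \<Sum>k\<le>m. d j * d k * min (real j / real m) (real k / real m))"
      by (intro sum.cong refl) (use m in \<open>auto simp: min_def divide_le_cancel\<close>)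
    finally show ?thesis .
  qed
  finally show ?thesis .
qed

end

section \<open>The Toeplitz functional as a quadratic form\<close>

text \<open>The hypotheses of the limit theorem, with the transforms of \<open>f\<close> and \<open>g\<close> named \<open>r\<close> and \<open>a\<close>.\<close>
locale stationary_Toeplitz = Toeplitz_pair f g r a p q for f g r a p q +
  fixes M :: "'a measure" and X :: "real => 'a => real"
  assumes prob_M: "prob_space M" and gaussian: "gaussian_process M X" and centered: "centered_process M X"
    and stationary: "stationary_process M X" and joint: "(\<lambda>(t, w). X t w) \<in> borel_measurable (lborel \<Otimes>\<^sub>M M)"
    and covariance: "\<And>t. r t = covariance_fun M X t"
begin

lemma meas_X: "X t \<in> borel_measurable M"
proof -
  have "gaussian_rv M (\<lambda>w. \<Sum>s\<in>{t}. 1 * X s w)"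
    by (rule gaussian[unfolded gaussian_process_def, rule_format, of "{t}" "\<lambda>_. 1"]) simp
  then show ?thesis by (simp add: gaussian_rv_def)
qed

lemma combination_moments:
  assumes S: "finite S"
  shows "integrable M (\<lambda>w. \<bar>\<Sum>s\<in>S. c s * X s w\<bar> ^ n)"
    and "\<exists>v. \<forall>n. (LINT w|M. (\<Sum>s\<in>S. c s * X s w) ^ n) = gaussian_moment v n"
proof -
  have g: "gaussian_rv M (\<lambda>w. \<Sum>s\<in>S. c s * X s w)"
    by (rule gaussian[unfolded gaussian_process_def, rule_format, OF S])
  have "(LINT w|M. (\<Sum>s\<in>S. c s * X s w)) = (\<Sum>s\<in>S. LINT w|M. c s * X s w)"
    using centered unfolding centered_process_def by (intro Bochner_Integration.integral_sum) simp
  also have "... = 0" using centered unfolding centered_process_def by simp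
  finally have m: "(LINT w|M. (\<Sum>s\<in>S. c s * X s w)) = 0" .
  show "integrable M (\<lambda>w. \<bar>\<Sum>s\<in>S. c s * X s w\<bar> ^ n)"
    by (rule prob_space.centered_gaussian_moments(1)[OF prob_M g m])
  show "\<exists>v. \<forall>n. (LINT w|M. (\<Sum>s\<in>S. c s * X s w) ^ n) = gaussian_moment v n"
    by (rule prob_space.centered_gaussian_moments(2)[OF prob_M g m])
qed

lemma stationary_law:
  assumes S: "finite S"
  shows "distr M (Pi\<^sub>M S (\<lambda>_. borel)) (\<lambda>w. \<lambda>t\<in>S. X (t + h) w) = distr M (Pi\<^sub>M S (\<lambda>_. borel)) (\<lambda>w. \<lambda>t\<in>S. X t w)"
  by (rule stationary[unfolded stationary_process_def, rule_format, OF S])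

lemma meas_restrict: "(\<lambda>w. \<lambda>t\<in>S. X (t + h) w) \<in> measurable M (Pi\<^sub>M S (\<lambda>_. borel))"
  by (rule measurable_restrict) (rule meas_X)

text \<open>Stationarity provides the uniformity in the index that a \<open>moment_field\<close> requires.\<close>
lemma nn_moment_shift: "(\<integral>\<^sup>+w. ennreal (\<bar>X s w\<bar> ^ n) \<partial>M) = (\<integral>\<^sup>+w. ennreal (\<bar>X 0 w\<bar> ^ n) \<partial>M)"
proof -
  let ?P = "Pi\<^sub>M {0::real} (\<lambda>_. borel :: real measure)"
  have [measurable]: "(\<lambda>x. ennreal (\<bar>x 0\<bar> ^ n)) \<in> borel_measurable ?P" by measurable
  have e: "(\<integral>\<^sup>+x. ennreal (\<bar>x 0\<bar> ^ n) \<partial>distr M ?P (\<lambda>w. \<lambda>t\<in>{0}. X (t + h) w)) = (\<integral>\<^sup>+w. ennreal (\<bar>X h w\<bar> ^ n) \<partial>M)" for h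
    by (subst nn_integral_distr[OF meas_restrict]) simp_all
  show ?thesis using e[of s] e[of 0] stationary_law[of "{0}" s] by simp
qed

lemma expectation_product: "(LINT w|M. X u w * X v w) = R u v"
proof -
  let ?J = "{u - v, 0}"
  let ?P = "Pi\<^sub>M ?J (\<lambda>_. borel :: real measure)"
  have [measurable]: "(\<lambda>x. x (u - v) * x 0) \<in> borel_measurable ?P" by measurable
  have e: "(\<integral>x. x (u - v) * x 0 \<partial>distr M ?P (\<lambda>w. \<lambda>t\<in>?J. X (t + h) w)) = (LINT w|M. X (u - v + h) w * X h w)" for h
    by (subst integral_distr[OF meas_restrict]) simp_all
  show ?thesis using e[of v] e[of 0] stationary_law[of ?J v] by (simp add: R_def covariance covariance_fun_def)
qed

lemma moment_field_window: "moment_field (window T) M X"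
  unfolding moment_field_def
proof (intro conjI allI)
  have "sets (window T \<Otimes>\<^sub>M M) = sets (lborel \<Otimes>\<^sub>M M)" by (rule sets_pair_measure_cong) simp_all
  then show "(\<lambda>(s, w). X s w) \<in> borel_measurable (window T \<Otimes>\<^sub>M M)"
    unfolding measurable_cong_sets[OF \<open>sets (window T \<Otimes>\<^sub>M M) = sets (lborel \<Otimes>\<^sub>M M)\<close> refl] by (intro joint)
  fix n
  have "integrable M (\<lambda>w. \<bar>X 0 w\<bar> ^ n)" using combination_moments(1)[of "{0}" "\<lambda>_. 1" n] by simp
  then have "(\<integral>\<^sup>+w. ennreal (\<bar>X 0 w\<bar> ^ n) \<partial>M) < \<infinity>" unfolding integrable_iff_bounded by simp
  then show "\<exists>C<\<infinity>. \<forall>s\<in>space (window T). (\<integral>\<^sup>+w. ennreal (\<bar>X s w\<bar> ^ n) \<partial>M) \<le> C"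
    by (intro exI[of _ "\<integral>\<^sup>+w. ennreal (\<bar>X 0 w\<bar> ^ n) \<partial>M"]) (auto intro: eq_refl[OF nn_moment_shift])
qed

lemma field: "gaussian_field M (window T) X"
proof (rule gaussian_field.intro[OF prob_M finite_window gaussian_field_axioms.intro])
  show "\<exists>v. \<forall>n. (LINT w|M. (\<Sum>s\<in>S. c s * X s w) ^ n) = gaussian_moment v n" if "finite S" for S c
    by (rule combination_moments(2)[OF that])
qed (rule space_window, rule moment_field_window)

lemma cov_eq: "gaussian_field.cov M X = R"
  by (intro ext) (simp only: gaussian_field.cov_def[OF field[of 0]] expectation_product)

abbreviation Q where "Q T \<equiv> gaussian_field.quad M (window T) X"

lemma quad_measurable: "bounded_kernel (window T) A ==> Q T A \<in> borel_measurable M"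
  by (rule all_moments_measurable[OF gaussian_field.all_moments_quad[OF field]])

text \<open>The outcomes for which the pathwise double integral exists; they do not depend on the time \<open>t\<close>.\<close>
definition good :: "real => 'a => bool" where "good T w \<longleftrightarrow> integrable (window T) (\<lambda>u. X u w)"

lemma AE_good: "AE w in M. good T w"
  unfolding good_def by (rule prob_space.moment_field_AE_integrable[OF prob_M finite_window moment_field_window])

lemma meas_path: "w \<in> space M ==> (\<lambda>u. X u w) \<in> borel_measurable borel"
  using measurable_compose[OF measurable_Pair2' joint] by simp

lemma meas_joint:
  assumes "s \<in> borel_measurable K" "w \<in> measurable K M"
  shows "(\<lambda>x. X (s x) (w x)) \<in> borel_measurable K"
proof -
  have "(\<lambda>x. (s x, w x)) \<in> measurable K (lborel \<Otimes>\<^sub>M M)" using assms by measurable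
  from measurable_compose[OF this joint] show ?thesis by simp
qed

lemma pred_good: "Measurable.pred M (good T)"
proof -
  interpret finite_measure "window T" by (rule finite_window)
  have "(\<lambda>(w, u). X u w) \<in> borel_measurable (M \<Otimes>\<^sub>M window T)"
    unfolding case_prod_beta' by (rule meas_joint) measurable
  from borel_measurable_lebesgue_integrable[OF this] show ?thesis unfolding good_def .
qed

abbreviation window2 where "window2 T \<equiv> window T \<Otimes>\<^sub>M window T"

lemma bounded_kernel_window2:
  assumes "bounded_kernel (window T) A"
  shows "(\<lambda>x. A (fst x) (snd x)) \<in> borel_measurable (window2 T)" "\<exists>C. \<forall>u v. \<bar>A u v\<bar> \<le> C"
  using assms unfolding bounded_kernel_def case_prod_beta' by auto

lemma good_product_integrable:
  assumes w: "w \<in> space M" "good T w" and A: "bounded_kernel (window T) A"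
  shows "integrable (window2 T) (\<lambda>x. A (fst x) (snd x) * (X (fst x) w * X (snd x) w))"
proof -
  interpret finite_measure "window T" by (rule finite_window)
  interpret P: pair_sigma_finite "window T" "window T" ..
  note [measurable] = meas_path[OF w(1)] bounded_kernel_window2(1)[OF A]
  have i: "integrable (window2 T) (\<lambda>x. X (fst x) w * X (snd x) w)"
  proof (rule integrableI_bounded)
    show "(\<lambda>x. X (fst x) w * X (snd x) w) \<in> borel_measurable (window2 T)" by measurable
    have "(\<integral>\<^sup>+x. ennreal (norm (X (fst x) w * X (snd x) w)) \<partial>window2 T) =
      (\<integral>\<^sup>+u. (\<integral>\<^sup>+v. ennreal (norm (X (fst (u, v)) w * X (snd (u, v)) w)) \<partial>window T) \<partial>window T)"
      by (rule nn_integral_fst[symmetric]) measurable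
    also have "... = (\<integral>\<^sup>+u. ennreal \<bar>X u w\<bar> * (\<integral>\<^sup>+v. ennreal \<bar>X v w\<bar> \<partial>window T) \<partial>window T)"
      by (intro nn_integral_cong) (simp add: abs_mult ennreal_mult nn_integral_cmult)
    also have "... = (\<integral>\<^sup>+u. ennreal \<bar>X u w\<bar> \<partial>window T) * (\<integral>\<^sup>+v. ennreal \<bar>X v w\<bar> \<partial>window T)"
      by (rule nn_integral_multc) measurable
    also have "... < \<infinity>" using w(2) unfolding good_def integrable_iff_bounded by (simp add: ennreal_mult_less_top)
    finally show "(\<integral>\<^sup>+x. ennreal (norm (X (fst x) w * X (snd x) w)) \<partial>window2 T) < \<infinity>" .
  qed
  obtain C where C: "\<And>u v. \<bar>A u v\<bar> \<le> C" using bounded_kernel_window2(2)[OF A] by auto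
  show ?thesis
  proof (rule Bochner_Integration.integrable_bound)
    show "integrable (window2 T) (\<lambda>x. C * (X (fst x) w * X (snd x) w))" using i by simp
    have "\<bar>A u v * y\<bar> \<le> \<bar>C * y\<bar>" for u v y
      unfolding abs_mult using C[of u v] by (intro mult_right_mono) auto
    then show "AE x in window2 T. norm (A (fst x) (snd x) * (X (fst x) w * X (snd x) w)) \<le> norm (C * (X (fst x) w * X (snd x) w))"
      by simp
  qed measurable
qed

lemma bounded_kernel_pair_integrable:
  assumes A: "bounded_kernel (window T) A"
  shows "integrable (window2 T) (\<lambda>x. A (fst x) (snd x))"
proof -
  interpret P: finite_measure "window2 T" by (rule gaussian_field.finite_nu[OF field])
  obtain C where "\<And>u v. \<bar>A u v\<bar> \<le> C" using bounded_kernel_window2(2)[OF A] by auto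
  then show ?thesis by (intro P.bounded_integrable[OF bounded_kernel_window2(1)[OF A]])
qed

lemma good_integrable:
  assumes w: "w \<in> space M" "good T w" and A: "bounded_kernel (window T) A"
  shows "integrable (window2 T) (\<lambda>x. A (fst x) (snd x) * (X (fst x) w * X (snd x) w - R (fst x) (snd x)))"
    and "(LINT x|window2 T. A (fst x) (snd x) * (X (fst x) w * X (snd x) w)) = Q T A w + (LINT x|window2 T. A (fst x) (snd x) * R (fst x) (snd x))"
proof -
  interpret finite_measure "window T" by (rule finite_window)
  have iR: "integrable (window2 T) (\<lambda>x. A (fst x) (snd x) * R (fst x) (snd x))"
    by (rule bounded_kernel_pair_integrable[OF bounded_kernel_mult[OF A bounded_kernel_R]])
  note iX = good_product_integrable[OF w A]
  show "integrable (window2 T) (\<lambda>x. A (fst x) (snd x) * (X (fst x) w * X (snd x) w - R (fst x) (snd x)))"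
    unfolding right_diff_distrib by (rule Bochner_Integration.integrable_diff[OF iX iR])
  show "(LINT x|window2 T. A (fst x) (snd x) * (X (fst x) w * X (snd x) w)) = Q T A w + (LINT x|window2 T. A (fst x) (snd x) * R (fst x) (snd x))"
    unfolding gaussian_field.quad_def[OF field] cov_eq right_diff_distrib Bochner_Integration.integral_diff[OF iX iR] by simp
qed

lemma toeplitz_Q_good:
  assumes w: "w \<in> space M" "good T w" and t: "0 < T" "t \<le> 1"
  shows "toeplitz_Q g X T t w = (LINT x|window2 T. block T t (fst x) (snd x) * (X (fst x) w * X (snd x) w))"
proof -
  interpret finite_measure "window T" by (rule finite_window)
  interpret P: pair_sigma_finite "window T" "window T" ..
  note [measurable] = meas_path[OF w(1)]
  have Tt: "T * t \<le> T" using t mult_left_le[of t T] by simp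
  have "(LINT x|window2 T. block T t (fst x) (snd x) * (X (fst x) w * X (snd x) w)) =
    (LINT u|window T. (LINT v|window T. block T t u v * (X u w * X v w)))"
    using P.integral_fst'[OF good_product_integrable[OF w bounded_kernel_block]] by simp
  also have "... = (LINT u|window T. (LBINT v. win T v * (block T t u v * (X u w * X v w))))"
    unfolding block_def by (intro Bochner_Integration.integral_cong refl integral_window) measurable
  also have "... = (LBINT u. win T u * (LBINT v. win T v * (block T t u v * (X u w * X v w))))"
    unfolding block_def by (intro integral_window) measurable
  also have "... = (LBINT u. indicator {0..T * t} u *\<^sub>R (LBINT v. indicator {0..T * t} v *\<^sub>R (Re (fourier g (u - v)) * X u w * X v w)))"
  proof (rule Bochner_Integration.integral_cong[OF refl])
    fix u
    have ind: "win (T * t) x = indicator {0..T * t} x" for x by (simp add: win_def indicator_def)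
    have "win T v * (block T t u v * (X u w * X v w)) =
       win (T * t) u * (win (T * t) v * (a (u - v) * X u w * X v w))" for v
    proof -
      have "win T v * (block T t u v * (X u w * X v w)) = (win T v * win (T * t) v) * (win (T * t) u * (a (u - v) * X u w * X v w))"
        unfolding block_def by (simp only: mult_ac)
      then show ?thesis unfolding win_mult[OF Tt] by (simp only: mult_ac)
    qed
    then have "win T u * (LBINT v. win T v * (block T t u v * (X u w * X v w))) =
      win T u * (LBINT v. win (T * t) u * (win (T * t) v * (a (u - v) * X u w * X v w)))" by (simp only:)
    also have "... = (win T u * win (T * t) u) * (LBINT v. win (T * t) v * (a (u - v) * X u w * X v w))"
      by (simp only: integral_mult_right_zero mult.assoc)
    finally have "win T u * (LBINT v. win T v * (block T t u v * (X u w * X v w))) =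
      (win T u * win (T * t) u) * (LBINT v. win (T * t) v * (a (u - v) * X u w * X v w))" .
    then show "win T u * (LBINT v. win T v * (block T t u v * (X u w * X v w))) =
      indicator {0..T * t} u *\<^sub>R (LBINT v. indicator {0..T * t} v *\<^sub>R (Re (fourier g (u - v)) * X u w * X v w))"
      unfolding win_mult[OF Tt] unfolding ind by (simp only: a Re_complex_of_real real_scaleR_def)
  qed
  finally show ?thesis unfolding toeplitz_Q_def set_lebesgue_integral_def by simp
qed

lemma meas_toeplitz_Q: "toeplitz_Q g X T t \<in> borel_measurable M"
proof -
  have "toeplitz_Q g X T t = (\<lambda>w. \<integral>u. (LBINT v. win (T * t) u * (win (T * t) v * (a (u - v) * X u w * X v w))) \<partial>lborel)"
  proof (rule ext)
    fix w
    have ind: "win (T * t) x = indicator {0..T * t} x" for x by (simp add: win_def indicator_def)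
    show "toeplitz_Q g X T t w = (LBINT u. (LBINT v. win (T * t) u * (win (T * t) v * (a (u - v) * X u w * X v w))))"
      unfolding toeplitz_Q_def set_lebesgue_integral_def integral_mult_right_zero ind by (simp add: a)
  qed
  moreover have "(\<lambda>w. \<integral>u. (LBINT v. win (T * t) u * (win (T * t) v * (a (u - v) * X u w * X v w))) \<partial>lborel) \<in> borel_measurable M"
  proof (intro lborel.borel_measurable_lebesgue_integral)
    note [measurable (raw)] = meas_joint
    show "(\<lambda>(w, u). \<integral>v. win (T * t) u * (win (T * t) v * (a (u - v) * X u w * X v w)) \<partial>lborel) \<in> borel_measurable (M \<Otimes>\<^sub>M lborel)"
      by measurable
  qed
  ultimately show ?thesis by (simp only:)
qed

text \<open>The iterated integral over the path is the centered quadratic form plus a constant, and since the form has mean zero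
this constant is the expectation of the functional.\<close>
lemma AE_toeplitz_Q:
  assumes t: "0 < T" "t \<le> 1"
  shows "AE w in M. toeplitz_Q g X T t w - (LINT \<eta>|M. toeplitz_Q g X T t \<eta>) = Q T (block T t) w"
proof -
  interpret prob_space M by (rule prob_M)
  define m where "m = (LINT x|window2 T. block T t (fst x) (snd x) * R (fst x) (snd x))"
  have e: "AE w in M. toeplitz_Q g X T t w = Q T (block T t) w + m"
    using AE_good[of T] AE_space
  proof eventually_elim
    case (elim w)
    then show ?case
      using toeplitz_Q_good[OF elim(2,1) t] good_integrable(2)[OF elim(2,1) bounded_kernel_block[of T T t]] by (simp add: m_def)
  qed
  have i: "integrable M (Q T (block T t))"
    by (rule all_moments_integrable[OF gaussian_field.all_moments_quad[OF field bounded_kernel_block]])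
  have "(LINT \<eta>|M. toeplitz_Q g X T t \<eta>) = (LINT \<eta>|M. Q T (block T t) \<eta> + m)"
    by (rule integral_cong_AE[OF meas_toeplitz_Q _ e]) (use i in simp)
  also have "... = m"
    using i gaussian_field.expectation_quad[OF field bounded_kernel_block[of T T t]] by (simp add: prob_space)
  finally have m: "(LINT \<eta>|M. toeplitz_Q g X T t \<eta>) = m" .
  show ?thesis using e unfolding m by eventually_elim simp
qed

text \<open>The continuous version: the value zero is arbitrary and only used on a null set.\<close>
definition version :: "real => real => 'a => real" where
  "version T t w = (if good T w then T powr (- 1 / 2) * Q T (block T t) w else 0)"

lemma AE_version:
  assumes t: "0 < T" "t \<le> 1"
  shows "AE w in M. version T t w = normalized_Q M g X T t w"
  using AE_good[of T] AE_toeplitz_Q[OF t]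
proof eventually_elim
  case (elim w) then show ?case by (simp add: version_def normalized_Q_def)
qed

lemma meas_version: "version T t \<in> borel_measurable M"
proof -
  note [measurable] = pred_good quad_measurable[OF bounded_kernel_block]
  show ?thesis unfolding version_def[abs_def] by measurable
qed

lemma win_tendsto:
  assumes c: "c \<longlonglongrightarrow> l" and u: "u \<noteq> l"
  shows "(\<lambda>n. win (c n) u) \<longlonglongrightarrow> win l u"
proof (rule tendsto_eventually)
  show "\<forall>\<^sub>F n in sequentially. win (c n) u = win l u"
  proof (cases "u < l")
    case True
    from order_tendstoD(1)[OF c this] show ?thesis by eventually_elim (use True in \<open>simp add: win_def\<close>)
  next
    case False
    then have "l < u" using u by simp
    from order_tendstoD(2)[OF c this] show ?thesis by eventually_elim (use False u in \<open>simp add: win_def\<close>)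
  qed
qed

lemma AE_window2_neq: "AE x in window2 T. fst x \<noteq> c \<and> snd x \<noteq> c"
proof -
  interpret finite_measure "window T" by (rule finite_window)
  interpret P: pair_sigma_finite "window T" "window T" ..
  have ne: "AE y in window T. y \<noteq> c"
    unfolding window_def by (subst AE_density) (use AE_lborel_singleton[of c] in auto)
  show ?thesis
  proof (rule P.AE_pair_measure)
    show "{x \<in> space (window2 T). fst x \<noteq> c \<and> snd x \<noteq> c} \<in> sets (window2 T)" by measurable
    show "AE x in window T. AE y in window T. fst (x, y) \<noteq> c \<and> snd (x, y) \<noteq> c"
      using ne by eventually_elim (use ne in simp)
  qed
qed

text \<open>As \<open>t\<close> varies the kernel changes only on a null set of points in the limit, so dominated convergence applies with
the integrable majorant given by the path.\<close>
lemma continuous_version_paths: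
  assumes w: "w \<in> space M"
  shows "continuous_on {0..1} (\<lambda>t. version T t w)"
proof (cases "good T w")
  case good: True
  define G where "G x = X (fst x) w * X (snd x) w - R (fst x) (snd x)" for x
  define C where "C = (LBINT x. \<bar>g x\<bar>)"
  have one: "bounded_kernel (window T) (\<lambda>_ _. 1)" by (rule bounded_kernel_windowI[of _ 1]) auto
  have G: "integrable (window2 T) G" using good_integrable(1)[OF w good one] by (simp add: G_def[abs_def])
  have "continuous_on {0..1} (\<lambda>t. Q T (block T t) w)"
  proof (rule continuous_on_sequentiallyI)
    fix t l assume t: "t \<longlonglongrightarrow> (l :: real)"
    show "(\<lambda>n. Q T (block T (t n)) w) \<longlonglongrightarrow> Q T (block T l) w"
      unfolding gaussian_field.quad_def[OF field] cov_eq G_def[symmetric]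
    proof (rule integral_dominated_convergence[where w = "\<lambda>x. C * \<bar>G x\<bar>"])
      show "integrable (window2 T) (\<lambda>x. C * \<bar>G x\<bar>)" using G by simp
      show "(\<lambda>x. block T s (fst x) (snd x) * G x) \<in> borel_measurable (window2 T)" for s
        using G bounded_kernel_window2(1)[OF bounded_kernel_block[of T T s]] by measurable
      then show "(\<lambda>x. block T (t n) (fst x) (snd x) * G x) \<in> borel_measurable (window2 T)" for n .
      show "AE x in window2 T. norm (block T (t n) (fst x) (snd x) * G x) \<le> C * \<bar>G x\<bar>" for n
        unfolding real_norm_def abs_mult C_def by (intro AE_I2 mult_right_mono block_bound) auto
      have Tt: "(\<lambda>n. T * t n) \<longlonglongrightarrow> T * l" by (rule tendsto_mult[OF tendsto_const t])
      show "AE x in window2 T. (\<lambda>n. block T (t n) (fst x) (snd x) * G x) \<longlonglongrightarrow> block T l (fst x) (snd x) * G x"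
        using AE_window2_neq[of "T * l" T]
      proof eventually_elim
        case (elim x)
        show ?case unfolding block_def
          by (rule tendsto_mult[OF tendsto_mult[OF tendsto_mult[OF win_tendsto[OF Tt] win_tendsto[OF Tt]] tendsto_const] tendsto_const])
             (use elim in auto)
      qed
    qed
  qed
  then show ?thesis using good unfolding version_def by (simp add: continuous_on_mult_left)
next
  case False then show ?thesis by (simp add: version_def)
qed

text \<open>Linear combinations of values at several times form a single quadratic form, to which the moment bound and the
central limit theorem apply.\<close>
lemma version_combination:
  assumes w: "w \<in> space M" "good T w"
  shows "(\<Sum>k\<le>m. d k * version T (\<tau> k) w) = Q T (combo T m d \<tau>) w"
proof -
  define G where "G x = X (fst x) w * X (snd x) w - R (fst x) (snd x)" for x
  have i: "integrable (window2 T) (\<lambda>x. block T t (fst x) (snd x) * G x)" for t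
    using good_integrable(1)[OF w bounded_kernel_block[of T T t]] by (simp add: G_def[abs_def])
  have "Q T (combo T m d \<tau>) w = (LINT x|window2 T. (\<Sum>k\<le>m. (T powr (- 1 / 2) * d k) * (block T (\<tau> k) (fst x) (snd x) * G x)))"
    unfolding gaussian_field.quad_def[OF field] cov_eq G_def[symmetric] combo_def
    by (rule Bochner_Integration.integral_cong[OF refl]) (simp add: sum_distrib_left sum_distrib_right mult_ac)
  also have "... = (\<Sum>k\<le>m. \<integral>x. (T powr (- 1 / 2) * d k) * (block T (\<tau> k) (fst x) (snd x) * G x) \<partial>window2 T)"
    by (rule Bochner_Integration.integral_sum) (intro integrable_mult_right i)
  also have "... = (\<Sum>k\<le>m. (T powr (- 1 / 2) * d k) * Q T (block T (\<tau> k)) w)"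
    unfolding gaussian_field.quad_def[OF field] cov_eq G_def[symmetric] by (simp only: integral_mult_right_zero)
  also have "... = (\<Sum>k\<le>m. d k * version T (\<tau> k) w)"
    by (rule sum.cong[OF refl]) (simp add: version_def w(2))
  finally show ?thesis by simp
qed

lemma AE_version_combination:
  "AE w in M. (\<Sum>k\<le>m. d k * version T (\<tau> k) w) = Q T (combo T m d \<tau>) w"
  using AE_good[of T] AE_space by eventually_elim (rule version_combination)

text \<open>The moment bound for quadratic forms, transferred to linear combinations of values of the process. It is used for single values and for
increments.\<close>
lemma moment_bound:
  assumes T: "0 < T" and \<tau>: "\<And>k. k \<le> m ==> \<tau> k \<le> 1" and n: "norm2 (window T) (combo_cov T m d \<tau>) \<le> c"
  shows "(\<integral>\<^sup>+w. ennreal ((\<Sum>k\<le>m. d k * version T (\<tau> k) w) ^ 2 ^ Suc j) \<partial>M) \<le> ennreal (moment_const j * c ^ 2 ^ j)"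
proof -
  let ?A = "combo T m d \<tau>"
  interpret F: gaussian_field M "window T" X by (rule field)
  have "(\<integral>\<^sup>+w. ennreal ((\<Sum>k\<le>m. d k * version T (\<tau> k) w) ^ 2 ^ Suc j) \<partial>M) = (\<integral>\<^sup>+w. ennreal (F.quad ?A w ^ 2 ^ Suc j) \<partial>M)"
    by (rule nn_integral_cong_AE) (use AE_version_combination[where m = m and d = d and T = T and \<tau> = \<tau>] in eventually_elim, simp only:)
  also have "... = ennreal (LINT w|M. F.quad ?A w ^ 2 ^ Suc j)"
    by (intro nn_integral_eq_integral all_moments_integrable_power F.all_moments_quad bounded_kernel_combo AE_I2) simp
  also have "... \<le> ennreal (moment_const j * c ^ 2 ^ j)"
  proof (rule ennreal_leI)
    have "(LINT w|M. F.quad ?A w ^ 2 ^ Suc j) \<le> moment_const j * norm2 (window T) (kernel_comp (window T) ?A F.cov) ^ 2 ^ j"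
      by (rule F.quad_moment_bound[OF bounded_kernel_combo combo_sym])
    also have "kernel_comp (window T) ?A F.cov = combo_cov T m d \<tau>"
      unfolding cov_eq by (rule kernel_comp_combo) (use T \<tau> in auto)
    also have "moment_const j * norm2 (window T) (combo_cov T m d \<tau>) ^ 2 ^ j \<le> moment_const j * c ^ 2 ^ j"
      by (intro mult_left_mono power_mono n norm2_nonneg moment_const_nonneg)
    finally show "(LINT w|M. F.quad ?A w ^ 2 ^ Suc j) \<le> moment_const j * c ^ 2 ^ j" .
  qed
  finally show ?thesis .
qed

lemma version_second_moment:
  assumes "0 < T" "t \<le> 1"
  shows "(\<integral>\<^sup>+w. ennreal ((version T t w)^2) \<partial>M) \<le> ennreal (2 * H_energy)"
  using moment_bound[of T 0 "\<lambda>_. t" "\<lambda>_. 1" H_energy 0] norm2_combo_cov[of T 0 "\<lambda>_. t" "\<lambda>_. 1"] assms by simp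

lemma version_fourth_moment_less:
  assumes T: "0 < T" and st: "0 \<le> s" "s \<le> t" "t \<le> 1"
  shows "(\<integral>\<^sup>+w. ennreal ((version T t w - version T s w) ^ 4) \<partial>M) \<le> ennreal (16 * moment_const 1 * H_energy\<^sup>2 * (t - s)^2)"
proof -
  have "(\<integral>\<^sup>+w. ennreal ((\<Sum>k\<le>1::nat. (if k = 0 then 1 else - 1) * version T (if k = 0 then t else s) w) ^ 2 ^ Suc 1) \<partial>M)
    \<le> ennreal (moment_const 1 * (4 * H_energy * (t - s)) ^ 2 ^ 1)"
    by (rule moment_bound[OF T _ norm2_increment[OF T st]]) (use st in auto)
  moreover have "(\<Sum>k\<le>1::nat. (if k = 0 then 1 else - 1) * version T (if k = 0 then t else s) w) ^ 2 ^ Suc 1 = (version T t w - version T s w) ^ 4" for w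
    by simp
  moreover have "moment_const 1 * (4 * H_energy * (t - s)) ^ 2 ^ 1 = 16 * moment_const 1 * H_energy\<^sup>2 * (t - s)^2"
    by (simp add: power_mult_distrib)
  ultimately show ?thesis by (simp only:)
qed

lemma version_fourth_moment:
  assumes T: "0 < T" and st: "s \<in> {0..1}" "t \<in> {0..1}"
  shows "(\<integral>\<^sup>+w. ennreal ((version T t w - version T s w) ^ 4) \<partial>M) \<le> ennreal (16 * moment_const 1 * H_energy\<^sup>2 * (t - s)^2)"
proof (cases "s \<le> t")
  case True then show ?thesis using version_fourth_moment_less[OF T, of s t] st by simp
next
  case False
  have "(version T t w - version T s w) ^ 4 = (version T s w - version T t w) ^ 4" for w
    using power_minus_even[of 4 "version T t w - version T s w"] by simp
  moreover have "(t - s)^2 = (s - t)^2" by (rule power2_commute)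
  ultimately show ?thesis using version_fourth_moment_less[OF T, of t s] st False by simp
qed

lemma version_char_tendsto:
  fixes m :: nat
  assumes T: "filterlim T at_top sequentially" "\<And>n. 0 < T n" and \<tau>: "\<And>k. k \<le> m ==> 0 \<le> \<tau> k \<and> \<tau> k \<le> 1"
  shows "(\<lambda>n. LINT w|M. iexp (\<Sum>k\<le>m. d k * version (T n) (\<tau> k) w)) \<longlonglongrightarrow>
    complex_of_real (exp (- (2 * (\<Sum>j\<le>m. \<Sum>k\<le>m. d j * d k * (min (\<tau> j) (\<tau> k) * conv_energy))) / 2))"
proof -
  define K where "K n = combo_cov (T n) m d \<tau>" for n
  have \<tau>1: "\<tau> k \<le> 1" if "k \<le> m" for k using \<tau>[OF that] by simp
  have "(\<lambda>n. LINT w|M. iexp (Q (T n) (combo (T n) m d \<tau>) w)) \<longlonglongrightarrow>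
    complex_of_real (exp (- (2 * (\<Sum>j\<le>m. \<Sum>k\<le>m. d j * d k * (min (\<tau> j) (\<tau> k) * conv_energy))) / 2))"
  proof (rule quad_central_limit)
    show "gaussian_field M (window (T n)) X" for n by (rule field)
    show "bounded_kernel (window (T n)) (combo (T n) m d \<tau>)" for n by (rule bounded_kernel_combo)
    show "combo (T n) m d \<tau> u v = combo (T n) m d \<tau> v u" for n u v by (rule combo_sym)
    show "K n = kernel_comp (window (T n)) (combo (T n) m d \<tau>) (gaussian_field.cov M X)" for n
      unfolding K_def cov_eq by (rule kernel_comp_combo[symmetric]) (use T(2)[of n] \<tau>1 in auto)
    show "norm2 (window (T n)) (K n) \<le> (\<Sum>k\<le>m. \<bar>d k\<bar>)^2 * H_energy" for n
      unfolding K_def by (rule norm2_combo_cov[OF T(2) \<tau>1])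
    show "(\<lambda>n. 2 * trace_pair (window (T n)) (K n) (K n)) \<longlonglongrightarrow> 2 * (\<Sum>j\<le>m. \<Sum>k\<le>m. d j * d k * (min (\<tau> j) (\<tau> k) * conv_energy))"
      unfolding K_def by (rule tendsto_mult[OF tendsto_const trace_combo_tendsto[OF T \<tau>]])
    show "(\<lambda>n. norm2 (window (T n)) (kernel_comp (window (T n)) (K n) (K n))) \<longlonglongrightarrow> 0"
    proof (rule tendsto_sandwich)
      show "\<forall>\<^sub>F n in sequentially. 0 \<le> norm2 (window (T n)) (kernel_comp (window (T n)) (K n) (K n))"
        by (simp add: norm2_nonneg)
      show "\<forall>\<^sub>F n in sequentially. norm2 (window (T n)) (kernel_comp (window (T n)) (K n) (K n)) \<le> (\<Sum>k\<le>m. \<bar>d k\<bar>) ^ 4 * J_mean (T n)"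
        unfolding K_def by (intro always_eventually allI norm2_combo_cov_comp[OF T(2) \<tau>1])
      show "(\<lambda>n. (\<Sum>k\<le>m. \<bar>d k\<bar>) ^ 4 * J_mean (T n)) \<longlonglongrightarrow> 0"
        using tendsto_mult[OF tendsto_const J_mean_tendsto[OF T]] by simp
    qed simp
  qed
  moreover have "(LINT w|M. iexp (\<Sum>k\<le>m. d k * version (T n) (\<tau> k) w)) = (LINT w|M. iexp (Q (T n) (combo (T n) m d \<tau>) w))" for n
  proof (rule iexp_integral_cong_AE)
    show "(\<lambda>w. \<Sum>k\<le>m. d k * version (T n) (\<tau> k) w) \<in> borel_measurable M"
      by (intro borel_measurable_sum borel_measurable_times borel_measurable_const meas_version)
  qed (rule quad_measurable[OF bounded_kernel_combo], rule AE_version_combination)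
  ultimately show ?thesis by (simp only:)
qed

end

section \<open>The functional limit theorem\<close>

context stationary_Toeplitz begin

lemma continuous_version_version: "0 < T ==> continuous_version M (normalized_Q M g X T) (version T)"
  unfolding continuous_version_def
  by (intro conjI ballI meas_version AE_version continuous_version_paths) simp_all

text \<open>Any continuous version agrees at each time with the one constructed above, so moment bounds and characteristic
functions carry over.\<close>
lemma AE_version_eq:
  assumes Y: "continuous_version M (normalized_Q M g X T) Y" and T: "0 < T" and t: "t \<in> {0..1}"
  shows "AE w in M. Y t w = version T t w"
proof -
  have t1: "t \<le> 1" using t by simp
  have "AE w in M. Y t w = normalized_Q M g X T t w" using Y t unfolding continuous_version_def by simp
  then show ?thesis using AE_version[OF T t1] by eventually_elim simp
qed

lemma C01_continuous_version: "continuous_version M Z Y ==> C01_process M Y"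
  unfolding continuous_version_def by (intro C01_process.intro) simp_all

lemma Kolmogorov_version:
  assumes Y: "continuous_version M (normalized_Q M g X T) Y" and T: "0 < T"
    and C: "16 * moment_const 1 * H_energy\<^sup>2 \<le> C"
  shows "Kolmogorov_process M Y C"
proof (intro Kolmogorov_process.intro Kolmogorov_process_axioms.intro C01_continuous_version[OF Y] prob_M)
  have "0 \<le> 16 * moment_const 1 * H_energy\<^sup>2" by (intro mult_nonneg_nonneg moment_const_nonneg) auto
  then show "0 \<le> C" using C by linarith
  fix s t :: real assume st: "s \<in> {0..1}" "t \<in> {0..1}"
  have "(\<integral>\<^sup>+w. ennreal ((Y t w - Y s w) ^ 4) \<partial>M) = (\<integral>\<^sup>+w. ennreal ((version T t w - version T s w) ^ 4) \<partial>M)"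
    by (rule nn_integral_cong_AE) (use AE_version_eq[OF Y T st(1)] AE_version_eq[OF Y T st(2)] in eventually_elim, simp only:)
  also have "... \<le> ennreal (16 * moment_const 1 * H_energy\<^sup>2 * (t - s)^2)" by (rule version_fourth_moment[OF T st])
  also have "... \<le> ennreal (C * (t - s)^2)" using C by (intro ennreal_leI mult_right_mono) auto
  finally show "(\<integral>\<^sup>+w. ennreal ((Y t w - Y s w) ^ 4) \<partial>M) \<le> ennreal (C * (t - s)^2)" .
qed

lemma continuous_version_second_moment:
  assumes Y: "continuous_version M (normalized_Q M g X T) Y" and T: "0 < T" and t: "t \<in> {0..1}"
  shows "(\<integral>\<^sup>+w. ennreal ((Y t w)^2) \<partial>M) \<le> ennreal (2 * H_energy)"
proof -
  have "(\<integral>\<^sup>+w. ennreal ((Y t w)^2) \<partial>M) = (\<integral>\<^sup>+w. ennreal ((version T t w)^2) \<partial>M)"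
    by (rule nn_integral_cong_AE) (use AE_version_eq[OF Y T t] in eventually_elim, simp only:)
  also have "... \<le> ennreal (2 * H_energy)" by (rule version_second_moment[OF T]) (use t in simp)
  finally show ?thesis .
qed

lemma continuous_version_char:
  assumes Y: "continuous_version M (normalized_Q M g X T) Y" and T: "0 < T" and \<tau>: "\<And>k. k \<le> m ==> \<tau> k \<in> {0..1}"
  shows "(LINT w|M. iexp (\<Sum>k\<le>m. d k * Y (\<tau> k) w)) = (LINT w|M. iexp (\<Sum>k\<le>(m::nat). d k * version T (\<tau> k) w))"
proof (rule iexp_integral_cong_AE)
  show "(\<lambda>w. \<Sum>k\<le>m. d k * version T (\<tau> k) w) \<in> borel_measurable M"
    by (intro borel_measurable_sum borel_measurable_times borel_measurable_const meas_version)
  have mY: "Y t \<in> borel_measurable M" if "t \<in> {0..1}" for t using Y that unfolding continuous_version_def by simp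
  show "(\<lambda>w. \<Sum>k\<le>m. d k * Y (\<tau> k) w) \<in> borel_measurable M"
    by (intro borel_measurable_sum borel_measurable_times borel_measurable_const mY \<tau>) simp
  have "AE w in M. k \<le> m \<longrightarrow> Y (\<tau> k) w = version T (\<tau> k) w" for k
    using AE_version_eq[OF Y T \<tau>, of k] by (cases "k \<le> m") simp_all
  then have "AE w in M. \<forall>k. k \<le> m \<longrightarrow> Y (\<tau> k) w = version T (\<tau> k) w" by (subst AE_all_countable) simp
  then show "AE w in M. (\<Sum>k\<le>m. d k * Y (\<tau> k) w) = (\<Sum>k\<le>m. d k * version T (\<tau> k) w)"
  proof eventually_elim
    case (elim w)
    show ?case by (rule sum.cong[OF refl]) (use elim in simp)
  qed
qed

text \<open>Convergence as \<open>T\<close> tends to infinity is tested along sequences, to which the criterion for continuous processes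
applies.\<close>
theorem functional_limit:
  assumes B: "standard_brownian_motion01 N B" and \<sigma>: "\<sigma>\<^sup>2 = 2 * conv_energy"
    and Y: "\<And>T. 0 < T ==> continuous_version M (normalized_Q M g X T) (Y T)"
  shows "converges_weakly_in C01 M (\<lambda>T. path01 (Y T)) at_top N (path01 (\<lambda>t w. \<sigma> * B t w))"
proof -
  interpret B: brownian N B by (rule brownian.intro[OF B])
  \<comment> \<open>One constant that serves all the moment bounds at once.\<close>
  define C where "C = 16 * moment_const 1 * H_energy\<^sup>2 + 2 * H_energy + 3 * \<sigma> ^ 4 + \<sigma>\<^sup>2"
  have "0 \<le> 16 * moment_const 1 * H_energy\<^sup>2" by (intro mult_nonneg_nonneg moment_const_nonneg) auto
  moreover have "0 \<le> 2 * H_energy" "0 \<le> 3 * \<sigma> ^ 4" "0 \<le> \<sigma>\<^sup>2" using H_energy_nonneg by auto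
  ultimately have C: "16 * moment_const 1 * H_energy\<^sup>2 \<le> C" "2 * H_energy \<le> C" "3 * \<sigma> ^ 4 \<le> C" "\<sigma>\<^sup>2 \<le> C"
    unfolding C_def by linarith+
  have seq: "C01_convergence (\<lambda>_. M) (\<lambda>i. Y (T i)) N (\<lambda>t w. \<sigma> * B t w) C"
    if T: "filterlim T at_top sequentially" "\<And>n. 0 < T n" for T :: "nat => real"
  proof (rule C01_convergence.intro)
    show "Kolmogorov_process M (Y (T i)) C" for i by (rule Kolmogorov_version[OF Y[OF T(2)] T(2) C(1)])
    show "Kolmogorov_process N (\<lambda>t w. \<sigma> * B t w) C" by (rule B.Kolmogorov_scaled[OF C(3)])
    show "(\<integral>\<^sup>+w. ennreal ((Y (T i) t w)^2) \<partial>M) \<le> ennreal C" if "t \<in> {0..1}" for i t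
      by (rule order_trans[OF continuous_version_second_moment[OF Y[OF T(2)] T(2) that] ennreal_leI[OF C(2)]])
    show "(\<integral>\<^sup>+w. ennreal ((\<sigma> * B t w)^2) \<partial>N) \<le> ennreal C" if "t \<in> {0..1}" for t
      by (rule order_trans[OF B.second_moment_scaled[OF that] ennreal_leI[OF C(4)]])
    fix n :: nat and d :: "nat => real"
    define m :: nat where "m = 2 ^ n"
    define \<tau> where "\<tau> k = real k / real m" for k
    have \<tau>_eq: "real k / 2 ^ n = \<tau> k" for k by (simp add: \<tau>_def m_def)
    have m: "0 < m" by (simp add: m_def)
    have \<tau>: "0 \<le> \<tau> k \<and> \<tau> k \<le> 1" if "k \<le> m" for k using that m by (simp add: \<tau>_def)
    have \<tau>': "\<tau> k \<in> {0..1}" if "k \<le> m" for k using \<tau>[OF that] by simp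
    define S where "S = (\<Sum>j\<le>m. \<Sum>k\<le>m. d j * d k * min (\<tau> j) (\<tau> k))"
    have "(\<Sum>j\<le>m. \<Sum>k\<le>m. d j * d k * (min (\<tau> j) (\<tau> k) * conv_energy)) = S * conv_energy"
      unfolding S_def sum_distrib_right by (simp only: mult.assoc)
    moreover have "- (2 * (S * conv_energy)) / 2 = - (\<sigma>\<^sup>2 * S) / 2" unfolding \<sigma> by simp
    ultimately have lim: "(\<lambda>i. LINT w|M. iexp (\<Sum>k\<le>m. d k * version (T i) (\<tau> k) w)) \<longlonglongrightarrow> complex_of_real (exp (- (\<sigma>\<^sup>2 * S) / 2))"
      using version_char_tendsto[where m = m and d = d and \<tau> = \<tau>, OF T \<tau>] by (simp only:)
    show "(\<lambda>i. LINT w|M. iexp (\<Sum>k\<le>2 ^ n. d k * Y (T i) (real k / 2 ^ n) w)) \<longlonglongrightarrow>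
      (LINT w|N. iexp (\<Sum>k\<le>2 ^ n. d k * (\<sigma> * B (real k / 2 ^ n) w)))"
    proof -
      have left: "(LINT w|M. iexp (\<Sum>k\<le>m. d k * Y (T i) (\<tau> k) w)) = (LINT w|M. iexp (\<Sum>k\<le>m. d k * version (T i) (\<tau> k) w))" for i
        by (rule continuous_version_char[OF Y[OF T(2)] T(2) \<tau>'])
      have right: "(LINT w|N. iexp (\<Sum>k\<le>m. d k * (\<sigma> * B (\<tau> k) w))) = complex_of_real (exp (- (\<sigma>\<^sup>2 * S) / 2))"
        unfolding S_def \<tau>_def by (rule B.char_scaled[OF m])
      show ?thesis unfolding \<tau>_eq m_def[symmetric] left right by (rule lim)
    qed
  qed
  show ?thesis unfolding converges_weakly_in_def
  proof (intro conjI allI impI)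
    show "\<forall>\<^sub>F T in at_top. path01 (Y T) \<in> measurable M (metric_borel C01)"
      using eventually_gt_at_top[of "0 :: real"]
      by eventually_elim (rule C01_process.measurable_path[OF C01_continuous_version[OF Y]])
    show "path01 (\<lambda>t w. \<sigma> * B t w) \<in> measurable N (metric_borel C01)"
      by (rule C01_process.measurable_path[OF B.C01_scaled])
    fix \<phi> :: "(real => real) => real"
    assume \<phi>: "continuous_map (mtopology_of C01) euclideanreal \<phi> \<and> bounded (\<phi> ` mspace C01)"
    show "((\<lambda>T. LINT w|M. \<phi> (path01 (Y T) w)) \<longlongrightarrow> (LINT w|N. \<phi> (path01 (\<lambda>t w. \<sigma> * B t w) w))) at_top"
    proof (rule tendsto_at_topI_sequentially)
      fix T :: "nat => real" assume T: "filterlim T at_top sequentially"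
      \<comment> \<open>A sequence tending to infinity is eventually, but not always, positive.\<close>
      define T' where "T' n = max 1 (T n)" for n
      have T': "filterlim T' at_top sequentially"
        by (rule filterlim_at_top_mono[OF T]) (simp add: T'_def)
      have pos: "0 < T' n" for n unfolding T'_def by (simp add: less_max_iff_disj)
      interpret W: C01_convergence "\<lambda>_. M" "\<lambda>i. Y (T' i)" N "\<lambda>t w. \<sigma> * B t w" C by (rule seq[OF T' pos])
      have lim: "(\<lambda>n. LINT w|M. \<phi> (path01 (Y (T' n)) w)) \<longlonglongrightarrow> (LINT w|N. \<phi> (path01 (\<lambda>t w. \<sigma> * B t w) w))"
        by (rule W.weak_convergence) (use \<phi> in simp_all)
      have "\<forall>\<^sub>F n in sequentially. 1 < T n" using T unfolding filterlim_at_top_dense by simp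
      then have "\<forall>\<^sub>F n in sequentially. (LINT w|M. \<phi> (path01 (Y (T' n)) w)) = (LINT w|M. \<phi> (path01 (Y (T n)) w))"
        by eventually_elim (simp add: T'_def)
      from Lim_transform_eventually[OF lim this]
      show "(\<lambda>n. LINT w|M. \<phi> (path01 (Y (T n)) w)) \<longlonglongrightarrow> (LINT w|N. \<phi> (path01 (\<lambda>t w. \<sigma> * B t w) w))" .
    qed
  qed
qed

end

text \<open>The exponents are at most two and the transforms are bounded.\<close>
lemma in_Lp_square_integrable:
  fixes h :: "real => real"
  assumes h: "h \<in> borel_measurable borel" "integrable lborel (\<lambda>x. \<bar>h x\<bar> powr p)" "\<And>x. \<bar>h x\<bar> \<le> B" and p: "p \<le> 2"
  shows "integrable lborel (\<lambda>x. (h x)^2)"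
proof -
  have "\<bar>h x\<bar> powr 2 = (h x)^2" for x by (cases "h x = 0") (simp_all add: powr_numeral)
  then show ?thesis using in_Lp_bounded_mono[OF h p] by simp
qed

theorem theorem2p2:
  fixes M :: "'a measure" and X :: "real \<Rightarrow> 'a \<Rightarrow> real"
    and f g :: "real \<Rightarrow> real" and p q \<sigma> :: real
    and N :: "'b measure" and B :: "real \<Rightarrow> 'b \<Rightarrow> real"
  assumes "prob_space M"
    and "gaussian_process M X" and "centered_process M X" and "stationary_process M X"
    and "(\<lambda>(t, \<omega>). X t \<omega>) \<in> borel_measurable (lborel \<Otimes>\<^sub>M M)"
    and "has_spectral_density M X f"
    and "integrable lborel g" and "\<And>x. g (- x) = g x" and "\<And>x. 0 \<le> g x"
    and "in_Lp 1 (\<lambda>x. f x * g x)" and "in_Lp 2 (\<lambda>x. f x * g x)"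
    and "1 \<le> p" and "1 \<le> q" and "1 / p + 1 / q \<ge> 3 / 2"
    and "in_Lp p (covariance_fun M X)" and "in_Lp q (fourier g)"
    and "standard_brownian_motion01 N B"
    and "\<sigma>\<^sup>2 = 16 * pi ^ 3 * (LINT x|lborel. (f x)^2 * (g x)^2)"
  shows "(\<forall>T>0. \<exists>Y. continuous_version M (normalized_Q M g X T) Y) \<and>
    (\<forall>Y. (\<forall>T>0. continuous_version M (normalized_Q M g X T) (Y T)) \<longrightarrow>
       converges_weakly_in C01 M (\<lambda>T. path01 (Y T)) at_top N (path01 (\<lambda>t \<omega>. \<sigma> * B t \<omega>)))"
proof -
  note pq = assms(12-14)
  define r where "r = covariance_fun M X"
  define a where "a t = Re (fourier g t)" for t
  have f: "integrable lborel f" "\<And>x. 0 \<le> f x" "\<And>t. fourier f t = complex_of_real (r t)"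
    using assms(6) by (simp_all add: has_spectral_density_def r_def)
  have a: "fourier g t = complex_of_real (a t)" for t
    using fourier_even_real[of g t, OF assms(8)] by (simp add: a_def complex_eq_iff)
  have "p \<le> 2" "q \<le> 2"
  proof -
    have "1 / q \<le> 1" "1 / p \<le> 1" using pq by simp_all
    then have "1 / 2 \<le> 1 / p" "1 / 2 \<le> 1 / q" using pq(3) by linarith+
    then show "p \<le> 2" "q \<le> 2" using pq by (simp_all add: field_simps)
  qed
  have r_p: "r \<in> borel_measurable borel" "integrable lborel (\<lambda>t. \<bar>r t\<bar> powr p)"
    using assms(15) by (simp_all add: in_Lp_def r_def)
  have r_bound: "\<bar>r t\<bar> \<le> (LBINT x. \<bar>f x\<bar>)" for t
    using fourier_bound[OF f(1), of t] by (simp add: f(3))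
  have "fourier g \<in> borel_measurable borel" using assms(16) by (simp add: in_Lp_def)
  then have a_meas: "a \<in> borel_measurable borel" unfolding a_def[abs_def] by measurable
  have a_q: "integrable lborel (\<lambda>t. \<bar>a t\<bar> powr q)"
    using assms(16) by (simp add: in_Lp_def a)
  have a_bound: "\<bar>a t\<bar> \<le> (LBINT x. \<bar>g x\<bar>)" for t
    using fourier_bound[OF assms(7), of t] by (simp add: a)
  interpret stationary_Toeplitz f g r a p q M X
  proof (intro stationary_Toeplitz.intro Toeplitz_pair.intro spectral_pair.intro Toeplitz_pair_axioms.intro stationary_Toeplitz_axioms.intro)
    show "integrable lborel (\<lambda>t. (r t)^2)" by (rule in_Lp_square_integrable[OF r_p r_bound \<open>p \<le> 2\<close>])
    show "integrable lborel (\<lambda>t. (a t)^2)" by (rule in_Lp_square_integrable[OF a_meas a_q a_bound \<open>q \<le> 2\<close>])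
    have "\<bar>y\<bar> powr 2 = y\<^sup>2" for y :: real by (cases "y = 0") (simp_all add: powr_numeral)
    then show "integrable lborel (\<lambda>x. (f x * g x)^2)" using assms(11) by (simp add: in_Lp_def)
    show "r t = covariance_fun M X t" for t by (simp add: r_def)
  qed (fact f a assms r_p a_q)+
  have "\<sigma>\<^sup>2 = 2 * conv_energy"
    unfolding conv_energy_def integral_conv_square assms(18) by (simp add: power_mult_distrib)
  from functional_limit[OF assms(17) this] continuous_version_version show ?thesis by blast
qed

end
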